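(* Let $L$ be a lattice of signature $(2,n)$, let $L'\subset L$ be a primitive sublattice of signature $(2,n')$ with $n'\geq3$, and put $K=(L')^{\perp}\cap L$. Let $\Gamma$ be a finite-index subgroup of $\mathrm O^+(L)$, $\Gamma'=\Gamma\cap\mathrm O^+(L')$, $G=\Gamma\cap\mathrm O(K)$, and $\mathcal D'=\mathbb PL'_{\mathbb C}\cap\mathcal D$. Let $\lambda=(\lambda_1\ge\cdots\ge\lambda_n\ge0)$ be a partition with ${}^t\lambda_1+{}^t\lambda_2\le n$, let $k\in\mathbb Z$, let $f\in M_{\lambda,k}(\Gamma)$ be nonzero, and let $\nu$ be the vanishing order of $f$ along $\mathcal D'$. Suppose that $\nu>0$. Then the quasi-pullback $f||_{\mathcal D'}$ is a cusp form. Thus $$f||_{\mathcal D'}\in\bigoplus_{\alpha}S_{\lambda'(\alpha),k+\nu}(\Gamma')\otimes\bigl((K_{\mathbb C})_{\lambda''(\alpha)}\otimes\mathrm{Sym}^{\nu}K_{\mathbb C}\bigr)^{G}.$$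
   Context: Basic setting (for any lattice $L$ of signature $(2,n)$, $n\ge3$; also used for $L'$ and $\Gamma'$). A lattice is a free $\mathbb Z$-module of finite rank with a nondegenerate symmetric bilinear form with values in $\mathbb Z$; $L_F=L\otimes_{\mathbb Z}F$. $\mathcal D=\mathcal D_L$ is a fixed connected component of $\{[\omega]\in\mathbb P(L_{\mathbb C}) : (\omega,\omega)=0,\ (\omega,\bar\omega)>0\}$; $\mathrm O^+$ denotes isometries preserving this component. Over $\mathcal D$: $\mathcal L\subset L_{\mathbb C}\otimes\mathcal O_{\mathcal D}$ is the tautological line bundle (fiber $\mathbb C\omega$) and $\mathcal E=\mathcal L^\perp/\mathcal L$ with its induced quadratic form. For a partition $\lambda$ as in the claim, $d=|\lambda|$ and an $n$-dimensional complex quadratic space $V$, $V^{[d]}\subset V^{\otimes d}$ is the intersection of the kernels of all contractions and $V_\lambda=c_\lambda\cdot V^{[d]}$ with $c_\lambda=b_\lambda a_\lambda$ the Young symmetrizer of the column canonical tableau ($a_\lambda$ the sum over the row subgroup, $b_\lambda$ the signed sum over the column subgroup); this is the irreducible representation of $\mathrm O(V)$ labelled by $\lambda$. Applied fiberwise to $\mathcal E$ this gives $\mathcal E_\lambda$; $\mathcal E_{\lambda,k}=\mathcal E_\lambda\otimes\mathcal L^{\otimes k}$; $M_{\lambda,k}(\Gamma)$ is the space of $\Gamma$-invariant holomorphic sections of $\mathcal E_{\lambda,k}$ over $\mathcal D$. Cusp forms. For a primitive isotropic $I\subset L$ of rank $1$, put $V(I)=(I^\perp/I)_{\mathbb C}$.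 The pairing with $I_{\mathbb C}$ gives $\mathcal L\simeq I_{\mathbb C}^\vee\otimes\mathcal O_{\mathcal D}$, and $I_{\mathbb C}^\perp/I_{\mathbb C}\leftarrow I_{\mathbb C}^\perp\cap\omega^\perp\to\omega^\perp/\mathbb C\omega$ give $\mathcal E\simeq V(I)\otimes\mathcal O_{\mathcal D}$; hence $\mathcal E_{\lambda,k}\simeq V(I)_\lambda\otimes(I_{\mathbb C}^\vee)^{\otimes k}\otimes\mathcal O_{\mathcal D}$. Let $U(I)_F=(I^\perp/I)_F\otimes I_F$ (generators of $I$ given norm $1$), a subgroup of $\mathrm O(L_F)$ by the Eichler transvections $E_{m\otimes l}(v)=v-(\tilde m,v)l+(l,v)\tilde m-\frac12(m,m)(l,v)l$, and $U(I)_{\mathbb Z}=U(I)_{\mathbb Q}\cap\Gamma$. With $e$ a generator of $I$ and $e'\in L_{\mathbb Q}$ isotropic with $(e,e')=1$, and $V(I)=\langle e,e'\rangle^\perp$, the map $z\otimes e\mapsto[e'+z-\frac12(z,z)e]$ identifies $\{Z\in U(I)_{\mathbb C}:\mathrm{Im}(Z)\in\mathcal C_I\}$ with $\mathcal D$, for one component $\mathcal C_I$ of $\{v\in U(I)_{\mathbb R}:(v,v)>0\}$. Then a modular form has a Fourier expansion $\sum_{l\in U(I)_{\mathbb Z}^\vee}a(l)\exp(2\pi i(l,Z))$; it is a cusp form if for every $I$, $a(l)\neq0$ implies $l\in\mathcal C_I$. $S_{\lambda,k}(\Gamma)\subset M_{\lambda,k}(\Gamma)$ is the space of cusp forms. Quasi-pullback.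 $\mathrm O^+(L'_{\mathbb R})\times\mathrm O(K_{\mathbb R})$ is embedded in $\mathrm O^+(L_{\mathbb R})$ as the stabilizer of $L'_{\mathbb R}$; $\Gamma'$ and $G$ are the intersections of $\Gamma$ with the two factors. $r=\mathrm{rank}(K)=n-n'$. Let $\mathcal L',\mathcal E'$ be the Hodge bundles of $\mathcal D'=\mathcal D_{L'}$. Then $\mathcal L|_{\mathcal D'}=\mathcal L'$ and $\mathcal E|_{\mathcal D'}=\mathcal E'\oplus(K_{\mathbb C}\otimes\mathcal O_{\mathcal D'})$. Let $V_\lambda\simeq\bigoplus_\alpha V'_{\lambda'(\alpha)}\boxtimes V''_{\lambda''(\alpha)}$ be the irreducible decomposition of the $\mathrm O(n,\mathbb C)$-representation $V_\lambda$ restricted to $\mathrm O(n',\mathbb C)\times\mathrm O(r,\mathbb C)$; so $\mathcal E_{\lambda}|_{\mathcal D'}\simeq\bigoplus_\alpha\mathcal E'_{\lambda'(\alpha)}\otimes(K_{\mathbb C})_{\lambda''(\alpha)}$. From $T_{\mathcal D}\simeq\mathcal E\otimes\mathcal L^{-1}$, the normal bundle of $\mathcal D'$ in $\mathcal D$ is $(\mathcal L')^{-1}\otimes K_{\mathbb C}$, so with $\mathcal I$ the ideal sheaf of $\mathcal D'$, $\mathcal I^\nu/\mathcal I^{\nu+1}\simeq(\mathcal L')^{\otimes\nu}\otimes\mathrm{Sym}^\nu K_{\mathbb C}^\vee$, and $K_{\mathbb C}^\vee\simeq K_{\mathbb C}$ by the pairing. The vanishing order $\nu$ of $f$ along $\mathcal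 D'$ is the largest $\nu$ such that $f$ is a section of $\mathcal I^\nu\mathcal E_{\lambda,k}$. The quasi-pullback $f||_{\mathcal D'}$ is the image of $f$ under $$H^0(\mathcal D,\mathcal I^\nu\mathcal E_{\lambda,k})^{\Gamma'\times G}\to H^0\bigl(\mathcal D',\mathcal E_\lambda|_{\mathcal D'}\otimes(\mathcal L')^{\otimes(k+\nu)}\otimes\mathrm{Sym}^\nu K_{\mathbb C}\bigr)^{\Gamma'\times G}=\bigoplus_\alpha M_{\lambda'(\alpha),k+\nu}(\Gamma')\otimes\bigl((K_{\mathbb C})_{\lambda''(\alpha)}\otimes\mathrm{Sym}^\nu K_{\mathbb C}\bigr)^G;$$ "cusp form" means that its components in $M_{\lambda'(\alpha),k+\nu}(\Gamma')$ are cusp forms. *)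

theory Defs
  imports "HOL-Analysis.Analysis" "HOL-Algebra.Coset" "HOL-Library.Function_Algebras"
begin

subsection \<open>Lattices in a real quadratic space\<close>

text \<open>
  All lattices live in a coordinate space \<open>real ^ 'm\<close> carrying the symmetric bilinear form with
  Gram matrix \<open>Q\<close>; the form is extended bilinearly to \<open>complex ^ 'm\<close>. A lattice need not have full
  rank there, so that a lattice and its sublattices are treated by the same definitions.
\<close>

definition rform :: "real ^ 'm ^ 'm \<Rightarrow> real ^ 'm \<Rightarrow> real ^ 'm \<Rightarrow> real" where
  "rform Q x y = (\<Sum>i\<in>UNIV. \<Sum>j\<in>UNIV. x $ i * Q $ i $ j * y $ j)"

definition cform :: "real ^ 'm ^ 'm \<Rightarrow> complex ^ 'm \<Rightarrow> complex ^ 'm \<Rightarrow> complex" where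
  "cform Q v w = (\<Sum>i\<in>UNIV. \<Sum>j\<in>UNIV. v $ i * complex_of_real (Q $ i $ j) * w $ j)"

definition cvec :: "real ^ 'm \<Rightarrow> complex ^ 'm" where
  "cvec x = (\<chi> i. complex_of_real (x $ i))"

definition cmat :: "real ^ 'm ^ 'm \<Rightarrow> complex ^ 'm ^ 'm" where
  "cmat M = (\<chi> i j. complex_of_real (M $ i $ j))"

definition cnjvec :: "complex ^ 'm \<Rightarrow> complex ^ 'm" where
  "cnjvec v = (\<chi> i. cnj (v $ i))"

definition Imvec :: "complex ^ 'm \<Rightarrow> real ^ 'm" where
  "Imvec v = (\<chi> i. Im (v $ i))"

definition int_span :: "(real ^ 'm) set \<Rightarrow> (real ^ 'm) set" where
  "int_span b = {\<Sum>v\<in>b. real_of_int (c v) *\<^sub>R v | c. True}"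

definition is_lattice :: "real ^ 'm ^ 'm \<Rightarrow> (real ^ 'm) set \<Rightarrow> bool" where
  "is_lattice Q L \<longleftrightarrow>
     (\<exists>b. finite b \<and> independent b \<and> L = int_span b) \<and>
     (\<forall>x\<in>L. \<forall>y\<in>L. rform Q x y \<in> \<int> \<and> rform Q x y = rform Q y x) \<and>
     (\<forall>x\<in>L. (\<forall>y\<in>L. rform Q x y = 0) \<longrightarrow> x = 0)"

text \<open>The spaces \<open>L \<otimes> \<rat>\<close> and \<open>L \<otimes> \<complex>\<close>; the space \<open>L \<otimes> \<real>\<close> is \<open>span L\<close>.\<close>

definition rat_space :: "(real ^ 'm) set \<Rightarrow> (real ^ 'm) set" where
  "rat_space L = {x. \<exists>N::nat. N > 0 \<and> real N *\<^sub>R x \<in> L}"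

definition cspace :: "(real ^ 'm) set \<Rightarrow> (complex ^ 'm) set" where
  "cspace L = vec.span (cvec ` L)"

definition has_signature :: "real ^ 'm ^ 'm \<Rightarrow> (real ^ 'm) set \<Rightarrow> nat \<Rightarrow> nat \<Rightarrow> bool" where
  "has_signature Q L p q \<longleftrightarrow>
     (\<exists>P N. subspace P \<and> subspace N \<and> P \<subseteq> span L \<and> N \<subseteq> span L \<and>
        dim P = p \<and> dim N = q \<and> dim (span L) = p + q \<and>
        (\<forall>x\<in>P. x \<noteq> 0 \<longrightarrow> rform Q x x > 0) \<and>
        (\<forall>x\<in>N. x \<noteq> 0 \<longrightarrow> rform Q x x < 0) \<and>
        (\<forall>x\<in>P. \<forall>y\<in>N. rform Q x y = 0))"

definition primitive_in :: "(real ^ 'm) set \<Rightarrow> (real ^ 'm) set \<Rightarrow> bool" where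
  "primitive_in L' L \<longleftrightarrow>
     L' \<subseteq> L \<and> (\<forall>x\<in>L. \<forall>N::int. N \<noteq> 0 \<and> real_of_int N *\<^sub>R x \<in> L' \<longrightarrow> x \<in> L')"

definition orth_lattice :: "real ^ 'm ^ 'm \<Rightarrow> (real ^ 'm) set \<Rightarrow> (real ^ 'm) set \<Rightarrow> (real ^ 'm) set" where
  "orth_lattice Q L L' = {x \<in> L. \<forall>y\<in>L'. rform Q x y = 0}"

subsection \<open>Period domains and orthogonal groups\<close>

text \<open>
  Subsets of the projective space of \<open>cspace L\<close> are represented by their affine cones without the
  origin. As the nonzero scalars are connected, the connected components of the cone below are
  exactly the cones over the connected components of its projectivization; in what follows \<open>D\<close>
  always is such a component, i.e. the cone over the period domain.
\<close>

definition period_cone :: "real ^ 'm ^ 'm \<Rightarrow> (real ^ 'm) set \<Rightarrow> (complex ^ 'm) set" where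
  "period_cone Q L = {\<omega> \<in> cspace L. cform Q \<omega> \<omega> = 0 \<and> Re (cform Q \<omega> (cnjvec \<omega>)) > 0}"

text \<open>Used for lattices of full rank only, whose isometries are given by unique matrices.\<close>

definition O_plus ::
  "real ^ 'm ^ 'm \<Rightarrow> (real ^ 'm) set \<Rightarrow> (complex ^ 'm) set \<Rightarrow> (real ^ 'm ^ 'm) monoid" where
  "O_plus Q L D =
     \<lparr> carrier = {g. (\<lambda>x. g *v x) ` L = L \<and>
                    (\<forall>x\<in>L. \<forall>y\<in>L. rform Q (g *v x) (g *v y) = rform Q x y) \<and>
                    (\<lambda>\<omega>. cmat g *v \<omega>) ` D = D},
       mult = (**), one = mat 1 \<rparr>"

text \<open>
  The pointwise stabilizer of \<open>P\<close> in \<open>\<Gamma>\<close>. Inside the stabilizer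
  \<open>O\<^sup>+(L'\<^sub>\<real>) \<times> O(K\<^sub>\<real>)\<close> of \<open>L'\<^sub>\<real>\<close>, the first factor consists of
  the elements fixing \<open>K\<close> pointwise and the second one of those fixing \<open>L'\<close> pointwise.
\<close>

definition fixing :: "(real ^ 'm ^ 'm) set \<Rightarrow> (real ^ 'm) set \<Rightarrow> (real ^ 'm ^ 'm) set" where
  "fixing \<Gamma> P = {g \<in> \<Gamma>. \<forall>x\<in>P. g *v x = x}"

subsection \<open>Tensors\<close>

text \<open>
  A tensor of degree \<open>d\<close> on \<open>complex ^ 'm\<close> is given by its coordinates, indexed by the lists of
  length \<open>d\<close>; it is zero on all other lists.
\<close>

type_synonym 'm tensor = "'m list \<Rightarrow> complex"

definition tscale :: "complex \<Rightarrow> 'm tensor \<Rightarrow> 'm tensor" where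
  "tscale c T = (\<lambda>idx. c * T idx)"

interpretation tensor: vector_space tscale
  by unfold_locales (auto simp: tscale_def fun_eq_iff algebra_simps)

definition pure_tensor :: "(complex ^ 'm) list \<Rightarrow> 'm tensor" where
  "pure_tensor vs = (\<lambda>idx. if length idx = length vs
                           then \<Prod>i<length vs. (vs ! i) $ (idx ! i) else 0)"

text \<open>The product of a tensor of degree \<open>d\<close> with another tensor.\<close>

definition tprod :: "nat \<Rightarrow> 'm tensor \<Rightarrow> 'm tensor \<Rightarrow> 'm tensor" where
  "tprod d S T = (\<lambda>idx. S (take d idx) * T (drop d idx))"

text \<open>The action of a linear map on tensors of all degrees.\<close>

definition tmap :: "complex ^ 'm ^ 'm \<Rightarrow> 'm::finite tensor \<Rightarrow> 'm tensor" where
  "tmap M T = (\<lambda>idx. \<Sum>jdx\<in>{jdx. length jdx = length idx}.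
                 (\<Prod>i<length idx. M $ (idx ! i) $ (jdx ! i)) * T jdx)"

text \<open>The left action: the \<open>i\<close>-th factor is moved to position \<open>\<sigma> i\<close>.\<close>

definition tperm :: "nat \<Rightarrow> (nat \<Rightarrow> nat) \<Rightarrow> 'm tensor \<Rightarrow> 'm tensor" where
  "tperm d \<sigma> T = (\<lambda>idx. if length idx = d then T (map (\<lambda>j. idx ! \<sigma> j) [0..<d]) else 0)"

text \<open>Contraction of the factors at positions \<open>i < j\<close>.\<close>

definition contraction ::
  "real ^ 'm ^ 'm \<Rightarrow> nat \<Rightarrow> nat \<Rightarrow> 'm::finite tensor \<Rightarrow> 'm tensor" where
  "contraction Q i j T = (\<lambda>idx. \<Sum>p\<in>UNIV. \<Sum>q\<in>UNIV. complex_of_real (Q $ p $ q) *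
     T (take i idx @ [p] @ drop i (take (j - 1) idx) @ [q] @ drop (j - 1) idx))"

text \<open>
  Tensor powers of a quotient \<open>V = A / R\<close>: the space \<open>V\<^bsup>\<otimes>d\<^esup>\<close> is
  \<open>tpow d A\<close> modulo \<open>tnull d A R\<close>. Its elements are represented by tensors, and equality is
  congruence modulo \<open>tnull d A R\<close>. A subspace of the quotient is represented by its preimage.
\<close>

definition tpow :: "nat \<Rightarrow> (complex ^ 'm) set \<Rightarrow> 'm tensor set" where
  "tpow d A = tensor.span {pure_tensor vs | vs. length vs = d \<and> set vs \<subseteq> A}"

definition tnull :: "nat \<Rightarrow> (complex ^ 'm) set \<Rightarrow> (complex ^ 'm) set \<Rightarrow> 'm tensor set" where
  "tnull d A R =
     tensor.span {pure_tensor vs | vs. length vs = d \<and> set vs \<subseteq> A \<and> set vs \<inter> R \<noteq> {}}"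

definition traceless ::
  "real ^ 'm ^ 'm \<Rightarrow> nat \<Rightarrow> (complex ^ 'm) set \<Rightarrow> (complex ^ 'm) set \<Rightarrow> 'm::finite tensor set" where
  "traceless Q d A R =
     {T \<in> tpow d A. \<forall>i j. i < j \<and> j < d \<longrightarrow> contraction Q i j T \<in> tnull (d - 2) A R}"

subsection \<open>Partitions, Young symmetrizers and orthogonal Schur functors\<close>

text \<open>A partition is a decreasing list, trailing zeros being allowed; rows and columns are
  numbered from 0.\<close>

definition col_len :: "nat list \<Rightarrow> nat \<Rightarrow> nat" where
  "col_len la j = card {i. i < length la \<and> j < la ! i}"

definition O_partition :: "nat \<Rightarrow> nat list \<Rightarrow> bool" where
  "O_partition n la \<longleftrightarrow>
     length la = n \<and> sorted_wrt (\<ge>) la \<and> col_len la 0 + col_len la 1 \<le> n"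

text \<open>The column canonical tableau is filled with \<open>0, 1, 2, \<dots>\<close> down the first column, then down the
  second column, and so on.\<close>

definition tableau :: "nat list \<Rightarrow> nat \<Rightarrow> nat \<Rightarrow> nat" where
  "tableau la i j = (\<Sum>j'<j. col_len la j') + i"

definition row_group :: "nat list \<Rightarrow> (nat \<Rightarrow> nat) set" where
  "row_group la = {\<sigma>. \<sigma> permutes {..<sum_list la} \<and>
     (\<forall>i<length la. \<sigma> ` {tableau la i j | j. j < la ! i} = {tableau la i j | j. j < la ! i})}"

definition col_group :: "nat list \<Rightarrow> (nat \<Rightarrow> nat) set" where
  "col_group la = {\<sigma>. \<sigma> permutes {..<sum_list la} \<and>
     (\<forall>j. \<sigma> ` {tableau la i j | i. i < col_len la j} = {tableau la i j | i. i < col_len la j})}"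

definition young_a :: "nat list \<Rightarrow> 'm tensor \<Rightarrow> 'm tensor" where
  "young_a la T = (\<Sum>\<sigma>\<in>row_group la. tperm (sum_list la) \<sigma> T)"

definition young_b :: "nat list \<Rightarrow> 'm tensor \<Rightarrow> 'm tensor" where
  "young_b la T = (\<Sum>\<sigma>\<in>col_group la. tscale (of_int (sign \<sigma>)) (tperm (sum_list la) \<sigma> T))"

definition young_c :: "nat list \<Rightarrow> 'm tensor \<Rightarrow> 'm tensor" where
  "young_c la T = young_b la (young_a la T)"

text \<open>The (representatives of the) space \<open>V\<^sub>\<lambda>\<close> for the quadratic space \<open>V = A / R\<close>.\<close>

definition schur ::
  "real ^ 'm ^ 'm \<Rightarrow> nat list \<Rightarrow> (complex ^ 'm) set \<Rightarrow> (complex ^ 'm) set \<Rightarrow> 'm::finite tensor set" where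
  "schur Q la A R = {young_c la T + N | T N.
     T \<in> traceless Q (sum_list la) A R \<and> N \<in> tnull (sum_list la) A R}"

subsection \<open>Hodge bundles and their sections\<close>

definition holomorphic_cvec :: "(complex ^ 'm) set \<Rightarrow> (complex ^ 'm \<Rightarrow> complex) \<Rightarrow> bool" where
  "holomorphic_cvec U H \<longleftrightarrow>
     (\<forall>y\<in>U. \<exists>H'. (H has_derivative H') (at y) \<and> (\<forall>c v. H' (c *s v) = c * H' v))"

definition cline :: "complex ^ 'm \<Rightarrow> (complex ^ 'm) set" where
  "cline \<omega> = {c *s \<omega> | c. True}"

definition cperp :: "real ^ 'm ^ 'm \<Rightarrow> (real ^ 'm) set \<Rightarrow> complex ^ 'm \<Rightarrow> (complex ^ 'm) set" where
  "cperp Q L \<omega> = {v \<in> cspace L. cform Q v \<omega> = 0}"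

text \<open>The fibre of \<open>\<E>\<close> at \<open>[\<omega>]\<close> is \<open>cperp Q L \<omega> / cline \<omega>\<close>.\<close>

definition hodge_fibre ::
  "real ^ 'm ^ 'm \<Rightarrow> (real ^ 'm) set \<Rightarrow> nat list \<Rightarrow> complex ^ 'm \<Rightarrow> 'm::finite tensor set" where
  "hodge_fibre Q L la \<omega> = schur Q la (cperp Q L \<omega>) (cline \<omega>)"

definition hodge_null ::
  "real ^ 'm ^ 'm \<Rightarrow> (real ^ 'm) set \<Rightarrow> nat \<Rightarrow> complex ^ 'm \<Rightarrow> 'm::finite tensor set" where
  "hodge_null Q L d \<omega> = tnull d (cperp Q L \<omega>) (cline \<omega>)"

text \<open>The cone over an open subset of the period domain with cone \<open>D\<close>.\<close>

definition open_subcone :: "(complex ^ 'm) set \<Rightarrow> (complex ^ 'm) set \<Rightarrow> bool" where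
  "open_subcone D S \<longleftrightarrow>
     openin (top_of_set D) S \<and> (\<forall>\<omega>\<in>S. \<forall>c. c \<noteq> 0 \<longrightarrow> c *s \<omega> \<in> S)"

text \<open>
  Holomorphic sections of \<open>\<E>\<^sub>\<lambda> \<otimes> \<L>\<^bsup>k\<^esup>\<close> over the open set with cone \<open>S\<close>:
  the section is \<open>[\<omega>] \<mapsto> f \<omega> \<otimes> \<omega>\<^bsup>k\<^esup>\<close>, so that \<open>f\<close> is homogeneous of degree \<open>-k\<close>. The tensor
  \<open>f \<omega>\<close> is a representative of an element of the fibre, and it is considered modulo
  \<open>hodge_null\<close>. Holomorphic means that there are local lifts which are restrictions of holomorphic
  functions on open subsets of \<open>complex ^ 'm\<close>.
\<close>

definition hodge_sections ::
  "real ^ 'm ^ 'm \<Rightarrow> (real ^ 'm) set \<Rightarrow> (complex ^ 'm) set \<Rightarrow> nat list \<Rightarrow> int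
     \<Rightarrow> (complex ^ 'm \<Rightarrow> 'm::finite tensor) set" where
  "hodge_sections Q L S la k = {f.
     (\<forall>\<omega>\<in>S. f \<omega> \<in> hodge_fibre Q L la \<omega>) \<and>
     (\<forall>\<omega>\<in>S. \<forall>c. c \<noteq> 0 \<longrightarrow>
        f (c *s \<omega>) - tscale (c powi (- k)) (f \<omega>) \<in> hodge_null Q L (sum_list la) \<omega>) \<and>
     (\<forall>\<omega>\<in>S. \<exists>U F. open U \<and> \<omega> \<in> U \<and> (\<forall>idx. holomorphic_cvec U (\<lambda>y. F y idx)) \<and>
        (\<forall>y\<in>U \<inter> S. F y - f y \<in> hodge_null Q L (sum_list la) y))}"

definition modular_forms ::
  "real ^ 'm ^ 'm \<Rightarrow> (real ^ 'm) set \<Rightarrow> (complex ^ 'm) set \<Rightarrow> nat list \<Rightarrow> int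
     \<Rightarrow> (real ^ 'm ^ 'm) set \<Rightarrow> (complex ^ 'm \<Rightarrow> 'm::finite tensor) set" where
  "modular_forms Q L D la k \<Gamma> = {f \<in> hodge_sections Q L D la k.
     \<forall>g\<in>\<Gamma>. \<forall>\<omega>\<in>D.
       f (cmat g *v \<omega>) - tmap (cmat g) (f \<omega>) \<in> hodge_null Q L (sum_list la) (cmat g *v \<omega>)}"

definition nonzero_section ::
  "real ^ 'm ^ 'm \<Rightarrow> (real ^ 'm) set \<Rightarrow> (complex ^ 'm) set \<Rightarrow> nat list
     \<Rightarrow> (complex ^ 'm \<Rightarrow> 'm::finite tensor) \<Rightarrow> bool" where
  "nonzero_section Q L D la f \<longleftrightarrow> (\<exists>\<omega>\<in>D. f \<omega> \<notin> hodge_null Q L (sum_list la) \<omega>)"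

subsection \<open>Cusp forms\<close>

text \<open>
  Cusps are given by a generator \<open>e\<close> of the primitive isotropic sublattice \<open>I\<close>, together with an
  isotropic rational vector \<open>e'\<close> with \<open>(e, e') = 1\<close>. Then \<open>I\<^sup>\<bottom> / I\<close> is identified with the
  orthogonal complement of \<open>e\<close> and \<open>e'\<close>, and \<open>U(I)\<close> with the same space via \<open>z \<mapsto> z \<otimes> e\<close>,
  which is an isometry as \<open>e\<close> has norm 1 in \<open>I\<close>.
\<close>

definition cusp_frame :: "real ^ 'm ^ 'm \<Rightarrow> (real ^ 'm) set \<Rightarrow> real ^ 'm \<Rightarrow> real ^ 'm \<Rightarrow> bool" where
  "cusp_frame Q L e e' \<longleftrightarrow>
     e \<in> L \<and> e \<noteq> 0 \<and> rform Q e e = 0 \<and> primitive_in (int_span {e}) L \<and>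
     e' \<in> rat_space L \<and> rform Q e' e' = 0 \<and> rform Q e e' = 1"

definition U_rat ::
  "real ^ 'm ^ 'm \<Rightarrow> (real ^ 'm) set \<Rightarrow> real ^ 'm \<Rightarrow> real ^ 'm \<Rightarrow> (real ^ 'm) set" where
  "U_rat Q L e e' = {x \<in> rat_space L. rform Q x e = 0 \<and> rform Q x e' = 0}"

definition U_real ::
  "real ^ 'm ^ 'm \<Rightarrow> (real ^ 'm) set \<Rightarrow> real ^ 'm \<Rightarrow> real ^ 'm \<Rightarrow> (real ^ 'm) set" where
  "U_real Q L e e' = {x \<in> span L. rform Q x e = 0 \<and> rform Q x e' = 0}"

definition U_cplx ::
  "real ^ 'm ^ 'm \<Rightarrow> (real ^ 'm) set \<Rightarrow> real ^ 'm \<Rightarrow> real ^ 'm \<Rightarrow> (complex ^ 'm) set" where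
  "U_cplx Q L e e' = {z \<in> cspace L. cform Q z (cvec e) = 0 \<and> cform Q z (cvec e') = 0}"

definition transvection ::
  "real ^ 'm ^ 'm \<Rightarrow> real ^ 'm \<Rightarrow> real ^ 'm \<Rightarrow> real ^ 'm ^ 'm" where
  "transvection Q m l = matrix (\<lambda>v. v - rform Q m v *\<^sub>R l + rform Q l v *\<^sub>R m
                                     - (1/2 * rform Q m m * rform Q l v) *\<^sub>R l)"

definition U_int ::
  "real ^ 'm ^ 'm \<Rightarrow> (real ^ 'm) set \<Rightarrow> (real ^ 'm ^ 'm) set \<Rightarrow> real ^ 'm \<Rightarrow> real ^ 'm
     \<Rightarrow> (real ^ 'm) set" where
  "U_int Q L \<Gamma> e e' = {m \<in> U_rat Q L e e'. transvection Q m e \<in> \<Gamma>}"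

definition U_dual ::
  "real ^ 'm ^ 'm \<Rightarrow> (real ^ 'm) set \<Rightarrow> (real ^ 'm ^ 'm) set \<Rightarrow> real ^ 'm \<Rightarrow> real ^ 'm
     \<Rightarrow> (real ^ 'm) set" where
  "U_dual Q L \<Gamma> e e' = {l \<in> U_rat Q L e e'. \<forall>m\<in>U_int Q L \<Gamma> e e'. rform Q l m \<in> \<int>}"

definition tube_point ::
  "real ^ 'm ^ 'm \<Rightarrow> real ^ 'm \<Rightarrow> real ^ 'm \<Rightarrow> complex ^ 'm \<Rightarrow> complex ^ 'm" where
  "tube_point Q e e' z = cvec e' + z - (1/2 * cform Q z z) *s cvec e"

definition tube ::
  "real ^ 'm ^ 'm \<Rightarrow> (real ^ 'm) set \<Rightarrow> real ^ 'm \<Rightarrow> real ^ 'm \<Rightarrow> (real ^ 'm) set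
     \<Rightarrow> (complex ^ 'm) set" where
  "tube Q L e e' C = {z \<in> U_cplx Q L e e'. Imvec z \<in> C}"

text \<open>\<open>C\<close> is the component \<open>\<C>\<^sub>I\<close> of the positive cone whose tube domain is identified with the
  period domain with cone \<open>D\<close>.\<close>

definition is_cusp_cone ::
  "real ^ 'm ^ 'm \<Rightarrow> (real ^ 'm) set \<Rightarrow> (complex ^ 'm) set \<Rightarrow> real ^ 'm \<Rightarrow> real ^ 'm
     \<Rightarrow> (real ^ 'm) set \<Rightarrow> bool" where
  "is_cusp_cone Q L D e e' C \<longleftrightarrow>
     C \<in> components {x \<in> U_real Q L e e'. rform Q x x > 0} \<and>
     D = {c *s tube_point Q e e' z | c z. c \<noteq> 0 \<and> z \<in> tube Q L e e' C}"

text \<open>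
  The isomorphism from \<open>V(I)\<close> to the fibre of \<open>\<E>\<close> at \<open>[\<omega>]\<close>, for \<open>\<omega>\<close> normalized by
  \<open>(e, \<omega>) = 1\<close>: it sends \<open>v\<close> to its unique lift to \<open>I\<^sup>\<bottom>\<close> that is orthogonal to \<open>\<omega>\<close>.
\<close>

definition cusp_triv ::
  "real ^ 'm ^ 'm \<Rightarrow> real ^ 'm \<Rightarrow> complex ^ 'm \<Rightarrow> complex ^ 'm ^ 'm" where
  "cusp_triv Q e \<omega> = matrix (\<lambda>v. v - cform Q v \<omega> *s cvec e)"

text \<open>
  \<open>F\<close> is the modular form \<open>f\<close> seen as a \<open>V(I)\<^sub>\<lambda> \<otimes> (I\<^sup>\<or>)\<^bsup>k\<^esup>\<close>-valued function on the tube
  domain. The factor \<open>\<L>\<^bsup>k\<^esup>\<close> is trivialized by \<open>\<omega>\<^bsup>k\<^esup>\<close> where \<open>\<omega>\<close> is the vector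
  \<open>tube_point\<close>, which satisfies \<open>(e, \<omega>) = 1\<close>.
\<close>

definition fourier_expansion ::
  "real ^ 'm ^ 'm \<Rightarrow> (real ^ 'm) set \<Rightarrow> nat list \<Rightarrow> (real ^ 'm ^ 'm) set \<Rightarrow> real ^ 'm \<Rightarrow> real ^ 'm
     \<Rightarrow> (real ^ 'm) set \<Rightarrow> (complex ^ 'm \<Rightarrow> 'm::finite tensor) \<Rightarrow> (real ^ 'm \<Rightarrow> 'm tensor) \<Rightarrow> bool" where
  "fourier_expansion Q L la \<Gamma> e e' C f a \<longleftrightarrow>
     (\<forall>l\<in>U_dual Q L \<Gamma> e e'. a l \<in> schur Q la (U_cplx Q L e e') {0}) \<and>
     (\<exists>F. \<forall>z\<in>tube Q L e e' C.
        F z \<in> schur Q la (U_cplx Q L e e') {0} \<and>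
        f (tube_point Q e e' z) - tmap (cusp_triv Q e (tube_point Q e e' z)) (F z)
          \<in> hodge_null Q L (sum_list la) (tube_point Q e e' z) \<and>
        (\<forall>idx. ((\<lambda>l. a l idx * exp (2 * of_real pi * \<i> * cform Q (cvec l) z))
                  has_sum F z idx) (U_dual Q L \<Gamma> e e')))"

definition cusp_forms ::
  "real ^ 'm ^ 'm \<Rightarrow> (real ^ 'm) set \<Rightarrow> (complex ^ 'm) set \<Rightarrow> nat list \<Rightarrow> int
     \<Rightarrow> (real ^ 'm ^ 'm) set \<Rightarrow> (complex ^ 'm \<Rightarrow> 'm::finite tensor) set" where
  "cusp_forms Q L D la k \<Gamma> = {f \<in> modular_forms Q L D la k \<Gamma>.
     \<forall>e e' C. cusp_frame Q L e e' \<and> is_cusp_cone Q L D e e' C \<longrightarrow>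
       (\<exists>a. fourier_expansion Q L la \<Gamma> e e' C f a \<and>
            (\<forall>l\<in>U_dual Q L \<Gamma> e e'. a l \<noteq> 0 \<longrightarrow> l \<in> C))}"

subsection \<open>Vanishing order and quasi-pullback\<close>

definition extends_at ::
  "(complex ^ 'm) set \<Rightarrow> (complex ^ 'm \<Rightarrow> complex) \<Rightarrow> complex ^ 'm \<Rightarrow> (complex ^ 'm \<Rightarrow> complex)
     \<Rightarrow> bool" where
  "extends_at S h \<omega> H \<longleftrightarrow>
     (\<exists>U. open U \<and> \<omega> \<in> U \<and> holomorphic_cvec U H \<and> (\<forall>y\<in>U \<inter> S. H y = h y))"

text \<open>Sections, over the open set with cone \<open>S\<close>, of the ideal sheaf of the locus cut out by
  \<open>cspace L'\<close>; functions on the projective domain are functions of degree 0 on the cone.\<close>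

definition ideal_sections ::
  "(real ^ 'm) set \<Rightarrow> (complex ^ 'm) set \<Rightarrow> (complex ^ 'm \<Rightarrow> complex) set" where
  "ideal_sections L' S = {h.
     (\<forall>\<omega>\<in>S. \<forall>c. c \<noteq> 0 \<longrightarrow> h (c *s \<omega>) = h \<omega>) \<and>
     (\<forall>\<omega>\<in>S. \<exists>H. extends_at S h \<omega> H) \<and>
     (\<forall>\<omega>\<in>S \<inter> cspace L'. h \<omega> = 0)}"

text \<open>An expression of \<open>f\<close>, near the point \<open>[\<omega>]\<close>, as a sum of terms
  \<open>h\<^sub>1 \<cdots> h\<^sub>\<nu> s\<close> with \<open>h\<^sub>i\<close> in the ideal sheaf and \<open>s\<close> a section of \<open>\<E>\<^bsub>\<lambda>,k\<^esub>\<close>.\<close>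

definition ideal_power_expansion ::
  "real ^ 'm ^ 'm \<Rightarrow> (real ^ 'm) set \<Rightarrow> (real ^ 'm) set \<Rightarrow> (complex ^ 'm) set \<Rightarrow> nat list \<Rightarrow> int
     \<Rightarrow> nat \<Rightarrow> (complex ^ 'm \<Rightarrow> 'm::finite tensor) \<Rightarrow> complex ^ 'm
     \<Rightarrow> (complex ^ 'm) set \<Rightarrow> nat \<Rightarrow> (nat \<Rightarrow> nat \<Rightarrow> complex ^ 'm \<Rightarrow> complex)
     \<Rightarrow> (nat \<Rightarrow> complex ^ 'm \<Rightarrow> 'm tensor) \<Rightarrow> bool" where
  "ideal_power_expansion Q L L' D la k \<nu> f \<omega> S N h s \<longleftrightarrow>
     open_subcone D S \<and> \<omega> \<in> S \<and>
     (\<forall>j<N. \<forall>i<\<nu>. h j i \<in> ideal_sections L' S) \<and>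
     (\<forall>j<N. s j \<in> hodge_sections Q L S la k) \<and>
     (\<forall>y\<in>S. f y - (\<Sum>j<N. tscale (\<Prod>i<\<nu>. h j i y) (s j y)) \<in> hodge_null Q L (sum_list la) y)"

definition in_ideal_power ::
  "real ^ 'm ^ 'm \<Rightarrow> (real ^ 'm) set \<Rightarrow> (real ^ 'm) set \<Rightarrow> (complex ^ 'm) set \<Rightarrow> nat list \<Rightarrow> int
     \<Rightarrow> nat \<Rightarrow> (complex ^ 'm \<Rightarrow> 'm::finite tensor) \<Rightarrow> bool" where
  "in_ideal_power Q L L' D la k \<nu> f \<longleftrightarrow>
     (\<forall>\<omega>\<in>D. \<exists>S N h s. ideal_power_expansion Q L L' D la k \<nu> f \<omega> S N h s)"

definition is_vanishing_order ::
  "real ^ 'm ^ 'm \<Rightarrow> (real ^ 'm) set \<Rightarrow> (real ^ 'm) set \<Rightarrow> (complex ^ 'm) set \<Rightarrow> nat list \<Rightarrow> int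
     \<Rightarrow> (complex ^ 'm \<Rightarrow> 'm::finite tensor) \<Rightarrow> nat \<Rightarrow> bool" where
  "is_vanishing_order Q L L' D la k f \<nu> \<longleftrightarrow>
     in_ideal_power Q L L' D la k \<nu> f \<and>
     (\<forall>\<mu>. in_ideal_power Q L L' D la k \<mu> f \<longrightarrow> \<mu> \<le> \<nu>)"

text \<open>The differential at \<open>\<omega>\<close> of a holomorphic function on \<open>S\<close>; on vectors \<open>u\<close> tangent to \<open>S\<close>, which
  means \<open>(u, \<omega>) = 0\<close>, it does not depend on the chosen local extension.\<close>

definition differential ::
  "(complex ^ 'm) set \<Rightarrow> (complex ^ 'm \<Rightarrow> complex) \<Rightarrow> complex ^ 'm \<Rightarrow> complex ^ 'm \<Rightarrow> complex" where
  "differential S h \<omega> u = frechet_derivative (SOME H. extends_at S h \<omega> H) (at \<omega>) u"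

text \<open>
  The image of \<open>f\<close> in \<open>\<I>\<^bsup>\<nu>\<^esup> / \<I>\<^bsup>\<nu>+1\<^esup> \<otimes> \<E>\<^bsub>\<lambda>,k\<^esub>\<close> at \<open>[\<omega>]\<close>, given as a polynomial
  map \<open>u \<mapsto> quasi_pullback \<dots> f \<omega> u\<close> of degree \<open>\<nu>\<close> on \<open>cspace K\<close>: the class of
  \<open>h\<^sub>1 \<cdots> h\<^sub>\<nu> s\<close> is \<open>dh\<^sub>1 \<cdots> dh\<^sub>\<nu> s\<close>, the vector \<open>u\<close> being
  the normal vector \<open>\<omega> \<mapsto> u\<close> in \<open>\<L>\<^bsup>-1\<^esup> \<otimes> K\<close>. Up to congruence modulo \<open>hodge_null\<close>,
  the value does not depend on the chosen expansion; as a function of \<open>\<omega>\<close> it is homogeneous of degree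
  \<open>-(k + \<nu>)\<close>.
\<close>

definition quasi_pullback ::
  "real ^ 'm ^ 'm \<Rightarrow> (real ^ 'm) set \<Rightarrow> (real ^ 'm) set \<Rightarrow> (complex ^ 'm) set \<Rightarrow> nat list \<Rightarrow> int
     \<Rightarrow> nat \<Rightarrow> (complex ^ 'm \<Rightarrow> 'm::finite tensor) \<Rightarrow> complex ^ 'm \<Rightarrow> complex ^ 'm \<Rightarrow> 'm tensor" where
  "quasi_pullback Q L L' D la k \<nu> f \<omega> =
     (SOME p. \<exists>S N h s. ideal_power_expansion Q L L' D la k \<nu> f \<omega> S N h s \<and>
        p = (\<lambda>u. \<Sum>j<N. tscale (\<Prod>i<\<nu>. differential S (h j i) \<omega> u) (s j \<omega>)))"

subsection \<open>Decomposition of the quasi-pullback\<close>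

text \<open>The space \<open>V'\<^bsub>\<lambda>'\<^esub> \<otimes> V''\<^bsub>\<lambda>''\<^esub>\<close>, realized by tensors of degree
  \<open>\<bar>\<lambda>'\<bar> + \<bar>\<lambda>''\<bar>\<close>.\<close>

definition schur_box ::
  "real ^ 'm ^ 'm \<Rightarrow> nat list \<Rightarrow> nat list \<Rightarrow> (complex ^ 'm) set \<Rightarrow> (complex ^ 'm) set
     \<Rightarrow> 'm::finite tensor set" where
  "schur_box Q la' la'' V' V'' = tensor.span
     {tprod (sum_list la') x y | x y. x \<in> schur Q la' V' {0} \<and> y \<in> schur Q la'' V'' {0}}"

definition preserves :: "real ^ 'm ^ 'm \<Rightarrow> (complex ^ 'm) set \<Rightarrow> complex ^ 'm ^ 'm \<Rightarrow> bool" where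
  "preserves Q V g \<longleftrightarrow> (\<lambda>v. g *v v) ` V = V \<and>
     (\<forall>v\<in>V. \<forall>w\<in>V. cform Q (g *v v) (g *v w) = cform Q v w)"

definition sum_space :: "(complex ^ 'm) set \<Rightarrow> (complex ^ 'm) set \<Rightarrow> (complex ^ 'm) set" where
  "sum_space V' V'' = {v + w | v w. v \<in> V' \<and> w \<in> V''}"

text \<open>
  An irreducible decomposition of \<open>(V' \<oplus> V'')\<^sub>\<lambda>\<close> under \<open>O(V') \<times> O(V'')\<close>, where \<open>V'\<close> and
  \<open>V''\<close> are orthogonal of dimension \<open>n'\<close> and \<open>r\<close>: the \<open>N\<close> constituents are labelled by \<open>\<alpha> < N\<close>, and
  \<open>\<phi> \<alpha>\<close> is the projection to the constituent with label \<open>\<alpha>\<close>.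
\<close>

definition irreducible_decomposition ::
  "real ^ 'm ^ 'm \<Rightarrow> (complex ^ 'm) set \<Rightarrow> (complex ^ 'm) set \<Rightarrow> nat \<Rightarrow> nat \<Rightarrow> nat list
     \<Rightarrow> nat \<Rightarrow> (nat \<Rightarrow> nat list) \<Rightarrow> (nat \<Rightarrow> nat list) \<Rightarrow> (nat \<Rightarrow> 'm::finite tensor \<Rightarrow> 'm tensor)
     \<Rightarrow> bool" where
  "irreducible_decomposition Q V' V'' n' r la N la' la'' \<phi> \<longleftrightarrow>
     (\<forall>\<alpha><N. O_partition n' (la' \<alpha>) \<and> O_partition r (la'' \<alpha>)) \<and>
     (\<forall>\<alpha><N. \<forall>S\<in>schur Q la (sum_space V' V'') {0}. \<forall>T\<in>schur Q la (sum_space V' V'') {0}.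
        \<forall>c. \<phi> \<alpha> (S + tscale c T) = \<phi> \<alpha> S + tscale c (\<phi> \<alpha> T)) \<and>
     (\<forall>\<alpha><N. \<forall>T\<in>schur Q la (sum_space V' V'') {0}. \<forall>g.
        preserves Q V' g \<and> preserves Q V'' g \<longrightarrow> \<phi> \<alpha> (tmap g T) = tmap g (\<phi> \<alpha> T)) \<and>
     bij_betw (\<lambda>T. \<lambda>\<alpha>\<in>{..<N}. \<phi> \<alpha> T) (schur Q la (sum_space V' V'') {0})
       (\<Pi>\<^sub>E \<alpha>\<in>{..<N}. schur_box Q (la' \<alpha>) (la'' \<alpha>) V' V'')"

text \<open>
  The decomposition carried over to the fibre of \<open>\<E>\<^sub>\<lambda>\<close> at a point \<open>[\<omega>]\<close> of the smaller
  domain: \<open>g\<close> identifies \<open>V'\<close> isometrically with the fibre of \<open>\<E>'\<close> and is the identity on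
  \<open>cspace K\<close>. By equivariance, the result does not depend on \<open>g\<close>, up to congruence modulo
  \<open>box_null\<close>.
\<close>

definition fibre_frame ::
  "real ^ 'm ^ 'm \<Rightarrow> (real ^ 'm) set \<Rightarrow> (real ^ 'm) set \<Rightarrow> (complex ^ 'm) set \<Rightarrow> complex ^ 'm
     \<Rightarrow> complex ^ 'm ^ 'm \<Rightarrow> bool" where
  "fibre_frame Q L' K V' \<omega> g \<longleftrightarrow>
     (\<forall>v\<in>V'. g *v v \<in> cperp Q L' \<omega>) \<and>
     (\<forall>v\<in>V'. \<forall>w\<in>V'. cform Q (g *v v) (g *v w) = cform Q v w) \<and>
     (\<forall>u\<in>cspace K. g *v u = u)"

definition fibre_component ::
  "real ^ 'm ^ 'm \<Rightarrow> (real ^ 'm) set \<Rightarrow> (real ^ 'm) set \<Rightarrow> (real ^ 'm) set \<Rightarrow> (complex ^ 'm) set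
     \<Rightarrow> nat list \<Rightarrow> ('m::finite tensor \<Rightarrow> 'm tensor) \<Rightarrow> complex ^ 'm \<Rightarrow> 'm tensor \<Rightarrow> 'm tensor" where
  "fibre_component Q L L' K V' la \<phi> \<omega> x =
     (SOME y. \<exists>g T. fibre_frame Q L' K V' \<omega> g \<and> T \<in> schur Q la (sum_space V' (cspace K)) {0} \<and>
        x - tmap g T \<in> hodge_null Q L (sum_list la) \<omega> \<and> y = tmap g (\<phi> T))"

definition box_null ::
  "real ^ 'm ^ 'm \<Rightarrow> (real ^ 'm) set \<Rightarrow> (real ^ 'm) set \<Rightarrow> nat \<Rightarrow> nat \<Rightarrow> complex ^ 'm
     \<Rightarrow> 'm::finite tensor set" where
  "box_null Q L' K d' d'' \<omega> = tensor.span
     {tprod d' x y | x y. x \<in> hodge_null Q L' d' \<omega> \<and> y \<in> tpow d'' (cspace K)}"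

text \<open>
  The space \<open>((K\<^sub>\<complex>)\<^bsub>\<lambda>''\<^esub> \<otimes> Sym\<^bsup>\<nu>\<^esup> K\<^sub>\<complex>)\<^bsup>G\<^esup>\<close>. By the pairing,
  \<open>\<kappa>\<^sub>1 \<cdots> \<kappa>\<^sub>\<nu>\<close> in \<open>Sym\<^bsup>\<nu>\<^esup> K\<^sub>\<complex>\<close> is
  the polynomial \<open>u \<mapsto> (\<kappa>\<^sub>1, u) \<cdots> (\<kappa>\<^sub>\<nu>, u)\<close>.
\<close>

definition sym_invariants ::
  "real ^ 'm ^ 'm \<Rightarrow> (real ^ 'm) set \<Rightarrow> (real ^ 'm ^ 'm) set \<Rightarrow> nat list \<Rightarrow> nat
     \<Rightarrow> (complex ^ 'm \<Rightarrow> 'm::finite tensor) set" where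
  "sym_invariants Q K G la \<nu> = {w.
     (\<exists>N \<kappa> t. (\<forall>j<N. t j \<in> schur Q la (cspace K) {0} \<and> (\<forall>i<\<nu>. \<kappa> j i \<in> cspace K)) \<and>
        w = (\<lambda>u. \<Sum>j<(N::nat). tscale (\<Prod>i<\<nu>. cform Q (\<kappa> j i) u) (t j))) \<and>
     (\<forall>g\<in>G. \<forall>u\<in>cspace K. w (cmat g *v u) = tmap (cmat g) (w u))}"

text \<open>The space \<open>S\<^bsub>\<lambda>',k\<^esub>(\<Gamma>') \<otimes> ((K\<^sub>\<complex>)\<^bsub>\<lambda>''\<^esub> \<otimes> Sym\<^bsup>\<nu>\<^esup> K\<^sub>\<complex>)\<^bsup>G\<^esup>\<close>
  as a space of sections over the smaller domain.\<close>

definition cusp_tensor_space ::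
  "real ^ 'm ^ 'm \<Rightarrow> (real ^ 'm) set \<Rightarrow> (real ^ 'm) set \<Rightarrow> (complex ^ 'm) set
     \<Rightarrow> (real ^ 'm ^ 'm) set \<Rightarrow> (real ^ 'm ^ 'm) set \<Rightarrow> nat list \<Rightarrow> nat list \<Rightarrow> int \<Rightarrow> nat
     \<Rightarrow> (complex ^ 'm \<Rightarrow> complex ^ 'm \<Rightarrow> 'm::finite tensor) set" where
  "cusp_tensor_space Q L' K D' \<Gamma>' G la' la'' k \<nu> = {q.
     \<exists>N s w. (\<forall>i<(N::nat). s i \<in> cusp_forms Q L' D' la' k \<Gamma>' \<and> w i \<in> sym_invariants Q K G la'' \<nu>) \<and>
       (\<forall>\<omega>\<in>D'. \<forall>u\<in>cspace K.
          q \<omega> u - (\<Sum>i<N. tprod (sum_list la') (s i \<omega>) (w i u))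
            \<in> box_null Q L' K (sum_list la') (sum_list la'') \<omega>)}"

end

theory Submission
 imports Defs "HOL-Complex_Analysis.Conformal_Mappings"
begin

text \<open>
  The values of \<open>f\<close> are sections of a bundle, so they are compared in a trivialization. A pair of real
  isotropic vectors \<open>e, e'\<close> with \<open>(e, e') = 1\<close> identifies every fibre of \<open>\<E>\<close> with the orthogonal complement of
  \<open>e\<close> and \<open>e'\<close> (maps \<open>Ptriv\<close> and \<open>Rtriv\<close>); null tensors become \<open>0\<close>. In it the quasi-pullback at \<open>(\<omega>, u)\<close> is
  the leading coefficient, in \<open>t\<close>, of \<open>f\<close> along the curve \<open>\<omega> + t u - \<dots>\<close> normal to the smaller domain
  (\<open>qp_limit\<close>). Hence it does not depend on the chosen expansion, it is equivariant, homogeneous and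
  holomorphic.

  At a cusp of \<open>L'\<close>, which is also one of \<open>L\<close>, expand \<open>f = \<Sum>\<^sub>l a(l) exp (2 \<pi> \<i> (l, Z))\<close> over the tube domain of \<open>L\<close>.
  Koecher's principle says that \<open>a(l) \<noteq> 0\<close> implies \<open>(l, y) \<ge> 0\<close> on the whole positive cone. For \<open>Z = z + t u\<close>
  with \<open>z\<close> in the tube domain of \<open>L'\<close> and \<open>u\<close> in \<open>K\<close>, the coefficient of \<open>t\<^sup>\<nu>\<close> is
  \<open>\<Sum>\<^sub>l a(l) (2 \<pi> \<i> (l, u))\<^sup>\<nu> / \<nu>! exp (2 \<pi> \<i> (l, z))\<close>. As \<open>\<nu> > 0\<close>, only those \<open>l\<close> contribute whose component in \<open>K\<close>
  is nonzero. That component has negative norm, and a vector \<open>l\<close> of the closed cone with a nonzero component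
  in a negative definite space has its other component in the open cone
  (\<open>tangential_frequency_positive\<close>). So all frequencies of the quasi-pullback lie in the open cone:
  \<open>quasi_pullback_fourier\<close>.

  Koecher's principle (\<open>Koecher_principle\<close>) rests on isometries of infinite order in \<open>\<Gamma>\<close> that fix the cusp. They
  are made from solutions of Pell's equation in planes spanned by two orthogonal lattice vectors.

  For the decomposition under \<open>O(V') \<times> O(K)\<close>, the components do not depend on the frame at a point by
  equivariance (\<open>transition\<close>); frames coming from different cusps, or moved by \<open>\<Gamma>\<close>, thus give the same
  components modulo null tensors. A component is, in \<open>u\<close>, a \<open>G\<close>-invariant polynomial with values in
  \<open>V''\<^bsub>\<lambda>''\<^esub>\<close>. Such polynomials form a finite-dimensional space, in which an element is determined by finitely
  many of its scalar values (\<open>interpolation\<close>). These values, as functions of \<open>\<omega>\<close>, are the cusp forms of the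
  tensor product (\<open>coord_cusp_form\<close>).
\<close>

section \<open>Linear maps of tensors\<close>

interpretation tensor_pair: vector_space_pair tscale tscale by unfold_locales

abbreviation tlinear :: "('a tensor => 'b tensor) => bool" where
 "tlinear \<equiv> Vector_Spaces.linear tscale tscale"

lemma tlinearI:
 assumes "!!S T. f (S + T) = f S + f T" "!!c T. f (tscale c T) = tscale c (f T)" shows "tlinear f"
 by unfold_locales (use assms in auto)

lemma tlinear_add: "tlinear f ==> f (S + T) = f S + f T" by (rule tensor_pair.linear_add)

lemma tlinear_scale: "tlinear f ==> f (tscale c T) = tscale c (f T)" by (rule tensor_pair.linear_scale)

lemma tlinear_diff: "tlinear f ==> f (S - T) = f S - f T" by (rule tensor_pair.linear_diff)

lemma tlinear_0: "tlinear f ==> f 0 = 0" by (rule tensor_pair.linear_0)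

lemma tlinear_sum: "tlinear f ==> f (SUM i:I. g i) = (SUM i:I. f (g i))" by (rule tensor_pair.linear_sum)

lemma tlinear_compose:
 assumes f: "tlinear f" and g: "tlinear g" shows "tlinear (%T. g (f T))"
 by (rule tlinearI) (simp_all only: tlinear_add[OF f] tlinear_add[OF g] tlinear_scale[OF f] tlinear_scale[OF g])

lemma tlinear_compose_sum:
 assumes "!!i. i : I ==> tlinear (f i)" shows "tlinear (%T. SUM i:I. f i T)"
proof (rule tlinearI)
 show "(SUM i:I. f i (S + T)) = (SUM i:I. f i S) + (SUM i:I. f i T)" for S T
  unfolding sum.distrib[symmetric] by (rule sum.cong[OF refl]) (rule tlinear_add[OF assms])
 show "(SUM i:I. f i (tscale c T)) = tscale c (SUM i:I. f i T)" for c T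
  unfolding tensor.scale_sum_right by (rule sum.cong[OF refl]) (rule tlinear_scale[OF assms])
qed

lemma tlinear_compose_scale:
 assumes f: "tlinear f" shows "tlinear (%T. tscale c (f T))" by (rule tlinearI)
  (simp_all only: tlinear_add[OF f] tlinear_scale[OF f] tensor.scale_right_distrib tensor.scale_scale mult.commute)

lemma tlinear_diff_fun:
 assumes f: "tlinear f" and g: "tlinear g" shows "tlinear (%T. f T - g T)" by (rule tlinearI)
  (simp_all only: tlinear_add[OF f] tlinear_scale[OF f] tlinear_add[OF g] tlinear_scale[OF g]
  tensor.scale_right_diff_distrib add_diff_add)

lemma tlinear_span_image:
 assumes f: "tlinear f" and "!!x. x : B ==> f x : tensor.span C" "x : tensor.span B" shows "f x : tensor.span C" using assms(3)
proof (induction rule: tensor.span_induct_alt)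
 case base
 then show ?case by (simp only: tlinear_0[OF f] tensor.span_zero)
next
 case (step c x y)
 then show ?case by (simp only: tlinear_add[OF f] tlinear_scale[OF f] tensor.span_add tensor.span_scale assms(2))
qed

lemma tlinear_span_eq:
 assumes "tlinear f" "tlinear g" "!!x. x : B ==> f x = g x" "x : tensor.span B" shows "f x = g x"
 using tlinear_span_image[OF tlinear_diff_fun[OF assms(1,2)], of B "{}" x] assms by auto

lemma sum_tensor_apply: "(SUM i:I. f i) x = (SUM i:I. f i (x :: 'm list) :: complex)"
 by (induction I rule: infinite_finite_induct) auto

lemma tscale_apply [simp]: "tscale c T idx = c * T idx" by (simp add: tscale_def)

section \<open>Sums over lists of a given length\<close>

lemma finite_len [simp]: "finite {xs :: 'm::finite list. length xs = n}"
 using finite_lists_length_eq[of "UNIV :: 'm set" n] by simp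

lemma sum_len_Suc:
 "(\<Sum>xs | length xs = Suc n. f xs) = (SUM a:UNIV. \<Sum>xs | length xs = n. f ((a::'m::finite) # xs))"
proof -
 have eq: "{xs. length xs = Suc n} = (%(a, xs). (a::'m) # xs) ` (UNIV \<times> {xs. length xs = n})"
  by (auto simp: length_Suc_conv image_def)
 show ?thesis unfolding eq sum.cartesian_product by (subst sum.reindex) (auto simp: inj_on_def case_prod_unfold o_def)
qed

lemma prod_sum_len:
 fixes g :: "nat => 'm::finite => complex"
 shows "(\<Sum>xs | length xs = n. \<Prod>i<n. g i (xs ! i)) = (\<Prod>i<n. SUM a:UNIV. g i a)"
proof (induction n arbitrary: g)
 case 0
 then show ?case by simp
next
 case (Suc n)
 have "(\<Sum>xs | length xs = Suc n. \<Prod>i<Suc n. g i (xs ! i))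
  = (SUM a:UNIV. \<Sum>xs | length xs = n. g 0 a * (\<Prod>i<n. g (Suc i) (xs ! i)))"
  by (subst sum_len_Suc) (simp add: prod.lessThan_Suc_shift del: prod.lessThan_Suc)
 also have "... = (SUM a:UNIV. g 0 a) * (\<Sum>xs | length xs = n. \<Prod>i<n. g (Suc i) (xs ! i))"
  by (simp only: sum_product)
 also have "... = (\<Prod>i<Suc n. SUM a:UNIV. g i a)"
  by (subst Suc.IH) (simp add: prod.lessThan_Suc_shift del: prod.lessThan_Suc)
 finally show ?case .
qed

section \<open>Pure tensors and the action of linear maps\<close>

lemma tlinear_tmap: "tlinear (tmap M)" by (rule tlinearI)
  (auto simp: tmap_def fun_eq_iff algebra_simps sum.distrib sum_distrib_left)

lemmas tmap_add = tlinear_add[OF tlinear_tmap]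
 and tmap_scale = tlinear_scale[OF tlinear_tmap]
 and tmap_diff = tlinear_diff[OF tlinear_tmap]
 and tmap_sum = tlinear_sum[OF tlinear_tmap]
 and tmap_0 = tlinear_0[OF tlinear_tmap]

lemma tmap_pure: "tmap M (pure_tensor vs) = pure_tensor (map (%v. M *v v) vs)"
proof
 fix idx :: "'a list"
 show "tmap M (pure_tensor vs) idx = pure_tensor (map (%v. M *v v) vs) idx"
 proof (cases "length idx = length vs")
  case True
  have "tmap M (pure_tensor vs) idx
  = (\<Sum>jdx | length jdx = length vs. \<Prod>i<length vs. M $ (idx ! i) $ (jdx ! i) * (vs ! i) $ (jdx ! i))"
  by (simp add: tmap_def pure_tensor_def True prod.distrib)
  also have "... = (\<Prod>i<length vs. SUM a:UNIV. M $ (idx ! i) $ a * (vs ! i) $ a)" by (rule prod_sum_len)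
  finally show ?thesis by (simp add: pure_tensor_def True matrix_vector_mult_def)
 next
  case False
  then show ?thesis by (auto simp: tmap_def pure_tensor_def intro!: sum.neutral)
 qed
qed

lemma pure_Nil: "pure_tensor [] = (%idx. if idx = [] then 1 else 0)" by (auto simp: pure_tensor_def)

lemma pure_Cons_Nil [simp]: "pure_tensor (v # vs) [] = 0" by (simp add: pure_tensor_def)

lemma pure_Cons_Cons [simp]: "pure_tensor (v # vs) (i # idx) = v $ i * pure_tensor vs idx"
 by (simp add: pure_tensor_def prod.lessThan_Suc_shift del: prod.lessThan_Suc)

lemma pure_append:
 "pure_tensor (vs @ ws) idx = pure_tensor vs (take (length vs) idx) * pure_tensor ws (drop (length vs) idx)"
proof (induction vs arbitrary: idx)
 case Nil
 then show ?case by (simp add: pure_Nil)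
next
 case (Cons v vs)
 show ?case by (cases idx) (auto simp: Cons.IH)
qed

lemma tprod_pure: "tprod (length vs) (pure_tensor vs) (pure_tensor ws) = pure_tensor (vs @ ws)"
 by (simp add: tprod_def fun_eq_iff pure_append)

lemma tlinear_tprod_left: "tlinear (%S. tprod d S T)" by (rule tlinearI) (auto simp: tprod_def fun_eq_iff algebra_simps)

lemma tlinear_tprod_right: "tlinear (%T. tprod d S T)" by (rule tlinearI) (auto simp: tprod_def fun_eq_iff algebra_simps)

lemma pure_axis:
 "pure_tensor (map (%a. axis a 1) jdx) = (%idx. if idx = jdx then 1 else 0)"
proof
 fix idx
 show "pure_tensor (map (%a. axis a 1) jdx) idx = (if idx = jdx then 1 else 0)"
 proof (induction jdx arbitrary: idx)
  case Nil
  then show ?case by (simp add: pure_Nil)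
 next
  case (Cons a jdx)
  then show ?case by (cases idx) (auto simp: axis_def)
 qed
qed

lemma tpow_deg: "T : tpow d A ==> length idx ~= d ==> T idx = 0" unfolding tpow_def
 by (induction rule: tensor.span_induct_alt) (auto simp: pure_tensor_def)

lemma tensor_expand:
 fixes T :: "'m::finite tensor"
 assumes "!!idx. length idx ~= d ==> T idx = 0"
 shows "T = (\<Sum>jdx | length jdx = d. tscale (T jdx) (pure_tensor (map (%a. axis a 1) jdx)))"
proof
 fix idx :: "'m list"
 have "(\<Sum>jdx | length jdx = d. tscale (T jdx) (pure_tensor (map (%a. axis a 1) jdx))) idx
  = (\<Sum>jdx | length jdx = d. if jdx = idx then T jdx else 0)"
  unfolding sum_tensor_apply by (rule sum.cong) (auto simp: pure_axis)
 also have "... = T idx" using assms[of idx] by (auto simp: sum.delta)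
 finally show "T idx = (\<Sum>jdx | length jdx = d. tscale (T jdx) (pure_tensor (map (%a. axis a 1) jdx))) idx" ..
qed

lemma tnull_subset_tpow: "tnull d A R <= tpow d A" unfolding tpow_def tnull_def by (rule tensor.span_mono) blast

lemma tpow_subspace: "tensor.subspace (tpow d A)" by (simp add: tpow_def)

lemma tnull_subspace: "tensor.subspace (tnull d A R)" by (simp add: tnull_def)

lemma tmap_tpow:
 assumes "T : tpow d A" "!!v. v : A ==> M *v v : A'" shows "tmap M T : tpow d A'" using assms(1) unfolding tpow_def
proof (rule tlinear_span_image[OF tlinear_tmap, rotated])
 fix x assume "x : {pure_tensor vs |vs. length vs = d & set vs <= A}"
 then obtain vs where "x = pure_tensor vs" "length vs = d" "set vs <= A" by blast
 then show "tmap M x : tensor.span {pure_tensor vs |vs. length vs = d & set vs <= A'}" using assms(2)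
  by (intro tensor.span_base CollectI exI[of _ "map (%v. M *v v) vs"]) (auto simp: tmap_pure)
qed

lemma tmap_tnull:
 assumes "T : tnull d A R" "!!v. v : A ==> M *v v : A'" "!!v. v : R ==> M *v v : R'" shows "tmap M T : tnull d A' R'"
 using assms(1) unfolding tnull_def
proof (rule tlinear_span_image[OF tlinear_tmap, rotated])
 fix x assume "x : {pure_tensor vs |vs. length vs = d & set vs <= A & set vs Int R ~= {}}"
 then obtain vs where "x = pure_tensor vs" "length vs = d" "set vs <= A" "set vs Int R ~= {}" by blast
 then show "tmap M x : tensor.span {pure_tensor vs |vs. length vs = d & set vs <= A' & set vs Int R' ~= {}}"
  using assms(2,3) by (intro tensor.span_base CollectI exI[of _ "map (%v. M *v v) vs"]) (auto simp: tmap_pure subset_iff)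
qed

lemma pure_zero: "0 : set vs ==> pure_tensor vs = 0"
proof
 fix idx assume "0 : set vs"
 then obtain i where "i < length vs" "vs ! i = 0" by (auto simp: in_set_conv_nth)
 then show "pure_tensor vs idx = 0 idx" by (auto simp: pure_tensor_def intro!: prod_zero bexI[of _ i])
qed

lemma tnull_zero [simp]: "tnull d A {0} = {0}"
proof -
 have "tnull d A {0} <= tensor.span {0}" unfolding tnull_def by (rule tensor.span_mono) (auto intro!: pure_zero)
 then show ?thesis using tensor.subspace_0[OF tnull_subspace, of d A "{0}"] by auto
qed

lemma tmap_tnull_zero:
 assumes "T : tnull d A R" "!!v. v : R ==> M *v v = 0" shows "tmap M T = 0"
 using tmap_tnull[of T d A R M UNIV "{0}"] assms by auto

lemma tmap_cong:
 assumes "T : tpow d A" "!!v. v : A ==> M *v v = M' *v v" shows "tmap M T = tmap M' T" using assms(1) unfolding tpow_def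
 by (rule tlinear_span_eq[OF tlinear_tmap tlinear_tmap, rotated])
  (use assms(2) in "auto simp: tmap_pure subset_iff intro!: arg_cong[of _ _ pure_tensor]")

lemma tmap_compose: 
 fixes M N :: "complex ^ 'm ^ 'm" shows "tmap M (tmap N T) = tmap (M ** N) T"
proof
 fix idx :: "'m list"
 let ?d = "length idx"
 have "tmap M (tmap N T) idx = (\<Sum>jdx | length jdx = ?d. \<Sum>kdx | length kdx = ?d.
  (\<Prod>i<?d. M $ (idx ! i) $ (jdx ! i) * N $ (jdx ! i) $ (kdx ! i)) * T kdx)"
  by (simp add: tmap_def sum_distrib_left prod.distrib mult.assoc)
 also have "... = (\<Sum>kdx | length kdx = ?d. (\<Sum>jdx | length jdx = ?d.
  (\<Prod>i<?d. M $ (idx ! i) $ (jdx ! i) * N $ (jdx ! i) $ (kdx ! i))) * T kdx)"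
  by (subst sum.swap) (simp add: sum_distrib_right)
 also have "... = tmap (M ** N) T idx" by (subst prod_sum_len) (simp add: tmap_def matrix_matrix_mult_def)
 finally show "tmap M (tmap N T) idx = tmap (M ** N) T idx" .
qed

lemma tmap_id:
 fixes T :: "'m::finite tensor"
 assumes "T : tpow d A" "!!v. v : A ==> M *v v = v" shows "tmap M T = T"
proof -
 have "tmap M T = id T" using assms(1) unfolding tpow_def by (rule tlinear_span_eq[OF tlinear_tmap tensor.linear_id, rotated])
  (use assms(2) in "auto simp: tmap_pure map_idI subset_iff")
 then show ?thesis by simp
qed

text \<open>Two maps that agree modulo \<open>R\<close> induce the same map to the tensor power of the quotient by
  \<open>R\<close>: the factors are exchanged one after the other.\<close>

lemma tmap_diff_tnull:
 assumes "T : tpow d A0"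
  and "!!v. v : A0 ==> M *v v : A" "!!v. v : A0 ==> M' *v v : A" "!!v. v : A0 ==> M *v v - M' *v v : R"
  and "R <= A" shows "tmap M T - tmap M' T : tnull d A R"
proof -
 have pure: "tmap M (pure_tensor vs) - tmap M' (pure_tensor vs) : tnull (length vs) A R"
  if "set vs <= A0" for vs using that
 proof (induction vs)
  case Nil
  then show ?case by (simp only: tmap_pure list.map diff_self tensor.subspace_0[OF tnull_subspace])
 next
  case (Cons v vs)
  let ?f = "%T. tprod 1 (pure_tensor [M' *v v]) T"
  have "tmap M (pure_tensor (v # vs)) - tmap M' (pure_tensor (v # vs))
  = pure_tensor ((M *v v - M' *v v) # map (%v. M *v v) vs)
  + ?f (tmap M (pure_tensor vs) - tmap M' (pure_tensor vs))"
  proof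
  fix idx show "(tmap M (pure_tensor (v # vs)) - tmap M' (pure_tensor (v # vs))) idx
  = (pure_tensor ((M *v v - M' *v v) # map (%v. M *v v) vs)
  + ?f (tmap M (pure_tensor vs) - tmap M' (pure_tensor vs))) idx"
  by (cases idx) (auto simp: tmap_pure tprod_def algebra_simps pure_Nil)
  qed
  moreover have "pure_tensor ((M *v v - M' *v v) # map (%v. M *v v) vs) : tnull (length (v # vs)) A R"
  unfolding tnull_def using Cons.prems assms(2-5) by (intro tensor.span_base CollectI exI conjI refl) (auto simp: subset_iff)
  moreover have "?f (tmap M (pure_tensor vs) - tmap M' (pure_tensor vs)) : tnull (length (v # vs)) A R"
  proof -
  have "tmap M (pure_tensor vs) - tmap M' (pure_tensor vs) : tnull (length vs) A R" by (rule Cons.IH) (use Cons.prems in simp)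
  then show ?thesis unfolding tnull_def
  proof (rule tlinear_span_image[OF tlinear_tprod_right, rotated])
  fix x assume "x : {pure_tensor us |us. length us = length vs & set us <= A & set us Int R ~= {}}"
  then obtain us where us: "x = pure_tensor us" "length us = length vs" "set us <= A" "set us Int R ~= {}" by blast
  have "?f x = pure_tensor ((M' *v v) # us)" using tprod_pure[of "[M' *v v]" us] us by simp
  then show "?f x : tensor.span {pure_tensor us |us. length us = length (v # vs) & set us <= A & set us Int R ~= {}}"
  using us assms(3) Cons.prems by (intro tensor.span_base CollectI exI[of _ "(M' *v v) # us"]) auto
  qed
  qed
  ultimately show ?case by (simp only: tensor.subspace_add[OF tnull_subspace])
 qed
 show ?thesis using assms(1) unfolding tpow_def tnull_def
  by (rule tlinear_span_image[OF tlinear_diff_fun[OF tlinear_tmap tlinear_tmap], rotated])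
  (use pure in "auto simp: tnull_def")
qed

lemma tprod_span_induct:
 assumes "S : tensor.span A" "T : tensor.span B"
  and "!!x y. x : A ==> y : B ==> tprod d x y : tensor.span C" shows "tprod d S T : tensor.span C" using assms(1)
proof (rule tlinear_span_image[OF tlinear_tprod_left, rotated])
 fix x assume "x : A"
 show "tprod d x T : tensor.span C"
  using assms(2) by (rule tlinear_span_image[OF tlinear_tprod_right, rotated]) (use assms(3) \<open>x : A\<close> in auto)
qed

lemma tmap_tprod:
 fixes M :: "complex ^ 'm ^ 'm"
 assumes S: "S : tpow d A" and T: "T : tpow d' B" shows "tmap M (tprod d S T) = tprod d (tmap M S) (tmap M T)"
 using S unfolding tpow_def
proof (rule tlinear_span_eq[where f = "%S. tmap M (tprod d S T)", rotated 3])
 fix x assume "x : {pure_tensor vs |vs. length vs = d & set vs <= A}"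
 then obtain vs where vs: "x = pure_tensor vs" "length vs = d" by blast
 show "tmap M (tprod d x T) = tprod d (tmap M x) (tmap M T)" using T unfolding tpow_def
 proof (rule tlinear_span_eq[where f = "%T. tmap M (tprod d x T)", rotated 3])
  fix y assume "y : {pure_tensor vs |vs. length vs = d' & set vs <= B}"
  then obtain ws where ws: "y = pure_tensor ws" "length ws = d'" by blast
  show "tmap M (tprod d x y) = tprod d (tmap M x) (tmap M y)"
  using tprod_pure[of vs ws] tprod_pure[of "map (%v. M *v v) vs" "map (%v. M *v v) ws"] by (simp add: vs ws tmap_pure)
 qed (intro tlinear_compose[OF tlinear_tprod_right tlinear_tmap]
  tlinear_compose[OF tlinear_tmap tlinear_tprod_right])+
qed (intro tlinear_compose[OF tlinear_tprod_left tlinear_tmap]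
  tlinear_compose[OF tlinear_tmap tlinear_tprod_left])+

lemma tprod_tpow:
 assumes "S : tpow d A" "T : tpow d' B" shows "tprod d S T : tpow (d + d') (A Un B)" using assms unfolding tpow_def
proof (rule tprod_span_induct)
 fix x y assume "x : {pure_tensor vs |vs. length vs = d & set vs <= A}"
  "y : {pure_tensor vs |vs. length vs = d' & set vs <= B}"
 then obtain vs ws where "x = pure_tensor vs" "length vs = d" "set vs <= A"
  "y = pure_tensor ws" "length ws = d'" "set ws <= B" by blast
 then show "tprod d x y : tensor.span {pure_tensor vs |vs. length vs = d + d' & set vs <= A Un B}"
  using tprod_pure[of vs ws] by (intro tensor.span_base CollectI exI[of _ "vs @ ws"]) auto
qed

section \<open>Permutations and contractions of the factors\<close>

lemma tlinear_tperm: "tlinear (tperm d \<sigma>)" by (rule tlinearI) (auto simp: tperm_def fun_eq_iff)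

lemma tperm_pure:
 assumes "\<sigma> permutes {..<length vs}"
 shows "tperm (length vs) \<sigma> (pure_tensor vs) = pure_tensor (map (%j. vs ! inv_into UNIV \<sigma> j) [0..<length vs])"
proof
 fix idx
 have "(\<Prod>i<length vs. (vs ! inv_into UNIV \<sigma> i) $ (idx ! i))
  = (\<Prod>i<length vs. (vs ! i) $ (idx ! \<sigma> i))"
  by (subst prod.permute[OF assms]) (simp add: permutes_inverses[OF assms])
 then show "tperm (length vs) \<sigma> (pure_tensor vs) idx
  = pure_tensor (map (%j. vs ! inv_into UNIV \<sigma> j) [0..<length vs]) idx" by (simp add: tperm_def pure_tensor_def)
qed

lemma set_permuted:
 assumes "\<sigma> permutes {..<length vs}" shows "set (map (%j. vs ! inv_into UNIV \<sigma> j) [0..<length vs]) = set vs"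
proof -
 have "set (map (%j. vs ! inv_into UNIV \<sigma> j) [0..<length vs]) = (!) vs ` inv_into UNIV \<sigma> ` {..<length vs}"
  by (auto simp: image_image)
 also have "inv_into UNIV \<sigma> ` {..<length vs} = {..<length vs}" by (rule permutes_image[OF permutes_inv[OF assms]])
 also have "(!) vs ` {..<length vs} = set vs" by (auto simp: set_conv_nth)
 finally show ?thesis .
qed

lemma tperm_tpow:
 assumes "\<sigma> permutes {..<d}" "T : tpow d A" shows "tperm d \<sigma> T : tpow d A" using assms(2) unfolding tpow_def
proof (rule tlinear_span_image[OF tlinear_tperm, rotated])
 fix x assume "x : {pure_tensor vs |vs. length vs = d & set vs <= A}"
 then obtain vs where "x = pure_tensor vs" "length vs = d" "set vs <= A" by blast
 then show "tperm d \<sigma> x : tensor.span {pure_tensor vs |vs. length vs = d & set vs <= A}"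
  using tperm_pure[of \<sigma> vs] set_permuted[of \<sigma> vs] assms(1)
  by (intro tensor.span_base CollectI exI[of _ "map (%j. vs ! inv_into UNIV \<sigma> j) [0..<length vs]"]) auto
qed

lemma tmap_tperm:
 assumes "\<sigma> permutes {..<d}" "T : tpow d A" shows "tmap M (tperm d \<sigma> T) = tperm d \<sigma> (tmap M T)"
 using assms(2) unfolding tpow_def
proof (rule tlinear_span_eq[where f = "%T. tmap M (tperm d \<sigma> T)", rotated 3])
 fix x assume "x : {pure_tensor vs |vs. length vs = d & set vs <= A}"
 then obtain vs where vs: "x = pure_tensor vs" "length vs = d" by blast
 have "map (%j. map (%v. M *v v) vs ! inv_into UNIV \<sigma> j) [0..<length vs]
  = map (%v. M *v v) (map (%j. vs ! inv_into UNIV \<sigma> j) [0..<length vs])"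
 proof (rule nth_equalityI)
  fix i assume "i < length (map (%j. map (%v. M *v v) vs ! inv_into UNIV \<sigma> j) [0..<length vs])"
  moreover have "inv_into UNIV \<sigma> i < length vs" if "i < length vs"
  using permutes_in_image[OF permutes_inv[OF assms(1)], of i] that vs by auto
  ultimately show "map (%j. map (%v. M *v v) vs ! inv_into UNIV \<sigma> j) [0..<length vs] ! i
  = map (%v. M *v v) (map (%j. vs ! inv_into UNIV \<sigma> j) [0..<length vs]) ! i" by simp
 qed simp
 then show "tmap M (tperm d \<sigma> x) = tperm d \<sigma> (tmap M x)"
  using tperm_pure[of \<sigma> vs] tperm_pure[of \<sigma> "map (%v. M *v v) vs"] assms(1)
  by (simp only: vs tmap_pure length_map)
qed (intro tlinear_compose[OF tlinear_tperm tlinear_tmap]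
  tlinear_compose[OF tlinear_tmap tlinear_tperm])+

lemma tlinear_young_a: "tlinear (young_a la)" unfolding young_a_def[abs_def] by (intro tlinear_compose_sum tlinear_tperm)

lemma tlinear_young_b: "tlinear (young_b la)"
 unfolding young_b_def[abs_def] by (intro tlinear_compose_sum tlinear_compose_scale tlinear_tperm)

lemma tlinear_young_c: "tlinear (young_c la)"
 unfolding young_c_def[abs_def] by (rule tlinear_compose[OF tlinear_young_a tlinear_young_b])

lemma row_group_permutes: "\<sigma> : row_group la ==> \<sigma> permutes {..<sum_list la}"
 and col_group_permutes: "\<sigma> : col_group la ==> \<sigma> permutes {..<sum_list la}"
 by (auto simp: row_group_def col_group_def)

lemma young_c_tpow:
 assumes "T : tpow (sum_list la) A" shows "young_c la T : tpow (sum_list la) A"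
proof -
 have "young_a la T : tpow (sum_list la) A" unfolding young_a_def
  by (intro tensor.subspace_sum[OF tpow_subspace] tperm_tpow row_group_permutes assms)
 then show ?thesis unfolding young_c_def young_b_def
  by (intro tensor.subspace_sum[OF tpow_subspace] tensor.subspace_scale[OF tpow_subspace]
  tperm_tpow col_group_permutes)
qed

lemma tmap_young_c:
 assumes "T : tpow (sum_list la) A" shows "tmap M (young_c la T) = young_c la (tmap M T)"
proof -
 have a: "young_a la T : tpow (sum_list la) A" unfolding young_a_def
  by (intro tensor.subspace_sum[OF tpow_subspace] tperm_tpow row_group_permutes assms)
 have 1: "tmap M (young_a la T) = young_a la (tmap M T)" unfolding young_a_def tmap_sum
  by (intro sum.cong refl tmap_tperm[OF row_group_permutes assms])
 have "tmap M (young_b la (young_a la T)) = young_b la (tmap M (young_a la T))" unfolding young_b_def tmap_sum tmap_scale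
  by (intro sum.cong refl arg_cong[of _ _ "tscale _"] tmap_tperm[OF col_group_permutes a])
 then show ?thesis by (simp only: young_c_def 1)
qed

lemma tlinear_contraction: "tlinear (contraction Q i j)" by (rule tlinearI)
  (auto simp: contraction_def fun_eq_iff algebra_simps sum.distrib sum_distrib_left)

lemma contraction_pure_aux:
 fixes idx :: "'m::finite list"
 shows "contraction Q (length as) (Suc (length as + length bs)) (pure_tensor (as @ x # bs @ y # cs)) idx
  = cform Q x y * pure_tensor (as @ bs @ cs) idx"
proof (cases "length idx = length as + length bs + length cs")
 case True
 have "pure_tensor (as @ x # bs @ y # cs) (take (length as) idx @ [p]
  @ drop (length as) (take (length as + length bs) idx) @ [q] @ drop (length as + length bs) idx)
  = x $ p * y $ q * pure_tensor (as @ bs @ cs) idx" for p q using True by (simp add: pure_append take_drop add.commute)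
 then show ?thesis by (simp add: contraction_def cform_def sum_distrib_left sum_distrib_right mult_ac)
next
 case False
 then show ?thesis by (auto simp: contraction_def pure_tensor_def min_def)
qed

lemma contraction_pure:
 assumes "i < j" "j < length vs" shows "contraction Q i j (pure_tensor vs) = tscale (cform Q (vs ! i) (vs ! j))
  (pure_tensor (take i vs @ drop (Suc i) (take j vs) @ drop (Suc j) vs))"
proof -
 define as where "as = take i vs"
 define bs where "bs = drop (Suc i) (take j vs)"
 define cs where "cs = drop (Suc j) vs"
 have "take j vs = as @ (vs ! i) # bs" using assms id_take_nth_drop[of i "take j vs"] by (simp add: as_def bs_def min_def)
 then have vs: "vs = as @ vs ! i # bs @ vs ! j # cs" using id_take_nth_drop[of j vs] assms by (simp add: cs_def)
 have l: "length as = i" "Suc (i + length bs) = j" using assms by (auto simp: as_def bs_def)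
 show ?thesis using contraction_pure_aux[of Q as bs "vs ! i" "vs ! j" cs]
  unfolding l vs[symmetric] as_def[symmetric] bs_def[symmetric] cs_def[symmetric] by (auto simp: fun_eq_iff)
qed

text \<open>Contractions commute with isometries, whence isometries act on Schur functors.\<close>

lemma tmap_contraction:
 assumes T: "T : tpow d A" and ij: "i < j" "j < d"
  and iso: "!!v w. v : A ==> w : A ==> cform Q (M *v v) (M *v w) = cform Q v w"
 shows "contraction Q i j (tmap M T) = tmap M (contraction Q i j T)" using T unfolding tpow_def
proof (rule tlinear_span_eq[where f = "%T. contraction Q i j (tmap M T)", rotated 3])
 fix x assume "x : {pure_tensor vs |vs. length vs = d & set vs <= A}"
 then obtain vs where vs: "x = pure_tensor vs" "length vs = d" "set vs <= A" by blast
 then have "vs ! i : A" "vs ! j : A" using ij by (auto simp: subset_iff)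
 then show "contraction Q i j (tmap M x) = tmap M (contraction Q i j x)" using ij vs iso[of "vs ! i" "vs ! j"]
  by (simp add: tmap_pure contraction_pure tmap_scale take_map drop_map)
qed (intro tlinear_compose[OF tlinear_contraction tlinear_tmap]
  tlinear_compose[OF tlinear_tmap tlinear_contraction])+

section \<open>Functoriality of the Schur functors\<close>

lemma traceless_subspace: "tensor.subspace (traceless Q d A R)" unfolding tensor.subspace_def traceless_def
 by (auto simp only: mem_Collect_eq tlinear_add[OF tlinear_contraction] tlinear_scale[OF tlinear_contraction]
  tlinear_0[OF tlinear_contraction] tensor.subspace_0[OF tnull_subspace] tensor.subspace_0[OF tpow_subspace]
  intro!: tensor.subspace_add[OF tnull_subspace] tensor.subspace_scale[OF tnull_subspace]
  tensor.subspace_add[OF tpow_subspace] tensor.subspace_scale[OF tpow_subspace])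

lemma schur_subspace: "tensor.subspace (schur Q la A R)" unfolding tensor.subspace_def
proof (intro conjI ballI allI)
 let ?d = "sum_list la"
 have "(0 :: 'a tensor) = young_c la 0 + 0" by (simp only: tlinear_0[OF tlinear_young_c] add_0)
 then show "0 : schur Q la A R"
  unfolding schur_def using tensor.subspace_0[OF traceless_subspace] tensor.subspace_0[OF tnull_subspace] by blast
next
 let ?d = "sum_list la"
 fix x y assume "x : schur Q la A R" "y : schur Q la A R"
 then obtain T N T' N' where *: "x = young_c la T + N" "T : traceless Q ?d A R" "N : tnull ?d A R"
  "y = young_c la T' + N'" "T' : traceless Q ?d A R" "N' : tnull ?d A R" unfolding schur_def by blast
 have "x + y = young_c la (T + T') + (N + N')" by (simp only: * tlinear_add[OF tlinear_young_c] add_ac)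
 then show "x + y : schur Q la A R"
  unfolding schur_def using * tensor.subspace_add[OF traceless_subspace] tensor.subspace_add[OF tnull_subspace] by blast
next
 let ?d = "sum_list la"
 fix c x assume "x : schur Q la A R"
 then obtain T N where *: "x = young_c la T + N" "T : traceless Q ?d A R" "N : tnull ?d A R" unfolding schur_def by blast
 have "tscale c x = young_c la (tscale c T) + tscale c N"
  by (simp only: * tlinear_scale[OF tlinear_young_c] tensor.scale_right_distrib)
 then show "tscale c x : schur Q la A R"
  unfolding schur_def using * tensor.subspace_scale[OF traceless_subspace] tensor.subspace_scale[OF tnull_subspace] by blast
qed

lemma schur_tpow: "schur Q la A R <= tpow (sum_list la) A" unfolding schur_def using tnull_subset_tpow[of "sum_list la" A R]
 by (auto simp: traceless_def intro!: tensor.subspace_add[OF tpow_subspace] young_c_tpow)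

lemma tmap_schur:
 assumes "T : schur Q la A R"
  and "!!v. v : A ==> M *v v : A'" "!!v. v : R ==> M *v v : R'"
  and iso: "!!v w. v : A ==> w : A ==> cform Q (M *v v) (M *v w) = cform Q v w" shows "tmap M T : schur Q la A' R'"
proof -
 let ?d = "sum_list la"
 obtain S N where *: "T = young_c la S + N" "S : traceless Q ?d A R" "N : tnull ?d A R"
  using assms(1) unfolding schur_def by blast
 have S: "S : tpow ?d A" using * by (simp add: traceless_def)
 have "tmap M S : traceless Q ?d A' R'" unfolding traceless_def
 proof (intro CollectI conjI allI impI)
  show "tmap M S : tpow ?d A'" by (rule tmap_tpow[OF S assms(2)])
  fix i j assume "i < j & j < ?d"
  then show "contraction Q i j (tmap M S) : tnull (?d - 2) A' R'" using * by (subst tmap_contraction[OF S _ _ iso])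
  (auto simp: traceless_def intro!: tmap_tnull[OF _ assms(2,3)])
 qed
 moreover have "tmap M T = young_c la (tmap M S) + tmap M N" by (simp only: * tmap_add tmap_young_c[OF S])
 ultimately show ?thesis unfolding schur_def using tmap_tnull[OF *(3) assms(2,3)] by blast
qed

section \<open>Slices of tensors in a product\<close>

text \<open>A tensor of degree \<open>d + d''\<close> is a matrix whose rows and columns are indexed by the first \<open>d\<close> and the last
  \<open>d''\<close> factors. The two slices are its columns and its rows.\<close>

definition lslice :: "nat => 'm list => 'm tensor => 'm tensor" where
 "lslice d jdx T = (%idx. if length idx = d then T (idx @ jdx) else 0)"

definition rslice :: "'m list => 'm tensor => 'm tensor" where
 "rslice idx T = (%jdx. T (idx @ jdx))"

lemma tlinear_lslice: "tlinear (lslice d jdx)" by (rule tlinearI) (auto simp: lslice_def fun_eq_iff)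

lemma tlinear_rslice: "tlinear (rslice idx)" by (rule tlinearI) (auto simp: rslice_def fun_eq_iff)

lemma lslice_tprod:
 assumes "x : tpow d A" shows "lslice d jdx (tprod d x y) = tscale (y jdx) x"
 using tpow_deg[OF assms] by (auto simp: lslice_def tprod_def fun_eq_iff)

lemma rslice_tprod:
 assumes "length idx = d" shows "rslice idx (tprod d x y) = tscale (x idx) y"
 using assms by (auto simp: rslice_def tprod_def fun_eq_iff)

lemma lslice_box:
 assumes "T : schur_box Q la' la'' V' V''" shows "lslice (sum_list la') jdx T : schur Q la' V' {0}"
proof -
 let ?S = "schur Q la' V' {0} :: 'a tensor set"
 have "lslice (sum_list la') jdx T : tensor.span ?S" using assms unfolding schur_box_def
 proof (rule tlinear_span_image[OF tlinear_lslice, rotated])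
  fix T assume "T : {tprod (sum_list la') x y |x y. x : schur Q la' V' {0} & y : schur Q la'' V'' {0}}"
  then obtain x y where "T = tprod (sum_list la') x y" "x : ?S" by blast
  moreover from this have "x : tpow (sum_list la') V'" using schur_tpow by blast
  ultimately show "lslice (sum_list la') jdx T : tensor.span ?S" by (simp add: lslice_tprod tensor.span_scale tensor.span_base)
 qed
 then show ?thesis using tensor.span_eq_iff[THEN iffD2, OF schur_subspace] by blast
qed

lemma rslice_box:
 assumes "T : schur_box Q la' la'' V' V''" "length idx = sum_list la'" shows "rslice idx T : schur Q la'' V'' {0}"
proof -
 let ?S = "schur Q la'' V'' {0} :: 'a tensor set"
 have "rslice idx T : tensor.span ?S" using assms(1) unfolding schur_box_def
  by (rule tlinear_span_image[OF tlinear_rslice, rotated])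
  (use assms(2) in "auto simp: rslice_tprod tensor.span_scale tensor.span_base")
 then show ?thesis using tensor.span_eq_iff[THEN iffD2, OF schur_subspace] by blast
qed

lemma lslice_tmap:
 fixes V' :: "(complex ^ 'm) set"
 assumes T: "T : schur_box Q la' la'' V' V''" and id: "!!v. v : V'' ==> M *v v = v"
 shows "lslice (sum_list la') jdx (tmap M T) = tmap M (lslice (sum_list la') jdx T)" using T unfolding schur_box_def
proof (rule tlinear_span_eq[where f = "%T. lslice (sum_list la') jdx (tmap M T)", rotated 3])
 let ?d = "sum_list la'"
 fix T :: "'m tensor"
 assume "T : {tprod (sum_list la') x y |x y. x : schur Q la' V' {0} & y : schur Q la'' V'' {0}}"
 then obtain x y where *: "T = tprod (sum_list la') x y" "x : tpow ?d V'" "y : tpow (sum_list la'') V''"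
  using schur_tpow by blast
 have "tmap M y = y" by (rule tmap_id[OF *(3) id])
 moreover have "tmap M x : tpow ?d UNIV" by (rule tmap_tpow[OF *(2)]) auto
 ultimately show "lslice ?d jdx (tmap M T) = tmap M (lslice ?d jdx T)"
  by (simp only: * tmap_tprod[OF *(2,3)] lslice_tprod[OF *(2)] lslice_tprod tmap_scale)
qed (intro tlinear_compose[OF tlinear_lslice tlinear_tmap] tlinear_compose[OF tlinear_tmap tlinear_lslice])+

lemma rslice_tmap:
 fixes V' :: "(complex ^ 'm) set"
 assumes T: "T : schur_box Q la' la'' V' V''" and id: "!!v. v : V' ==> M *v v = v"
  and len: "length idx = sum_list la'" shows "rslice idx (tmap M T) = tmap M (rslice idx T)" using T unfolding schur_box_def
proof (rule tlinear_span_eq[where f = "%T. rslice idx (tmap M T)", rotated 3])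
 let ?d = "sum_list la'"
 fix T :: "'m tensor"
 assume "T : {tprod (sum_list la') x y |x y. x : schur Q la' V' {0} & y : schur Q la'' V'' {0}}"
 then obtain x y where *: "T = tprod (sum_list la') x y" "x : tpow ?d V'" "y : tpow (sum_list la'') V''"
  using schur_tpow by blast
 have "tmap M x = x" by (rule tmap_id[OF *(2) id])
 then show "rslice idx (tmap M T) = tmap M (rslice idx T)"
  by (simp only: * tmap_tprod[OF *(2,3)] rslice_tprod[OF len] tmap_scale)
qed (intro tlinear_compose[OF tlinear_rslice tlinear_tmap] tlinear_compose[OF tlinear_tmap tlinear_rslice])+

lemma schur_box_tpow: "schur_box Q la' la'' V' V'' <= tpow (sum_list la' + sum_list la'') (V' Un V'')"
proof -
 have "schur_box Q la' la'' V' V'' <= tensor.span (tpow (sum_list la' + sum_list la'') (V' Un V''))"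
  unfolding schur_box_def by (rule tensor.span_mono) (use schur_tpow in "blast intro: tprod_tpow")
 then show ?thesis using tensor.span_eq_iff[THEN iffD2, OF tpow_subspace] by blast
qed

lemma schur_box_subspace: "tensor.subspace (schur_box Q la' la'' V' V'')" by (simp add: schur_box_def)

lemma tmap_diff_box_null:
 fixes V' :: "(complex ^ 'm) set"
 assumes T: "T : schur_box Q la' la'' V' (cspace K)"
  and "!!v. v : V' ==> M *v v : cperp Q L' om" "!!v. v : V' ==> M' *v v : cperp Q L' om"
  and "!!v. v : V' ==> M *v v - M' *v v : cline om" "cline om <= cperp Q L' om"
  and id: "!!v. v : cspace K ==> M *v v = v" "!!v. v : cspace K ==> M' *v v = v"
 shows "tmap M T - tmap M' T : box_null Q L' K (sum_list la') (sum_list la'') om" using T unfolding schur_box_def box_null_def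
proof (rule tlinear_span_image[OF tlinear_diff_fun[OF tlinear_tmap tlinear_tmap], rotated])
 fix T :: "'m tensor"
 assume "T : {tprod (sum_list la') x y |x y. x : schur Q la' V' {0} & y : schur Q la'' (cspace K) {0}}"
 then obtain x y where *: "T = tprod (sum_list la') x y" "x : tpow (sum_list la') V'" "y : tpow (sum_list la'') (cspace K)"
  using schur_tpow by blast
 have y: "tmap M y = y" "tmap M' y = y" by (rule tmap_id[OF *(3)], use id in auto)+
 have "tmap M T - tmap M' T = tprod (sum_list la') (tmap M x - tmap M' x) y"
  by (simp only: * tmap_tprod[OF *(2,3)] y tlinear_diff[OF tlinear_tprod_left])
 moreover have "tmap M x - tmap M' x : hodge_null Q L' (sum_list la') om"
  unfolding hodge_null_def by (rule tmap_diff_tnull[OF *(2)]) (use assms in auto)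
 ultimately show "tmap M T - tmap M' T : tensor.span
  {tprod (sum_list la') x y |x y. x : hodge_null Q L' (sum_list la') om & y : tpow (sum_list la'') (cspace K)}"
  using * by (intro tensor.span_base) blast
qed

lemma tlinear_matrix:
 fixes T :: "'m::finite tensor"
 assumes "tlinear f" "!!idx. length idx ~= d ==> T idx = 0"
 shows "f T idx = (\<Sum>jdx | length jdx = d. T jdx * f (pure_tensor (map (%a. axis a 1) jdx)) idx)"
proof -
 have "f T = (\<Sum>jdx | length jdx = d. tscale (T jdx) (f (pure_tensor (map (%a. axis a 1) jdx))))"
  by (subst tensor_expand[of d T]) (use assms in "auto simp only: tlinear_sum[OF assms(1)] tlinear_scale[OF assms(1)]")
 then show ?thesis by (simp only: sum_tensor_apply tscale_apply)
qed

text \<open>The projections of the decomposition are given on a subspace only. Extended to all tensors they are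
  finite matrices, so they respect holomorphy and convergent sums.\<close>

lemma tlinear_extension:
 fixes \<phi> :: "'a tensor => 'b tensor"
 assumes S: "tensor.subspace S" and S': "tensor.subspace S'"
  and lin: "!!x y c. x : S ==> y : S ==> \<phi> (x + tscale c y) = \<phi> x + tscale c (\<phi> y)"
  and im: "!!x. x : S ==> \<phi> x : S'"
 obtains \<psi> where "tlinear \<psi>" "!!x. x : S ==> \<psi> x = \<phi> x" "!!x. \<psi> x : S'"
proof -
 obtain B where B: "B <= S" "tensor.independent B" "S <= tensor.span B" using tensor.maximal_independent_subset[of S] by blast
 obtain g where g: "tlinear g" "ALL x:B. g x = \<phi> x" "range g = tensor.span (\<phi> ` B)"
  using tensor_pair.linear_independent_extend_subspace[OF B(2), of \<phi>] by blast
 have "\<phi> (0 + tscale (-1) 0) = \<phi> 0 + tscale (-1) (\<phi> 0)" by (rule lin) (rule tensor.subspace_0[OF S])+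
 then have \<phi>0: "\<phi> 0 = 0" by (auto simp: fun_eq_iff)
 have "g x = \<phi> x & x : S" if "x : tensor.span B" for x using that
 proof (induction rule: tensor.span_induct_alt)
  case base
  then show ?case by (simp only: tlinear_0[OF g(1)] \<phi>0 tensor.subspace_0[OF S])
 next
  case (step c x y)
  have "\<phi> (y + tscale c x) = \<phi> y + tscale c (\<phi> x)" by (rule lin) (use step B in auto)
  moreover have "g (y + tscale c x) = g y + tscale c (g x)" by (simp only: tlinear_add[OF g(1)] tlinear_scale[OF g(1)])
  ultimately show ?case using step g(2) B tensor.subspace_add[OF S] tensor.subspace_scale[OF S] by (auto simp only: add.commute)
 qed
 moreover have "g x : S'" for x
 proof -
  have "tensor.span (\<phi> ` B) <= S'" by (rule tensor.span_minimal) (use B im S' in auto)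
  then show ?thesis using g(3) by blast
 qed
 ultimately show ?thesis using that[of g] g(1) B(3) by blast
qed

section \<open>Holomorphic functions of several variables\<close>

lemma norm_smult_vec: "norm (c *s (v :: complex ^ 'm)) = norm c * norm v"
 by (simp add: norm_vec_def norm_mult L2_set_right_distrib)

lemma smult_of_real: "complex_of_real r *s (v :: complex ^ 'm) = r *\<^sub>R v" unfolding vec_eq_iff
 by (simp only: vector_smult_component vector_scaleR_component) (simp add: scaleR_conv_of_real)

lemma holomorphic_cvecD:
 assumes "holomorphic_cvec U H" "y : U" shows "(H has_derivative frechet_derivative H (at y)) (at y)"
  and "frechet_derivative H (at y) (c *s v) = c * frechet_derivative H (at y) v"
proof -
 obtain H' where H': "(H has_derivative H') (at y)" "!!c v. H' (c *s v) = c * H' v"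
  using assms unfolding holomorphic_cvec_def by blast
 then have "H' = frechet_derivative H (at y)" by (rule_tac frechet_derivative_at) auto
 then show "(H has_derivative frechet_derivative H (at y)) (at y)"
  "frechet_derivative H (at y) (c *s v) = c * frechet_derivative H (at y) v" using H' by auto
qed

lemma hol_cvec_continuous_on:
 assumes "holomorphic_cvec U H" shows "continuous_on U H" unfolding continuous_on_eq_continuous_within
 using holomorphic_cvecD(1)[OF assms] has_derivative_continuous continuous_at_imp_continuous_within by blast

lemma hol_cvec_subset: "holomorphic_cvec U H ==> V <= U ==> holomorphic_cvec V H"
 unfolding holomorphic_cvec_def by blast

lemma hol_cvec_cong:
 assumes "holomorphic_cvec U H" "open U" "!!y. y : U ==> G y = H y" shows "holomorphic_cvec U G" unfolding holomorphic_cvec_def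
proof
 fix y assume y: "y : U"
 then obtain H' where H': "(H has_derivative H') (at y)" "ALL c v. H' (c *s v) = c * H' v"
  using assms unfolding holomorphic_cvec_def by blast
 have "(G has_derivative H') (at y)" by (rule has_derivative_transform_within_open[OF H'(1) assms(2) y]) (use assms(3) in auto)
 then show "EX H'. (G has_derivative H') (at y) & (ALL c v. H' (c *s v) = c * H' v)" using H' by blast
qed

lemma hol_cvec_const: "holomorphic_cvec U (%y. a)" unfolding holomorphic_cvec_def by (auto intro!: exI[of _ "%_. 0"])

lemma hol_cvec_coord: "holomorphic_cvec U (%y. y $ i)" unfolding holomorphic_cvec_def
 by (intro ballI exI[of _ "%y. y $ i"]) (auto intro!: bounded_linear_imp_has_derivative bounded_linear_vec_nth)

lemma hol_cvec_add:
 "holomorphic_cvec U F ==> holomorphic_cvec U G ==> holomorphic_cvec U (%y. F y + G y)" unfolding holomorphic_cvec_def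
proof
 fix y assume *: "ALL y:U. EX H'. (F has_derivative H') (at y) & (ALL c v. H' (c *s v) = c * H' v)"
  "ALL y:U. EX H'. (G has_derivative H') (at y) & (ALL c v. H' (c *s v) = c * H' v)" "y : U"
 then obtain F' G' where "(F has_derivative F') (at y)" "ALL c v. F' (c *s v) = c * F' v"
  "(G has_derivative G') (at y)" "ALL c v. G' (c *s v) = c * G' v" by metis
 then show "EX H'. ((%y. F y + G y) has_derivative H') (at y) & (ALL c v. H' (c *s v) = c * H' v)"
  by (intro exI[of _ "%v. F' v + G' v"]) (auto intro: has_derivative_add simp: algebra_simps)
qed

lemma hol_cvec_mult:
 "holomorphic_cvec U F ==> holomorphic_cvec U G ==> holomorphic_cvec U (%y. F y * G y)" unfolding holomorphic_cvec_def
proof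
 fix y assume *: "ALL y:U. EX H'. (F has_derivative H') (at y) & (ALL c v. H' (c *s v) = c * H' v)"
  "ALL y:U. EX H'. (G has_derivative H') (at y) & (ALL c v. H' (c *s v) = c * H' v)" "y : U"
 then obtain F' G' where "(F has_derivative F') (at y)" "ALL c v. F' (c *s v) = c * F' v"
  "(G has_derivative G') (at y)" "ALL c v. G' (c *s v) = c * G' v" by metis
 then show "EX H'. ((%y. F y * G y) has_derivative H') (at y) & (ALL c v. H' (c *s v) = c * H' v)"
  by (intro exI[of _ "%v. F y * G' v + F' v * G y"]) (auto intro!: has_derivative_mult simp: algebra_simps)
qed

lemma hol_cvec_inverse:
 "holomorphic_cvec U F ==> (!!y. y : U ==> F y ~= 0) ==> holomorphic_cvec U (%y. inverse (F y))" unfolding holomorphic_cvec_def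
proof
 fix y assume *: "ALL y:U. EX H'. (F has_derivative H') (at y) & (ALL c v. H' (c *s v) = c * H' v)"
  "!!y. y : U ==> F y ~= 0" "y : U"
 then obtain F' where "(F has_derivative F') (at y)" "ALL c v. F' (c *s v) = c * F' v" by metis
 then have "((%y. inverse (F y)) has_derivative (%v. - (inverse (F y) * F' v * inverse (F y)))) (at y)"
  using * by (intro Deriv.has_derivative_inverse) auto
 then show "EX H'. ((%y. inverse (F y)) has_derivative H') (at y) & (ALL c v. H' (c *s v) = c * H' v)"
  using \<open>ALL c v. F' (c *s v) = c * F' v\<close> by (intro exI[of _ "%v. - (inverse (F y) * F' v * inverse (F y))"]) auto
qed

lemma hol_cvec_cmult: "holomorphic_cvec U F ==> holomorphic_cvec U (%y. c * F y)"
 by (rule hol_cvec_mult[OF hol_cvec_const])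

lemma hol_cvec_diff:
 "holomorphic_cvec U F ==> holomorphic_cvec U G ==> holomorphic_cvec U (%y. F y - G y)"
 using hol_cvec_add[OF _ hol_cvec_cmult, of U F G "-1"] by simp

lemma hol_cvec_divide:
 "holomorphic_cvec U F ==> holomorphic_cvec U G ==> (!!y. y : U ==> G y ~= 0) ==>
  holomorphic_cvec U (%y. F y / G y)"
 using hol_cvec_mult[OF _ hol_cvec_inverse, of U F G] by (simp add: divide_inverse)

lemma hol_cvec_sum:
 "(!!i. i : I ==> holomorphic_cvec U (F i)) ==> holomorphic_cvec U (%y. SUM i:I. F i y)"
 by (induction I rule: infinite_finite_induct) (auto intro: hol_cvec_const hol_cvec_add)

lemma hol_cvec_prod:
 "(!!i. i : I ==> holomorphic_cvec U (F i)) ==> holomorphic_cvec U (%y. \<Prod>i\<in>I. F i y)"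
 by (induction I rule: infinite_finite_induct) (auto intro: hol_cvec_const hol_cvec_mult)

lemma has_field_derivative_along_curve:
 assumes H: "holomorphic_cvec U H" and Y: "Y t : U"
  and d: "!!i. ((%t. Y t $ i) has_field_derivative Y' $ i) (at t)"
 shows "((%t. H (Y t)) has_field_derivative frechet_derivative H (at (Y t)) Y') (at t)"
proof -
 have "((%t. Y t) has_derivative (%s. s *s Y')) (at t)" unfolding has_derivative_componentwise_within[of Y]
 proof
  fix b :: "complex ^ 'a" assume "b : Basis"
  then obtain u i where b: "b = axis i u" "u : Basis" by (auto simp: Basis_vec_def)
  have "((%t. Y t $ i) has_derivative (%s. s * Y' $ i)) (at t)"
  using d[of i] by (simp add: has_field_derivative_def mult_commute_abs)
  then have "((%t. Y t $ i \<bullet> u) has_derivative (%s. (s * Y' $ i) \<bullet> u)) (at t)"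
  by (rule has_derivative_inner_left)
  then show "((%x. Y x \<bullet> b) has_derivative (%x. (x *s Y') \<bullet> b)) (at t)" by (simp add: b inner_axis)
 qed
 from has_derivative_compose[OF this holomorphic_cvecD(1)[OF H Y]]
 show ?thesis by (simp add: has_field_derivative_def holomorphic_cvecD(2)[OF H Y] mult_commute_abs)
qed

lemma holomorphic_on_curve:
 assumes H: "holomorphic_cvec U H" and Y: "!!t. t : S ==> Y t : U"
  and S: "open S" and d: "!!i. (%t. Y t $ i) holomorphic_on S" shows "(%t. H (Y t)) holomorphic_on S"
proof -
 have "((%t. H (Y t)) has_field_derivative frechet_derivative H (at (Y t)) (\<chi> i. deriv (%t. Y t $ i) t)) (at t)"
  if "t : S" for t by (rule has_field_derivative_along_curve[where Y = Y and t = t, OF H Y[OF that]])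
  (use holomorphic_derivI[OF d S that] in auto)
 then show ?thesis using S by (auto simp: holomorphic_on_open)
qed

lemma holomorphic_on_line:
 assumes H: "holomorphic_cvec U H" and U: "open U" shows "(%t. H (y + t *s v)) holomorphic_on {t. y + t *s v : U}"
proof (rule holomorphic_on_curve[OF H])
 have "continuous_on UNIV (%t. y + t *s v)" unfolding vector_scalar_mult_def by (intro continuous_intros)
 then show "open {t. y + t *s v : U}" using open_vimage[OF U, of "%t. y + t *s v"] by (simp add: vimage_def)
qed (auto intro!: holomorphic_intros)

lemma has_field_derivative_line:
 assumes H: "holomorphic_cvec U H" and y: "y + t *s v : U"
 shows "((%t. H (y + t *s v)) has_field_derivative frechet_derivative H (at (y + t *s v)) v) (at t)"
 by (rule has_field_derivative_along_curve[where Y = "%t. y + t *s v" and t = t, OF H y]) (auto intro!: derivative_eq_intros)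

text \<open>Cauchy's estimates for a function of one variable on a large disc.\<close>

lemma taylor_estimate:
 assumes g: "g holomorphic_on ball 0 R" and R: "R \<ge> 2" and M: "!!t. t : ball 0 R ==> norm (g t) <= M"
 shows "norm (g 1 - g 0 - deriv g 0) <= 18 * (M + 1) / R^2"
proof -
 have b2: "norm (deriv (deriv g) w) <= 18 * (M + 1) / R^2" if "w : cball 0 1" for w
 proof -
  have sub: "cball w (R/3) <= ball 0 R"
  proof
  fix z assume "z : cball w (R/3)"
  moreover have "norm z <= norm w + norm (z - w)" by norm
  ultimately show "z : ball 0 R" using that R by (auto simp: dist_norm norm_minus_commute)
  qed
  have "norm ((deriv ^^ 2) g w) <= fact 2 * (M + 1) / (R/3)^2"
  proof (rule Cauchy_higher_deriv_bound)
  show "g holomorphic_on ball w (R / 3)" by (rule holomorphic_on_subset[OF g]) (use sub ball_subset_cball in blast)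
  show "continuous_on (cball w (R / 3)) g" by (rule continuous_on_subset[OF holomorphic_on_imp_continuous_on[OF g] sub])
  fix z assume "z : ball w (R/3)"
  then have "z : ball 0 R" using sub ball_subset_cball by blast
  then show "g z : ball 0 (M + 1)" using M[of z] by simp
  qed (use R in auto)
  then show ?thesis by (simp add: numeral_2_eq_2 power_divide field_simps)
 qed
 have "norm ((deriv ^^ 0) g 1 - (\<Sum>i\<le>1. (deriv ^^ i) g 0 * (1 - 0) ^ i / fact i)) <= 18 * (M + 1) / R^2 * norm (1 - 0 :: complex) ^ Suc 1 / fact 1"
 proof (rule complex_Taylor[where f = "%i. (deriv ^^ i) g" and S = "cball 0 1" and n = 1])
  fix i :: nat and x :: complex assume "x : cball 0 1" "i <= 1"
  then have x: "x : ball 0 R" using R by auto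
  have "((deriv ^^ i) g has_field_derivative deriv ((deriv ^^ i) g) x) (at x)"
  by (rule holomorphic_derivI[OF holomorphic_higher_deriv[OF g] _ x]) auto
  then show "((deriv ^^ i) g has_field_derivative (deriv ^^ Suc i) g x) (at x within cball 0 1)"
  by (simp add: has_field_derivative_at_within)
 qed (use b2 in auto)
 then show ?thesis by (simp add: diff_diff_eq)
qed

lemma taylor_estimate_cvec:
 assumes H: "holomorphic_cvec U H" and U: "open U" and r: "r > 0" and sub: "cball y (3 * r) <= U"
  and M: "!!z. z : cball y (3 * r) ==> norm (H z) <= M"
  and v: "norm v <= r" and x: "x : cball y r"
 shows "norm (H (x + v) - H x - frechet_derivative H (at x) v) <= 18 * (M + 1) / (4 * r^2) * (norm v)^2"
proof (cases "v = 0")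
 case True
 have "frechet_derivative H (at x) (0 *s v) = 0 * frechet_derivative H (at x) v"
  by (rule holomorphic_cvecD(2)[OF H]) (use x r sub in auto)
 then show ?thesis using True by simp
next
 case False
 define R where "R = 2 * r / norm v"
 have R2: "R \<ge> 2" using v False by (simp add: R_def field_simps)
 have in_cball: "x + t *s v : cball y (3 * r)" if "t : ball 0 R" for t
 proof -
  have "norm (t *s v) <= 2 * r" using that False by (simp add: norm_smult_vec R_def field_simps)
  moreover have "norm (x + t *s v - y) <= norm (x - y) + norm (t *s v)"
  using norm_triangle_ineq[of "x - y" "t *s v"] by (simp add: algebra_simps)
  ultimately show ?thesis using x by (simp add: dist_norm norm_minus_commute)
 qed
 let ?g = "%t. H (x + t *s v)"
 have "(?g has_field_derivative frechet_derivative H (at (x + 0 *s v)) v) (at 0)"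
  by (rule has_field_derivative_line[OF H]) (use x r sub in auto)
 then have d: "deriv ?g 0 = frechet_derivative H (at x) v" by (simp add: DERIV_imp_deriv)
 have "norm (?g 1 - ?g 0 - deriv ?g 0) <= 18 * (M + 1) / R^2"
 proof (rule taylor_estimate[OF _ R2])
  show "?g holomorphic_on ball 0 R" by (rule holomorphic_on_subset[OF holomorphic_on_line[OF H U]]) (use in_cball sub in auto)
 qed (use in_cball M in auto)
 then show ?thesis using False r by (simp add: d R_def power_divide field_simps)
qed

lemma hol_cvec_derivative:
 assumes H: "holomorphic_cvec U H" and U: "open U" shows "holomorphic_cvec U (%y. frechet_derivative H (at y) u)"
 unfolding holomorphic_cvec_def
proof
 fix y assume y: "y : U"
 let ?D = "%x. frechet_derivative H (at x)"
 obtain r0 where r0: "r0 > 0" "cball y r0 <= U" using U y open_contains_cball by blast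
 define r where "r = r0 / 6"
 have r: "r > 0" "cball y (6 * r) <= U" using r0 by (auto simp: r_def)
 have "compact (H ` cball y (6 * r))"
  by (intro compact_continuous_image continuous_on_subset[OF hol_cvec_continuous_on[OF H]] r) auto
 then obtain M where M: "!!z. z : cball y (6 * r) ==> norm (H z) <= M" by (metis compact_imp_bounded bounded_iff imageI)
 define C where "C = 18 * (M + 1) / (4 * r^2)"
 have "M \<ge> 0" using M[of y] r norm_ge_zero order_trans by (metis centre_in_cball less_eq_real_def mult_nonneg_nonneg zero_le_numeral)
 then have C: "C \<ge> 0" by (simp add: C_def)
 have est: "norm (H (x + v) - H x - ?D x v) <= C * (norm v)^2" if "norm v <= r" "x : cball y (2 * r)" for x v
 proof -
  have sub: "cball x (3 * r) <= cball y (6 * r)" using that r by (simp add: cball_subset_cball_iff dist_commute)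
  show ?thesis unfolding C_def by (rule taylor_estimate_cvec[OF H U r(1) _ _ that(1), of x]) (use sub r M in auto)
 qed
 define \<rho> where "\<rho> = r / (norm u + 1)"
 have \<rho>: "\<rho> > 0" using r by (simp add: \<rho>_def add_nonneg_pos)
 have line: "norm (\<tau> *s u) <= r" if "norm \<tau> <= \<rho>" for \<tau>
 proof -
  have "norm \<tau> * norm u <= \<rho> * (norm u + 1)" by (rule mult_mono) (use that \<rho> in auto)
  also have "... = r" using add_nonneg_pos[of "norm u" 1] by (simp add: \<rho>_def)
  finally show ?thesis by (simp add: norm_smult_vec)
 qed
 have line': "y + v + \<tau> *s u : cball y (2 * r)" if "norm \<tau> <= \<rho>" "norm v <= r" for \<tau> v
  using line[OF that(1)] that(2) norm_triangle_ineq[of v "\<tau> *s u"]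
  unfolding mem_cball by (subst dist_commute) (simp add: dist_norm add.assoc)
 have inU: "cball y (2 * r) <= U" using r by (auto simp: subset_iff)
 have holo: "(%\<tau>. H (y + v + \<tau> *s u)) holomorphic_on ball 0 \<rho>" if "norm v <= r" for v
  by (rule holomorphic_on_subset[OF holomorphic_on_line[OF H U]]) (use line' that inU in force)
 have cont: "continuous_on (cball 0 \<rho>) (%\<tau>. H (y + v + \<tau> *s u))" if "norm v <= r" for v
  by (rule continuous_on_subset[OF holomorphic_on_imp_continuous_on[OF holomorphic_on_line[OF H U]]])
  (use line' that inU in force)
 \<comment> \<open>The mixed derivative exists because the difference quotients converge uniformly.\<close>
 have hol_D: "continuous_on (cball 0 \<rho>) (%\<tau>. ?D (y + \<tau> *s u) v) &
  (%\<tau>. ?D (y + \<tau> *s u) v) holomorphic_on ball 0 \<rho>" for v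
 proof -
  define f where "f = (%n::nat. %\<tau>. of_nat (Suc n) * (H (y + inverse (of_nat (Suc n)) *s v + \<tau> *s u) - H (y + 0 + \<tau> *s u)))"
  have small: "\<forall>\<^sub>F n in sequentially. norm (inverse (of_nat (Suc n)) *s v) <= r"
  proof -
  have "(%n. inverse (real (Suc n)) * norm v) \<longlonglongrightarrow> 0 * norm v"
  by (intro tendsto_intros LIMSEQ_inverse_real_of_nat)
  then have "\<forall>\<^sub>F n in sequentially. inverse (real (Suc n)) * norm v < r" using r by (auto dest: order_tendstoD)
  then show ?thesis by eventually_elim (simp add: norm_smult_vec norm_inverse del: of_nat_Suc)
  qed
  have "\<forall>\<^sub>F n in sequentially. continuous_on (cball 0 \<rho>) (f n) & f n holomorphic_on ball 0 \<rho>"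
  using small
  proof eventually_elim
  case (elim n)
  show ?case unfolding f_def by (intro conjI continuous_intros holomorphic_intros cont holo elim) (use r in auto)
  qed
  moreover have "uniform_limit (cball 0 \<rho>) f (%\<tau>. ?D (y + \<tau> *s u) v) sequentially"
  proof (rule uniform_limitI)
  fix e :: real assume e: "e > 0"
  have "(%n. inverse (real (Suc n)) * (C * (norm v)^2)) \<longlonglongrightarrow> 0 * (C * (norm v)^2)"
  by (intro tendsto_intros LIMSEQ_inverse_real_of_nat)
  then have "\<forall>\<^sub>F n in sequentially. inverse (real (Suc n)) * (C * (norm v)^2) < e"
  using e by (auto dest: order_tendstoD)
  with small show "\<forall>\<^sub>F n in sequentially. \<forall>\<tau>\<in>cball 0 \<rho>. dist (f n \<tau>) (?D (y + \<tau> *s u) v) < e"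
  proof eventually_elim
  case (elim n)
  show ?case
  proof
  fix \<tau> :: complex assume "\<tau> : cball 0 \<rho>"
  then have x: "y + \<tau> *s u : cball y (2 * r)" using line'[of \<tau> 0] r by simp
  define a :: complex where "a = of_nat (Suc n)"
  have a0: "a ~= 0" "norm a = real (Suc n)" unfolding a_def by (simp_all del: of_nat_Suc)
  let ?w = "inverse a *s v"
  have lin: "?D (y + \<tau> *s u) v = a * ?D (y + \<tau> *s u) ?w"
  using holomorphic_cvecD(2)[OF H, of "y + \<tau> *s u" "inverse a" v] x inU a0 by auto
  have "f n \<tau> - ?D (y + \<tau> *s u) v = a * (H (y + \<tau> *s u + ?w) - H (y + \<tau> *s u) - ?D (y + \<tau> *s u) ?w)"
  unfolding lin f_def a_def[symmetric] by (simp add: algebra_simps)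
  then have "norm (f n \<tau> - ?D (y + \<tau> *s u) v) <= norm a * (C * (norm ?w)^2)"
  using est[OF _ x, of ?w] elim(1) by (auto simp: norm_mult a_def intro: mult_left_mono)
  also have "... = inverse (real (Suc n)) * (C * (norm v)^2)" unfolding norm_smult_vec norm_inverse a0(2)
  by (simp add: power_mult_distrib power2_eq_square field_simps del: of_nat_Suc)
  finally show "dist (f n \<tau>) (?D (y + \<tau> *s u) v) < e" using elim(2) by (simp add: dist_norm)
  qed
  qed
  qed
  ultimately show ?thesis by (rule holomorphic_uniform_limit) (auto simp: trivial_limit_sequentially)
 qed
 define B where "B v = deriv (%\<tau>. ?D (y + \<tau> *s u) v) 0" for v
 have dB: "((%\<tau>. ?D (y + \<tau> *s u) v) has_field_derivative B v) (at 0)" for v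
  unfolding B_def by (rule holomorphic_derivI[OF conjunct2[OF hol_D]]) (use \<rho> in auto)
 have linD: "?D x (v + w) = ?D x v + ?D x w" "?D x (c *s v) = c * ?D x v" if "x : U" for x v w c
  using has_derivative_linear[OF holomorphic_cvecD(1)[OF H that]] holomorphic_cvecD(2)[OF H that] by (auto simp: linear_add)
 have nb: "\<forall>\<^sub>F \<tau> in nhds 0. y + \<tau> *s u : U"
 proof -
  have "\<forall>\<^sub>F \<tau> in nhds 0. (\<tau> :: complex) : ball 0 \<rho>" by (rule eventually_nhds_in_open) (use \<rho> in auto)
  then show ?thesis by eventually_elim (use line'[of _ 0] r inU in auto)
 qed
 have B_add: "B (v + w) = B v + B w" for v w unfolding B_def
  by (rule trans[OF deriv_cong_ev[of _ "%\<tau>. ?D (y + \<tau> *s u) v + ?D (y + \<tau> *s u) w"] DERIV_imp_deriv])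
  (use nb in "auto elim!: eventually_mono simp: linD intro!: DERIV_add dB[unfolded B_def]")
 have B_scale: "B (c *s v) = c * B v" for c v unfolding B_def
  by (rule trans[OF deriv_cong_ev[of _ "%\<tau>. c * ?D (y + \<tau> *s u) v"] DERIV_imp_deriv])
  (use nb in "auto elim!: eventually_mono simp: linD intro!: DERIV_cmult dB[unfolded B_def]")
 have "linear B" by (rule linearI) (use B_add B_scale[of "of_real _"] in "auto simp: smult_of_real scaleR_conv_of_real")
 then have bB: "bounded_linear B" by (simp add: linear_conv_bounded_linear)
 define K where "K = (C + 1) / \<rho>"
 have "((%x. ?D x u) has_derivative B) (at y)"
 proof (rule has_derivativeI_sandwich[OF r(1) bB])
  fix x assume x: "x : UNIV" "x ~= y" "dist x y < r"
  define v where "v = x - y"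
  have v: "v ~= 0" "norm v <= r" using x by (auto simp: v_def dist_norm)
  define k where "k = (%\<tau>. H (y + v + \<tau> *s u) - H (y + 0 + \<tau> *s u) - ?D (y + \<tau> *s u) v)"
  have "norm ((deriv ^^ 1) k 0) <= fact 1 * ((C + 1) * (norm v)^2) / \<rho> ^ 1"
  proof (rule Cauchy_higher_deriv_bound)
  show "k holomorphic_on ball 0 \<rho>" "continuous_on (cball 0 \<rho>) k"
  unfolding k_def by (intro holomorphic_intros continuous_intros holo cont conjunct1[OF hol_D] conjunct2[OF hol_D]; use v r in simp)+
  fix \<tau> :: complex assume "\<tau> : ball 0 \<rho>"
  then have "y + \<tau> *s u : cball y (2 * r)" using line'[of \<tau> 0] r by simp
  from est[OF v(2) this] have "norm (k \<tau>) <= C * (norm v)^2" by (simp add: k_def algebra_simps)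
  also have "... < (C + 1) * (norm v)^2" using v by simp
  finally show "k \<tau> : ball 0 ((C + 1) * (norm v)^2)" by simp
  qed (use \<rho> in auto)
  moreover have "(k has_field_derivative (?D (y + v + 0 *s u) u - ?D (y + 0 + 0 *s u) u - B v)) (at 0)" unfolding k_def
  by (intro DERIV_diff has_field_derivative_line[OF H] dB; use line'[of 0 v] line'[of 0 0] v r \<rho> inU in auto)
  then have "deriv k 0 = ?D x u - ?D y u - B (x - y)" by (simp add: DERIV_imp_deriv v_def)
  ultimately have "norm (?D x u - ?D y u - B (x - y)) <= (C + 1) / \<rho> * norm v * norm v" by (simp add: power2_eq_square)
  then show "norm (?D x u - ?D y u - B (x - y)) / norm (x - y) <= K * norm (x - y)"
  using v by (simp add: v_def K_def divide_le_eq)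
 next
  have "((%x. K * norm (x - y)) \<longlongrightarrow> K * norm (y - y)) (at y)" by (intro tendsto_intros)
  then show "((%x. K * norm (x - y)) \<longlongrightarrow> 0) (at y)" by simp
 qed
 then show "EX H'. ((%y. ?D y u) has_derivative H') (at y) & (ALL c v. H' (c *s v) = c * H' v)" using B_scale by blast
qed

section \<open>Bilinear forms\<close>

lemma rform_add_left: "rform Q (x + y) z = rform Q x z + rform Q y z"
 and rform_add_right: "rform Q z (x + y) = rform Q z x + rform Q z y"
 and rform_scale_left: "rform Q (c *\<^sub>R x) z = c * rform Q x z"
 and rform_scale_right: "rform Q z (c *\<^sub>R x) = c * rform Q z x"
 and rform_diff_left: "rform Q (x - y) z = rform Q x z - rform Q y z"
 and rform_diff_right: "rform Q z (x - y) = rform Q z x - rform Q z y"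
 and rform_minus_left: "rform Q (- x) z = - rform Q x z"
 and rform_minus_right: "rform Q z (- x) = - rform Q z x"
 and rform_0_left: "rform Q 0 z = 0" and rform_0_right: "rform Q z 0 = 0"
 by (auto simp: rform_def algebra_simps sum.distrib sum_distrib_left sum_subtractf sum_negf)

lemmas rform_simps = rform_add_left rform_add_right rform_scale_left rform_scale_right
 rform_diff_left rform_diff_right rform_minus_left rform_minus_right rform_0_left rform_0_right

lemma rform_sum_left: "rform Q (SUM i:I. f i) z = (SUM i:I. rform Q (f i) z)"
 by (induction I rule: infinite_finite_induct) (auto simp: rform_simps)

lemma cform_add_left: "cform Q (x + y) z = cform Q x z + cform Q y z"
 and cform_add_right: "cform Q z (x + y) = cform Q z x + cform Q z y"
 and cform_scale_left: "cform Q (c *s x) z = c * cform Q x z"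
 and cform_scale_right: "cform Q z (c *s x) = c * cform Q z x"
 and cform_diff_left: "cform Q (x - y) z = cform Q x z - cform Q y z"
 and cform_diff_right: "cform Q z (x - y) = cform Q z x - cform Q z y"
 and cform_minus_left: "cform Q (- x) z = - cform Q x z"
 and cform_minus_right: "cform Q z (- x) = - cform Q z x"
 and cform_0_left: "cform Q 0 z = 0" and cform_0_right: "cform Q z 0 = 0"
 by (auto simp: cform_def algebra_simps sum.distrib sum_distrib_left sum_subtractf sum_negf)

lemmas cform_simps = cform_add_left cform_add_right cform_scale_left cform_scale_right
 cform_diff_left cform_diff_right cform_minus_left cform_minus_right cform_0_left cform_0_right

lemma cform_sum_left: "cform Q (SUM i:I. f i) z = (SUM i:I. cform Q (f i) z)"
 by (induction I rule: infinite_finite_induct) (auto simp: cform_simps)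

lemma cform_sum_right: "cform Q z (SUM i:I. f i) = (SUM i:I. cform Q z (f i))"
 by (induction I rule: infinite_finite_induct) (auto simp: cform_simps)

lemma cvec_add: "cvec (x + y) = cvec x + cvec y"
 and cvec_diff: "cvec (x - y) = cvec x - cvec y"
 and cvec_scale: "cvec (c *\<^sub>R x) = of_real c *s cvec x"
 and cvec_0: "cvec 0 = 0" by (auto simp: cvec_def vec_eq_iff)

lemma cvec_sum: "cvec (SUM i:I. f i) = (SUM i:I. cvec (f i))"
 by (induction I rule: infinite_finite_induct) (auto simp: cvec_0 cvec_add)

lemma cform_cvec: "cform Q (cvec x) (cvec y) = of_real (rform Q x y)" by (simp add: cform_def rform_def cvec_def)

definition Revec :: "complex ^ 'm => real ^ 'm" where
 "Revec v = (\<chi> i. Re (v $ i))"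

lemma Re_Im_decomp: "v = cvec (Revec v) + \<i> *s cvec (Imvec v)"
 by (simp add: vec_eq_iff cvec_def Revec_def Imvec_def complex_eq_iff)

lemma Revec_simps [simp]: "Revec (cvec x + \<i> *s cvec y) = x" "Imvec (cvec x + \<i> *s cvec y) = y"
 by (simp_all add: vec_eq_iff cvec_def Revec_def Imvec_def)

lemma cnjvec_decomp: "cnjvec v = cvec (Revec v) - \<i> *s cvec (Imvec v)"
 by (simp add: vec_eq_iff cvec_def Revec_def Imvec_def cnjvec_def complex_eq_iff)

lemma Revec_add: "Revec (v + w) = Revec v + Revec w" and Imvec_add: "Imvec (v + w) = Imvec v + Imvec w"
 and Revec_0: "Revec 0 = 0" and Imvec_0: "Imvec 0 = 0"
 and Revec_scale: "Revec (c *s v) = Re c *\<^sub>R Revec v - Im c *\<^sub>R Imvec v"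
 and Imvec_scale: "Imvec (c *s v) = Re c *\<^sub>R Imvec v + Im c *\<^sub>R Revec v"
 and Revec_cvec: "Revec (cvec x) = x" and Imvec_cvec: "Imvec (cvec x) = 0"
 by (auto simp: vec_eq_iff Revec_def Imvec_def cvec_def)

lemma matrix_cvec: "cmat g *v cvec x = cvec (g *v x)" by (simp add: vec_eq_iff cmat_def cvec_def matrix_vector_mult_def)

lemma cspace_iff: "v : cspace L \<longleftrightarrow> Revec v : span L & Imvec v : span L"
proof
 assume "v : cspace L"
 then show "Revec v : span L & Imvec v : span L" unfolding cspace_def
 proof (induction rule: vec.span_induct_alt)
  case base
  then show ?case by (simp add: Revec_0 Imvec_0 span_zero)
 next
  case (step c x y)
  then obtain u where "x = cvec u" "u : L" by blast
  then show ?case using step by (auto simp: Revec_add Imvec_add Revec_scale Imvec_scale Revec_cvec Imvec_cvec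
  intro!: span_add span_scale intro: span_base)
 qed
next
 have real: "cvec x : cspace L" if "x : span L" for x using that
 proof (induction rule: span_induct_alt)
  case base
  then show ?case by (simp add: cvec_0 cspace_def vec.span_zero)
 next
  case (step c x y)
  then show ?case unfolding cvec_add cvec_scale cspace_def by (intro vec.span_add vec.span_scale) (auto intro: vec.span_base)
 qed
 assume "Revec v : span L & Imvec v : span L"
 then show "v : cspace L" using real by (subst Re_Im_decomp[of v]) (simp add: cspace_def vec.span_add vec.span_scale)
qed

lemma cvec_cspace: "cvec x : cspace L \<longleftrightarrow> x : span L"
 by (simp add: cspace_iff Revec_cvec Imvec_cvec span_zero)

lemma cspace_subspace: "vec.subspace (cspace L)" by (simp add: cspace_def)

lemma cspace_UNIV: "span L = UNIV ==> cspace L = UNIV" by (auto simp: cspace_iff)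

lemma cform_span_0:
 assumes "!!x y. x : A ==> y : B ==> rform Q x y = 0" "v : cspace A" "w : cspace B" shows "cform Q v w = 0"
proof -
 have 1: "cform Q (cvec x) w = 0" if "x : A" for x using assms(3) unfolding cspace_def
  by (induction rule: vec.span_induct_alt) (use assms(1) that in "auto simp: cform_simps cform_cvec")
 show ?thesis using assms(2) unfolding cspace_def by (induction rule: vec.span_induct_alt) (use 1 in "auto simp: cform_simps")
qed

lemma rform_span_0:
 assumes "!!x y. x : A ==> y : B ==> rform Q x y = 0" "v : span A" "w : span B" shows "rform Q v w = 0"
 using cform_span_0[OF assms(1), of A B "cvec v" "cvec w"] assms(2,3) by (simp add: cvec_cspace cform_cvec)

lemma continuous_on_rform [continuous_intros]:
 "continuous_on S f ==> continuous_on S g ==> continuous_on S (%x. rform Q (f x) (g x))"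
 unfolding rform_def by (intro continuous_intros)

lemma continuous_on_cform [continuous_intros]:
 "continuous_on S f ==> continuous_on S g ==> continuous_on S (%x. cform Q (f x) (g x))"
 unfolding cform_def by (intro continuous_intros)

lemma continuous_on_smult [continuous_intros]:
 "continuous_on S f ==> continuous_on S g ==> continuous_on S (%x. f x *s (g x :: complex ^ 'm))"
 unfolding vector_scalar_mult_def by (intro continuous_intros)

lemma continuous_on_cvec [continuous_intros]:
 "continuous_on S f ==> continuous_on S (%x. cvec (f x))" unfolding cvec_def by (intro continuous_intros)

lemma continuous_on_cnjvec [continuous_intros]:
 "continuous_on S f ==> continuous_on S (%x. cnjvec (f x))" unfolding cnjvec_def by (intro continuous_intros)

lemma continuous_on_Imvec [continuous_intros]:
 "continuous_on S f ==> continuous_on S (%x. Imvec (f x))" unfolding Imvec_def by (intro continuous_intros)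

section \<open>Lattices and rational vectors\<close>

lemma lattice_closed:
 assumes "is_lattice Q L" shows lattice_0: "0 : L" and lattice_add: "x : L ==> y : L ==> x + y : L"
  and lattice_scale: "x : L ==> real_of_int k *\<^sub>R x : L"
proof -
 obtain b where b: "finite b" "L = int_span b" using assms unfolding is_lattice_def by blast
 show "0 : L" unfolding b int_span_def by (intro CollectI exI[of _ "%_. 0"]) simp
 show "x : L ==> y : L ==> x + y : L"
 proof -
  assume "x : L" "y : L"
  then obtain c c' where "x = (SUM v:b. real_of_int (c v) *\<^sub>R v)" "y = (SUM v:b. real_of_int (c' v) *\<^sub>R v)"
  unfolding b int_span_def by blast
  then have "x + y = (SUM v:b. real_of_int ((%v. c v + c' v) v) *\<^sub>R v)"
  by (simp add: sum.distrib scaleR_left_distrib)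
  then show "x + y : L" unfolding b(2) int_span_def by (intro CollectI exI[of _ "%v. c v + c' v"]) simp
 qed
 show "x : L ==> real_of_int k *\<^sub>R x : L"
 proof -
  assume "x : L"
  then obtain c where "x = (SUM v:b. real_of_int (c v) *\<^sub>R v)" unfolding b int_span_def by blast
  then have "real_of_int k *\<^sub>R x = (SUM v:b. real_of_int ((%v. k * c v) v) *\<^sub>R v)"
  by (simp add: scaleR_sum_right)
  then show "real_of_int k *\<^sub>R x : L" unfolding b(2) int_span_def by (intro CollectI exI[of _ "%v. k * c v"]) simp
 qed
qed

lemma lattice_minus: "is_lattice Q L ==> x : L ==> - x : L" using lattice_scale[of Q L x "-1"] by simp

lemma lattice_diff: "is_lattice Q L ==> x : L ==> y : L ==> x - y : L"
 using lattice_add[of Q L x "-y"] lattice_minus[of Q L y] by simp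

lemma lattice_rat_space: "L <= rat_space L" by (auto simp: rat_space_def intro: exI[of _ 1])

lemma rat_space_subset_span: "rat_space L <= span L"
proof
 fix x assume "x : rat_space L"
 then obtain N :: nat where N: "N > 0" "real N *\<^sub>R x : L" unfolding rat_space_def by blast
 then have "inverse (real N) *\<^sub>R (real N *\<^sub>R x) : span L" by (intro span_scale span_base)
 then show "x : span L" using N by simp
qed

lemma rat_space_scale:
 assumes L: "is_lattice Q L" and q: "q : \<rat>" and x: "x : rat_space L" shows "q *\<^sub>R x : rat_space L"
proof -
 obtain N :: nat where N: "N > 0" "real N *\<^sub>R x : L" using x unfolding rat_space_def by blast
 obtain a b :: int where ab: "b > 0" "q = of_int a / of_int b" using Rats_cases'[OF q] by metis
 have "real (nat b) * q = real_of_int a" using ab by simp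
 moreover have "real (nat b * N) *\<^sub>R (q *\<^sub>R x) = (real (nat b) * q) *\<^sub>R (real N *\<^sub>R x)"
  by (simp add: mult_ac)
 ultimately have "real (nat b * N) *\<^sub>R (q *\<^sub>R x) : L" using lattice_scale[OF L N(2), of a] by (simp only:)
 then show ?thesis unfolding rat_space_def using ab N by (intro CollectI exI[of _ "nat b * N"]) auto
qed

lemma rat_space_add:
 assumes L: "is_lattice Q L" and x: "x : rat_space L" and y: "y : rat_space L" shows "x + y : rat_space L"
proof -
 obtain N :: nat where N: "N > 0" "real N *\<^sub>R x : L" using x unfolding rat_space_def by blast
 obtain M :: nat where M: "M > 0" "real M *\<^sub>R y : L" using y unfolding rat_space_def by blast
 have "real (N * M) *\<^sub>R (x + y) = real_of_int (int M) *\<^sub>R (real N *\<^sub>R x) + real_of_int (int N) *\<^sub>R (real M *\<^sub>R y)"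
  by (simp add: scaleR_add_right mult.commute)
 also have "... : L" by (intro lattice_add[OF L] lattice_scale[OF L] N M)
 finally show ?thesis unfolding rat_space_def using N M by (intro CollectI exI[of _ "N * M"]) auto
qed

lemma rat_space_diff:
 assumes "is_lattice Q L" "x : rat_space L" "y : rat_space L" shows "x - y : rat_space L"
 using rat_space_add[OF assms(1,2) rat_space_scale[OF assms(1) _ assms(3), of "-1"]] by simp

lemma rat_space_0: "is_lattice Q L ==> 0 : rat_space L" using lattice_0 lattice_rat_space by blast

lemma rat_space_sum:
 assumes "is_lattice Q L" "!!i. i : I ==> f i : rat_space L" shows "(SUM i:I. f i) : rat_space L"
 using assms(2) by (induction I rule: infinite_finite_induct)
  (auto simp: rat_space_0[OF assms(1)] intro!: rat_space_add[OF assms(1)])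

lemma rform_rat:
 assumes L: "is_lattice Q L" and x: "x : rat_space L" and y: "y : rat_space L" shows "rform Q x y : \<rat>"
proof -
 obtain N :: nat where N: "N > 0" "real N *\<^sub>R x : L" using x unfolding rat_space_def by blast
 obtain M :: nat where M: "M > 0" "real M *\<^sub>R y : L" using y unfolding rat_space_def by blast
 have "rform Q (real N *\<^sub>R x) (real M *\<^sub>R y) : \<int>" using L N M unfolding is_lattice_def by blast
 then have "real N * real M * rform Q x y : \<rat>" using Ints_subset_Rats by (auto simp: rform_simps mult_ac)
 then have "(real N * real M * rform Q x y) / (real N * real M) : \<rat>" by (intro Rats_divide) auto
 then show ?thesis using N M by simp
qed

lemma span_rat_space: "is_lattice Q L ==> span (rat_space L) = span L"
 by (metis lattice_rat_space rat_space_subset_span span_mono span_span subset_antisym)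

locale symmetric_form =
 fixes Q :: "real ^ 'm ^ 'm"
 assumes sym_Q: "Q $ i $ j = Q $ j $ i"
begin

lemma rform_sym: "rform Q x y = rform Q y x" unfolding rform_def by (subst sum.swap) (simp add: sym_Q[of "_ :: 'm"] mult_ac)

lemma cform_sym: "cform Q x y = cform Q y x" unfolding cform_def by (subst sum.swap) (simp add: sym_Q mult_ac)

definition orth_set :: "(real ^ 'm) set => bool" where
 "orth_set B \<longleftrightarrow> finite B & (ALL x:B. rform Q x x ~= 0) & (ALL x:B. ALL y:B. x ~= y --> rform Q x y = 0)"

lemma orth_expand:
 assumes B: "orth_set B" and x: "x : span B" shows "x = (SUM b:B. (rform Q x b / rform Q b b) *\<^sub>R b)" using x
proof (induction rule: span_induct_alt)
 case base
 then show ?case by (simp add: rform_simps)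
next
 case (step c x y)
 have "(SUM b:B. (rform Q x b / rform Q b b) *\<^sub>R b) = (SUM b:B. if b = x then x else 0)"
  using B step(1) unfolding orth_set_def by (intro sum.cong) auto
 also have "... = x" using B step(1) by (simp add: orth_set_def)
 finally have x: "(SUM b:B. (rform Q x b / rform Q b b) *\<^sub>R b) = x" .
 have "(SUM b:B. (rform Q (c *\<^sub>R x + y) b / rform Q b b) *\<^sub>R b)
  = c *\<^sub>R (SUM b:B. (rform Q x b / rform Q b b) *\<^sub>R b) + (SUM b:B. (rform Q y b / rform Q b b) *\<^sub>R b)"
  by (simp add: rform_simps add_divide_distrib scaleR_left_distrib sum.distrib scaleR_sum_right)
 then show ?case using step x by simp
qed

lemma orthogonal_proj:
 assumes B: "orth_set B" and b: "b : B"
 shows "rform Q (x - (SUM b:B. (rform Q x b / rform Q b b) *\<^sub>R b)) b = 0"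
proof -
 have "rform Q (SUM b:B. (rform Q x b / rform Q b b) *\<^sub>R b) b = (SUM b':B. if b' = b then rform Q x b else 0)"
  unfolding rform_sum_left rform_scale_left using B b unfolding orth_set_def by (intro sum.cong) auto
 then show ?thesis using B b by (simp add: rform_simps orth_set_def)
qed

lemma orth_independent: "orth_set B ==> independent B"
proof -
 assume B: "orth_set B"
 show "independent B"
 proof (rule independent_if_scalars_zero)
  show "finite B" using B by (simp add: orth_set_def)
  fix f x assume *: "(SUM x:B. f x *\<^sub>R x) = 0" "x : B"
  then have "0 = rform Q (SUM x:B. f x *\<^sub>R x) x" by (simp add: rform_simps)
  also have "... = (SUM y:B. if y = x then f x * rform Q x x else 0)" unfolding rform_sum_left rform_scale_left
  using B * unfolding orth_set_def by (intro sum.cong) auto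
  also have "... = f x * rform Q x x" using B * by (simp add: orth_set_def)
  finally show "f x = 0" using B * by (auto simp: orth_set_def)
 qed
qed

lemma orthogonal_insert:
 assumes B: "orth_set B" and x: "rform Q x x ~= 0" and xb: "!!b. b : B ==> rform Q x b = 0"
 shows "orth_set (insert x B)"
proof -
 have "rform Q b x = 0" if "b : B" for b using xb[OF that] rform_sym[of b x] by simp
 then show ?thesis using assms by (auto simp: orth_set_def)
qed

text \<open>Gram-Schmidt over the rational numbers: by polarization a nonzero form has an anisotropic
  vector, so that an orthogonal family of maximal size spans.\<close>

lemma rational_orth_basis:
 assumes L: "is_lattice Q L" and B0: "orth_set B0" "B0 <= rat_space L"
 obtains B where "orth_set B" "B0 <= B" "B <= rat_space L" "span B = span L"
proof -
 let ?P = "%B. orth_set B & B0 <= B & B <= rat_space L"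
 have "EX B. ?P B & (ALL B'. ?P B' --> card B' <= card B)"
 proof (rule ex_has_greatest_nat)
  show "?P B0" using B0 by blast
  show "ALL B. ?P B --> card B < Suc (DIM(real ^ 'm))"
  using orth_independent independent_card_le[where 'a = "real ^ 'm"] by (auto simp: less_Suc_eq_le)
 qed
 then obtain B where B: "?P B" and max: "!!B'. ?P B' ==> card B' <= card B" by blast
 let ?\<pi> = "%x. SUM b:B. (rform Q x b / rform Q b b) *\<^sub>R b"
 have \<pi>: "?\<pi> x : rat_space L" if "x : rat_space L" for x using B that
  by (intro rat_space_sum[OF L] rat_space_scale[OF L] Rats_divide rform_rat[OF L]) auto
 have iso: "rform Q x x = 0" if "x : rat_space L" "!!b. b : B ==> rform Q x b = 0" for x
 proof (rule ccontr)
  assume x: "rform Q x x ~= 0"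
  then have "x ~: B" using that(2) by blast
  moreover have "?P (insert x B)" using B x that orthogonal_insert by auto
  ultimately show False using max[of "insert x B"] B by (simp add: orth_set_def)
 qed
 have "L <= span B"
 proof
  fix v assume v: "v : L"
  define p where "p = v - ?\<pi> v"
  have p: "p : rat_space L" "!!b. b : B ==> rform Q p b = 0" using \<pi>[of v] v lattice_rat_space B unfolding p_def
  by (auto intro!: rat_space_diff[OF L] orthogonal_proj)
  have "rform Q p y = 0" if y: "y : L" for y
  proof -
  define q where "q = y - ?\<pi> y"
  have q: "q : rat_space L" "!!b. b : B ==> rform Q q b = 0" using \<pi>[of y] y lattice_rat_space B unfolding q_def
  by (auto intro!: rat_space_diff[OF L] orthogonal_proj)
  have "rform Q (p + q) (p + q) = 0" by (rule iso) (use p q in "auto simp: rform_simps intro: rat_space_add[OF L]")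
  then have "rform Q p q = 0" using iso[of p] iso[of q] p q by (simp add: rform_simps rform_sym[of q p])
  moreover have "rform Q p (?\<pi> y) = 0"
  using p(2) rform_sym by (subst rform_sym) (simp add: rform_sum_left rform_scale_left)
  ultimately show ?thesis by (simp add: q_def rform_simps)
  qed
  moreover obtain N :: nat where N: "N > 0" "real N *\<^sub>R p : L" using p(1) unfolding rat_space_def by blast
  moreover from calculation have "ALL y:L. rform Q (real N *\<^sub>R p) y = 0" by (simp add: rform_simps)
  ultimately have "real N *\<^sub>R p = 0" using L unfolding is_lattice_def by blast
  then have "v = ?\<pi> v" using N by (simp add: p_def)
  also have "?\<pi> v : span B" by (intro span_sum span_scale span_base)
  finally show "v : span B" .
 qed
 then have "span B = span L"
  using span_mono[of L "span B"] span_mono[of B "span L"] B rat_space_subset_span[of L] by (auto simp: span_span)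
 then show ?thesis using that B by blast
qed

lemma lattice_nondegenerate:
 assumes L: "is_lattice Q L" and x: "x : span L" "!!y. y : L ==> rform Q x y = 0" shows "x = 0"
proof -
 obtain B where B: "orth_set B" "B <= rat_space L" "span B = span L"
  using rational_orth_basis[OF L, of "{}"] by (auto simp: orth_set_def)
 have "rform Q x b = 0" if "b : B" for b
  using rform_span_0[of "{x}" L Q x b] x(2) that B(2) rat_space_subset_span[of L] by (auto simp: span_base)
 then show ?thesis using orth_expand[OF B(1), of x] B(3) x(1) by simp
qed

lemma cspace_nondegenerate:
 assumes L: "is_lattice Q L" and v: "v : cspace L" "!!w. w : cspace L ==> cform Q v w = 0" shows "v = 0"
proof -
 have "rform Q (Revec v) y = 0 & rform Q (Imvec v) y = 0" if "y : L" for y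
 proof -
  have "cform Q v (cvec y) = 0" using v(2) that by (simp add: cvec_cspace span_base)
  then have "of_real (rform Q (Revec v) y) + \<i> * of_real (rform Q (Imvec v) y) = 0"
  by (subst (asm) Re_Im_decomp) (simp add: cform_simps cform_cvec)
  then show ?thesis by (simp add: complex_eq_iff)
 qed
 then have "Revec v = 0" "Imvec v = 0" using lattice_nondegenerate[OF L] v(1) by (auto simp: cspace_iff)
 then show ?thesis by (subst Re_Im_decomp) (simp add: cvec_0)
qed

section \<open>Orthonormal bases of complex quadratic spaces\<close>

definition onb :: "(complex ^ 'm) set => nat => (nat => complex ^ 'm) => bool" where
 "onb W p c \<longleftrightarrow> (\<forall>i<p. c i : W) & (\<forall>i<p. \<forall>j<p. cform Q (c i) (c j) = (if i = j then 1 else 0)) &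
  (ALL v:W. v = (\<Sum>i<p. cform Q v (c i) *s c i))"

lemma orthonormal_independent:
 fixes p :: nat
 assumes "!!i j. i < p ==> j < p ==> cform Q (c i) (c j) = (if i = j then 1 else 0)"
 shows "inj_on c {..<p} & vec.independent (c ` {..<p})"
proof
 show inj: "inj_on c {..<p}"
 proof
  fix i j assume "i : {..<p}" "j : {..<p}" "c i = c j"
  then show "i = j" using assms[of i i] assms[of i j] by (auto split: if_splits)
 qed
 show "vec.independent (c ` {..<p})"
 proof (rule vec.independent_if_scalars_zero)
  fix f x assume *: "(SUM x:c ` {..<p}. f x *s x) = 0" "x : c ` {..<p}"
  then obtain j where j: "j < p" "x = c j" by blast
  have "0 = cform Q (\<Sum>i<p. f (c i) *s c i) (c j)" using * by (simp add: sum.reindex[OF inj] o_def cform_simps)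
  also have "... = (\<Sum>i<p. if i = j then f (c j) else 0)"
  unfolding cform_sum_left cform_scale_left using assms j by (intro sum.cong) auto
  also have "... = f (c j)" using j by (subst sum.delta) auto
  finally show "f x = 0" using j by simp
 qed simp
qed

lemma onb_dim:
 assumes "onb W p c" shows "vec.dim W = p"
proof -
 have ind: "inj_on c {..<p}" "vec.independent (c ` {..<p})" using orthonormal_independent[of p c] assms by (auto simp: onb_def)
 have "vec.span (c ` {..<p}) = vec.span W"
 proof
  show "vec.span (c ` {..<p}) <= vec.span W" using assms by (intro vec.span_mono) (auto simp: onb_def)
  have "W <= vec.span (c ` {..<p})"
  proof
  fix v assume "v : W"
  then have "v = (\<Sum>i<p. cform Q v (c i) *s c i)" using assms by (simp add: onb_def)
  also have "... : vec.span (c ` {..<p})" by (intro vec.span_sum vec.span_scale vec.span_base) auto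
  finally show "v : vec.span (c ` {..<p})" .
  qed
  then show "vec.span W <= vec.span (c ` {..<p})" by (intro vec.span_minimal) auto
 qed
 from vec.dim_eq_card[OF this ind(2)] show ?thesis using ind(1) by (simp add: card_image)
qed

lemma onb_exists:
 assumes W: "vec.subspace W"
  and nd: "!!v. v : W ==> (!!w. w : W ==> cform Q v w = 0) ==> v = 0"
 obtains c where "onb W (vec.dim W) c"
proof -
 let ?P = "%pc :: nat \<times> (nat => complex ^ 'm). (\<forall>i<fst pc. snd pc i : W) &
  (\<forall>i<fst pc. \<forall>j<fst pc. cform Q (snd pc i) (snd pc j) = (if i = j then 1 else 0))"
 have bound: "fst pc <= vec.dim (UNIV :: (complex ^ 'm) set)" if "?P pc" for pc :: "nat \<times> (nat => complex ^ 'm)"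
 proof -
  have "inj_on (snd pc) {..<fst pc}" "vec.independent (snd pc ` {..<fst pc})"
  using orthonormal_independent[of "fst pc" "snd pc"] that by auto
  then show ?thesis using vec.independent_card_le_dim[of "snd pc ` {..<fst pc}" UNIV] by (simp add: card_image)
 qed
 have "EX pc. ?P pc & (ALL pc'. ?P pc' --> fst pc' <= fst pc)"
  by (rule ex_has_greatest_nat[where P = ?P and f = fst and k = "(0, %_. 0)"
  and b = "Suc (vec.dim (UNIV :: (complex ^ 'm) set))"]) 
  (use bound in "auto simp: less_Suc_eq_le")
 then obtain pc where pc0: "?P pc & (ALL pc'. ?P pc' --> fst pc' <= fst pc)" by (rule exE)
 define p c where "p = fst pc" and "c = snd pc"
 have pc: "(\<forall>i<p. c i : W) & (\<forall>i<p. \<forall>j<p. cform Q (c i) (c j) = (if i = j then 1 else 0))"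
  using conjunct1[OF pc0] by (simp only: p_def c_def)
 have max: "p' <= p" if "?P (p', c')" for p' c' using mp[OF spec[OF conjunct2[OF pc0]] that] by (simp add: p_def)
 let ?\<pi> = "%v. \<Sum>i<p. cform Q v (c i) *s c i"
 have \<pi>W: "v - ?\<pi> v : W" if "v : W" for v
  using pc that by (intro vec.subspace_diff[OF W] vec.subspace_sum[OF W] vec.subspace_scale[OF W]) auto
 have \<pi>: "cform Q (v - ?\<pi> v) (c j) = 0" if "j < p" for v j
 proof -
  have "cform Q (?\<pi> v) (c j) = (\<Sum>i<p. if i = j then cform Q v (c j) else 0)"
  unfolding cform_sum_left cform_scale_left using pc that by (intro sum.cong) auto
  then show ?thesis using that by (simp add: cform_simps)
 qed
 have iso: "cform Q x x = 0" if x: "x : W" "!!j. j < p ==> cform Q x (c j) = 0" for x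
 proof (rule ccontr)
  assume n: "cform Q x x ~= 0"
  define y where "y = inverse (csqrt (cform Q x x)) *s x"
  have sq: "csqrt (cform Q x x) * csqrt (cform Q x x) = cform Q x x"
  using power2_csqrt[of "cform Q x x"] by (simp add: power2_eq_square)
  have "cform Q y y = cform Q x x / (csqrt (cform Q x x) * csqrt (cform Q x x))"
  by (simp add: y_def cform_simps divide_inverse mult_ac)
  then have yy: "cform Q y y = 1" using n unfolding sq by simp
  have yc: "cform Q y (c j) = 0" "cform Q (c j) y = 0" if "j < p" for j
  using x(2)[OF that] by (simp_all add: y_def cform_simps cform_sym[of "c j" x])
  have "y : W" using x(1) by (simp add: y_def vec.subspace_scale[OF W])
  then have 1: "(c(p := y)) i : W" if "i < Suc p" for i using pc that by (cases "i = p") auto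
  have 2: "cform Q ((c(p := y)) i) ((c(p := y)) j) = (if i = j then 1 else 0)" if "i < Suc p" "j < Suc p" for i j
  proof (cases "i = p"; cases "j = p")
  assume "i ~= p" "j ~= p"
  then show ?thesis using pc that by simp
  qed (use yy yc[of i] yc[of j] that in auto)
  have "?P (Suc p, c(p := y))" unfolding fst_conv snd_conv by (intro conjI allI impI 1 2)
  from max[OF this] have "Suc p <= p" .
  then show False by simp
 qed
 have "v = ?\<pi> v" if v: "v : W" for v
 proof -
  let ?p = "v - ?\<pi> v"
  have "cform Q ?p w = 0" if w: "w : W" for w
  proof -
  let ?q = "w - ?\<pi> w"
  have pol: "cform Q x y = 0" if "cform Q (x + y) (x + y) = 0" "cform Q x x = 0" "cform Q y y = 0" for x y
  using that by (simp add: cform_add_left cform_add_right cform_sym[of y x])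
  have "cform Q ?p ?q = 0"
  proof (rule pol)
  show "cform Q (?p + ?q) (?p + ?q) = 0"
  by (rule iso[OF vec.subspace_add[OF W \<pi>W[OF v] \<pi>W[OF w]]]) (simp only: cform_add_left \<pi> add_0)
  show "cform Q ?p ?p = 0" by (rule iso[OF \<pi>W[OF v] \<pi>])
  show "cform Q ?q ?q = 0" by (rule iso[OF \<pi>W[OF w] \<pi>])
  qed
  moreover have "cform Q ?p (?\<pi> w) = 0" unfolding cform_sum_right cform_scale_right using \<pi>[of _ v] by simp
  ultimately show ?thesis using cform_diff_right[of Q ?p w "?\<pi> w"] by simp
  qed
  then show ?thesis using nd[OF \<pi>W[OF v]] by simp
 qed
 then have "onb W p c" using pc by (simp add: onb_def)
 with onb_dim[OF this] show ?thesis using that by blast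
qed

end

section \<open>Spaces with two positive directions\<close>

locale period_space = symmetric_form Q for Q :: "real ^ 'm ^ 'm" +
 assumes nondegenerate: "(!!y. rform Q x y = 0) ==> x = 0"
  and no_positive_triple: "rform Q x x > 0 ==> rform Q y y > 0 ==> rform Q z z > 0 ==>
  rform Q x y = 0 ==> rform Q x z = 0 ==> rform Q y z = 0 ==> False"
begin

lemma negative_orthogonal:
 assumes p: "rform Q p p > 0" "rform Q q q > 0" "rform Q p q = 0"
  and v: "rform Q v p = 0" "rform Q v q = 0" "v ~= 0" shows "rform Q v v < 0"
proof (rule ccontr)
 assume "~ ?thesis"
 moreover have "~ rform Q v v > 0" using no_positive_triple[of p q v] p v rform_sym by metis
 ultimately have v0: "rform Q v v = 0" by simp
 obtain w where w: "rform Q v w ~= 0" using nondegenerate v(3) by blast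
 define w' where "w' = w - (rform Q w p / rform Q p p) *\<^sub>R p - (rform Q w q / rform Q q q) *\<^sub>R q"
 have pq: "rform Q q p = 0" using p rform_sym by metis
 have w': "rform Q w' p = 0" "rform Q w' q = 0" "rform Q v w' = rform Q v w" using p pq v by (simp_all add: w'_def rform_simps)
 \<comment> \<open>A small multiple of \<open>w'\<close> moves the isotropic vector \<open>v\<close> into the positive cone.\<close>
 define a where "a = rform Q v w"
 define b where "b = rform Q w' w'"
 define s where "s = \<bar>b\<bar> + 1"
 define t where "t = a / s"
 have n: "rform Q (v + t *\<^sub>R w') (v + t *\<^sub>R w') = 2 * t * a + t^2 * b"
  using v0 w'(3) rform_sym[of w' v] by (simp add: rform_simps a_def b_def power2_eq_square algebra_simps)
 have s: "s > 0" "2 * s + b > 0" by (auto simp: s_def)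
 then have "2 * t * a + t^2 * b = (a^2 / s^2) * (2 * s + b)" by (simp add: t_def power2_eq_square field_simps)
 also have "... > 0" using w s by (intro mult_pos_pos divide_pos_pos) (auto simp: a_def)
 finally have "rform Q (v + t *\<^sub>R w') (v + t *\<^sub>R w') > 0" using n by simp
 moreover have "rform Q (v + t *\<^sub>R w') p = 0" "rform Q (v + t *\<^sub>R w') q = 0"
  using v w' by (simp_all add: rform_simps)
 ultimately show False using no_positive_triple[of "v + t *\<^sub>R w'" p q] p by blast
qed

lemma cform_Re_Im:
 "cform Q v w = of_real (rform Q (Revec v) (Revec w) - rform Q (Imvec v) (Imvec w))
  + \<i> * of_real (rform Q (Revec v) (Imvec w) + rform Q (Imvec v) (Revec w))"
proof -
 have "cform Q (cvec a + \<i> *s cvec b) (cvec c + \<i> *s cvec d)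
  = of_real (rform Q a c - rform Q b d) + \<i> * of_real (rform Q a d + rform Q b c)" for a b c d
  by (simp add: cform_simps cform_cvec algebra_simps)
 from this[of "Revec v" "Imvec v" "Revec w" "Imvec w"] show ?thesis by (simp only: Re_Im_decomp[symmetric])
qed

lemma Revec_cnjvec: "Revec (cnjvec v) = Revec v" and Imvec_cnjvec: "Imvec (cnjvec v) = - Imvec v"
 by (simp_all add: vec_eq_iff Revec_def Imvec_def cnjvec_def)

lemma period_cone_Re_Im:
 assumes "om : period_cone Q L"
 shows "rform Q (Revec om) (Revec om) > 0" "rform Q (Imvec om) (Imvec om) > 0" "rform Q (Revec om) (Imvec om) = 0"
proof -
 let ?a = "Revec om" and ?b = "Imvec om"
 have om: "cform Q om om = 0" "Re (cform Q om (cnjvec om)) > 0" using assms by (auto simp: period_cone_def)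
 have 1: "rform Q ?a ?a = rform Q ?b ?b" "rform Q ?a ?b = 0"
  using om(1) rform_sym[of ?b ?a] by (auto simp: cform_Re_Im complex_eq_iff)
 have "rform Q ?a ?a + rform Q ?b ?b > 0" using om(2) by (simp add: cform_Re_Im Revec_cnjvec Imvec_cnjvec rform_simps)
 then show "rform Q ?a ?a > 0" "rform Q ?b ?b > 0" "rform Q ?a ?b = 0" using 1 by auto
qed

text \<open>Otherwise \<open>e\<close> is orthogonal to the positive plane spanned by the real and imaginary part of \<open>\<omega>\<close>, so it has
  negative norm.\<close>

lemma period_isotropic:
 assumes om: "om : period_cone Q L" and e: "rform Q e e = 0" "e ~= 0" shows "cform Q om (cvec e) ~= 0"
proof
 assume "cform Q om (cvec e) = 0"
 then have "of_real (rform Q (Revec om) e) + \<i> * of_real (rform Q (Imvec om) e) = 0"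
  by (simp add: cform_Re_Im Revec_cvec Imvec_cvec rform_simps)
 then have "rform Q e (Revec om) = 0" "rform Q e (Imvec om) = 0" using rform_sym by (auto simp: complex_eq_iff)
 from negative_orthogonal[OF period_cone_Re_Im[OF om] this e(2)] e(1) show False by simp
qed

section \<open>Hyperbolic pairs and the future cone\<close>

definition hyp :: "real ^ 'm => real ^ 'm => bool" where
 "hyp e e' \<longleftrightarrow> rform Q e e = 0 & rform Q e' e' = 0 & rform Q e e' = 1"

lemma hypD:
 assumes "hyp e e'" shows "rform Q e e = 0" "rform Q e' e' = 0" "rform Q e e' = 1" "rform Q e' e = 1" "e ~= 0"
 using assms rform_sym[of e' e] by (auto simp: hyp_def rform_simps)

text \<open>The component containing \<open>y0\<close> of the cone of positive vectors: by the reversed Cauchy-Schwarz inequality two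
  positive vectors lie in the same component if and only if their product is positive.\<close>

definition fcone :: "real ^ 'm => real ^ 'm => real ^ 'm => (real ^ 'm) set" where
 "fcone e e' y0 = {x. rform Q x e = 0 & rform Q x e' = 0 & rform Q x x > 0 & rform Q x y0 > 0}"

lemma hyp_positive:
 assumes "hyp e e'" shows "rform Q (e + e') (e + e') > 0" using hypD[OF assms] by (simp add: rform_simps)

lemma orthogonal_to_positive:
 assumes h: "hyp e e'" and y: "rform Q y e = 0" "rform Q y e' = 0" "rform Q y y > 0"
  and z: "rform Q z e = 0" "rform Q z e' = 0" "rform Q z y = 0" "z ~= 0" shows "rform Q z z < 0"
 by (rule negative_orthogonal[OF hyp_positive[OF h] y(3)])
  (use y z rform_sym[of "e + e'" y] in "auto simp: rform_simps")

lemma fcone_pairing: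
 assumes h: "hyp e e'" and y0: "y0 : fcone e e' y0" and x: "x : fcone e e' y0" and y: "y : fcone e e' y0"
 shows "rform Q x y > 0"
proof (rule ccontr)
 assume n: "~ rform Q x y > 0"
 define z where "z = rform Q y y0 *\<^sub>R x - rform Q x y0 *\<^sub>R y"
 have xy: "rform Q x y0 > 0" "rform Q y y0 > 0" "rform Q x x > 0" "rform Q y y > 0" using x y by (auto simp: fcone_def)
 have "rform Q z z = (rform Q y y0)^2 * rform Q x x + (rform Q x y0)^2 * rform Q y y
  + 2 * (rform Q y y0 * rform Q x y0) * (- rform Q x y)"
  using rform_sym[of y x] by (simp add: z_def rform_simps power2_eq_square algebra_simps)
 moreover have "... > 0" using xy n by (intro add_pos_nonneg add_pos_pos mult_pos_pos mult_nonneg_nonneg) auto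
 ultimately have zz: "rform Q z z > 0" by simp
 moreover have "rform Q z z < 0"
 proof (rule orthogonal_to_positive[OF h, of y0])
  show "z ~= 0" using zz by (auto simp: rform_simps)
 qed (use x y y0 in "auto simp: fcone_def z_def rform_simps")
 ultimately show False by simp
qed

lemma fcone_add:
 assumes h: "hyp e e'" and y0: "y0 : fcone e e' y0" and x: "x : fcone e e' y0" and y: "y : fcone e e' y0"
 shows "x + y : fcone e e' y0"
 using x y fcone_pairing[OF h y0 x y] fcone_pairing[OF h y0 y x] by (auto simp: fcone_def rform_simps)

lemma fcone_scale:
 assumes "x : fcone e e' y0" "c > 0" shows "c *\<^sub>R x : fcone e e' y0" using assms by (auto simp: fcone_def rform_simps)

lemma fcone_convex:
 assumes h: "hyp e e'" and y0: "y0 : fcone e e' y0" shows "convex (fcone e e' y0)" unfolding convex_def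
proof (intro ballI allI impI)
 fix x y and u v :: real
 assume *: "x : fcone e e' y0" "y : fcone e e' y0" "0 <= u" "0 <= v" "u + v = 1"
 then consider "u = 0" "v = 1" | "v = 0" "u = 1" | "u > 0" "v > 0" by fastforce
 then show "u *\<^sub>R x + v *\<^sub>R y : fcone e e' y0" by cases (use * in "auto intro!: fcone_add[OF h y0] fcone_scale")
qed

lemma cusp_component:
 assumes h: "hyp e e'" and C: "C : components {x : U_real Q L e e'. rform Q x x > 0}" and y0: "y0 : C"
 shows "C = span L Int fcone e e' y0" and "y0 : fcone e e' y0"
proof -
 let ?S = "{x : U_real Q L e e'. rform Q x x > 0}"
 have CS: "C <= ?S" using C by (rule in_components_subset)
 have conn: "connected C" using C by (rule in_components_connected)
 have y: "rform Q y0 e = 0" "rform Q y0 e' = 0" "rform Q y0 y0 > 0" using CS y0 by (auto simp: U_real_def)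
 then show y0c: "y0 : fcone e e' y0" by (simp add: fcone_def)
 have nz: "rform Q x y0 ~= 0" if x: "x : ?S" for x
 proof
  assume 0: "rform Q x y0 = 0"
  have "rform Q x x < 0" by (rule orthogonal_to_positive[OF h y]) (use x 0 in "auto simp: U_real_def rform_simps")
  then show False using x by simp
 qed
 have pos: "rform Q x y0 > 0" if x: "x : C" for x
 proof (rule ccontr)
  assume n: "~ rform Q x y0 > 0"
  have "connected ((%x. rform Q x y0) ` C)" by (intro connected_continuous_image conn continuous_intros)
  then have "{rform Q x y0..rform Q y0 y0} <= (%x. rform Q x y0) ` C" by (rule connected_contains_Icc) (use x y0 in auto)
  moreover have "0 : {rform Q x y0..rform Q y0 y0}" using n y by auto
  ultimately obtain z where "z : C" "rform Q z y0 = 0" by (metis (no_types, lifting) imageE subsetD)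
  then show False using nz CS by blast
 qed
 show "C = span L Int fcone e e' y0"
 proof
  show "C <= span L Int fcone e e' y0" using CS pos by (auto simp: U_real_def fcone_def)
  show "span L Int fcone e e' y0 <= C"
  proof (rule components_maximal[OF C])
  show "connected (span L Int fcone e e' y0)"
  by (intro convex_connected convex_Int fcone_convex[OF h y0c] subspace_imp_convex subspace_span)
  show "span L Int fcone e e' y0 <= ?S" by (auto simp: U_real_def fcone_def)
  show "C Int (span L Int fcone e e' y0) ~= {}" using y0 y0c CS by (auto simp: U_real_def)
  qed
 qed
qed

section \<open>Points of the tube domain\<close>

lemma tube_point_isotropic:
 assumes h: "hyp e e'" and z: "cform Q z (cvec e) = 0" "cform Q z (cvec e') = 0"
 shows "cform Q (tube_point Q e e' z) (tube_point Q e e' z) = 0"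
  and "cform Q (tube_point Q e e' z) (cvec e) = 1" "cform Q (cvec e) (tube_point Q e e' z) = 1"
 using hypD[OF h] z cform_sym[of "cvec e" z] cform_sym[of "cvec e'" z] by (simp_all add: tube_point_def cform_simps cform_cvec)

lemma tube_point_norm:
 assumes h: "hyp e e'" and z: "cform Q z (cvec e) = 0" "cform Q z (cvec e') = 0"
 shows "Re (cform Q (tube_point Q e e' z) (cnjvec (tube_point Q e e' z))) = 2 * rform Q (Imvec z) (Imvec z)"
proof -
 let ?a = "1/2 * cform Q z z" and ?x = "Revec z" and ?y = "Imvec z"
 have cz: "cnjvec (tube_point Q e e' z) = cvec e' + cnjvec z - cnj ?a *s cvec e"
  by (simp add: vec_eq_iff cnjvec_def tube_point_def cvec_def)
 have "rform Q ?x e = 0" "rform Q ?y e = 0" "rform Q ?x e' = 0" "rform Q ?y e' = 0"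
  using z by (auto simp: cform_Re_Im Revec_cvec Imvec_cvec rform_simps complex_eq_iff)
 then have r: "rform Q ?x e = 0" "rform Q ?y e = 0" "rform Q ?x e' = 0" "rform Q ?y e' = 0"
  "rform Q e ?x = 0" "rform Q e ?y = 0" "rform Q e' ?x = 0" "rform Q e' ?y = 0" using rform_sym by auto
 have zb: "cform Q (cnjvec z) (cvec e) = 0" "cform Q (cnjvec z) (cvec e') = 0"
  "cform Q (cvec e) (cnjvec z) = 0" "cform Q (cvec e') (cnjvec z) = 0" by (simp_all add: cnjvec_decomp cform_simps cform_cvec r)
 have zz: "cform Q z z = of_real (rform Q ?x ?x - rform Q ?y ?y) + \<i> * of_real (2 * rform Q ?x ?y)"
  using rform_sym[of ?y ?x] by (simp add: cform_Re_Im)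
 have zzb: "cform Q z (cnjvec z) = of_real (rform Q ?x ?x + rform Q ?y ?y)"
  using rform_sym[of ?y ?x] by (simp add: cform_Re_Im Revec_cnjvec Imvec_cnjvec rform_simps)
 have "cform Q (tube_point Q e e' z) (cnjvec (tube_point Q e e' z)) = cform Q z (cnjvec z) - ?a - cnj ?a"
  unfolding cz unfolding tube_point_def by (simp add: cform_simps cform_cvec hypD[OF h] z zb)
 then show ?thesis by (simp add: zz zzb)
qed

lemma continuous_on_tube_point [continuous_intros]:
 "continuous_on S f ==> continuous_on S (%x. tube_point Q e e' (f x))" unfolding tube_point_def by (intro continuous_intros)

lemma tube_point_in_component:
 assumes h: "hyp e e'" and D: "D : components (period_cone Q L)" and L: "cspace L = UNIV"
  and y0: "y0 : fcone e e' y0" and z0: "z0 : D" "z0 = tube_point Q e e' w0"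
  "cform Q w0 (cvec e) = 0" "cform Q w0 (cvec e') = 0" "Imvec w0 : fcone e e' y0"
  and z: "cform Q z (cvec e) = 0" "cform Q z (cvec e') = 0" "Imvec z : fcone e e' y0" shows "tube_point Q e e' z : D"
proof -
 let ?T = "{z. cform Q z (cvec e) = 0 & cform Q z (cvec e') = 0 & Imvec z : fcone e e' y0}"
 have "convex ?T" unfolding convex_def using convexD[OF fcone_convex[OF h y0]]
  by (auto simp: smult_of_real[symmetric] cform_simps Imvec_add Imvec_scale)
 then have "connected (tube_point Q e e' ` ?T)" by (intro connected_continuous_image convex_connected continuous_intros)
 moreover have "tube_point Q e e' ` ?T <= period_cone Q L"
  using tube_point_isotropic[OF h] tube_point_norm[OF h] by (auto simp: period_cone_def L fcone_def)
 ultimately have "tube_point Q e e' ` ?T <= D" by (rule components_maximal[OF D]) (use z0 in blast)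
 then show ?thesis using z by blast
qed

section \<open>Trivialization of the Hodge bundle by a hyperbolic pair\<close>

text \<open>The projection along \<open>y\<close> to the complement of \<open>e\<close>, followed by the projection along \<open>e\<close> to the complement of
  \<open>e'\<close>. On the complement of \<open>y\<close> its kernel is the line of \<open>y\<close>, so it trivializes the fibre of \<open>\<E>\<close>.\<close>

definition Ptriv :: "real ^ 'm => real ^ 'm => complex ^ 'm => complex ^ 'm ^ 'm" where
 "Ptriv e e' y = (\<chi> i j. (let v = axis j 1; x = v - (cform Q v (cvec e) / cform Q y (cvec e)) *s y
  in (x - cform Q x (cvec e') *s cvec e) $ i))"

text \<open>The section of \<open>Ptriv\<close> with values in the complement of \<open>y\<close>, equal to \<open>cusp_triv\<close> if \<open>(e, y) = 1\<close>.\<close>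

definition Rtriv :: "real ^ 'm => complex ^ 'm => complex ^ 'm ^ 'm" where
 "Rtriv e y = (\<chi> i j. (axis j 1 - (cform Q (axis j 1) y / cform Q y (cvec e)) *s cvec e) $ i)"

lemma matrix_of_linear:
 fixes f :: "complex ^ 'm => complex ^ 'm"
 assumes "!!v w. f (v + w) = f v + f w" "!!c v. f (c *s v) = c *s f v"
 shows "(\<chi> i j. f (axis j 1) $ i) *v v = f v" "matrix f *v v = f v"
proof -
 have "Vector_Spaces.linear (*s) (*s) f" by unfold_locales (use assms in auto)
 from matrix_works[OF this] show "matrix f *v v = f v" .
 then show "(\<chi> i j. f (axis j 1) $ i) *v v = f v" by (simp add: matrix_def)
qed

lemma Ptriv_apply:
 "Ptriv e e' y *v v = (let x = v - (cform Q v (cvec e) / cform Q y (cvec e)) *s y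
  in x - cform Q x (cvec e') *s cvec e)" unfolding Ptriv_def Let_def
 by (rule matrix_of_linear(1)) (simp_all add: cform_simps vec_eq_iff algebra_simps add_divide_distrib diff_divide_distrib)

lemma Rtriv_apply: "Rtriv e y *v v = v - (cform Q v y / cform Q y (cvec e)) *s cvec e" unfolding Rtriv_def
 by (rule matrix_of_linear(1)) (simp_all add: cform_simps vec_eq_iff algebra_simps add_divide_distrib)

lemma cusp_triv_apply: "cusp_triv Q e y *v v = v - cform Q v y *s cvec e" unfolding cusp_triv_def
 by (rule matrix_of_linear(2)) (simp_all add: cform_simps vec_eq_iff algebra_simps)

lemma Ptriv_smult: "c ~= 0 ==> Ptriv e e' (c *s y) = Ptriv e e' y" by (simp add: Ptriv_def vec_eq_iff Let_def cform_simps)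

lemma Rtriv_smult: "c ~= 0 ==> Rtriv e (c *s y) = Rtriv e y" by (simp add: Rtriv_def vec_eq_iff cform_simps)

text \<open>The space \<open>V(I)\<close> for the isotropic line spanned by \<open>e\<close>.\<close>

definition Uc :: "real ^ 'm => real ^ 'm => (complex ^ 'm) set" where
 "Uc e e' = {v. cform Q v (cvec e) = 0 & cform Q v (cvec e') = 0}"

context
 fixes e e' y
 assumes h: "hyp e e'" and y: "cform Q y y = 0" "cform Q y (cvec e) ~= 0"
begin

lemma Ptriv_Uc: "Ptriv e e' y *v v : Uc e e'" using hypD[OF h] y
 by (simp add: Ptriv_apply Let_def Uc_def cform_simps cform_cvec)

lemma Ptriv_isometry:
 assumes "cform Q v y = 0" "cform Q w y = 0" shows "cform Q (Ptriv e e' y *v v) (Ptriv e e' y *v w) = cform Q v w"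
proof -
 define x where "x = (%v. v - (cform Q v (cvec e) / cform Q y (cvec e)) *s y)"
 have xe: "cform Q (x v) (cvec e) = 0" "cform Q (cvec e) (x v) = 0" for v
  using y cform_sym[of "cvec e" "x v"] by (simp_all add: x_def cform_simps)
 have P: "Ptriv e e' y *v v = x v - cform Q (x v) (cvec e') *s cvec e" for v by (simp only: Ptriv_apply Let_def x_def)
 have "cform Q (Ptriv e e' y *v v) (Ptriv e e' y *v w) = cform Q (x v) (x w)"
  using hypD[OF h] unfolding P by (simp add: cform_simps cform_cvec xe)
 also have "... = cform Q v w" using assms y(1) cform_sym[of y w] by (simp add: x_def cform_simps)
 finally show ?thesis .
qed

lemma Ptriv_cline: "v : cline y ==> Ptriv e e' y *v v = 0" using y by (auto simp: cline_def Ptriv_apply Let_def cform_simps)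

lemma Ptriv_kernel:
 assumes "cform Q v y = 0" "Ptriv e e' y *v v = 0" shows "v : cline y"
proof -
 define x where "x = v - (cform Q v (cvec e) / cform Q y (cvec e)) *s y"
 have x: "x = cform Q x (cvec e') *s cvec e" using assms(2) by (simp only: Ptriv_apply Let_def x_def[symmetric]) simp
 have "cform Q x y = 0" using assms(1) y(1) by (simp add: x_def cform_simps)
 then have "cform Q x (cvec e') * cform Q (cvec e) y = 0" by (subst (asm) x) (simp add: cform_simps)
 then have "cform Q x (cvec e') = 0" using y(2) cform_sym[of "cvec e" y] by simp
 then have "x = 0" using x by simp
 then show ?thesis by (auto simp: x_def cline_def)
qed

lemma Rtriv_perp: "cform Q (Rtriv e y *v v) y = 0" using y cform_sym[of "cvec e" y] by (simp add: Rtriv_apply cform_simps)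

lemma Rtriv_isometry:
 assumes "v : Uc e e'" "w : Uc e e'" shows "cform Q (Rtriv e y *v v) (Rtriv e y *v w) = cform Q v w"
 using assms hypD[OF h] cform_sym[of "cvec e" w] by (simp add: Rtriv_apply Uc_def cform_simps cform_cvec)

lemma Ptriv_Rtriv:
 assumes "v : Uc e e'" shows "Ptriv e e' y *v (Rtriv e y *v v) = v"
 using assms hypD[OF h] by (simp add: Ptriv_apply Rtriv_apply Let_def Uc_def cform_simps cform_cvec)

lemma Rtriv_Ptriv:
 assumes "cform Q v y = 0" shows "Rtriv e y *v (Ptriv e e' y *v v) - v : cline y"
proof (rule Ptriv_kernel)
 show "cform Q (Rtriv e y *v (Ptriv e e' y *v v) - v) y = 0" using assms Rtriv_perp by (simp add: cform_simps)
 show "Ptriv e e' y *v (Rtriv e y *v (Ptriv e e' y *v v) - v) = 0"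
  by (simp add: matrix_vector_mult_diff_distrib Ptriv_Rtriv[OF Ptriv_Uc])
qed

end

lemma Ptriv_cspace:
 assumes "y : cspace L" "e : span L" "v : cspace L" shows "Ptriv e e' y *v v : cspace L"
 unfolding Ptriv_apply Let_def using assms
 by (intro vec.subspace_diff[OF cspace_subspace] vec.subspace_scale[OF cspace_subspace]) (auto simp: cvec_cspace)

lemma Rtriv_cspace:
 assumes "e : span L" "v : cspace L" shows "Rtriv e y *v v : cspace L" unfolding Rtriv_apply using assms
 by (intro vec.subspace_diff[OF cspace_subspace] vec.subspace_scale[OF cspace_subspace]) (auto simp: cvec_cspace)

lemma Ptriv_fix:
 assumes "cform Q v (cvec e) = 0" "cform Q v (cvec e') = 0" shows "Ptriv e e' y *v v = v" using assms by (simp add: Ptriv_apply)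

lemma Rtriv_fix: "cform Q v y = 0 ==> Rtriv e y *v v = v" by (simp add: Rtriv_apply)

lemma U_cplx_eq: "U_cplx Q L e e' = cspace L Int Uc e e'" by (auto simp: U_cplx_def Uc_def)

text \<open>The null tensors at \<open>y\<close> form the kernel of the trivialization, so that congruences may be
  tested after the trivialization.\<close>

lemma hodge_null_iff:
 assumes h: "hyp e e'" "e : span L" and y: "y : cspace L" "cform Q y y = 0" "cform Q y (cvec e) ~= 0"
  and T: "T : tpow d (cperp Q L y)" shows "T : hodge_null Q L d y \<longleftrightarrow> tmap (Ptriv e e' y) T = 0"
  and "tmap (Rtriv e y) (tmap (Ptriv e e' y) T) - T : hodge_null Q L d y"
proof -
 have cl: "cline y <= cperp Q L y"
  using y by (auto simp: cline_def cperp_def cform_simps vec.subspace_scale[OF cspace_subspace])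
 have "tmap (Rtriv e y ** Ptriv e e' y) T - tmap (mat 1) T : hodge_null Q L d y" unfolding hodge_null_def
 proof (rule tmap_diff_tnull[OF T])
  fix v assume v: "v : cperp Q L y"
  then show "Rtriv e y ** Ptriv e e' y *v v : cperp Q L y" using Rtriv_perp[OF h(1) y(2,3)]
  by (auto simp: matrix_vector_mul_assoc[symmetric] cperp_def intro!: Rtriv_cspace Ptriv_cspace h y)
  show "Rtriv e y ** Ptriv e e' y *v v - mat 1 *v v : cline y"
  using Rtriv_Ptriv[OF h(1) y(2,3)] v by (simp add: matrix_vector_mul_assoc[symmetric] cperp_def)
 qed (use cl in auto)
 moreover have "tmap (mat 1) T = T" by (rule tmap_id[OF T]) simp
 ultimately show *: "tmap (Rtriv e y) (tmap (Ptriv e e' y) T) - T : hodge_null Q L d y" by (simp only: tmap_compose)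
 show "T : hodge_null Q L d y \<longleftrightarrow> tmap (Ptriv e e' y) T = 0"
 proof
  show "T : hodge_null Q L d y ==> tmap (Ptriv e e' y) T = 0"
  unfolding hodge_null_def by (erule tmap_tnull_zero) (rule Ptriv_cline[OF h(1) y(2,3)])
  assume 0: "tmap (Ptriv e e' y) T = 0"
  have "tscale (-1) (tmap (Rtriv e y) (tmap (Ptriv e e' y) T) - T) : hodge_null Q L d y"
  using * unfolding hodge_null_def by (rule tensor.subspace_scale[OF tnull_subspace])
  moreover have "tscale (-1) (tmap (Rtriv e y) (tmap (Ptriv e e' y) T) - T) = T"
  unfolding 0 by (simp only: tmap_0) (simp add: fun_eq_iff)
  ultimately show "T : hodge_null Q L d y" by (simp only:)
 qed
qed

lemma hodge_fibre_tpow: "hodge_fibre Q L la y <= tpow (sum_list la) (cperp Q L y)"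
 unfolding hodge_fibre_def by (rule schur_tpow)

lemma tmap_Ptriv_fibre:
 assumes h: "hyp e e'" "e : span L" and y: "y : cspace L" "cform Q y y = 0" "cform Q y (cvec e) ~= 0"
  and T: "T : hodge_fibre Q L la y" shows "tmap (Ptriv e e' y) T : schur Q la (U_cplx Q L e e') {0}"
 using T unfolding hodge_fibre_def U_cplx_eq by (rule tmap_schur)
  (auto simp: cperp_def Ptriv_cline[OF h(1) y(2,3)] intro!: Ptriv_cspace h y Ptriv_Uc Ptriv_isometry[OF h(1) y(2,3)])

lemma tmap_Rtriv_fibre:
 assumes h: "hyp e e'" "e : span L" and y: "y : cspace L" "cform Q y y = 0" "cform Q y (cvec e) ~= 0"
  and T: "T : schur Q la (U_cplx Q L e e') {0}" shows "tmap (Rtriv e y) T : hodge_fibre Q L la y"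
 using T unfolding hodge_fibre_def U_cplx_eq
proof (rule tmap_schur)
 show "Rtriv e y *v v : cline y" if "v : {0}" for v using that by (auto simp: cline_def intro!: exI[of _ 0])
qed (use Rtriv_perp[OF h(1) y(2,3)] Rtriv_isometry[OF h(1) y(2,3)] h(2) in "auto simp: cperp_def intro!: Rtriv_cspace")

lemma holomorphic_cform:
 assumes "!!i. holomorphic_cvec U (%y. f y $ i)" "!!i. holomorphic_cvec U (%y. g y $ i)"
 shows "holomorphic_cvec U (%y. cform Q (f y) (g y))" unfolding cform_def
 by (intro hol_cvec_sum hol_cvec_mult hol_cvec_const assms)

lemma holomorphic_Ptriv:
 assumes "!!y. y : U ==> cform Q y (cvec e) ~= 0" shows "holomorphic_cvec U (%y. Ptriv e e' y $ i $ j)"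
 unfolding Ptriv_def Let_def vec_lambda_beta vector_minus_component vector_smult_component
 by (intro hol_cvec_diff hol_cvec_mult hol_cvec_divide holomorphic_cform
  hol_cvec_const hol_cvec_coord assms; simp only: vector_minus_component vector_smult_component)
  (intro hol_cvec_diff hol_cvec_mult hol_cvec_divide holomorphic_cform
  hol_cvec_const hol_cvec_coord assms)

lemma holomorphic_Rtriv:
 assumes "!!y. y : U ==> cform Q y (cvec e) ~= 0" shows "holomorphic_cvec U (%y. Rtriv e y $ i $ j)"
 unfolding Rtriv_def vec_lambda_beta vector_minus_component vector_smult_component
 by (intro hol_cvec_diff hol_cvec_mult hol_cvec_divide holomorphic_cform
  hol_cvec_const hol_cvec_coord assms)

end

lemma holomorphic_tmap:
 assumes "!!i j. holomorphic_cvec U (%y. M y $ i $ j)" "!!idx. holomorphic_cvec U (%y. F y idx)"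
 shows "holomorphic_cvec U (%y. tmap (M y) (F y) idx)" unfolding tmap_def
 by (intro hol_cvec_sum hol_cvec_mult hol_cvec_prod assms)

section \<open>A sublattice and its orthogonal complement\<close>

definition isometric :: "real ^ 'm ^ 'm => real ^ 'm ^ 'm => bool" where
 "isometric Q g \<longleftrightarrow> (ALL x y. rform Q (g *v x) (g *v y) = rform Q x y)"

lemma cmat_decomp: "cmat g *v v = cvec (g *v Revec v) + \<i> *s cvec (g *v Imvec v)"
 by (subst Re_Im_decomp[of v]) (simp add: matrix_vector_right_distrib matrix_cvec vector_scalar_commute)

lemma Revec_cmat: "Revec (cmat g *v v) = g *v Revec v" and Imvec_cmat: "Imvec (cmat g *v v) = g *v Imvec v"
 by (simp_all add: cmat_decomp)

lemma (in period_space) isometric_cform: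
 assumes "isometric Q g" shows "cform Q (cmat g *v v) (cmat g *v w) = cform Q v w"
 using assms by (simp add: cform_Re_Im[of _ w] cform_Re_Im[of _ "cmat g *v w"] Revec_cmat Imvec_cmat isometric_def)

locale sublattice_pair = period_space Q for Q :: "real ^ 'm ^ 'm" +
 fixes L L' K :: "(real ^ 'm) set" and D D' :: "(complex ^ 'm) set"
 assumes lattice: "is_lattice Q L" "span L = UNIV" and lattice': "is_lattice Q L'" "L' <= L"
  and K: "K = orth_lattice Q L L'"
  and two_positive: "EX p:span L'. EX q:span L'. rform Q p p > 0 & rform Q q q > 0 & rform Q p q = 0"
  and D: "D : components (period_cone Q L)" and D': "D' = D Int cspace L'"
begin

lemma L'_K_orth: "x : span L' ==> k : span K ==> rform Q x k = 0"
proof (rule rform_span_0[of L' K])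
 show "rform Q x y = 0" if "x : L'" "y : K" for x y using that rform_sym[of x y] by (simp add: K orth_lattice_def)
qed

lemma L'_K_orth_cplx: "v : cspace L' ==> u : cspace K ==> cform Q v u = 0"
proof (rule cform_span_0[of L' K])
 show "rform Q x y = 0" if "x : L'" "y : K" for x y using that rform_sym[of x y] by (simp add: K orth_lattice_def)
qed

lemma rat_space_mono: "rat_space L' <= rat_space L" using lattice'(2) by (auto simp: rat_space_def)

lemma orthogonal_in_K:
 assumes x: "x : rat_space L" "!!y. y : L' ==> rform Q x y = 0" shows "x : span K"
proof -
 obtain N :: nat where N: "N > 0" "real N *\<^sub>R x : L" using x(1) unfolding rat_space_def by blast
 then have "real N *\<^sub>R x : K" using x(2) by (simp add: K orth_lattice_def rform_simps)
 then have "inverse (real N) *\<^sub>R (real N *\<^sub>R x) : span K" by (intro span_scale span_base)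
 then show ?thesis using N by simp
qed

lemma adapted_basis:
 assumes B0: "orth_set B0" "B0 <= rat_space L'"
 shows "EX B' BK. orth_set (B' Un BK) & B0 <= B' & B' <= rat_space L' & span B' = span L' &
  BK <= rat_space L & BK <= span K & span (B' Un BK) = UNIV & B' Int BK = {}"
proof -
 obtain B' where B': "orth_set B'" "B0 <= B'" "B' <= rat_space L'" "span B' = span L'"
  using rational_orth_basis[OF lattice'(1) B0] by blast
 obtain B where B: "orth_set B" "B' <= B" "B <= rat_space L" "span B = span L"
  using rational_orth_basis[OF lattice(1) B'(1)] B'(3) rat_space_mono by blast
 have "b : span K" if b: "b : B - B'" for b
 proof (rule orthogonal_in_K)
  show "b : rat_space L" using b B by blast
  fix y assume "y : L'"
  then have "y : span B'" using B'(4) by (simp add: span_base)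
  moreover have "rform Q b b' = 0" if "b' : B'" for b'
  proof -
  have "b : B" "b' : B" "b ~= b'" using that b B(2) by auto
  then show ?thesis using B(1) by (simp add: orth_set_def)
  qed
  ultimately show "rform Q b y = 0" by (intro rform_span_0[of "{b}" B' Q b y]) (simp_all add: span_base)
 qed
 moreover have "B' Un (B - B') = B" using B(2) by blast
 ultimately show ?thesis using B B' lattice(2) by (intro exI[of _ B'] exI[of _ "B - B'"]) auto
qed

lemma decomposition: "EX x':span L'. EX k:span K. x = x' + k"
proof -
 have "orth_set {}" by (simp add: orth_set_def)
 from adapted_basis[OF this] obtain B' BK
  where B: "span B' = span L'" "BK <= span K" "span (B' Un BK) = UNIV" by blast
 have "x : span (B' Un BK)" using B by simp
 then obtain a b where "x = a + b" "a : span B'" "b : span BK" unfolding span_Un by blast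
 moreover have "span BK <= span K" by (rule span_minimal[OF B(2) subspace_span])
 ultimately show ?thesis using B(1) by blast
qed

lemma span_L'_iff: "x : span L' \<longleftrightarrow> (ALL k:span K. rform Q x k = 0)"
proof
 assume x: "ALL k:span K. rform Q x k = 0"
 obtain x' k where d: "x' : span L'" "k : span K" "x = x' + k" using decomposition by blast
 have "rform Q k y = 0" for y
 proof -
  obtain y' l where e: "y' : span L'" "l : span K" "y = y' + l" using decomposition by blast
  have "rform Q x l = 0" using x e(2) by blast
  then have "rform Q k l = 0" using L'_K_orth[OF d(1) e(2)] by (simp add: d(3) rform_simps)
  then show ?thesis using L'_K_orth[OF e(1) d(2)] rform_sym[of k y'] by (simp add: e(3) rform_simps)
 qed
 then have "k = 0" by (rule nondegenerate)
 then show "x : span L'" using d by simp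
qed (use L'_K_orth in blast)

lemma span_K_iff: "x : span K \<longleftrightarrow> (ALL y:span L'. rform Q y x = 0)"
proof
 assume x: "ALL y:span L'. rform Q y x = 0"
 obtain x' k where d: "x' : span L'" "k : span K" "x = x' + k" using decomposition by blast
 have "rform Q x' y = 0" if "y : L'" for y
 proof -
  have "rform Q y x = 0" "rform Q y k = 0" using x that L'_K_orth[OF _ d(2), of y] by (simp_all add: span_base)
  then show ?thesis using rform_sym[of x' y] by (simp add: d(3) rform_simps)
 qed
 then have "x' = 0" by (rule lattice_nondegenerate[OF lattice'(1) d(1)])
 then show "x : span K" using d by simp
qed (use L'_K_orth in blast)

lemma decomposition_cplx: "EX v':cspace L'. EX u:cspace K. v = v' + u"
proof -
 obtain a k where 1: "a : span L'" "k : span K" "Revec v = a + k" using decomposition by blast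
 obtain b l where 2: "b : span L'" "l : span K" "Imvec v = b + l" using decomposition by blast
 have "v = (cvec a + \<i> *s cvec b) + (cvec k + \<i> *s cvec l)"
  by (subst Re_Im_decomp[of v]) (simp add: 1 2 cvec_add vector_add_ldistrib)
 then show ?thesis using 1 2 by (intro bexI) (auto simp: cspace_iff)
qed

lemma K_negative:
 assumes "k : span K" "k ~= 0" shows "rform Q k k < 0"
proof -
 obtain p q where "p : span L'" "q : span L'" "rform Q p p > 0" "rform Q q q > 0" "rform Q p q = 0" using two_positive by blast
 then show ?thesis using negative_orthogonal[of p q k] L'_K_orth[of p k] L'_K_orth[of q k]
  rform_sym[of k p] rform_sym[of k q] assms by auto
qed

lemma K_nondegenerate:
 assumes "u : cspace K" "!!w. w : cspace K ==> cform Q u w = 0" shows "u = 0"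
proof -
 have "rform Q (Revec u) (Revec u) = 0" "rform Q (Imvec u) (Imvec u) = 0"
  using assms(1) assms(2)[of "cvec (Revec u)"] assms(2)[of "cvec (Imvec u)"]
  by (auto simp: cspace_iff Revec_cvec Imvec_cvec cform_Re_Im[of _ "cvec _"] rform_simps complex_eq_iff span_zero)
 moreover have "Revec u : span K" "Imvec u : span K" using assms(1) by (simp_all add: cspace_iff)
 ultimately have "Revec u = 0" "Imvec u = 0" using K_negative[of "Revec u"] K_negative[of "Imvec u"] by fastforce+
 then show ?thesis by (subst Re_Im_decomp[of u]) (simp add: cvec_0)
qed

lemma cspace_L [simp]: "cspace L = UNIV" by (rule cspace_UNIV[OF lattice(2)])

lemma span_L [simp]: "x : span L" by (simp add: lattice(2))

lemma D_isotropic: "om : D ==> cform Q om om = 0" using in_components_subset[OF D] by (auto simp: period_cone_def)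

lemma D_period_cone: "om : D ==> om : period_cone Q L" using in_components_subset[OF D] by auto

lemma D_nz:
 assumes "om : D" "hyp e e'" shows "cform Q om (cvec e) ~= 0"
 using period_isotropic[OF D_period_cone[OF assms(1)]] hypD[OF assms(2)] by blast

lemma D_smult:
 assumes om: "om : D" and c: "c ~= 0" shows "c *s om : D"
proof -
 have cnj: "cnjvec (d *s om) = cnj d *s cnjvec om" for d by (simp add: vec_eq_iff cnjvec_def)
 have Re: "Re (cform Q (d *s om) (cnjvec (d *s om))) = (norm d)^2 * Re (cform Q om (cnjvec om))" for d
 proof -
  have "cform Q (d *s om) (cnjvec (d *s om)) = (d * cnj d) * cform Q om (cnjvec om)" by (simp add: cnj cform_simps mult_ac)
  then show ?thesis by (simp add: complex_norm_square[symmetric])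
 qed
 have "connected ((%d. d *s om) ` (- {0 :: complex}))"
  by (intro connected_continuous_image continuous_intros connected_punctured_universe) simp
 moreover have "(%d. d *s om) ` (- {0}) <= period_cone Q L"
 proof -
  have "cform Q (d *s om) (d *s om) = 0" for d using D_isotropic[OF om] by (simp add: cform_simps)
  then show ?thesis using D_period_cone[OF om] by (auto simp: period_cone_def Re)
 qed
 moreover have "om : (%d. d *s om) ` (- {0})" by (rule image_eqI[of _ _ 1]) auto
 ultimately have "(%d. d *s om) ` (- {0}) <= D" using components_maximal[OF D] om by blast
 then show ?thesis using c by blast
qed

section \<open>Curves normal to the smaller domain\<close>

text \<open>The quadratic term keeps the curve on the quadric of isotropic vectors.\<close>

definition ncurve :: "real ^ 'm => complex ^ 'm => complex ^ 'm => complex => complex ^ 'm" where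
 "ncurve e om u t = om + t *s u - (t^2 * cform Q u u / (2 * cform Q om (cvec e))) *s cvec e"

lemma ncurve_0 [simp]: "ncurve e om u 0 = om" by (simp add: ncurve_def)

lemma continuous_on_ncurve [continuous_intros]:
 "continuous_on S g ==> continuous_on S (%t. ncurve e om u (g t))"
 unfolding ncurve_def divide_inverse by (intro continuous_intros)

context
 fixes e e' om u
 assumes h: "hyp e e'" "e : span L'" and om: "om : D'" and u: "u : cspace K"
begin

lemma ncurve_facts:
 "cform Q (ncurve e om u t) (ncurve e om u t) = 0" "cform Q (ncurve e om u t) (cvec e) = cform Q om (cvec e)"
proof -
 have ue: "cform Q (cvec e) u = 0" "cform Q u (cvec e) = 0"
  using L'_K_orth_cplx[of "cvec e" u] cform_sym[of u "cvec e"] h u by (auto simp: cvec_cspace)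
 have uw: "cform Q om u = 0" "cform Q u om = 0"
  using L'_K_orth_cplx[of om u] cform_sym[of u om] om u by (auto simp: D')
 have ee: "cform Q (cvec e) (cvec e) = 0" using hypD[OF h(1)] by (simp add: cform_cvec)
 have we: "cform Q om (cvec e) ~= 0" "cform Q om om = 0" using D_nz[OF _ h(1)] D_isotropic om by (auto simp: D')
 show "cform Q (ncurve e om u t) (cvec e) = cform Q om (cvec e)" by (simp add: ncurve_def cform_simps ue ee)
 show "cform Q (ncurve e om u t) (ncurve e om u t) = 0" using we cform_sym[of "cvec e" om]
  by (simp add: ncurve_def cform_simps ue ee uw power2_eq_square)
qed

lemma ncurve_in_D: "\<forall>\<^sub>F t in nhds 0. ncurve e om u t : D"
proof -
 let ?g = "%t. Re (cform Q (ncurve e om u t) (cnjvec (ncurve e om u t)))"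
 have "open {t. ?g t > 0}" by (intro open_Collect_less continuous_intros)
 moreover have "0 : {t. ?g t > 0}" using om D_period_cone by (auto simp: D' period_cone_def)
 ultimately obtain r where r: "r > 0" "ball 0 r <= {t. ?g t > 0}" using open_contains_ball by blast
 have "ncurve e om u ` ball 0 r <= D"
 proof (rule components_maximal[OF D])
  show "connected (ncurve e om u ` ball 0 r)" by (intro connected_continuous_image continuous_intros) auto
  show "ncurve e om u ` ball 0 r <= period_cone Q L" using r(2) ncurve_facts(1) by (auto simp: period_cone_def)
  show "D Int ncurve e om u ` ball 0 r ~= {}" using om r(1) by (auto simp: D' intro!: exI[of _ om] image_eqI[of _ _ 0])
 qed
 moreover have "\<forall>\<^sub>F t in nhds 0. (t::complex) : ball 0 r" by (rule eventually_nhds_in_open) (use r in auto)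
 ultimately show ?thesis by (auto elim!: eventually_mono)
qed

lemma ncurve_tendsto: "(ncurve e om u \<longlongrightarrow> om) (nhds 0)"
proof -
 have "isCont (ncurve e om u) 0" using continuous_on_ncurve[of UNIV "%t. t"] by (simp add: continuous_on_eq_continuous_at)
 then show ?thesis using tendsto_at_iff_tendsto_nhds[of "ncurve e om u" 0] by (simp add: isCont_def)
qed

lemma ncurve_in_open: "open U ==> om : U ==> \<forall>\<^sub>F t in nhds 0. ncurve e om u t : U"
 using topological_tendstoD[OF ncurve_tendsto] by blast

lemma ncurve_in_subcone:
 assumes "open_subcone D S" "om : S" shows "\<forall>\<^sub>F t in nhds 0. ncurve e om u t : S"
proof -
 obtain T where T: "open T" "S = D Int T" using assms(1) by (auto simp: open_subcone_def openin_open)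
 show ?thesis using ncurve_in_open[OF T(1)] ncurve_in_D assms(2) T(2) by (auto elim: eventually_elim2)
qed

text \<open>Only the first order of the curve matters: along it a function in the ideal of the smaller domain
  vanishes, and its derivative is its differential in the direction \<open>u\<close>.\<close>

lemma ideal_section_limit:
 assumes S: "open_subcone D S" "om : S" and g: "g : ideal_sections L' S" and H: "extends_at S g om H"
 shows "((%t. g (ncurve e om u t) / t) \<longlongrightarrow> frechet_derivative H (at om) u) (at 0)"
proof -
 obtain U where U: "open U" "om : U" "holomorphic_cvec U H" "!!y. y : U Int S ==> H y = g y"
  using H unfolding extends_at_def by blast
 have "((%t. H (ncurve e om u t)) has_field_derivative frechet_derivative H (at (ncurve e om u 0)) u) (at 0)"
 proof (rule has_field_derivative_along_curve[OF U(3)])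
  show "ncurve e om u 0 : U" using U(2) by simp
  fix i
  define c where "c = cform Q u u / (2 * cform Q om (cvec e))"
  have "(%t. ncurve e om u t $ i) = (%t. om $ i + t * u $ i - t^2 * (c * cvec e $ i))"
  by (simp add: ncurve_def c_def fun_eq_iff)
  moreover have "((%t. om $ i + t * u $ i - t^2 * (c * cvec e $ i)) has_field_derivative
  0 + 1 * u $ i - 2 * 0 * (c * cvec e $ i)) (at 0)" by (rule derivative_eq_intros refl | simp)+
  ultimately show "((%t. ncurve e om u t $ i) has_field_derivative u $ i) (at 0)" by simp
 qed
 moreover have "H om = 0" using U(4) U(2) S(2) g om by (auto simp: ideal_sections_def D')
 ultimately have "((%t. H (ncurve e om u t) / t) \<longlongrightarrow> frechet_derivative H (at om) u) (at 0)"
  by (simp add: DERIV_def)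
 moreover have "\<forall>\<^sub>F t in at 0. H (ncurve e om u t) / t = g (ncurve e om u t) / t"
 proof -
  have "\<forall>\<^sub>F t in nhds 0. H (ncurve e om u t) / t = g (ncurve e om u t) / t"
  using ncurve_in_subcone[OF S] ncurve_in_open[OF U(1,2)] by eventually_elim (use U(4) in auto)
  then show ?thesis by (simp add: eventually_nhds_conv_at)
 qed
 ultimately show ?thesis by (rule Lim_transform_eventually)
qed

lemma differential_eq:
 assumes S: "open_subcone D S" "om : S" and g: "g : ideal_sections L' S" and H: "extends_at S g om H"
 shows "differential S g om u = frechet_derivative H (at om) u"
proof -
 have "extends_at S g om (SOME H. extends_at S g om H)" using H by (rule someI[where P = "extends_at S g om"])
 from ideal_section_limit[OF S g this] ideal_section_limit[OF S g H]
 show ?thesis unfolding differential_def by (intro tendsto_unique[OF trivial_limit_at]) 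
qed

end

end

section \<open>The quasi-pullback as a normal derivative\<close>

lemma Ptriv_equivariant:
 assumes "period_space Q" "isometric Q g"
 shows "period_space.Ptriv Q (g *v e) (g *v e') (cmat g *v y) ** cmat g = cmat g ** period_space.Ptriv Q e e' y"
proof -
 interpret period_space Q by fact
 have "Ptriv (g *v e) (g *v e') (cmat g *v y) *v (cmat g *v v) = cmat g *v (Ptriv e e' y *v v)" for v
 proof -
  have lin: "cmat g *v (a - b *s c) = cmat g *v a - b *s (cmat g *v c)" for a b c
  by (simp add: matrix_vector_mult_diff_distrib vector_scalar_commute)
  show ?thesis unfolding Ptriv_apply Let_def matrix_cvec[symmetric] lin
  by (simp only: isometric_cform[OF assms(2)] lin[symmetric])
 qed
 then show ?thesis by (simp add: matrix_eq matrix_vector_mul_assoc[symmetric])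
qed

locale qp_data = sublattice_pair Q L L' K D D'
 for Q :: "real ^ 'm ^ 'm" and L L' K :: "(real ^ 'm) set" and D D' :: "(complex ^ 'm) set" +
 fixes f :: "complex ^ 'm => 'm tensor" and la :: "nat list" and k :: int and \<nu> :: nat
  and e e' :: "real ^ 'm"
 assumes f: "f : hodge_sections Q L D la k" and ideal: "in_ideal_power Q L L' D la k \<nu> f"
  and h: "hyp e e'" "e : span L'" "e' : span L'"
begin

abbreviation "deg \<equiv> sum_list la"
abbreviation "qp \<equiv> quasi_pullback Q L L' D la k \<nu> f"
abbreviation "P \<equiv> Ptriv e e'"

lemma null_vanish:
 assumes "y : D" "hyp a a'" "T : hodge_null Q L deg y" shows "tmap (Ptriv a a' y) T = 0" using assms(3) unfolding hodge_null_def
 by (rule tmap_tnull_zero) (rule Ptriv_cline[OF assms(2) D_isotropic[OF assms(1)] D_nz[OF assms(1,2)]])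

lemma null_vanish_diff:
 assumes "y : D" "hyp a a'" "S - T : hodge_null Q L deg y" shows "tmap (Ptriv a a' y) S = tmap (Ptriv a a' y) T"
 using null_vanish[OF assms] unfolding tmap_diff by (simp only: right_minus_eq)

lemma null_diff_iff:
 assumes y: "y : D" and a: "hyp a a'" and S: "S : tpow deg (cperp Q L y)" and T: "T : tpow deg (cperp Q L y)"
 shows "S - T : hodge_null Q L deg y \<longleftrightarrow> tmap (Ptriv a a' y) S = tmap (Ptriv a a' y) T"
proof -
 have "S - T : tpow deg (cperp Q L y)" using S T by (rule tensor.subspace_diff[OF tpow_subspace])
 from hodge_null_iff(1)[OF a _ _ D_isotropic[OF y] D_nz[OF y a] this]
 show ?thesis unfolding tmap_diff by (simp only: right_minus_eq span_L cspace_L UNIV_I)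
qed

lemma tmap_combination:
 "tmap M (\<Sum>j<N. tscale (c j) (T j)) idx = (\<Sum>j<N. c j * tmap M (T j) idx)"
 by (simp only: tmap_sum tmap_scale sum_tensor_apply tscale_apply)

definition lifts_near where
 "lifts_near S s om U F \<longleftrightarrow> open U & om : U & (ALL idx. holomorphic_cvec U (%y. F y idx)) &
  (ALL y:U Int S. F y - s y : hodge_null Q L deg y)"

lemma expansion_lift:
 assumes E: "ideal_power_expansion Q L L' D la k \<nu> f om S N hh s" and j: "j < N" shows "EX U F. lifts_near S (s j) om U F"
proof -
 have "s j : hodge_sections Q L S la k" "om : S" using E j by (auto simp: ideal_power_expansion_def)
 then show ?thesis unfolding hodge_sections_def lifts_near_def by blast
qed

lemma expansion_lifts:
 assumes E: "ideal_power_expansion Q L L' D la k \<nu> f om S N hh s"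
 shows "EX U F. \<forall>j<N. lifts_near S (s j) om (U j) (F j)"
proof -
 define U where "U j = (SOME U. EX F. lifts_near S (s j) om U F)" for j
 define F where "F j = (SOME F. lifts_near S (s j) om (U j) F)" for j
 have "lifts_near S (s j) om (U j) (F j)" if "j < N" for j
  using someI_ex[OF expansion_lift[OF E that]] unfolding U_def[symmetric] F_def by (rule someI_ex)
 then show ?thesis by blast
qed

lemma expansion_limit:
 assumes E: "ideal_power_expansion Q L L' D la k \<nu> f om S N hh s"
  and a: "hyp a a'" "a : span L'" and om: "om : D'" and u: "u : cspace K"
 shows "((%t. tmap (Ptriv a a' (ncurve a om u t)) (f (ncurve a om u t)) idx / t ^ \<nu>) \<longlongrightarrow>
  tmap (Ptriv a a' om) (\<Sum>j<N. tscale (\<Prod>i<\<nu>. differential S (hh j i) om u) (s j om)) idx) (at 0)"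
proof -
 let ?Y = "ncurve a om u"
 have S: "open_subcone D S" "om : S" and hh: "!!j i. j < N ==> i < \<nu> ==> hh j i : ideal_sections L' S"
  and ex: "!!y. y : S ==> f y - (\<Sum>j<N. tscale (\<Prod>i<\<nu>. hh j i y) (s j y)) : hodge_null Q L deg y"
  using E by (auto simp: ideal_power_expansion_def)
 have SD: "S <= D" using S(1) by (auto simp: open_subcone_def openin_open)
 obtain U F where "\<forall>j<N. lifts_near S (s j) om (U j) (F j)" using expansion_lifts[OF E] by blast
 then have UF: "open (U j) & om : U j & (ALL idx. holomorphic_cvec (U j) (%y. F j y idx)) &
  (ALL y:U j Int S. F j y - s j y : hodge_null Q L deg y)" if "j < N" for j
  using that unfolding lifts_near_def by simp
 let ?lim = "\<Sum>j<N. (\<Prod>i<\<nu>. differential S (hh j i) om u) * tmap (Ptriv a a' om) (F j om) idx"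
 have "((%t. \<Sum>j<N. (\<Prod>i<\<nu>. hh j i (?Y t) / t) * tmap (Ptriv a a' (?Y t)) (F j (?Y t)) idx) \<longlongrightarrow> ?lim) (at 0)"
 proof (intro tendsto_sum tendsto_mult tendsto_prod)
  fix j i assume j: "j : {..<N}"
  {
  assume i: "i : {..<\<nu>}"
  have "hh j i : ideal_sections L' S" using hh i j by auto
  moreover from this obtain H where "extends_at S (hh j i) om H" using S(2) unfolding ideal_sections_def by blast
  ultimately show "((%t. hh j i (?Y t) / t) \<longlongrightarrow> differential S (hh j i) om u) (at 0)"
  using ideal_section_limit[OF a om u S] differential_eq[OF a om u S] by metis
  }
  have "holomorphic_cvec (U j Int {y. cform Q y (cvec a) ~= 0}) (%y. tmap (Ptriv a a' y) (F j y) idx)"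
  using UF[of j] j by (intro holomorphic_tmap holomorphic_Ptriv) (auto intro: hol_cvec_subset)
  moreover have "om : U j Int {y. cform Q y (cvec a) ~= 0}" using UF[of j] j D_nz[OF _ a(1)] om by (auto simp: D')
  ultimately have "isCont (%y. tmap (Ptriv a a' y) (F j y) idx) om"
  using holomorphic_cvecD(1) has_derivative_continuous by blast
  moreover have "(?Y \<longlongrightarrow> om) (at 0)"
  using ncurve_tendsto[OF a om u] tendsto_mono[OF at_within_le_nhds] by blast
  ultimately show "((%t. tmap (Ptriv a a' (?Y t)) (F j (?Y t)) idx) \<longlongrightarrow> tmap (Ptriv a a' om) (F j om) idx) (at 0)"
  by (rule isCont_tendsto_compose)
 qed
 moreover have "\<forall>\<^sub>F t in at 0. (\<Sum>j<N. (\<Prod>i<\<nu>. hh j i (?Y t) / t) * tmap (Ptriv a a' (?Y t)) (F j (?Y t)) idx)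
  = tmap (Ptriv a a' (?Y t)) (f (?Y t)) idx / t ^ \<nu>"
 proof -
  have "\<forall>\<^sub>F t in nhds 0. ALL j:{..<N}. ?Y t : U j"
  by (rule eventually_ball_finite) (use UF ncurve_in_open[OF a om u] in auto)
  with ncurve_in_subcone[OF a om u S]
  have "\<forall>\<^sub>F t in nhds 0. (\<Sum>j<N. (\<Prod>i<\<nu>. hh j i (?Y t) / t) * tmap (Ptriv a a' (?Y t)) (F j (?Y t)) idx)
  = tmap (Ptriv a a' (?Y t)) (f (?Y t)) idx / t ^ \<nu>"
  proof eventually_elim
  case (elim t)
  have yD: "?Y t : D" using elim SD by blast
  have "tmap (Ptriv a a' (?Y t)) (F j (?Y t)) = tmap (Ptriv a a' (?Y t)) (s j (?Y t))" if "j < N" for j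
  using UF[OF that] elim that by (intro null_vanish_diff[OF yD a(1)]) auto
  moreover have "tmap (Ptriv a a' (?Y t)) (f (?Y t)) idx
  = (\<Sum>j<N. (\<Prod>i<\<nu>. hh j i (?Y t)) * tmap (Ptriv a a' (?Y t)) (s j (?Y t)) idx)"
  using null_vanish_diff[OF yD a(1) ex] elim by (simp only: tmap_combination)
  ultimately show ?case by (simp add: sum_divide_distrib prod_dividef)
  qed
  then show ?thesis by (simp add: eventually_nhds_conv_at)
 qed
 ultimately have "((%t. tmap (Ptriv a a' (?Y t)) (f (?Y t)) idx / t ^ \<nu>) \<longlongrightarrow> ?lim) (at 0)"
  by (rule Lim_transform_eventually)
 moreover have "tmap (Ptriv a a' om) (F j om) = tmap (Ptriv a a' om) (s j om)" if "j < N" for j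
  using UF[OF that] S om by (intro null_vanish_diff[OF _ a(1)]) (auto simp: D')
 then have "?lim = tmap (Ptriv a a' om) (\<Sum>j<N. tscale (\<Prod>i<\<nu>. differential S (hh j i) om u) (s j om)) idx"
  by (simp only: tmap_combination) (auto intro: sum.cong)
 ultimately show ?thesis by (simp only:)
qed

lemma qp_expansion:
 assumes "om : D"
 obtains S N hh s where "ideal_power_expansion Q L L' D la k \<nu> f om S N hh s"
  "qp om = (%u. \<Sum>j<N. tscale (\<Prod>i<\<nu>. differential S (hh j i) om u) (s j om))"
proof -
 let ?A = "%p. EX S N hh s. ideal_power_expansion Q L L' D la k \<nu> f om S N hh s &
  p = (%u. \<Sum>j<N. tscale (\<Prod>i<\<nu>. differential S (hh j i) om u) (s j om))"
 have "EX p. ?A p" using ideal assms unfolding in_ideal_power_def by blast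
 then have "?A (SOME p. ?A p)" by (rule someI_ex)
 then show ?thesis using that unfolding quasi_pullback_def by blast
qed

text \<open>This characterizes the quasi-pullback without a choice of an expansion of \<open>f\<close>: all further properties
  follow from it by uniqueness of limits.\<close>

lemma qp_limit:
 assumes a: "hyp a a'" "a : span L'" and om: "om : D'" and u: "u : cspace K"
 shows "((%t. tmap (Ptriv a a' (ncurve a om u t)) (f (ncurve a om u t)) idx / t ^ \<nu>) \<longlongrightarrow>
  tmap (Ptriv a a' om) (qp om u) idx) (at 0)"
proof -
 have "om : D" using om by (simp add: D')
 then obtain S N hh s where "ideal_power_expansion Q L L' D la k \<nu> f om S N hh s"
  "qp om = (%u. \<Sum>j<N. tscale (\<Prod>i<\<nu>. differential S (hh j i) om u) (s j om))" by (rule qp_expansion)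
 then show ?thesis using expansion_limit[OF _ a om u] by simp
qed

lemma qp_fibre:
 assumes om: "om : D'" shows "qp om u : hodge_fibre Q L la om"
proof -
 have "om : D" using om by (simp add: D')
 then obtain S N hh s where E: "ideal_power_expansion Q L L' D la k \<nu> f om S N hh s"
  "qp om = (%u. \<Sum>j<N. tscale (\<Prod>i<\<nu>. differential S (hh j i) om u) (s j om))" by (rule qp_expansion)
 have "s j om : hodge_fibre Q L la om" if "j < N" for j
  using E(1) that by (auto simp: ideal_power_expansion_def hodge_sections_def)
 then show ?thesis unfolding E(2) hodge_fibre_def
  by (intro tensor.subspace_sum[OF schur_subspace] tensor.subspace_scale[OF schur_subspace]) auto
qed

lemma qp_tpow: "om : D' ==> qp om u : tpow deg (cperp Q L om)" using qp_fibre hodge_fibre_tpow by blast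

lemma qp_polynomial:
 assumes om: "om : D'"
 obtains N l T where "!!j. j < N ==> T j : hodge_fibre Q L la om"
  "!!j i v w. j < N ==> i < \<nu> ==> l j i (v + w) = l j i v + l j i w"
  "!!j i c v. j < N ==> i < \<nu> ==> l j i (c *s v) = c * l j i v"
  "qp om = (%u. \<Sum>j<(N::nat). tscale (\<Prod>i<\<nu>. l j i u) (T j))"
proof -
 have "om : D" using om by (simp add: D')
 then obtain S N hh s where E: "ideal_power_expansion Q L L' D la k \<nu> f om S N hh s"
  "qp om = (%u. \<Sum>j<N. tscale (\<Prod>i<\<nu>. differential S (hh j i) om u) (s j om))" by (rule qp_expansion)
 have lin: "differential S (hh j i) om (v + w) = differential S (hh j i) om v + differential S (hh j i) om w
  & differential S (hh j i) om (c *s v) = c * differential S (hh j i) om v"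
  if "j < N" "i < \<nu>" for j i v w c
 proof -
  have "hh j i : ideal_sections L' S" "om : S" using E(1) that by (auto simp: ideal_power_expansion_def)
  then obtain H where "extends_at S (hh j i) om H" unfolding ideal_sections_def by blast
  then have "extends_at S (hh j i) om (SOME H. extends_at S (hh j i) om H)"
  by (rule someI[where P = "extends_at S (hh j i) om"])
  then obtain U where U: "om : U" "holomorphic_cvec U (SOME H. extends_at S (hh j i) om H)" unfolding extends_at_def by blast
  show ?thesis unfolding differential_def
  using holomorphic_cvecD[OF U(2,1)] has_derivative_linear[OF holomorphic_cvecD(1)[OF U(2,1)]] by (simp add: linear_add)
 qed
 have s: "s j om : hodge_fibre Q L la om" if "j < N" for j
  using E(1) that by (auto simp: ideal_power_expansion_def hodge_sections_def)
 show ?thesis by (rule that[of N "%j. s j om" "%j i. differential S (hh j i) om"]) (use s lin E(2) in auto)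
qed

lemma qp_equivariant:
 assumes g: "isometric Q g" "!!y. y : D ==> cmat g *v y : D"
  "!!x. x : span L' ==> g *v x : span L'" "!!x. x : span K ==> g *v x : span K"
  and fg: "!!y. y : D ==> f (cmat g *v y) - tmap (cmat g) (f y) : hodge_null Q L deg (cmat g *v y)"
  and om: "om : D'" and u: "u : cspace K"
 shows "qp (cmat g *v om) (cmat g *v u) - tmap (cmat g) (qp om u) : hodge_null Q L deg (cmat g *v om)"
  and "cmat g *v om : D'"
proof -
 have gh: "hyp (g *v e) (g *v e')" "g *v e : span L'" using h g by (auto simp: hyp_def isometric_def)
 show gom: "cmat g *v om : D'" using om g by (auto simp: D' cspace_iff Revec_cmat Imvec_cmat)
 have gu: "cmat g *v u : cspace K" using u g by (auto simp: cspace_iff Revec_cmat Imvec_cmat)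
 let ?P' = "Ptriv (g *v e) (g *v e')"
 have gP: "?P' (cmat g *v y) ** cmat g = cmat g ** P y" for y by (rule Ptriv_equivariant[OF _ g(1)]) (rule period_space_axioms)
 have curve: "ncurve (g *v e) (cmat g *v om) (cmat g *v u) t = cmat g *v ncurve e om u t" for t
  by (simp add: ncurve_def matrix_vector_mult_diff_distrib matrix_vector_right_distrib vector_scalar_commute
  isometric_cform[OF g(1)] matrix_cvec[symmetric])
 have "tmap (?P' (cmat g *v om)) (qp (cmat g *v om) (cmat g *v u)) idx
  = tmap (cmat g) (tmap (P om) (qp om u)) idx" for idx
 proof (rule tendsto_unique[OF _ qp_limit[OF gh gom gu]])
  have "((%t. \<Sum>jdx | length jdx = length idx. (\<Prod>i<length idx. cmat g $ (idx ! i) $ (jdx ! i)) *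
  (tmap (P (ncurve e om u t)) (f (ncurve e om u t)) jdx / t ^ \<nu>)) \<longlongrightarrow>
  tmap (cmat g) (tmap (P om) (qp om u)) idx) (at 0)" unfolding tmap_def[of "cmat g"]
  by (intro tendsto_sum tendsto_mult tendsto_const qp_limit[OF h(1,2) om u])
  moreover have "\<forall>\<^sub>F t in at 0. (\<Sum>jdx | length jdx = length idx. (\<Prod>i<length idx. cmat g $ (idx ! i) $ (jdx ! i)) *
  (tmap (P (ncurve e om u t)) (f (ncurve e om u t)) jdx / t ^ \<nu>))
  = tmap (?P' (ncurve (g *v e) (cmat g *v om) (cmat g *v u) t))
  (f (ncurve (g *v e) (cmat g *v om) (cmat g *v u) t)) idx / t ^ \<nu>"
  proof -
  have "\<forall>\<^sub>F t in at 0. ncurve e om u t : D"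
  using ncurve_in_D[OF h(1,2) om u] by (simp add: eventually_nhds_conv_at)
  then show ?thesis
  proof eventually_elim
  case (elim t)
  have "tmap (?P' (cmat g *v ncurve e om u t)) (f (cmat g *v ncurve e om u t))
  = tmap (?P' (cmat g *v ncurve e om u t)) (tmap (cmat g) (f (ncurve e om u t)))"
  by (rule null_vanish_diff[OF g(2)[OF elim] gh(1) fg[OF elim]])
  also have "... = tmap (cmat g) (tmap (P (ncurve e om u t)) (f (ncurve e om u t)))" by (simp only: tmap_compose gP)
  finally show ?case by (simp add: curve tmap_def[of "cmat g"] sum_divide_distrib)
  qed
  qed
  ultimately show "((%t. tmap (?P' (ncurve (g *v e) (cmat g *v om) (cmat g *v u) t))
  (f (ncurve (g *v e) (cmat g *v om) (cmat g *v u) t)) idx / t ^ \<nu>) \<longlongrightarrow>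
  tmap (cmat g) (tmap (P om) (qp om u)) idx) (at 0)" by (rule Lim_transform_eventually)
 qed simp
 then have "tmap (?P' (cmat g *v om)) (qp (cmat g *v om) (cmat g *v u))
  = tmap (?P' (cmat g *v om)) (tmap (cmat g) (qp om u))"
  unfolding tmap_compose gP by (simp only: fun_eq_iff tmap_compose simp_thms)
 moreover have "tmap (cmat g) (qp om u) : tpow deg (cperp Q L (cmat g *v om))"
  by (rule tmap_tpow[OF qp_tpow[OF om]]) (simp add: cperp_def isometric_cform[OF g(1)])
 ultimately show "qp (cmat g *v om) (cmat g *v u) - tmap (cmat g) (qp om u) : hodge_null Q L deg (cmat g *v om)"
  using gom by (subst null_diff_iff[OF _ gh(1) qp_tpow]) (auto simp: D')
qed

lemma qp_homogeneous:
 assumes om: "om : D'" and u: "u : cspace K" and c: "c ~= 0"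
 shows "tmap (P (c *s om)) (qp (c *s om) u) = tscale (c powi (- (k + int \<nu>))) (tmap (P om) (qp om u))"
  and "c *s om : D'"
proof -
 show com: "c *s om : D'" using om D_smult[OF _ c] by (auto simp: D' vec.subspace_scale[OF cspace_subspace])
 have curve: "ncurve e (c *s om) u t = c *s ncurve e om u (t / c)" for t
  using c by (simp add: ncurve_def cform_simps vec_eq_iff field_simps power2_eq_square)
 have lim0: "filterlim (%t. t / c) (at 0) (at 0)" unfolding filterlim_at
 proof
  have "((%t. t / c) \<longlongrightarrow> 0 / c) (at 0)" by (intro tendsto_intros c)
  then show "((%t. t / c) \<longlongrightarrow> 0) (at 0)" by simp
  show "\<forall>\<^sub>F x in at 0. x / c : UNIV & x / c ~= 0" using c by (simp add: eventually_at_filter)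
 qed
 have "tmap (P (c *s om)) (qp (c *s om) u) idx = c powi (- (k + int \<nu>)) * tmap (P om) (qp om u) idx" for idx
 proof (rule tendsto_unique[OF _ qp_limit[OF h(1,2) com u]])
  let ?G = "%t. tmap (P (ncurve e om u t)) (f (ncurve e om u t)) idx / t ^ \<nu>"
  have "((%t. c powi (- (k + int \<nu>)) * ?G (t / c)) \<longlongrightarrow> c powi (- (k + int \<nu>)) * tmap (P om) (qp om u) idx) (at 0)"
  by (intro tendsto_mult tendsto_const filterlim_compose[OF qp_limit[OF h(1,2) om u] lim0])
  moreover have "\<forall>\<^sub>F t in at 0. c powi (- (k + int \<nu>)) * ?G (t / c)
  = tmap (P (ncurve e (c *s om) u t)) (f (ncurve e (c *s om) u t)) idx / t ^ \<nu>"
  proof -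
  have "\<forall>\<^sub>F t in at 0. ncurve e om u t : D"
  using ncurve_in_D[OF h(1,2) om u] by (simp add: eventually_nhds_conv_at)
  then have "\<forall>\<^sub>F t in at 0. ncurve e om u (t / c) : D" using lim0 by (rule eventually_compose_filterlim)
  then show ?thesis
  proof eventually_elim
  case (elim t)
  let ?y = "ncurve e om u (t / c)"
  have "f (c *s ?y) - tscale (c powi (- k)) (f ?y) : hodge_null Q L deg ?y" using f elim c by (auto simp: hodge_sections_def)
  from null_vanish_diff[OF elim h(1) this]
  have "tmap (P ?y) (f (c *s ?y)) = tscale (c powi (- k)) (tmap (P ?y) (f ?y))" by (simp only: tmap_scale)
  then have "tmap (P (c *s ?y)) (f (c *s ?y)) idx / t ^ \<nu> = c powi (- k) * tmap (P ?y) (f ?y) idx / t ^ \<nu>"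
  by (simp add: Ptriv_smult[OF c])
  also have "... = c powi (- (k + int \<nu>)) * ?G (t / c)"
  using c power_int_diff[of c "- k" "int \<nu>"] by (simp add: power_divide)
  finally show ?case by (simp add: curve)
  qed
  qed
  ultimately show "((%t. tmap (P (ncurve e (c *s om) u t)) (f (ncurve e (c *s om) u t)) idx / t ^ \<nu>) \<longlongrightarrow>
  c powi (- (k + int \<nu>)) * tmap (P om) (qp om u) idx) (at 0)" by (rule Lim_transform_eventually)
 qed simp
 then show "tmap (P (c *s om)) (qp (c *s om) u) = tscale (c powi (- (k + int \<nu>))) (tmap (P om) (qp om u))"
  by (simp add: fun_eq_iff)
qed

text \<open>The differentials are derivatives of local holomorphic extensions, which are holomorphic again.\<close>

lemma qp_holomorphic:
 assumes om0: "om0 : D'" and u: "u : cspace K"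
 obtains U F where "open U" "om0 : U" "!!idx. holomorphic_cvec U (%y. F y idx)"
  "!!om. om : U Int D' ==> tmap (P om) (qp om u) = F om" "!!y. y : U ==> cform Q y (cvec e) ~= 0"
proof -
 have "om0 : D" using om0 by (simp add: D')
 then obtain S N hh s where E: "ideal_power_expansion Q L L' D la k \<nu> f om0 S N hh s" using qp_expansion by blast
 have S: "open_subcone D S" "om0 : S" and hh: "!!j i. j < N ==> i < \<nu> ==> hh j i : ideal_sections L' S"
  using E by (auto simp: ideal_power_expansion_def)
 obtain T where T: "open T" "S = D Int T" using S(1) by (auto simp: open_subcone_def openin_open)
 obtain U F where "\<forall>j<N. lifts_near S (s j) om0 (U j) (F j)" using expansion_lifts[OF E] by blast
 then have UF: "open (U j) & om0 : U j & (ALL idx. holomorphic_cvec (U j) (%y. F j y idx)) &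
  (ALL y:U j Int S. F j y - s j y : hodge_null Q L deg y)" if "j < N" for j
  using that unfolding lifts_near_def by simp
 define H where "H j i = (SOME H. extends_at S (hh j i) om0 H)" for j i
 have ext: "EX V. open V & om0 : V & holomorphic_cvec V (H j i) & (ALL y:V Int S. H j i y = hh j i y)"
  if "j < N" "i < \<nu>" for j i
 proof -
  have "EX H. extends_at S (hh j i) om0 H" using hh[OF that] S(2) unfolding ideal_sections_def by blast
  then have "extends_at S (hh j i) om0 (H j i)" unfolding H_def by (rule someI_ex)
  then show ?thesis unfolding extends_at_def .
 qed
 define V where "V j i = (SOME V. open V & om0 : V & holomorphic_cvec V (H j i) & (ALL y:V Int S. H j i y = hh j i y))" for j i
 have HV: "open (V j i) & om0 : V j i & holomorphic_cvec (V j i) (H j i)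
  & (ALL y:V j i Int S. H j i y = hh j i y)" if "j < N" "i < \<nu>" for j i
  using ext[OF that] unfolding V_def by (rule someI_ex)
 define W where "W = T Int {y. cform Q y (cvec e) ~= 0} Int (\<Inter>j\<in>{..<N}. U j) Int (\<Inter>j\<in>{..<N}. \<Inter>i\<in>{..<\<nu>}. V j i)"
 define G where "G y = (\<Sum>j<N. tscale (\<Prod>i<\<nu>. frechet_derivative (H j i) (at y) u) (tmap (P y) (F j y)))" for y
 have sub: "W <= U j" "i < \<nu> ==> W <= V j i" if "j < N" for j i using that by (auto simp: W_def)
 show ?thesis
 proof (rule that[of W G])
  show "open W" unfolding W_def using T UF HV
  by (intro open_Int open_INT open_Collect_neq continuous_intros finite_lessThan ballI) auto
  show "om0 : W" using T S(2) UF HV D_nz[OF \<open>om0 : D\<close> h(1)] by (auto simp: W_def)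
  show "cform Q y (cvec e) ~= 0" if "y : W" for y using that by (simp add: W_def)
  show "holomorphic_cvec W (%y. G y idx)" for idx unfolding G_def sum_tensor_apply tscale_apply
  proof (intro hol_cvec_sum hol_cvec_mult hol_cvec_prod holomorphic_tmap holomorphic_Ptriv)
  fix j i assume "j : {..<N}"
  then show "holomorphic_cvec W (%y. F j y idx)" for idx using UF[of j] sub(1)[of j] hol_cvec_subset by blast
  assume "i : {..<\<nu>}"
  then show "holomorphic_cvec W (%y. frechet_derivative (H j i) (at y) u)"
  using \<open>j : {..<N}\<close> HV[of j i] sub(2)[of j i] hol_cvec_derivative[of "V j i" "H j i" u]
  hol_cvec_subset by blast
  qed (simp add: W_def)
  show "tmap (P om) (qp om u) = G om" if om: "om : W Int D'" for om
  proof
  fix idx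
  have om': "om : D'" "om : S" "om : D" using om T by (auto simp: W_def D')
  have E': "ideal_power_expansion Q L L' D la k \<nu> f om S N hh s" using E om'(2) by (auto simp: ideal_power_expansion_def)
  have d: "differential S (hh j i) om u = frechet_derivative (H j i) (at om) u" if "j < N" "i < \<nu>" for j i
  proof (rule differential_eq[OF h(1,2) om'(1) u S(1) om'(2) hh[OF that]])
  show "extends_at S (hh j i) om (H j i)" unfolding extends_at_def using HV[OF that] sub(2)[OF that] om by blast
  qed
  have F: "tmap (P om) (F j om) = tmap (P om) (s j om)" if "j < N" for j
  using UF[OF that] sub(1)[OF that] om om' by (intro null_vanish_diff[OF _ h(1)]) auto
  have "tmap (P om) (qp om u) idx
  = tmap (P om) (\<Sum>j<N. tscale (\<Prod>i<\<nu>. differential S (hh j i) om u) (s j om)) idx"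
  by (rule tendsto_unique[OF _ qp_limit[OF h(1,2) om'(1) u] expansion_limit[OF E' h(1,2) om'(1) u]]) simp
  also have "... = G om idx" unfolding tmap_combination G_def sum_tensor_apply tscale_apply
  by (intro sum.cong arg_cong2[where f = "(*)"] prod.cong) (auto simp: d F)
  finally show "tmap (P om) (qp om u) idx = G om idx" .
  qed
 qed
qed

end

section \<open>Fourier expansion of a periodic function of one variable\<close>

definition ec :: "complex => complex" where
 "ec t = exp (2 * of_real pi * \<i> * t)"

lemma ec_add: "ec (s + t) = ec s * ec t" by (simp add: ec_def exp_add[symmetric] algebra_simps)

lemma ec_0 [simp]: "ec 0 = 1" by (simp add: ec_def)

lemma ec_nonzero [simp]: "ec t ~= 0" by (simp add: ec_def)

lemma ec_minus: "ec (- t) = inverse (ec t)" using ec_add[of t "- t"] by (simp add: field_simps)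

lemma norm_ec: "norm (ec t) = exp (- 2 * pi * Im t)" by (simp add: ec_def)

lemma ec_eq_1_iff: "ec t = 1 \<longleftrightarrow> t : \<int>"
proof
 assume "ec t = 1"
 then obtain n :: int where n: "Re (2 * of_real pi * \<i> * t) = 0" "Im (2 * of_real pi * \<i> * t) = of_int (2 * n) * pi"
  unfolding ec_def exp_eq_1 by blast
 then have "t = of_int n" by (simp add: complex_eq_iff)
 then show "t : \<int>" by simp
next
 assume "t : \<int>"
 then obtain n where "t = of_int n" by (auto elim: Ints_cases)
 then show "ec t = 1" unfolding ec_def exp_eq_1 by (intro conjI exI[of _ n]) auto
qed

lemma ec_int [simp]: "ec (of_int n) = 1" by (simp add: ec_eq_1_iff)

lemma ec_derivative: "(ec has_field_derivative 2 * of_real pi * \<i> * ec t) (at t)"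
 unfolding ec_def by (auto intro!: derivative_eq_intros)

lemma continuous_on_ec [continuous_intros]: "continuous_on S f ==> continuous_on S (%x. ec (f x))"
 unfolding ec_def by (intro continuous_intros)

lemma holomorphic_on_ec [holomorphic_intros]: "f holomorphic_on S ==> (%x. ec (f x)) holomorphic_on S"
 unfolding ec_def by (intro holomorphic_intros)

definition fcoeff :: "(complex => complex) => int => complex" where
 "fcoeff g j = integral {0..1} (%s. g (of_real s) * ec (- (of_int j * of_real s)))"

definition upper :: "real => complex set" where
 "upper eps = {t. Im t > - eps}"

lemma open_upper: "open (upper eps)" and convex_upper: "convex (upper eps)"
 unfolding upper_def using open_halfspace_Im_gt convex_halfspace_Im_gt by auto

lemma fcoeff_bound:
 assumes "continuous_on {0..1} (%s. g (of_real s))" "!!s. s : {0..1} ==> norm (g (of_real s)) <= M"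
 shows "norm (fcoeff g j) <= M"
proof -
 have "norm (g (of_real 0)) <= M" by (rule assms(2)) simp
 then have "0 <= M" by (rule order_trans[OF norm_ge_zero])
 moreover have "((%s. g (of_real s) * ec (- (of_int j * of_real s))) has_integral fcoeff g j) (cbox 0 1)"
  unfolding fcoeff_def cbox_interval by (intro integrable_integral integrable_continuous_interval continuous_intros assms(1))
 ultimately have "norm (fcoeff g j) <= M * measure lborel (cbox 0 (1::real))"
  by (rule has_integral_bound) (use assms(2) in "auto simp: norm_mult norm_ec")
 then show ?thesis by simp
qed

text \<open>The integral of a periodic holomorphic function over a horizontal period does not depend on the
  period, since its derivative is the difference of two equal boundary values.\<close>

lemma fcoeff_shift:
 assumes g: "g holomorphic_on upper eps" and per: "ALL t:upper eps. g (t + 1) = g t"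
  and eps: "eps > 0" and t: "t : upper eps" shows "fcoeff (%s. g (s + t)) j = ec (of_int j * t) * fcoeff g j"
proof -
 define k where "k t = g t * ec (- (of_int j * t))" for t
 define \<Phi> where "\<Phi> t = integral (cbox 0 1) (%s. k (of_real s + t))" for t
 have mem: "of_real s + t : upper eps" if "t : upper eps" for s t using that by (simp add: upper_def)
 have hk: "k holomorphic_on upper eps" unfolding k_def by (intro holomorphic_intros g)
 have kper: "k (t + 1) = k t" if "t : upper eps" for t
 proof -
  have "ec (- (of_int j * (t + 1))) = ec (- (of_int j * t)) * ec (of_int (- j))" by (simp add: ec_add[symmetric] algebra_simps)
  then show ?thesis using bspec[OF per that] ec_int[of "- j"] by (simp add: k_def)
 qed
 have dk: "(k has_field_derivative deriv k (of_real s + t)) (at (of_real s + t))" if "t : upper eps" for s t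
  by (rule holomorphic_derivI[OF hk open_upper mem[OF that]])
 have "(\<Phi> has_field_derivative 0) (at t within upper eps)" if t: "t : upper eps" for t
 proof -
  have "((%t. integral (cbox 0 1) (%s. k (of_real s + t))) has_field_derivative
  integral (cbox 0 1) (%s. deriv k (of_real s + t))) (at t within upper eps)"
  proof (rule leibniz_rule_field_derivative[OF _ _ _ t convex_upper])
  fix t s assume t: "t : upper eps"
  have "((%t. k (of_real s + t)) has_field_derivative deriv k (of_real s + t) * 1) (at t within upper eps)"
  by (rule DERIV_chain2[where g = "%t. of_real s + t", OF dk[OF t]]) (auto intro!: derivative_eq_intros)
  then show "((%t. k (of_real s + t)) has_field_derivative deriv k (of_real s + t)) (at t within upper eps)" by simp
  show "(%s. k (of_real s + t)) integrable_on cbox 0 1"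
  by (intro integrable_continuous continuous_on_compose2[OF holomorphic_on_imp_continuous_on[OF hk]] continuous_intros)
  (use mem[OF t] in auto)
  next
  show "continuous_on (upper eps \<times> cbox 0 1) (%(t, s). deriv k (of_real s + t))" unfolding case_prod_unfold
  by (intro continuous_on_compose2[OF holomorphic_on_imp_continuous_on[OF holomorphic_deriv[OF hk open_upper]]] continuous_intros)
  (use mem in auto)
  qed
  moreover have "((%s. deriv k (of_real s + t)) has_integral k (of_real 1 + t) - k (of_real 0 + t)) {0..1}"
  proof (rule fundamental_theorem_of_calculus)
  fix s :: real
  have "((k \<circ> (%s. of_real s + t)) has_vector_derivative 1 * deriv k (of_real s + t)) (at s within {0..1})"
  proof (rule has_vector_derivative_at_within, rule field_vector_diff_chain_at[OF _ dk[OF t]])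
  show "((%s. of_real s + t) has_vector_derivative 1) (at s)"
  unfolding has_vector_derivative_def by (auto intro!: derivative_eq_intros simp: scaleR_conv_of_real)
  qed
  then show "((%s. k (of_real s + t)) has_vector_derivative deriv k (of_real s + t)) (at s within {0..1})" by (simp add: o_def)
  qed simp
  then have "integral (cbox 0 1) (%s. deriv k (of_real s + t)) = 0"
  using kper[OF t] by (auto simp: add.commute dest: integral_unique)
  ultimately show ?thesis unfolding \<Phi>_def by simp
 qed
 then obtain c where "!!t. t : upper eps ==> \<Phi> t = c"
  using has_field_derivative_zero_constant[OF convex_upper, of eps \<Phi>] by blast
 then have "\<Phi> t = \<Phi> 0" using t eps by (simp add: upper_def)
 moreover have "\<Phi> t = ec (- (of_int j * t)) * fcoeff (%s. g (s + t)) j"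
 proof -
  have "k (of_real s + t) = ec (- (of_int j * t)) * (g (of_real s + t) * ec (- (of_int j * of_real s)))" for s :: real
  proof -
  have "ec (- (of_int j * (of_real s + t))) = ec (- (of_int j * t)) * ec (- (of_int j * of_real s))"
  unfolding ec_add[symmetric] by (simp add: algebra_simps)
  then show ?thesis by (simp add: k_def)
  qed
  then show ?thesis unfolding \<Phi>_def fcoeff_def by (simp only: integral_mult_right cbox_interval)
 qed
 moreover have "\<Phi> 0 = fcoeff g j" unfolding \<Phi>_def fcoeff_def k_def by simp
 ultimately show ?thesis by (simp add: ec_minus field_simps)
qed

lemma fcoeff_decay:
 assumes g: "g holomorphic_on upper eps" and per: "ALL t:upper eps. g (t + 1) = g t"
  and dl: "0 <= dl" "dl < eps"
  and M: "ALL s:{0..1}. ALL y. \<bar>y\<bar> <= dl --> norm (g (of_real s + \<i> * of_real y)) <= M"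
 shows "norm (fcoeff g j) <= M * exp (- 2 * pi * dl) ^ nat \<bar>j\<bar>"
proof -
 define y where "y = (if j \<ge> 0 then - dl else dl)"
 define t where "t = \<i> * of_real y"
 have y: "\<bar>y\<bar> <= dl" "- eps < y" using dl by (auto simp: y_def)
 have t: "t : upper eps" using y by (simp add: t_def upper_def)
 have "continuous_on {0..1} (%s. g (of_real s + t))"
  by (intro continuous_on_compose2[OF holomorphic_on_imp_continuous_on[OF g]] continuous_intros)
  (use y in "auto simp: t_def upper_def")
 then have "norm (fcoeff (%s. g (s + t)) j) <= M" by (rule fcoeff_bound) (use M y in "auto simp: t_def")
 moreover have "norm (ec (of_int j * t)) = exp (2 * pi * dl) ^ nat \<bar>j\<bar>"
 proof -
  have "real_of_int j * y = - (dl * real (nat \<bar>j\<bar>))" by (auto simp: y_def)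
  then have "norm (ec (of_int j * t)) = exp (real (nat \<bar>j\<bar>) * (2 * pi * dl))" by (simp add: norm_ec t_def mult_ac)
  then show ?thesis by (simp only: exp_of_nat_mult)
 qed
 ultimately have "exp (2 * pi * dl) ^ nat \<bar>j\<bar> * norm (fcoeff g j) <= M"
  using fcoeff_shift[OF g per _ t, of j] dl by (simp add: norm_mult)
 then have "exp (2 * pi * dl) ^ nat \<bar>j\<bar> * norm (fcoeff g j) * exp (- 2 * pi * dl) ^ nat \<bar>j\<bar>
  <= M * exp (- 2 * pi * dl) ^ nat \<bar>j\<bar>" by (rule mult_right_mono) simp
 moreover have "exp (2 * pi * dl) ^ nat \<bar>j\<bar> * exp (- 2 * pi * dl) ^ nat \<bar>j\<bar> = 1"
  unfolding power_mult_distrib[symmetric] exp_add[symmetric] by simp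
 then have "exp (2 * pi * dl) ^ nat \<bar>j\<bar> * norm (fcoeff g j) * exp (- 2 * pi * dl) ^ nat \<bar>j\<bar> = norm (fcoeff g j)"
  by (metis mult.assoc mult.commute mult_1)
 ultimately show ?thesis by (simp only:)
qed

lemma summable_on_int_geometric:
 assumes "0 <= r" "r < (1::real)" shows "(%j::int. r ^ nat \<bar>j\<bar>) summable_on UNIV"
proof -
 have nat: "(%n. r ^ n) summable_on (UNIV :: nat set)"
  using assms by (intro norm_summable_imp_summable_on) (simp add: summable_geometric)
 have 1: "(%j::int. r ^ nat \<bar>j\<bar>) summable_on range int" using nat by (subst summable_on_reindex) (auto simp: o_def)
 have 2: "(%j::int. r ^ nat \<bar>j\<bar>) summable_on range (%n. - int (Suc n))"
 proof (subst summable_on_reindex)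
  show "inj (%n. - int (Suc n))" by (auto simp: inj_on_def)
  have "(%n. r * r ^ n) summable_on (UNIV :: nat set)" using nat by (rule summable_on_cmult_right)
  then show "(%j. r ^ nat \<bar>j\<bar>) \<circ> (%n. - int (Suc n)) summable_on UNIV" by (simp add: o_def nat_add_distrib)
 qed
 have "range int Un range (%n. - int (Suc n)) = UNIV"
 proof -
  have "j : range int Un range (%n. - int (Suc n))" for j by (cases j) auto
  then show ?thesis by blast
 qed
 moreover have "(%j::int. r ^ nat \<bar>j\<bar>) summable_on (range int Un range (%n. - int (Suc n)))"
  by (rule summable_on_Un_disjoint[OF 1 2]) auto
 ultimately show ?thesis by simp
qed

lemma fcoeff_const: "fcoeff (%_. c) j = (if j = 0 then c else 0)"
proof (cases "j = 0")
 case False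
 have "fcoeff (%_. c) j = ec (of_int j * (1 / (2 * of_int j))) * fcoeff (%_. c) j"
  by (rule fcoeff_shift[of "%_. c" 1]) (auto simp: upper_def Im_divide)
 moreover have "ec (of_int j * (1 / (2 * of_int j))) = ec (1/2)" using False by simp
 moreover have "ec (1/2) = -1" by (simp add: ec_def)
 ultimately show ?thesis using False by simp
qed (simp add: fcoeff_def)

lemma removable_quotient:
 assumes g: "g holomorphic_on upper eps" and per: "ALL t:upper eps. g (t + 1) = g t"
  and eps: "eps > 0"
 shows "EX h. h holomorphic_on upper eps & (ALL t:upper eps. h (t + 1) = h t & g t - g 0 = h t * (ec t - 1))"
proof -
 define h where "h t = (if t : \<int> then deriv g 0 / (2 * of_real pi * \<i>) else (g t - g 0) / (ec t - 1))" for t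
 have int: "g (t + of_nat n) = g t" if "t : upper eps" for t n
 proof (induction n)
  case (Suc n)
  have "t + of_nat n : upper eps" using that by (simp add: upper_def)
  from bspec[OF per this] show ?case using Suc by (simp add: add_ac)
 qed simp
 have int0: "g (of_int k + t) = g t" if "t : upper eps" for k t
 proof (cases "k \<ge> 0")
  case True
  then show ?thesis using int[OF that, of "nat k"] by (simp add: add.commute)
 next
  case False
  have "of_int k + t : upper eps" using that by (simp add: upper_def)
  from int[OF this, of "nat (- k)"] show ?thesis using False by (simp add: add_ac)
 qed
 have eq: "g t - g 0 = h t * (ec t - 1)" if t: "t : upper eps" for t
 proof (cases "t : \<int>")
  case True
  then obtain k where k: "t = of_int k" by (auto elim: Ints_cases)
  have "0 : upper eps" using eps by (simp add: upper_def)
  from int0[OF this, of k] have "g t = g 0" by (simp add: k)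
  then show ?thesis using k by simp
 qed (simp add: h_def ec_eq_1_iff)
 have perh: "h (t + 1) = h t" if "t : upper eps" for t
 proof -
  have "t + 1 : \<int> \<longleftrightarrow> t : \<int>" by (metis Ints_1 Ints_add Ints_diff add_diff_cancel_right')
  moreover have "ec (t + 1) = ec t" using ec_int[of 1] by (simp add: ec_add)
  ultimately show ?thesis using bspec[OF per that] by (simp add: h_def)
 qed
 have "h field_differentiable (at t)" if t: "t : upper eps" for t
 proof (cases "t : \<int>")
  case False
  have "open (upper eps - \<int>)" by (intro open_Diff open_upper closed_Ints)
  moreover have "(%t. (g t - g 0) / (ec t - 1)) holomorphic_on (upper eps - \<int>)"
  by (intro holomorphic_intros holomorphic_on_subset[OF g]) (auto simp: ec_eq_1_iff)
  then have "h holomorphic_on (upper eps - \<int>)" by (rule holomorphic_transform) (simp add: h_def)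
  ultimately show ?thesis using t False holomorphic_on_imp_differentiable_at by blast
 next
  case True
  then obtain k where k: "t = of_int k" by (auto elim: Ints_cases)
  define B where "B = upper eps Int ball t 1"
  define G where "G z = (if z = t then deriv g t else (g z - g t) / (z - t))" for z
  define E where "E z = (if z = t then deriv ec t else (ec z - ec t) / (z - t))" for z
  have B: "open B" "t : B" using that by (auto simp: B_def open_upper)
  have notint: "z ~: \<int>" if "z : B" "z ~= t" for z
  proof
  assume "z : \<int>"
  then obtain l where l: "z = of_int l" by (auto elim: Ints_cases)
  have "norm (of_int (k - l) :: complex) < 1" using that(1) by (simp add: B_def k l dist_norm)
  then have "\<bar>real_of_int (k - l)\<bar> < 1" unfolding norm_of_int .
  then have "k = l" by linarith
  then show False using that k l by simp
  qed
  have dec: "deriv ec t = 2 * of_real pi * \<i>" using DERIV_imp_deriv[OF ec_derivative, of t] by (simp add: k)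
  have E0: "E z ~= 0" if "z : B" for z
  proof (cases "z = t")
  case False
  have "ec t = 1" by (simp add: k)
  then show ?thesis using notint[OF that False] False ec_eq_1_iff[of z] by (simp add: E_def)
  qed (simp add: E_def dec)
  have dg: "deriv g t = deriv g 0"
  proof -
  have "deriv g t = deriv (%s. g (of_int k + s)) 0" by (subst deriv_shift_0) (simp add: o_def k add.commute)
  also have "... = deriv g 0"
  proof (rule deriv_cong_ev)
  have "\<forall>\<^sub>F x in nhds 0. x : upper eps" by (rule eventually_nhds_in_open[OF open_upper]) (use eps in "simp add: upper_def")
  then show "\<forall>\<^sub>F x in nhds 0. g (of_int k + x) = g x" by eventually_elim (rule int0)
  qed simp
  finally show ?thesis .
  qed
  have "G holomorphic_on B" "E holomorphic_on B" unfolding G_def E_def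
  by (rule pole_lemma_open holomorphic_on_subset[OF g] holomorphic_intros B | auto simp: B_def open_upper)+
  then have "(%z. G z / E z) holomorphic_on B" by (intro holomorphic_intros E0)
  moreover have "G z / E z = h z" if "z : B" for z
  proof (cases "z = t")
  case False
  have "g t = g 0" using int0[of 0 k] eps by (simp add: k upper_def)
  then show ?thesis using False notint[OF that False] by (simp add: G_def E_def h_def k)
  qed (use dec dg k in "simp add: G_def E_def h_def")
  ultimately have "h holomorphic_on B" by (metis (no_types, lifting) holomorphic_transform)
  then show ?thesis using B holomorphic_on_imp_differentiable_at by blast
 qed
 then have "h holomorphic_on upper eps" by (simp add: holomorphic_on_def field_differentiable_at_within)
 then show ?thesis using eq perh by blast
qed

lemma bounded_on_period:
 assumes g: "g holomorphic_on upper eps" and dl: "dl < eps"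
 shows "EX M. ALL s:{0..1}. ALL y. \<bar>y\<bar> <= dl --> norm (g (of_real s + \<i> * of_real y)) <= M"
proof -
 have "continuous_on ({0..1} \<times> {-dl..dl}) (%p. g (of_real (fst p) + \<i> * of_real (snd p)))"
  by (intro continuous_on_compose2[OF holomorphic_on_imp_continuous_on[OF g]] continuous_intros)
  (use dl in "auto simp: upper_def")
 then have "bounded ((%p. g (of_real (fst p) + \<i> * of_real (snd p))) ` ({0..1} \<times> {-dl..dl}))"
  by (intro compact_imp_bounded compact_continuous_image compact_Times) auto
 then obtain M where "ALL x:(%p. g (of_real (fst p) + \<i> * of_real (snd p))) ` ({0..1} \<times> {-dl..dl}). norm x <= M"
  unfolding bounded_iff by blast
 then have *: "!!p. p : {0..1} \<times> {-dl..dl} ==> norm (g (of_real (fst p) + \<i> * of_real (snd p))) <= M" by blast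
 show ?thesis
 proof (intro exI[of _ M] ballI allI impI)
  fix s y :: real assume "s : {0..1}" "\<bar>y\<bar> <= dl"
  then show "norm (g (of_real s + \<i> * of_real y)) <= M" using *[of "(s, y)"] by (auto simp: abs_le_iff)
 qed
qed

text \<open>Division by \<open>e(t) - 1\<close> turns the symmetric partial sums of the Fourier series at \<open>0\<close> into
  telescoping sums.\<close>

lemma fourier_at_0:
 assumes g: "g holomorphic_on upper eps" and per: "ALL t:upper eps. g (t + 1) = g t"
  and eps: "eps > 0" shows "(fcoeff g has_sum g 0) UNIV"
proof -
 from removable_quotient[OF g per eps] obtain h where h: "h holomorphic_on upper eps"
  "ALL t:upper eps. h (t + 1) = h t & g t - g 0 = h t * (ec t - 1)" by (elim exE conjE)
 have hh: "h holomorphic_on upper eps" "ALL t:upper eps. h (t + 1) = h t"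
  "!!t. t : upper eps ==> g t - g 0 = h t * (ec t - 1)" using h by auto
 define dl where "dl = eps / 2"
 have dl: "0 < dl" "dl < eps" using eps by (auto simp: dl_def)
 define r where "r = exp (- 2 * pi * dl)"
 have r: "0 <= r" "r < 1" using dl by (auto simp: r_def)
 from bounded_on_period[OF g dl(2)] obtain M
  where M: "ALL s:{0..1}. ALL y. \<bar>y\<bar> <= dl --> norm (g (of_real s + \<i> * of_real y)) <= M" by (elim exE)
 from bounded_on_period[OF hh(1) dl(2)] obtain M'
  where M': "ALL s:{0..1}. ALL y. \<bar>y\<bar> <= dl --> norm (h (of_real s + \<i> * of_real y)) <= M'" by (elim exE)
 have dg: "norm (fcoeff g j) <= M * r ^ nat \<bar>j\<bar>" for j
  unfolding r_def by (rule fcoeff_decay[OF g per _ dl(2) M]) (use dl in auto)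
 have dh: "norm (fcoeff h j) <= M' * r ^ nat \<bar>j\<bar>" for j
  unfolding r_def by (rule fcoeff_decay[OF hh(1,2) _ dl(2) M']) (use dl in auto)
 have cont: "continuous_on {0..1} (%s. f (of_real s))" if "f holomorphic_on upper eps" for f :: "complex => complex"
  by (intro continuous_on_compose2[OF holomorphic_on_imp_continuous_on[OF that]] continuous_intros)
  (use eps in "auto simp: upper_def")
 have rec: "fcoeff g j = (if j = 0 then g 0 else 0) + (fcoeff h (j - 1) - fcoeff h j)" for j
 proof -
  have "fcoeff g j = fcoeff (%_. g 0) j + (fcoeff h (j - 1) - fcoeff h j)"
  proof -
  have i: "(%s. f (of_real s) * ec (- (of_int i * of_real s))) integrable_on {0..1}" if "f holomorphic_on upper eps" for f i
  by (intro integrable_continuous_interval continuous_intros cont that)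
  have "g (of_real s) * ec (- (of_int j * of_real s)) = g 0 * ec (- (of_int j * of_real s))
  + (h (of_real s) * ec (- (of_int (j - 1) * of_real s)) - h (of_real s) * ec (- (of_int j * of_real s)))" for s :: real
  proof -
  have "of_real s : upper eps" using eps by (simp add: upper_def)
  from hh(3)[OF this] have "g (of_real s) = g 0 + h (of_real s) * (ec (of_real s) - 1)" by (simp add: algebra_simps)
  moreover have "ec (- (of_int (j - 1) * of_real s)) = ec (of_real s) * ec (- (of_int j * of_real s))"
  by (simp add: ec_add[symmetric] algebra_simps)
  ultimately show ?thesis by (simp only:) (simp add: algebra_simps)
  qed
  then have "fcoeff g j = integral {0..1} (%s. g 0 * ec (- (of_int j * of_real s))
  + (h (of_real s) * ec (- (of_int (j - 1) * of_real s)) - h (of_real s) * ec (- (of_int j * of_real s))))"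
  unfolding fcoeff_def by simp
  also have "... = fcoeff (%_. g 0) j + (fcoeff h (j - 1) - fcoeff h j)" unfolding fcoeff_def
  by (intro integral_unique has_integral_add has_integral_diff integrable_integral
  i[of "%_. g 0"] i hh(1) holomorphic_on_const)
  finally show ?thesis .
  qed
  then show ?thesis by (simp only: fcoeff_const)
 qed
 have part: "(SUM j:{- int N..int N}. fcoeff g j) = g 0 + (fcoeff h (- int N - 1) - fcoeff h (int N))" for N
 proof (induction N)
  case 0
  then show ?case using rec[of 0] by simp
 next
  case (Suc N)
  have "{- int (Suc N)..int (Suc N)} = insert (- int N - 1) (insert (int N + 1) {- int N..int N})" by auto
  then have "(SUM j:{- int (Suc N)..int (Suc N)}. fcoeff g j)
  = fcoeff g (- int N - 1) + (fcoeff g (int N + 1) + (SUM j:{- int N..int N}. fcoeff g j))" by simp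
  also have "fcoeff g (- int N - 1) = fcoeff h (- int N - 2) - fcoeff h (- int N - 1)"
  using rec[of "- int N - 1"] by (simp add: algebra_simps)
  also have "fcoeff g (int N + 1) = fcoeff h (int N) - fcoeff h (int N + 1)" using rec[of "int N + 1"] by simp
  finally show ?case unfolding Suc.IH by (simp add: algebra_simps)
 qed
 have "(%j. norm (fcoeff g j)) summable_on UNIV" using summable_on_cmult_right[OF summable_on_int_geometric[OF r], of M]
  by (rule Infinite_Sum.abs_summable_on_comparison_test') (rule dg)
 then have "fcoeff g summable_on UNIV" by (rule abs_summable_summable)
 then obtain S where S: "(fcoeff g has_sum S) UNIV" by (auto simp: summable_on_def)
 have "filterlim (%N. {- int N..int N}) (finite_subsets_at_top UNIV) sequentially" unfolding filterlim_finite_subsets_at_top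
 proof (intro allI impI)
  fix X :: "int set" assume X: "finite X & X <= UNIV"
  define B where "B = (SUM x:X. nat \<bar>x\<bar>)"
  have "nat \<bar>x\<bar> <= B" if "x : X" for x unfolding B_def using X that by (intro member_le_sum) auto
  then have "X <= {- int N..int N}" if "B <= N" for N using that order_trans by (force simp: nat_le_iff abs_le_iff)
  then show "\<forall>\<^sub>F N in sequentially. finite {- int N..int N} & X <= {- int N..int N} & {- int N..int N} <= UNIV"
  unfolding eventually_sequentially by (intro exI[of _ B]) simp
 qed
 then have "(%N. SUM j:{- int N..int N}. fcoeff g j) \<longlonglongrightarrow> S"
  using S unfolding has_sum_def by (rule filterlim_compose[rotated])
 moreover have "(%N. SUM j:{- int N..int N}. fcoeff g j) \<longlonglongrightarrow> g 0 + (0 - 0)" unfolding part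
 proof (intro tendsto_intros)
  have rN: "(%N. M' * r ^ N) \<longlonglongrightarrow> 0" "(%N. M' * r ^ Suc N) \<longlonglongrightarrow> 0"
  using r LIMSEQ_realpow_zero[of r] LIMSEQ_Suc[of "%N. r ^ N" 0] by (auto intro!: tendsto_mult_right_zero)
  show "(%N. fcoeff h (int N)) \<longlonglongrightarrow> 0"
  by (rule Lim_null_comparison[OF _ rN(1)]) (use dh[of "int _"] in "auto intro!: always_eventually")
  have "nat \<bar>- int N - 1\<bar> = Suc N" for N by simp
  then show "(%N. fcoeff h (- int N - 1)) \<longlonglongrightarrow> 0"
  by (intro Lim_null_comparison[OF _ rN(2)] always_eventually allI) (metis dh)
 qed
 ultimately have "S = g 0" using LIMSEQ_unique by fastforce
 then show ?thesis using S by simp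
qed

section \<open>Fourier expansion in several variables\<close>

lemma hol_cvec_average:
 assumes F: "holomorphic_cvec Om F" and Om: "open Om" and w: "continuous_on {0..1} w"
  and mem: "!!z s. z : Om ==> s : {0..1} ==> z + of_real s *s b : Om"
 shows "holomorphic_cvec Om (%z. integral {0..1} (%s. F (z + of_real s *s b) * w s))" unfolding holomorphic_cvec_def
proof
 fix z assume z: "z : Om"
 let ?D = "%x. frechet_derivative F (at x)"
 define p where "p = (%s::real. z + of_real s *s b)"
 have cp: "continuous_on {0..1} (%s. z + of_real s *s b)" for z unfolding vector_scalar_mult_def by (intro continuous_intros)
 have comp: "compact (p ` {0..1})" unfolding p_def by (intro compact_continuous_image cp) auto
 have disj: "p ` {0..1} Int (- Om) = {}" using mem[OF z] by (auto simp: p_def)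
 obtain d where d: "d > 0" "ALL x:p ` {0..1}. ALL y:- Om. d <= dist x y"
  using separate_compact_closed[OF comp _ disj] Om by (auto simp: closed_def)
 define r where "r = d / 4"
 have r: "r > 0" using d by (simp add: r_def)
 have sub: "cball (p s) (3 * r) <= Om" if "s : {0..1}" for s
 proof
  fix y assume "y : cball (p s) (3 * r)"
  then have "dist (p s) y < d" using d(1) by (simp add: r_def)
  then show "y : Om" using d(2) that by force
 qed
 define X where "X = (%q. fst q + snd q) ` (p ` {0..1} \<times> cball 0 (3 * r))"
 have "compact X" unfolding X_def by (intro compact_continuous_image compact_Times comp continuous_intros) auto
 moreover have X: "cball (p s) (3 * r) <= X" if "s : {0..1}" for s
 proof
  fix y assume "y : cball (p s) (3 * r)"
  then show "y : X" unfolding X_def using that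
  by (intro image_eqI[of _ _ "(p s, y - p s)"]) (auto simp: dist_norm norm_minus_commute)
 qed
 moreover have "X <= Om"
 proof
  fix y assume "y : X"
  then obtain s v where "s : {0..1}" "y = p s + v" "norm v <= 3 * r" unfolding X_def by auto
  then show "y : Om" using sub[of s] by (auto simp: subset_iff dist_norm)
 qed
 ultimately have "bounded (F ` X)"
  using F by (intro compact_imp_bounded compact_continuous_image continuous_on_subset[OF hol_cvec_continuous_on]) auto
 then obtain M where M: "!!y. y : X ==> norm (F y) <= M" unfolding bounded_iff by blast
 have "bounded (w ` {0..1})" using w by (intro compact_imp_bounded compact_continuous_image) auto
 then obtain W where W: "!!s. s : {0..1} ==> norm (w s) <= W" unfolding bounded_iff by blast
 have W0: "0 <= W" by (rule order_trans[OF norm_ge_zero W[of 0]]) simp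
 define C where "C = 18 * (M + 1) / (4 * r^2)"
 have "0 <= M" by (rule order_trans[OF norm_ge_zero M[of "p 0"]]) (use X[of 0] r in auto)
 then have C0: "0 <= C" by (simp add: C_def)
 have est: "norm (F (p s + v) - F (p s) - ?D (p s) v) <= C * (norm v)^2" if "s : {0..1}" "norm v <= r" for s v
  unfolding C_def by (rule taylor_estimate_cvec[OF F Om r sub[OF that(1)] _ that(2)]) (use X[OF that(1)] M r in auto)
 have cD: "continuous_on {0..1} (%s. ?D (p s) v)" for v unfolding p_def
  by (rule continuous_on_compose2[OF hol_cvec_continuous_on[OF hol_cvec_derivative[OF F Om]] cp])
  (use mem[OF z] in auto)
 have cF: "continuous_on {0..1} (%s. F (z + of_real s *s b))" if "z : Om" for z
  by (rule continuous_on_compose2[OF hol_cvec_continuous_on[OF F] cp]) (use mem[OF that] in auto)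
 define D where "D v = integral {0..1} (%s. ?D (p s) v * w s)" for v
 have iD: "(%s. ?D (p s) v * w s) integrable_on {0..1}" for v by (intro integrable_continuous_interval continuous_intros cD w)
 have pin: "p s : Om" if "s : {0..1}" for s using mem[OF z that] by (simp add: p_def)
 have D_add: "D (u + v) = D u + D v" for u v
 proof -
  have "D (u + v) = integral {0..1} (%s. ?D (p s) u * w s + ?D (p s) v * w s)" unfolding D_def
  by (intro integral_cong) (use has_derivative_linear[OF holomorphic_cvecD(1)[OF F pin]] in "simp add: linear_add algebra_simps")
  also have "... = D u + D v" unfolding D_def by (rule integral_add[OF iD iD])
  finally show ?thesis .
 qed
 have D_scale: "D (c *s v) = c * D v" for c v
 proof -
  have "D (c *s v) = integral {0..1} (%s. c * (?D (p s) v * w s))"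
  unfolding D_def by (intro integral_cong) (simp add: holomorphic_cvecD(2)[OF F pin])
  then show ?thesis by (simp add: D_def)
 qed
 have "linear D" by (rule linearI) (use D_add D_scale[of "of_real _"] in "auto simp: smult_of_real scaleR_conv_of_real")
 then have bD: "bounded_linear D" by (simp add: linear_conv_bounded_linear)
 let ?G = "%z. integral {0..1} (%s. F (z + of_real s *s b) * w s)"
 obtain r1 where r1: "r1 > 0" "ball z r1 <= Om" using Om z open_contains_ball by blast
 define e where "e = min r r1"
 have "(?G has_derivative D) (at z)"
 proof (rule has_derivativeI_sandwich[of e])
  show "0 < e" using r r1 by (simp add: e_def)
  fix x assume x: "x : UNIV" "x ~= z" "dist x z < e"
  define v where "v = x - z"
  have v: "v ~= 0" "norm v <= r" and xOm: "x : Om" using x r1 by (auto simp: v_def e_def dist_norm norm_minus_commute)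
  have xs: "x + of_real s *s b = p s + v" for s by (simp add: p_def v_def)
  have "((%s. F (x + of_real s *s b) * w s - F (z + of_real s *s b) * w s - ?D (p s) v * w s)
  has_integral (?G x - ?G z - D v)) (cbox 0 1)" unfolding D_def cbox_interval
  by (intro has_integral_diff integrable_integral iD integrable_continuous_interval continuous_intros cF w z xOm)
  then have "norm (?G x - ?G z - D v) <= C * (norm v)^2 * W * measure lborel (cbox 0 (1::real))"
  proof (rule has_integral_bound[rotated])
  show "0 <= C * (norm v)^2 * W" using C0 W0 by simp
  fix s :: real assume "s : cbox 0 1"
  then have s: "s : {0..1}" by simp
  have "F (x + of_real s *s b) * w s - F (z + of_real s *s b) * w s - ?D (p s) v * w s
  = (F (p s + v) - F (p s) - ?D (p s) v) * w s" by (simp add: xs algebra_simps) (simp add: p_def)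
  then show "norm (F (x + of_real s *s b) * w s - F (z + of_real s *s b) * w s - ?D (p s) v * w s) <= C * (norm v)^2 * W"
  using mult_mono[OF est[OF s v(2)] W[OF s]] C0 by (simp add: norm_mult)
  qed
  then have "norm (?G x - ?G z - D (x - z)) <= (C * W * norm v) * norm v" by (simp add: v_def power2_eq_square mult_ac)
  then show "norm (?G x - ?G z - D (x - z)) / norm (x - z) <= C * W * norm (x - z)" using v by (simp add: v_def divide_le_eq)
 next
  have "((%x. C * W * norm (x - z)) \<longlongrightarrow> C * W * norm (z - z)) (at z)" by (intro tendsto_intros)
  then show "((%x. C * W * norm (x - z)) \<longlongrightarrow> 0) (at z)" by simp
 qed (rule bD)
 then show "EX H'. (?G has_derivative H') (at z) & (ALL c v. H' (c *s v) = c * H' v)" using D_scale by blast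
qed

text \<open>The \<open>j\<close>-th Fourier coefficient of \<open>F\<close> in the direction \<open>b\<close>, as a function of the base point.\<close>

definition average :: "complex ^ 'm => int => (complex ^ 'm => complex) => complex ^ 'm => complex" where
 "average b j F z = fcoeff (%t. F (z + t *s b)) j"

fun averages :: "(complex ^ 'm) list => int list => (complex ^ 'm => complex) => complex ^ 'm => complex" where
 "averages [] js F = F"
| "averages (b # bs) js F = averages bs (tl js) (average b (hd js) F)"

fun period_box :: "real => (complex ^ 'm) list => (complex ^ 'm) set" where
 "period_box dl [] = {0}"
| "period_box dl (b # bs) = (%(s, y, w). (of_real s + \<i> * of_real y) *s b + w) ` ({0..1} \<times> {-dl..dl} \<times> period_box dl bs)"

definition weight :: "real => int list => real" where
 "weight r js = (\<Prod>j\<leftarrow>js. r ^ nat \<bar>j\<bar>)"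

lemma weight_simps [simp]: "weight r [] = 1" "weight r (j # js) = r ^ nat \<bar>j\<bar> * weight r js"
 by (simp_all add: weight_def)

lemma weight_nonneg: "0 <= r ==> 0 <= weight r js" by (induction js) auto

lemma len_Suc_reindex:
 "bij_betw (%(j, js). j # js) (UNIV \<times> {js. length js = n}) {js :: int list. length js = Suc n}"
 by (rule bij_betwI[where g = "%js. (hd js, tl js)"]) (auto simp: length_Suc_conv)

lemma summable_on_weight:
 assumes r: "0 <= r" "r < 1" shows "weight r summable_on {js. length js = n}"
proof (induction n)
 case (Suc n)
 obtain W where W: "(weight r has_sum W) {js. length js = n}" using Suc by (auto simp: summable_on_def)
 have "(%(j, js). r ^ nat \<bar>j\<bar> * weight r js) summable_on (SIGMA j:UNIV. {js. length js = n})"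
 proof (rule summable_on_SigmaI)
  show "((%js. (case (j, js) of (j, js) => r ^ nat \<bar>j\<bar> * weight r js)) has_sum r ^ nat \<bar>j\<bar> * W) {js. length js = n}" for j
  using has_sum_cmult_right[OF W] by simp
  show "(%j::int. r ^ nat \<bar>j\<bar> * W) summable_on UNIV"
  by (rule summable_on_cmult_left[OF summable_on_int_geometric[OF r]])
 qed (use r weight_nonneg in auto)
 then show ?case by (subst summable_on_reindex_bij_betw[OF len_Suc_reindex, symmetric]) (simp add: case_prod_unfold)
qed simp

locale tube_region =
 fixes Om :: "(complex ^ 'm) set" and B :: "(complex ^ 'm) set"
 assumes open_Om: "open Om" and up: "z : Om ==> b : B ==> 0 <= Im t ==> z + t *s b : Om"
begin

lemma slice:
 assumes F: "holomorphic_cvec Om F" and per: "ALL z:Om. F (z + b) = F z" and b: "b : B"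
  and z: "z - (\<i> * of_real dl) *s b : Om" and dl: "dl \<ge> 0"
 shows "\<exists>eps>dl. (%t. F (z + t *s b)) holomorphic_on upper eps & (ALL t:upper eps. F (z + (t + 1) *s b) = F (z + t *s b))"
proof -
 let ?z = "z - (\<i> * of_real dl) *s b"
 have "open ((%y::real. ?z - (\<i> * of_real y) *s b) -` Om)"
  by (intro open_vimage open_Om) (unfold vector_scalar_mult_def, intro continuous_intros)
 moreover have "0 : (%y::real. ?z - (\<i> * of_real y) *s b) -` Om" using z by simp
 ultimately obtain e where e: "e > 0" "ball 0 e <= (%y::real. ?z - (\<i> * of_real y) *s b) -` Om"
  using open_contains_ball by blast
 define y where "y = e / 2"
 have "y : ball 0 e" using e(1) by (simp add: y_def)
 then have y: "y > 0" "?z - (\<i> * of_real y) *s b : Om" using e by (simp add: y_def, blast)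
 have mem: "z + t *s b : Om" if "t : upper (dl + y)" for t
 proof -
  have "?z - (\<i> * of_real y) *s b + (t + \<i> * of_real (dl + y)) *s b : Om"
  by (rule up[OF y(2) b]) (use that in "simp add: upper_def")
  then show ?thesis by (simp add: algebra_simps vector_sadd_rdistrib)
 qed
 have "(%t. F (z + t *s b)) holomorphic_on upper (dl + y)"
  by (rule holomorphic_on_subset[OF holomorphic_on_line[OF F open_Om]]) (use mem in auto)
 moreover have "F (z + (t + 1) *s b) = F (z + t *s b)" if "t : upper (dl + y)" for t
  using per mem[OF that] by (auto simp: vector_sadd_rdistrib add.assoc[symmetric])
 ultimately show ?thesis using y by (intro exI[of _ "dl + y"]) auto
qed

lemma slice_at:
 assumes F: "holomorphic_cvec Om F" and per: "ALL z:Om. F (z + b) = F z" and b: "b : B" and z: "z : Om"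
 obtains eps where "eps > 0" "(%t. F (z + t *s b)) holomorphic_on upper eps"
  "ALL t:upper eps. F (z + (t + 1) *s b) = F (z + t *s b)" using slice[OF F per b, of z 0] z by auto

lemma average_shift:
 assumes F: "holomorphic_cvec Om F" and per: "ALL z:Om. F (z + b) = F z" and b: "b : B" and z: "z : Om"
  and t: "0 <= Im t" shows "average b j F (z + t *s b) = ec (of_int j * t) * average b j F z"
proof -
 obtain eps where eps: "eps > 0" "(%t. F (z + t *s b)) holomorphic_on upper eps"
  "ALL t:upper eps. F (z + (t + 1) *s b) = F (z + t *s b)" by (rule slice_at[OF F per b z])
 have eq: "z + t *s b + s *s b = z + (s + t) *s b" for s by (simp add: vector_sadd_rdistrib)
 show ?thesis unfolding average_def eq by (rule fcoeff_shift[OF eps(2,3,1)]) (use t eps(1) in "simp add: upper_def")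
qed

lemma average_has_sum:
 assumes F: "holomorphic_cvec Om F" and per: "ALL z:Om. F (z + b) = F z" and b: "b : B" and z: "z : Om"
 shows "((%j. average b j F z) has_sum F z) UNIV"
proof -
 obtain eps where eps: "eps > 0" "(%t. F (z + t *s b)) holomorphic_on upper eps"
  "ALL t:upper eps. F (z + (t + 1) *s b) = F (z + t *s b)" by (rule slice_at[OF F per b z])
 show ?thesis using fourier_at_0[OF eps(2,3,1)] by (simp add: average_def[abs_def])
qed

lemma average_holomorphic:
 assumes F: "holomorphic_cvec Om F" and b: "b : B" shows "holomorphic_cvec Om (average b j F)"
 unfolding average_def[abs_def] fcoeff_def
 by (rule hol_cvec_average[OF F open_Om]) (auto intro!: continuous_intros up b)

lemma average_equivariant:
 assumes eq: "ALL x:Om. F (x + v) = c * F x" and b: "b : B" and z: "z : Om"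
 shows "average b j F (z + v) = c * average b j F z"
proof -
 have "F (z + v + of_real s *s b) = c * F (z + of_real s *s b)" for s :: real
 proof -
  have "z + v + of_real s *s b = z + of_real s *s b + v" by simp
  then show ?thesis using eq up[OF z b, of "of_real s"] by (simp only:) simp
 qed
 then show ?thesis unfolding average_def fcoeff_def by (simp add: mult.assoc)
qed

lemma averages_equivariant:
 "ALL x:Om. F (x + v) = c * F x ==> set bs <= B ==> z : Om ==> averages bs js F (z + v) = c * averages bs js F z"
 by (induction bs arbitrary: js F) (auto simp: average_equivariant)

lemma averages_shift:
 assumes "holomorphic_cvec Om F" "ALL b:set bs. ALL z:Om. F (z + b) = F z" "set bs <= B" "z : Om"
  "length js = length bs" "i < length bs" "0 <= Im t"
 shows "averages bs js F (z + t *s (bs ! i)) = ec (of_int (js ! i) * t) * averages bs js F z" using assms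
proof (induction bs arbitrary: js F i)
 case (Cons b bs)
 obtain j js' where js: "js = j # js'" "length js' = length bs" using Cons.prems(5) by (cases js) auto
 have F: "holomorphic_cvec Om F" "ALL z:Om. F (z + b) = F z" "b : B" "set bs <= B" using Cons.prems by auto
 show ?case
 proof (cases i)
  case 0
  have "averages bs js' (average b j F) (z + t *s b) = ec (of_int j * t) * averages bs js' (average b j F) z"
  by (rule averages_equivariant[OF _ F(4) Cons.prems(4)]) (use average_shift[OF F(1,2,3)] Cons.prems in auto)
  then show ?thesis by (simp add: 0 js)
 next
  case (Suc i')
  have "ALL b':set bs. ALL z:Om. average b j F (z + b') = average b j F z"
  proof (intro ballI)
  fix b' z assume "b' : set bs" "z : Om"
  then show "average b j F (z + b') = average b j F z" using average_equivariant[of F b' 1 b z j] Cons.prems(2) F(3) by auto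
  qed
  from Cons.IH[OF average_holomorphic[OF F(1,3)] this F(4) Cons.prems(4) js(2), of i'] Cons.prems(6,7)
  show ?thesis by (simp add: Suc js)
 qed
qed simp

text \<open>Shifting the path of integration by \<open>\<plusminus> \<i> \<delta>\<close> in every direction gives the exponential decay; for \<open>\<delta> = 0\<close> it
  is the bound of a Fourier coefficient by the supremum over real translates.\<close>

lemma averages_bound:
 assumes "holomorphic_cvec Om F" "ALL b:set bs. ALL z:Om. F (z + b) = F z" "set bs <= B"
  "ALL w:period_box dl bs. z + w : Om & norm (F (z + w)) <= M" "0 <= dl" "length js = length bs"
 shows "norm (averages bs js F z) <= M * weight (exp (- 2 * pi * dl)) js" using assms
proof (induction bs arbitrary: js F M)
 case (Cons b bs)
 obtain j js' where js: "js = j # js'" "length js' = length bs" using Cons.prems(6) by (cases js) auto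
 let ?r = "exp (- 2 * pi * dl)"
 have F: "holomorphic_cvec Om F" "ALL z:Om. F (z + b) = F z" "b : B" "set bs <= B" using Cons.prems by auto
 have box: "z + ((of_real s + \<i> * of_real y) *s b + w) : Om & norm (F (z + ((of_real s + \<i> * of_real y) *s b + w))) <= M"
  if "s : {0..1}" "\<bar>y\<bar> <= dl" "w : period_box dl bs" for s y w
 proof -
  have "(of_real s + \<i> * of_real y) *s b + w : period_box dl (b # bs)"
  using that by (auto intro!: image_eqI[of _ _ "(s, y, w)"])
  then show ?thesis using Cons.prems(4) by blast
 qed
 have per: "ALL b':set bs. ALL z:Om. average b j F (z + b') = average b j F z"
 proof (intro ballI)
  fix b' z assume "b' : set bs" "z : Om"
  then show "average b j F (z + b') = average b j F z" using average_equivariant[of F b' 1 b z j] Cons.prems(2) F(3) by auto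
 qed
 have "ALL w:period_box dl bs. z + w : Om & norm (average b j F (z + w)) <= M * ?r ^ nat \<bar>j\<bar>"
 proof
  fix w assume w: "w : period_box dl bs"
  have eq: "z + w - (\<i> * of_real dl) *s b = z + ((of_real 0 + \<i> * of_real (- dl)) *s b + w)"
  by (simp add: vec_eq_iff algebra_simps)
  have "z + w - (\<i> * of_real dl) *s b : Om" unfolding eq by (rule conjunct1[OF box]) (use w Cons.prems(5) in auto)
  from slice[OF F(1,2,3) this Cons.prems(5)] obtain eps where eps: "dl < eps"
  "(%t. F (z + w + t *s b)) holomorphic_on upper eps"
  "ALL t:upper eps. F (z + w + (t + 1) *s b) = F (z + w + t *s b)" by blast
  have "norm (fcoeff (%t. F (z + w + t *s b)) j) <= M * ?r ^ nat \<bar>j\<bar>"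
  proof (rule fcoeff_decay[OF eps(2,3) Cons.prems(5) eps(1)], intro ballI allI impI)
  fix s y :: real assume "s : {0..1}" "\<bar>y\<bar> <= dl"
  then show "norm (F (z + w + (of_real s + \<i> * of_real y) *s b)) <= M" using box[of s y w] w by (simp add: add_ac)
  qed
  moreover have "z + w : Om" using box[of 0 0 w] w Cons.prems(5) by simp
  ultimately show "z + w : Om & norm (average b j F (z + w)) <= M * ?r ^ nat \<bar>j\<bar>" by (simp add: average_def)
 qed
 from Cons.IH[OF average_holomorphic[OF F(1,3)] per F(4) this Cons.prems(5) js(2)]
 show ?case by (simp add: js mult.assoc)
qed simp

lemma period_box_mono: "dl <= dl' ==> period_box dl bs <= period_box dl' bs"
proof (induction bs)
 case (Cons b bs)
 then have "{0..1} \<times> {-dl..dl} \<times> period_box dl bs <= {0..1} \<times> {-dl'..dl'} \<times> period_box dl' bs" by auto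
 then show ?case unfolding period_box.simps by (rule image_mono)
qed simp

lemma compact_period_box: "compact (period_box dl bs)"
proof (induction bs)
 case (Cons b bs)
 have "continuous_on X (%(s, y, w). (complex_of_real s + \<i> * of_real y) *s b + w)" for X
  unfolding vector_scalar_mult_def case_prod_unfold by (intro continuous_intros)
 then show ?case using Cons by (simp only: period_box.simps) (intro compact_continuous_image compact_Times compact_Icc)
qed simp

lemma small_period_box:
 "set bs <= B ==> z : Om ==> \<exists>dl>0. ALL w:period_box dl bs. z + w : Om"
proof (induction bs arbitrary: z)
 case (Cons b bs)
 have "open ((%y::real. z - (\<i> * of_real y) *s b) -` Om)"
  by (intro open_vimage open_Om) (unfold vector_scalar_mult_def, intro continuous_intros)
 moreover have "0 : (%y::real. z - (\<i> * of_real y) *s b) -` Om" using Cons.prems by simp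
 ultimately obtain e where e: "e > 0" "ball 0 e <= (%y::real. z - (\<i> * of_real y) *s b) -` Om"
  using open_contains_ball by blast
 define y0 where "y0 = e / 2"
 have "y0 : ball 0 e" using e(1) by (simp add: y0_def)
 then have y0: "y0 > 0" "z - (\<i> * of_real y0) *s b : Om" using e by (simp add: y0_def, blast)
 obtain dl where dl: "dl > 0" "ALL w:period_box dl bs. z - (\<i> * of_real y0) *s b + w : Om"
  using Cons.IH[OF _ y0(2)] Cons.prems by auto
 define dl' where "dl' = min dl y0"
 have "z + w : Om" if w_in: "w : period_box dl' (b # bs)" for w
 proof -
  obtain s y v where w: "w = (of_real s + \<i> * of_real y) *s b + v" "- dl' <= y" "v : period_box dl' bs"
  proof -
  assume w_that: "!!s y v. w = (of_real s + \<i> * of_real y) *s b + v ==> - dl' <= y ==> v : period_box dl' bs ==> thesis"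
  from w_in obtain q where q: "q : {0..1} \<times> {-dl'..dl'} \<times> period_box dl' bs"
  "w = (case q of (s, y, v) => (of_real s + \<i> * of_real y) *s b + v)" unfolding period_box.simps by (rule imageE)
  show thesis by (rule w_that[of "fst q" "fst (snd q)" "snd (snd q)"]) (use q in "auto simp only: case_prod_unfold mem_Times_iff atLeastAtMost_iff")
  qed
  have "v : period_box dl bs" using w(3) period_box_mono[of dl' dl bs] by (auto simp: dl'_def)
  then have "z - (\<i> * of_real y0) *s b + v + (of_real s + \<i> * of_real (y + y0)) *s b : Om"
  using dl(2) w(2) Cons.prems by (intro up) (auto simp: dl'_def)
  then show ?thesis by (simp add: w(1) vector_sadd_rdistrib algebra_simps)
 qed
 then show ?case using dl(1) y0(1) by (intro exI[of _ dl']) (auto simp: dl'_def)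
qed (auto intro: exI[of _ 1])

lemma averages_abs_summable:
 assumes F: "holomorphic_cvec Om F" "ALL b:set bs. ALL z:Om. F (z + b) = F z" "set bs <= B" and z: "z : Om"
 shows "(%js. norm (averages bs js F z)) summable_on {js. length js = length bs}"
proof -
 obtain dl where dl: "dl > 0" "ALL w:period_box dl bs. z + w : Om" using small_period_box[OF F(3) z] by blast
 have "bounded ((%w. F (z + w)) ` period_box dl bs)" by (intro compact_imp_bounded compact_continuous_image compact_period_box
  continuous_on_compose2[OF hol_cvec_continuous_on[OF F(1)]] continuous_intros) (use dl in auto)
 then obtain M where "ALL w:period_box dl bs. norm (F (z + w)) <= M" unfolding bounded_iff by blast
 then have "ALL w:period_box dl bs. z + w : Om & norm (F (z + w)) <= M" using dl(2) by blast
 note bd = averages_bound[OF F this less_imp_le[OF dl(1)]]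
 have "(%js. M * weight (exp (- 2 * pi * dl)) js) summable_on {js. length js = length bs}"
  by (intro summable_on_cmult_right summable_on_weight) (use dl(1) in auto)
 then show ?thesis by (rule Infinite_Sum.abs_summable_on_comparison_test') (use bd in auto)
qed

lemma averages_has_sum:
 assumes "holomorphic_cvec Om F" "ALL b:set bs. ALL z:Om. F (z + b) = F z" "set bs <= B" "z : Om"
 shows "((%js. averages bs js F z) has_sum F z) {js. length js = length bs}" using assms
proof (induction bs arbitrary: F)
 case (Cons b bs)
 have F: "holomorphic_cvec Om F" "ALL z:Om. F (z + b) = F z" "b : B" "set bs <= B" using Cons.prems by auto
 have per: "ALL b':set bs. ALL z:Om. average b j F (z + b') = average b j F z" for j
 proof (intro ballI)
  fix b' z assume "b' : set bs" "z : Om"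
  then show "average b j F (z + b') = average b j F z" using average_equivariant[of F b' 1 b z j] Cons.prems(2) F(3) by auto
 qed
 have "((%(j, js). averages (b # bs) (j # js) F z) has_sum F z) (SIGMA j:UNIV. {js. length js = length bs})"
 proof (rule has_sum_SigmaI)
  show "((%js. (case (j, js) of (j, js) => averages (b # bs) (j # js) F z)) has_sum average b j F z) {js. length js = length bs}" for j
  using Cons.IH[OF average_holomorphic[OF F(1,3)] per F(4) Cons.prems(4)] by simp
  show "((%j. average b j F z) has_sum F z) UNIV" by (rule average_has_sum[OF F(1,2,3) Cons.prems(4)])
  have "(%js. averages (b # bs) js F z) summable_on {js. length js = length (b # bs)}"
  by (rule abs_summable_summable[OF averages_abs_summable[OF Cons.prems]])
  then show "(%(j, js). averages (b # bs) (j # js) F z) summable_on (SIGMA j:UNIV. {js. length js = length bs})"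
  using summable_on_reindex_bij_betw[OF len_Suc_reindex[of "length bs"], of "%js. averages (b # bs) js F z"]
  by (simp add: case_prod_unfold)
 qed
 then show ?case using has_sum_reindex_bij_betw[OF len_Suc_reindex[of "length bs"], of "%js. averages (b # bs) js F z" "F z"]
  by (simp add: case_prod_unfold)
next
 case Nil
 then show ?case using has_sum_finite[of "{[] :: int list}" "%_. F z"] by simp
qed

lemma averages_shift_sum:
 assumes F: "holomorphic_cvec Om F" "ALL b:set bs. ALL z:Om. F (z + b) = F z" "set bs <= B" and z: "z : Om"
  and js: "length js = length bs" and ts: "!!i. i < length bs ==> 0 <= Im (ts i)"
 shows "averages bs js F (z + (\<Sum>i<length bs. ts i *s (bs ! i)))
  = ec (\<Sum>i<length bs. of_int (js ! i) * ts i) * averages bs js F z"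
proof -
 have "z + (\<Sum>i<k. ts i *s (bs ! i)) : Om & averages bs js F (z + (\<Sum>i<k. ts i *s (bs ! i)))
  = ec (\<Sum>i<k. of_int (js ! i) * ts i) * averages bs js F z" if "k <= length bs" for k using that
 proof (induction k)
  case (Suc k)
  then have k: "k < length bs" by simp
  from Suc have IH: "z + (\<Sum>i<k. ts i *s (bs ! i)) : Om" "averages bs js F (z + (\<Sum>i<k. ts i *s (bs ! i)))
  = ec (\<Sum>i<k. of_int (js ! i) * ts i) * averages bs js F z" by auto
  have "bs ! k : B" using F(3) nth_mem[OF k] by blast
  then show ?case using averages_shift[OF F IH(1) js k ts[OF k]] up[OF IH(1) _ ts[OF k]]
  by (simp add: IH(2) add.assoc[symmetric] ec_add mult_ac)
 qed (use z in simp)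
 then show ?thesis by simp
qed

text \<open>Each coefficient is a multiple of the exponential of the linear form that takes the values \<open>js\<close> on the
  periods.\<close>

lemma fourier_coefficients:
 assumes F: "holomorphic_cvec Om F" "ALL b:set bs. ALL z:Om. F (z + b) = F z" "set bs <= B"
  and z0: "z0 : Om" and z: "z : Om" and js: "length js = length bs"
  and ts: "z - z0 = (\<Sum>i<length bs. ts i *s (bs ! i))"
 shows "averages bs js F z = averages bs js F z0 * ec (\<Sum>i<length bs. of_int (js ! i) * ts i)"
proof -
 define \<sigma> where "\<sigma> i = \<i> * of_real \<bar>Im (ts i)\<bar>" for i
 have e1: "z0 + (\<Sum>i<length bs. (ts i + \<sigma> i) *s (bs ! i)) = z + (\<Sum>i<length bs. \<sigma> i *s (bs ! i))"
  using ts by (simp add: vector_sadd_rdistrib sum.distrib algebra_simps)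
 have e2: "averages bs js F (z0 + (\<Sum>i<length bs. (ts i + \<sigma> i) *s (bs ! i)))
  = ec (\<Sum>i<length bs. of_int (js ! i) * (ts i + \<sigma> i)) * averages bs js F z0"
  by (rule averages_shift_sum[OF F z0 js]) (auto simp: \<sigma>_def)
 have e3: "averages bs js F (z + (\<Sum>i<length bs. \<sigma> i *s (bs ! i)))
  = ec (\<Sum>i<length bs. of_int (js ! i) * \<sigma> i) * averages bs js F z"
  by (rule averages_shift_sum[OF F z js]) (auto simp: \<sigma>_def)
 have "ec (\<Sum>i<length bs. of_int (js ! i) * (ts i + \<sigma> i))
  = ec (\<Sum>i<length bs. of_int (js ! i) * \<sigma> i) * ec (\<Sum>i<length bs. of_int (js ! i) * ts i)"
  by (simp add: distrib_left sum.distrib ec_add)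
 with e2[unfolded e1 e3] have "ec (\<Sum>i<length bs. of_int (js ! i) * \<sigma> i) * averages bs js F z
  = ec (\<Sum>i<length bs. of_int (js ! i) * \<sigma> i) * (averages bs js F z0 * ec (\<Sum>i<length bs. of_int (js ! i) * ts i))"
  by (simp only: mult_ac)
 then show ?thesis by simp
qed

end

section \<open>Pell's equation\<close>

lemma nonsquare_norm:
 fixes D x y :: int
 assumes D: "!!s. s * s ~= D" and y: "y ~= 0" shows "x^2 - D * y^2 ~= 0"
proof
 assume 0: "x^2 - D * y^2 = 0"
 then have "y^2 dvd x^2" by (metis dvd_triv_right eq_iff_diff_eq_0)
 then have "y dvd x" by (simp add: pow_divides_pow_iff)
 then obtain s where "x = y * s" by (auto elim: dvdE)
 then have "y^2 * (s * s) = y^2 * D" using 0 by (simp add: power2_eq_square algebra_simps)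
 then show False using D[of s] y by simp
qed

text \<open>Good rational approximations \<open>x / y\<close> of the square root of \<open>D\<close> have norms bounded by a constant, and there
  are infinitely many, as the square root is irrational.\<close>

lemma infinitely_many_small_norms:
 fixes D :: int
 assumes D: "!!s. s * s ~= D" and D1: "D > 1"
 shows "EX B. infinite {(x, y). 0 < x & 0 < y & \<bar>x^2 - D * y^2\<bar> <= (B :: int)}"
proof -
 define r where "r = sqrt (of_int D)"
 have r: "r > 1" "r * r = of_int D" using D1 by (auto simp: r_def)
 define B where "B = \<lceil>2 * r + 1\<rceil>"
 define S where "S = {(x, y). 0 < x & 0 < y & \<bar>x^2 - D * y^2\<bar> <= B}"
 have fac: "of_int (x^2 - D * y^2) = (of_int x - of_int y * r) * (of_int x + of_int y * r)" for x y
  using r(2) by (simp add: power2_eq_square algebra_simps)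
 have "infinite S"
 proof
  assume fin: "finite S"
  define T where "T = insert 1 ((%(x, y). \<bar>of_int x - of_int y * r\<bar>) ` S)"
  have T: "finite T" "T ~= {}" using fin by (auto simp: T_def)
  have "t > 0" if "t : T" for t using that
  proof -
  have "of_int x - of_int y * r ~= 0" if "(x, y) : S" for x y
  proof
  assume "of_int x - of_int y * r = 0"
  then have "of_int (x^2 - D * y^2) = (0::real)" unfolding fac by simp
  moreover have "x^2 - D * y^2 ~= 0" by (rule nonsquare_norm[OF D]) (use that in "auto simp: S_def")
  ultimately show False by (simp only: of_int_eq_0_iff)
  qed
  then show ?thesis using \<open>t : T\<close> by (auto simp: T_def)
  qed
  then have "Min T > 0" using T by simp
  then obtain n :: nat where n: "inverse (of_nat (Suc n)) < Min T" using reals_Archimedean by blast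
  define N where "N = Suc n"
  have N: "N > 0" "1 / real N < Min T" using n by (auto simp: N_def inverse_eq_divide)
  obtain h k where hk: "0 < k" "k <= int N" "\<bar>of_int k * r - of_int h\<bar> < 1 / N"
  using Dirichlet_approx[OF N(1), of r] by blast
  have N1: "1 / real N <= 1" using N(1) by simp
  have k1: "1 <= real_of_int k" using hk(1) by simp
  have "real_of_int k * r \<ge> r" using mult_right_mono[OF k1, of r] r by simp
  then have "real_of_int h > 0" using hk(3) N1 r by linarith
  then have h0: "h > 0" by simp
  have "\<bar>of_int h - of_int k * r\<bar> * \<bar>of_int h + of_int k * r\<bar> <= 1 / N * (2 * (of_int k * r) + 1)"
  proof (rule mult_mono)
  show "\<bar>of_int h - of_int k * r\<bar> <= 1 / N" using hk(3) by linarith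
  show "\<bar>of_int h + of_int k * r\<bar> <= 2 * (of_int k * r) + 1" using hk(3) N1 h0 \<open>real_of_int k * r \<ge> r\<close> r by linarith
  qed auto
  also have "... <= 2 * r + 1"
  proof -
  have "real_of_int k <= real_of_int (int N)" using hk(2) by (simp only: of_int_le_iff)
  then have "of_int k / real N <= 1" using N(1) by simp
  then have "2 * r * (of_int k / real N) <= 2 * r * 1" using r by (intro mult_left_mono) auto
  moreover have "1 / real N * (2 * (of_int k * r) + 1) = 2 * r * (of_int k / real N) + 1 / real N"
  by (simp add: add_divide_distrib algebra_simps)
  ultimately show ?thesis using N1 by linarith
  qed
  finally have "\<bar>real_of_int (h^2 - D * k^2)\<bar> <= 2 * r + 1" unfolding fac abs_mult .
  then have "real_of_int \<bar>h^2 - D * k^2\<bar> <= of_int B" unfolding B_def by linarith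
  then have "\<bar>h^2 - D * k^2\<bar> <= B" by (simp only: of_int_le_iff)
  then have "(h, k) : S" using h0 hk(1) by (simp add: S_def)
  then have "\<bar>of_int h - of_int k * r\<bar> : T" unfolding T_def by force
  then have "Min T <= \<bar>of_int h - of_int k * r\<bar>" using T by simp
  then show False using hk(3) N(2) by linarith
 qed
 then show ?thesis unfolding S_def by blast
qed

text \<open>Two of the infinitely many elements with small norms have the same norm \<open>k\<close> and are congruent modulo
  \<open>k\<close>; their quotient is the unit.\<close>

lemma pell_equation:
 fixes D :: int
 assumes D: "!!s. s * s ~= D" and D1: "D > 1" shows "EX p q. 1 < p & 0 < q & p^2 - D * q^2 = 1"
proof -
 obtain B where inf: "infinite {(x, y). 0 < x & 0 < y & \<bar>x^2 - D * y^2\<bar> <= (B :: int)}"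
  using infinitely_many_small_norms[OF D D1] by blast
 let ?S = "{(x, y). 0 < x & 0 < y & \<bar>x^2 - D * y^2\<bar> <= (B :: int)}"
 define f where "f = (%(x, y). let k = x^2 - D * y^2 in (k, x mod k, y mod k))"
 have "f ` ?S <= {-B..B} \<times> {-B..B} \<times> {-B..B}"
 proof -
  have md: "\<bar>a mod k\<bar> <= B" if "k ~= 0" "\<bar>k\<bar> <= B" for a k :: int
  using abs_mod_less[OF that(1), of a] that(2) by linarith
  have "f (x, y) : {-B..B} \<times> {-B..B} \<times> {-B..B}" if "0 < x" "0 < y" "\<bar>x^2 - D * y^2\<bar> <= B" for x y
  using nonsquare_norm[OF D, of y x] md[of "x^2 - D * y^2" x] md[of "x^2 - D * y^2" y] that
  by (auto simp: f_def Let_def abs_le_iff)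
  then show ?thesis by blast
 qed
 then have "finite (f ` ?S)" by (rule finite_subset) auto
 from pigeonhole_infinite[OF inf this] obtain a where a: "infinite {b : ?S. f b = f a}" by blast
 then have "{b : ?S. f b = f a} ~= {}" by (rule infinite_imp_nonempty)
 then obtain b1 where b1: "b1 : {b : ?S. f b = f a}" by (metis (no_types, lifting) ex_in_conv)
 have "infinite ({b : ?S. f b = f a} - {b1})" using a by simp
 then have "{b : ?S. f b = f a} - {b1} ~= {}" by (rule infinite_imp_nonempty)
 then obtain b2 where b2: "b2 : {b : ?S. f b = f a} - {b1}" by (metis (no_types, lifting) ex_in_conv)
 define x1 y1 x2 y2 where "x1 = fst b1" and "y1 = snd b1" and "x2 = fst b2" and "y2 = snd b2"
 then have b: "b1 = (x1, y1)" "b2 = (x2, y2)" by simp_all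
 define k where "k = x1^2 - D * y1^2"
 have pos: "0 < x1" "0 < y1" "0 < x2" "0 < y2" and ne: "(x1, y1) ~= (x2, y2)" using b1 b2 b by auto
 have "f b2 = f b1" using b1 b2 by simp
 then have "x2^2 - D * y2^2 = k & x2 mod (x2^2 - D * y2^2) = x1 mod k & y2 mod (x2^2 - D * y2^2) = y1 mod k"
  unfolding b f_def Let_def prod.case prod.inject k_def[symmetric] .
 then have k2: "x2^2 - D * y2^2 = k" and md: "x2 mod k = x1 mod k" "y2 mod k = y1 mod k" by auto
 have k0: "k ~= 0" unfolding k_def by (rule nonsquare_norm[OF D]) (use pos in auto)
 have dx: "k dvd x2 - x1" and dy: "k dvd y2 - y1" using md by (simp_all add: mod_eq_dvd_iff)
 have "x1 * x2 - D * y1 * y2 = k + x1 * (x2 - x1) - D * y1 * (y2 - y1)" by (simp add: k_def power2_eq_square algebra_simps)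
 then have "k dvd x1 * x2 - D * y1 * y2" using dx dy by simp
 then obtain X where X: "x1 * x2 - D * y1 * y2 = k * X" by (auto elim: dvdE)
 have "x2 * y1 - x1 * y2 = (x2 - x1) * y1 - x1 * (y2 - y1)" by (simp add: algebra_simps)
 then have "k dvd x2 * y1 - x1 * y2" using dx dy by simp
 then obtain Y where Y: "x2 * y1 - x1 * y2 = k * Y" by (auto elim: dvdE)
 have "(x1 * x2 - D * y1 * y2)^2 - D * (x2 * y1 - x1 * y2)^2 = (x1^2 - D * y1^2) * (x2^2 - D * y2^2)"
  by (simp add: power2_eq_square algebra_simps)
 then have "k^2 * (X^2 - D * Y^2) = k^2 * 1" unfolding X Y k2 k_def[symmetric] by (simp add: power2_eq_square algebra_simps)
 then have XY: "X^2 - D * Y^2 = 1" using k0 by simp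
 have Y0: "Y ~= 0"
 proof
  assume "Y = 0"
  then have e: "x2 * y1 = x1 * y2" using Y by simp
  have "x2^2 * k = (x2 * x1)^2 - D * (x2 * y1)^2" by (simp add: k_def power_mult_distrib algebra_simps)
  also have "... = x1^2 * k" unfolding e by (simp add: k2[symmetric] power_mult_distrib algebra_simps)
  finally have "x2^2 = x1^2" using k0 by simp
  then have "x2 = x1" using pos by (simp add: power2_eq_iff_nonneg)
  then show False using e pos ne by simp
 qed
 have "X^2 = 1 + D * Y^2" using XY by simp
 moreover have "D * Y^2 > 0" using D1 Y0 by simp
 ultimately have "\<bar>X\<bar>^2 > 1^2" by simp
 then have "1 < \<bar>X\<bar>" by (rule power_less_imp_less_base) simp
 then show ?thesis using XY Y0 by (intro exI[of _ "\<bar>X\<bar>"] exI[of _ "\<bar>Y\<bar>"]) simp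
qed

lemma nonsquare_value:
 fixes a b :: int
 assumes a: "0 < a" and b: "0 < b" shows "EX s t. (s, t) ~= (0, 0) & (ALL u. u * u ~= s^2 * a + t^2 * b)"
proof (cases "(EX c. c * c = a) & (EX d. d * d = b)")
 case True
 then obtain c0 d0 where "c0 * c0 = a" "d0 * d0 = b" by blast
 then have cd: "\<bar>c0\<bar> * \<bar>c0\<bar> = a" "\<bar>d0\<bar> * \<bar>d0\<bar> = b" by auto
 define c d where "c = \<bar>c0\<bar>" "d = \<bar>d0\<bar>"
 have cd: "c * c = a" "d * d = b" "0 < c" "0 < d" using cd a b by (auto simp: c_d_def)
 \<comment> \<open>For \<open>t = a\<close> the value lies strictly between two consecutive squares.\<close>
 have "u * u ~= 1^2 * a + a^2 * b" for u
 proof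
  assume u: "u * u = 1^2 * a + a^2 * b"
  have e: "1^2 * a + a^2 * b = (d * a) * (d * a) + a" by (simp add: cd(2)[symmetric] power2_eq_square algebra_simps)
  have da: "0 < d * a" using a cd by simp
  have "(d * a)^2 < \<bar>u\<bar>^2" using u a unfolding e by (simp add: power2_eq_square)
  then have 1: "d * a < \<bar>u\<bar>" by (rule power_less_imp_less_base) simp
  have "a <= d * a" using a cd(4) by simp
  then have "\<bar>u\<bar>^2 < (d * a + 1)^2" using u da unfolding e by (simp add: power2_eq_square algebra_simps)
  then have "\<bar>u\<bar> < d * a + 1" by (rule power_less_imp_less_base) (use da in simp)
  then show False using 1 by simp
 qed
 then show ?thesis by (intro exI[of _ 1] exI[of _ a]) auto
next
 case False
 then consider "ALL c. c * c ~= a" | "ALL d. d * d ~= b" by blast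
 then show ?thesis
 proof cases
  case 1
  then show ?thesis by (intro exI[of _ 1] exI[of _ 0]) auto
 next
  case 2
  then show ?thesis by (intro exI[of _ 0] exI[of _ 1]) auto
 qed
qed

section \<open>Groups of finite index\<close>

primrec mpow :: "real ^ 'm ^ 'm => nat => real ^ 'm ^ 'm" where
 "mpow g 0 = mat 1"
| "mpow g (Suc n) = g ** mpow g n"

lemma mpow_add: "mpow g (m + n) = mpow g m ** mpow g n" by (induction m) (auto simp: matrix_mul_assoc)

lemma O_plus_mult_closed:
 assumes "g : carrier (O_plus Q L D)" "h : carrier (O_plus Q L D)" shows "g ** h : carrier (O_plus Q L D)"
proof -
 have g: "(%x. g *v x) ` L = L" "!!x y. x : L ==> y : L ==> rform Q (g *v x) (g *v y) = rform Q x y"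
  "(%om. cmat g *v om) ` D = D"
  and h: "(%x. h *v x) ` L = L" "!!x y. x : L ==> y : L ==> rform Q (h *v x) (h *v y) = rform Q x y"
  "(%om. cmat h *v om) ` D = D" using assms by (auto simp: O_plus_def)
 have "cmat (g ** h) = cmat g ** cmat h" by (simp add: cmat_def matrix_matrix_mult_def vec_eq_iff)
 then have "(%om. cmat (g ** h) *v om) ` D = (%om. cmat g *v om) ` (%om. cmat h *v om) ` D"
  by (simp add: image_image matrix_vector_mul_assoc)
 moreover have "(%x. (g ** h) *v x) ` L = (%x. g *v x) ` (%x. h *v x) ` L" by (simp add: image_image matrix_vector_mul_assoc)
 moreover have "rform Q ((g ** h) *v x) ((g ** h) *v y) = rform Q x y" if "x : L" "y : L" for x y
 proof -
  have "h *v x : L" "h *v y : L" using that h(1) by auto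
  then show ?thesis using g(2) h(2) that by (simp add: matrix_vector_mul_assoc[symmetric])
 qed
 ultimately show ?thesis using g h by (simp add: O_plus_def)
qed

lemma mpow_carrier:
 assumes "g : carrier (O_plus Q L D)" shows "mpow g (Suc n) : carrier (O_plus Q L D)"
proof (induction n)
 case (Suc n)
 then show ?case using O_plus_mult_closed[OF assms] by simp
qed (use assms in simp)

text \<open>Two powers of \<open>g\<close> lie in the same coset.\<close>

lemma finite_index_power:
 assumes \<Gamma>: "subgroup \<Gamma> (O_plus Q L D)" "finite (rcosets\<^bsub>O_plus Q L D\<^esub> \<Gamma>)"
  and g: "g : carrier (O_plus Q L D)" and inv: "h ** g = mat 1" "g ** h = mat 1" shows "\<exists>j>0. mpow g j : \<Gamma>"
proof -
 let ?G = "O_plus Q L D"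
 let ?c = "%n. \<Gamma> #>\<^bsub>?G\<^esub> mpow g (Suc n)"
 have "range ?c <= rcosets\<^bsub>?G\<^esub> \<Gamma>" using mpow_carrier[OF g] unfolding RCOSETS_def by blast
 then have "finite (range ?c)" using \<Gamma>(2) finite_subset by blast
 then have "~ inj ?c" using finite_imageD[of ?c UNIV] by auto
 then obtain m n where mn: "m < n" "?c m = ?c n" unfolding inj_def by (metis nat_neq_iff)
 have one: "mat 1 : \<Gamma>" using subgroup.one_closed[OF \<Gamma>(1)] by (simp add: O_plus_def)
 have "mpow g (Suc n) : ?c n" unfolding r_coset_def using one by (auto simp: O_plus_def intro!: bexI[of _ "mat 1"])
 then have "mpow g (Suc n) : ?c m" by (simp only: mn(2))
 then have "EX a:\<Gamma>. mpow g (Suc n) = a ** mpow g (Suc m)" unfolding r_coset_def by (simp add: O_plus_def)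
 then obtain a where a: "a : \<Gamma>" "mpow g (Suc n) = a ** mpow g (Suc m)" by (elim bexE)
 define b where "b = mpow h (Suc m)"
 have canc: "mpow g k ** mpow h k = mat 1" for k
 proof (induction k)
  case (Suc k)
  have "mpow g (k + 1) ** mpow h (Suc k) = mpow g k ** (g ** h) ** mpow h k" unfolding mpow_add by (simp add: matrix_mul_assoc)
  then show ?case using Suc inv by simp
 qed simp
 have "n = (n - m) + m" using mn by simp
 then have "mpow g (Suc n) = mpow g (n - m) ** mpow g (Suc m)" by (metis mpow_add add_Suc_right)
 then have "mpow g (n - m) ** (mpow g (Suc m) ** b) = a ** (mpow g (Suc m) ** b)" using a(2) by (simp only: matrix_mul_assoc)
 then have "mpow g (n - m) = a" unfolding b_def canc by simp
 then show ?thesis using a(1) mn(1) by (intro exI[of _ "n - m"]) auto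
qed

lemma isometric_of_lattice:
 assumes "span L = UNIV" "!!x y. x : L ==> y : L ==> rform Q (g *v x) (g *v y) = rform Q x y" shows "isometric Q g"
proof -
 have 1: "rform Q (g *v x) (g *v y) = rform Q x y" if "x : L" for x y
 proof -
  have "y : span L" using assms(1) by simp
  then show ?thesis by (induction rule: span_induct_alt)
  (auto simp: rform_simps matrix_vector_right_distrib matrix_vector_mult_scaleR assms(2) that)
 qed
 have "rform Q (g *v x) (g *v y) = rform Q x y" for x y
 proof -
  have "x : span L" using assms(1) by simp
  then show ?thesis by (induction rule: span_induct_alt)
  (auto simp: rform_simps matrix_vector_right_distrib matrix_vector_mult_scaleR 1)
 qed
 then show ?thesis by (simp add: isometric_def)
qed

lemma isometric_inverse:
 assumes "isometric Q g" "g ** h = mat 1" shows "isometric Q h"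
proof -
 have "rform Q (h *v x) (h *v y) = rform Q (g *v (h *v x)) (g *v (h *v y))" for x y using assms(1) by (simp add: isometric_def)
 then show ?thesis using assms(2) by (simp add: isometric_def matrix_vector_mul_assoc)
qed

text \<open>The isometry permutes the connected components of the cone, and it maps a point of \<open>D\<close> into \<open>D\<close>.\<close>

lemma (in sublattice_pair) isometric_D:
 assumes g: "isometric Q g" and w: "w : D" "cmat g *v w : D" and y: "y : D" shows "cmat g *v y : D"
proof -
 have "continuous_on X (%v. cmat g *v v)" for X unfolding matrix_vector_mult_def by (intro continuous_intros)
 then have "connected ((%v. cmat g *v v) ` D)" by (intro connected_continuous_image in_components_connected[OF D])
 moreover have "(%v. cmat g *v v) ` D <= period_cone Q L"
 proof
  fix x assume "x : (%v. cmat g *v v) ` D"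
  then obtain v where v: "v : D" "x = cmat g *v v" by blast
  have "cnjvec (cmat g *v v) = cmat g *v cnjvec v" by (simp add: vec_eq_iff cnjvec_def cmat_def matrix_vector_mult_def)
  then show "x : period_cone Q L" using D_period_cone[OF v(1)] isometric_cform[OF g] by (simp add: period_cone_def v(2))
 qed
 ultimately have "(%v. cmat g *v v) ` D <= D" by (rule components_maximal[OF D]) (use w in blast)
 then show ?thesis using y by blast
qed

lemma (in sublattice_pair) O_plus_carrierI:
 assumes g: "isometric Q g" and inv: "g ** h = mat 1" "h ** g = mat 1"
  and gL: "!!x. x : L ==> g *v x : L" and hL: "!!x. x : L ==> h *v x : L"
  and w: "w : D" "cmat g *v w : D" shows "g : carrier (O_plus Q L D)"
proof -
 have h: "isometric Q h" by (rule isometric_inverse[OF g inv(1)])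
 have cm: "cmat g *v (cmat h *v v) = v" "cmat h *v (cmat g *v v) = v" for v
 proof -
  have "cmat (a ** b) = cmat a ** cmat b" for a b :: "real ^ 'm ^ 'm" by (simp add: cmat_def matrix_matrix_mult_def vec_eq_iff)
  moreover have "cmat (mat 1) = (mat 1 :: complex ^ 'm ^ 'm)" by (simp add: cmat_def mat_def vec_eq_iff)
  ultimately show "cmat g *v (cmat h *v v) = v" "cmat h *v (cmat g *v v) = v"
  using inv by (metis matrix_vector_mul_assoc matrix_vector_mul_lid)+
 qed
 have "(%x. g *v x) ` L = L"
 proof
  show "L <= (%x. g *v x) ` L" using hL inv(1) by (auto intro!: image_eqI[of _ _ "h *v _"] simp: matrix_vector_mul_assoc)
 qed (use gL in auto)
 moreover have "(%om. cmat g *v om) ` D = D"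
 proof
  show "(%om. cmat g *v om) ` D <= D" using isometric_D[OF g w] by auto
  show "D <= (%om. cmat g *v om) ` D"
  proof
  fix v assume v: "v : D"
  have "cmat h *v v : D" by (rule isometric_D[OF h w(2) _ v]) (simp add: cm w(1))
  then show "v : (%om. cmat g *v om) ` D" by (intro image_eqI[of _ _ "cmat h *v v"]) (simp_all add: cm)
  qed
 qed
 ultimately show ?thesis using g by (simp add: O_plus_def isometric_def)
qed

section \<open>Transvections and boosts\<close>

lemma hol_cvec_compose:
 assumes H: "holomorphic_cvec V H" and Y: "!!i. holomorphic_cvec U (%y. Y y $ i)" "!!y. y : U ==> Y y : V"
 shows "holomorphic_cvec U (%y. H (Y y))" unfolding holomorphic_cvec_def
proof
 fix y assume y: "y : U"
 define Y' where "Y' v = (\<chi> i. frechet_derivative (%y. Y y $ i) (at y) v)" for v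
 have "(Y has_derivative Y') (at y)" unfolding has_derivative_componentwise_within[of Y]
 proof
  fix b :: "complex ^ 'a" assume "b : Basis"
  then obtain u i where b: "b = axis i u" "u : Basis" by (auto simp: Basis_vec_def)
  have "((%y. Y y $ i \<bullet> u) has_derivative (%v. frechet_derivative (%y. Y y $ i) (at y) v \<bullet> u)) (at y)"
  by (rule has_derivative_inner_left[OF holomorphic_cvecD(1)[OF Y(1) y]])
  then show "((%x. Y x \<bullet> b) has_derivative (%x. Y' x \<bullet> b)) (at y)" by (simp add: b inner_axis Y'_def)
 qed
 from has_derivative_compose[OF this holomorphic_cvecD(1)[OF H Y(2)[OF y]]]
 have "((%y. H (Y y)) has_derivative (%v. frechet_derivative H (at (Y y)) (Y' v))) (at y)" .
 moreover have "Y' (c *s v) = c *s Y' v" for c v by (simp add: Y'_def vec_eq_iff holomorphic_cvecD(2)[OF Y(1) y])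
 ultimately show "EX H'. ((%y. H (Y y)) has_derivative H') (at y) & (ALL c v. H' (c *s v) = c * H' v)"
  using holomorphic_cvecD(2)[OF H Y(2)[OF y]] by (intro exI conjI) auto
qed

lemma real_matrix_of_linear:
 fixes g :: "real ^ 'm => real ^ 'm"
 assumes "!!v w. g (v + w) = g v + g w" "!!c v. g (c *\<^sub>R v) = c *\<^sub>R g v" shows "matrix g *v v = g v"
proof -
 have "Vector_Spaces.linear (*s) (*s) g"
  by unfold_locales (use assms in "auto simp: scalar_mult_eq_scaleR vector_add_ldistrib vector_sadd_rdistrib scaleR_left_distrib")
 from matrix_works[OF this] show ?thesis .
qed

lemma transvection_apply:
 "transvection Q m l *v v = v - rform Q m v *\<^sub>R l + rform Q l v *\<^sub>R m - (1/2 * rform Q m m * rform Q l v) *\<^sub>R l"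
 unfolding transvection_def by (rule real_matrix_of_linear) (simp_all add: rform_simps algebra_simps)

lemma transvection_apply_cplx:
 "cmat (transvection Q m l) *v v = v - cform Q (cvec m) v *s cvec l + cform Q (cvec l) v *s cvec m
  - (1/2 * of_real (rform Q m m) * cform Q (cvec l) v) *s cvec l"
proof -
 have "cvec (transvection Q m l *v a) + \<i> *s cvec (transvection Q m l *v b)
  = (cvec a + \<i> *s cvec b) - cform Q (cvec m) (cvec a + \<i> *s cvec b) *s cvec l
  + cform Q (cvec l) (cvec a + \<i> *s cvec b) *s cvec m
  - (1/2 * of_real (rform Q m m) * cform Q (cvec l) (cvec a + \<i> *s cvec b)) *s cvec l" for a b
  by (simp add: transvection_apply cvec_add cvec_diff cvec_scale cform_simps cform_cvec vec_eq_iff algebra_simps)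
 from this[of "Revec v" "Imvec v"] show ?thesis unfolding cmat_decomp by (simp only: Re_Im_decomp[symmetric])
qed

definition boost :: "real ^ 'm ^ 'm => real ^ 'm => real ^ 'm => real => real => real => real ^ 'm ^ 'm" where
 "boost Q y w a b c = matrix (%v. v + rform Q v y *\<^sub>R (a *\<^sub>R y + b *\<^sub>R w) - rform Q v w *\<^sub>R (c *\<^sub>R w + b *\<^sub>R y))"

lemma boost_apply:
 "boost Q y w a b c *v v = v + rform Q v y *\<^sub>R (a *\<^sub>R y + b *\<^sub>R w) - rform Q v w *\<^sub>R (c *\<^sub>R w + b *\<^sub>R y)"
 unfolding boost_def by (rule real_matrix_of_linear) (simp_all add: rform_simps algebra_simps)

text \<open>A solution \<open>p\<^sup>2 - A B q\<^sup>2 = 1\<close> gives an isometry of the plane spanned by orthogonal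
  vectors \<open>y\<close> and \<open>w\<close> of norms \<open>A\<close> and \<open>-B\<close>, namely the square of the multiplication by \<open>p + q sqrt (A B)\<close>.
  It is extended by the identity. For integral \<open>p\<close> and \<open>q\<close> it differs from the identity by integral
  multiples of maps \<open>v \<mapsto> (v, y) w\<close> and the like, so it preserves lattices containing \<open>y\<close> and \<open>w\<close>.\<close>

context symmetric_form
begin

context
 fixes y w :: "real ^ 'm" and A B p q :: real
 assumes yw: "rform Q y y = A" "rform Q w w = - B" "rform Q y w = 0" and pell: "p^2 - A * B * q^2 = 1"
begin

abbreviation "boost_p p' q' \<equiv> boost Q y w (2 * B * q'^2) (2 * p' * q') (2 * A * q'^2)"

lemma boost_isometric: "isometric Q (boost_p p q)" unfolding isometric_def
proof (intro allI)
 fix v v'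
 have p2: "p * p = 1 + A * B * (q * q)" using pell by (simp add: power2_eq_square)
 define s t s' t' where "s = rform Q v y" "t = rform Q v w" "s' = rform Q v' y" "t' = rform Q v' w"
 note st = s_t_s'_t'_def
 have sym: "rform Q y v' = s'" "rform Q w v' = t'" "rform Q w y = 0"
  using yw(3) rform_sym[of y v'] rform_sym[of w v'] rform_sym[of w y] by (simp_all add: st)
 define a b c where "a = 2 * B * q^2" "b = 2 * p * q" "c = 2 * A * q^2"
 note abc = a_b_c_def
 have "b * b = 4 * (q * q) * (p * p)" by (simp add: abc)
 then have bb: "b * b = 4 * (q * q) * (1 + A * B * (q * q))" using p2 by simp
 have r1: "2 * a + A * a^2 - B * b^2 = 0" "2 * c + B * c^2 - A * b^2 = 0" "A * a = B * c"
  unfolding power2_eq_square bb by (simp_all add: abc power2_eq_square algebra_simps)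
 have ap: "boost_p p q *v x = x + rform Q x y *\<^sub>R (a *\<^sub>R y + b *\<^sub>R w) - rform Q x w *\<^sub>R (c *\<^sub>R w + b *\<^sub>R y)" for x
  by (simp only: boost_apply abc)
 have "rform Q (boost_p p q *v v) (boost_p p q *v v')
  = rform Q v v' + (2 * a + A * a^2 - B * b^2) * (s * s') - b * (A * a - B * c) * (s * t' + t * s')
  - (2 * c + B * c^2 - A * b^2) * (t * t')"
  unfolding ap by (simp add: rform_simps yw sym st[symmetric] power2_eq_square algebra_simps)
 then show "rform Q (boost_p p q *v v) (boost_p p q *v v') = rform Q v v'" using r1 by simp
qed

lemma boost_inverse: "boost_p p q ** boost_p p (- q) = mat 1" "boost_p p (- q) ** boost_p p q = mat 1"
proof -
 have p2: "p * p = 1 + A * B * (q * q)" using pell by (simp add: power2_eq_square)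
 have wy: "rform Q w y = 0" using yw(3) rform_sym[of w y] by simp
 have "boost_p p' q' *v (boost_p p' (- q') *v v) = v" if "p' * p' = 1 + A * B * (q' * q')" for p' q' v
 proof -
  define s t where "s = rform Q v y" "t = rform Q v w"
  note st = s_t_def
  define a b c where "a = 2 * B * (q' * q')" "b = 2 * p' * q'" "c = 2 * A * (q' * q')"
  note abc = a_b_c_def
  have r: "2 * a + A * (a * a) - B * (b * b) = 0" "2 * c + B * (c * c) - A * (b * b) = 0" "A * a = B * c"
  proof -
  have "b * b = 4 * (q' * q') * (p' * p')" by (simp add: abc)
  then have bb: "b * b = 4 * (q' * q') * (1 + A * B * (q' * q'))" using that by simp
  show "2 * a + A * (a * a) - B * (b * b) = 0" "2 * c + B * (c * c) - A * (b * b) = 0" "A * a = B * c"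
  unfolding bb by (simp_all add: abc algebra_simps)
  qed
  define v1 where "v1 = v + s *\<^sub>R (a *\<^sub>R y - b *\<^sub>R w) - t *\<^sub>R (c *\<^sub>R w - b *\<^sub>R y)"
  have v1: "boost_p p' (- q') *v v = v1" by (simp add: boost_apply v1_def st abc power2_eq_square algebra_simps)
  have v1y: "rform Q v1 y = s + A * (s * a + t * b)" and v1w: "rform Q v1 w = t + B * (s * b + t * c)"
  by (simp_all add: v1_def rform_simps yw wy st[symmetric] algebra_simps)
  have "boost_p p' q' *v v1 = v1 + (s + A * (s * a + t * b)) *\<^sub>R (a *\<^sub>R y + b *\<^sub>R w)
  - (t + B * (s * b + t * c)) *\<^sub>R (c *\<^sub>R w + b *\<^sub>R y)"
  by (simp add: boost_apply v1y v1w abc power2_eq_square)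
  also have "... = v + (s * (2 * a + A * (a * a) - B * (b * b)) + t * b * (A * a - B * c)) *\<^sub>R y
  + (s * b * (A * a - B * c) - t * (2 * c + B * (c * c) - A * (b * b))) *\<^sub>R w"
  by (simp add: v1_def vec_eq_iff algebra_simps)
  also have "... = v" unfolding r by simp
  finally have "boost_p p' q' *v v1 = v" .
  then show ?thesis by (simp only: v1)
 qed
 from this[of p q] this[of p "- q"] p2
 show "boost_p p q ** boost_p p (- q) = mat 1" "boost_p p (- q) ** boost_p p q = mat 1"
  by (simp_all add: matrix_eq matrix_vector_mul_assoc[symmetric])
qed

lemma boost_orbit:
 assumes p1: "p \<ge> 2" and q0: "q > 0" and AB: "A > 0" "B > 0"
 shows "EX P R. mpow (boost_p p q) m *v y = P *\<^sub>R y + (R * A) *\<^sub>R w & P \<ge> 2 ^ m & R \<ge> 0"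
proof (induction m)
 case 0
 then show ?case by (intro exI[of _ 1] exI[of _ 0]) simp
next
 case (Suc m)
 then obtain P R where PR: "mpow (boost_p p q) m *v y = P *\<^sub>R y + (R * A) *\<^sub>R w" "P \<ge> 2 ^ m" "R \<ge> 0" by blast
 define p' where "p' = 1 + 2 * A * B * q^2"
 have wy: "rform Q w y = 0" using yw(3) rform_sym[of w y] by simp
 have "mpow (boost_p p q) (Suc m) *v y = boost_p p q *v (P *\<^sub>R y + (R * A) *\<^sub>R w)"
  by (simp add: PR(1)[symmetric] matrix_vector_mul_assoc)
 also have "... = (P * p' + R * A * B * (2 * p * q)) *\<^sub>R y + ((P * (2 * p * q) + R * p') * A) *\<^sub>R w"
  by (simp add: boost_apply rform_simps yw wy p'_def power2_eq_square algebra_simps)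
 finally have eq: "mpow (boost_p p q) (Suc m) *v y
  = (P * p' + R * A * B * (2 * p * q)) *\<^sub>R y + ((P * (2 * p * q) + R * p') * A) *\<^sub>R w" .
 have "A * B * q^2 = p^2 - 1" using pell by simp
 moreover have "p^2 \<ge> 2^2" using p1 by (intro power_mono) auto
 ultimately have p'2: "p' \<ge> 2" by (simp add: p'_def)
 have P0: "P \<ge> 0" using PR(2) by (rule order_trans[rotated]) simp
 have "2 ^ m * 2 <= P * p'" using PR(2) p'2 P0 by (intro mult_mono) auto
 moreover have "0 <= R * A * B * (2 * p * q)" using PR(3) AB p1 q0 by simp
 ultimately have "2 ^ Suc m <= P * p' + R * A * B * (2 * p * q)" unfolding power_Suc by linarith
 moreover have "0 <= P * (2 * p * q) + R * p'" using PR(3) P0 p1 q0 p'2 by simp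
 ultimately show ?case using eq by blast
qed

end

end

section \<open>Exponential sums\<close>

lemma span_list:
 fixes bs :: "'a::real_vector list"
 assumes "x : span (set bs)" shows "EX ts. x = (\<Sum>i<length bs. ts i *\<^sub>R (bs ! i))"
proof -
 let ?S = "{x. EX ts. x = (\<Sum>i<length bs. ts i *\<^sub>R (bs ! i))}"
 have "subspace ?S" unfolding subspace_def
 proof (intro conjI ballI allI)
  show "0 : ?S" by (auto intro!: exI[of _ "%_. 0"])
  fix x assume "x : ?S"
  then obtain s where s: "x = (\<Sum>i<length bs. s i *\<^sub>R (bs ! i))" by blast
  show "c *\<^sub>R x : ?S" for c by (auto intro!: exI[of _ "%i. c * s i"] simp: s scaleR_sum_right)
  fix y assume "y : ?S"
  then obtain t where t: "y = (\<Sum>i<length bs. t i *\<^sub>R (bs ! i))" by blast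
  show "x + y : ?S" by (auto intro!: exI[of _ "%i. s i + t i"] simp: s t sum.distrib scaleR_add_left)
 qed
 moreover have "set bs <= ?S"
 proof
  fix b assume "b : set bs"
  then obtain j where j: "j < length bs" "b = bs ! j" by (auto simp: in_set_conv_nth)
  have "(\<Sum>i<length bs. (if i = j then 1 else 0) *\<^sub>R (bs ! i)) = (\<Sum>i<length bs. if i = j then bs ! i else 0)"
  by (rule sum.cong) auto
  also have "... = b" using j by (simp add: sum.delta)
  finally show "b : ?S" by (auto intro!: exI[of _ "%i. if i = j then 1 else 0"])
 qed
 ultimately have "span (set bs) <= ?S" by (rule span_minimal[rotated])
 then show ?thesis using assms by blast
qed

text \<open>Used for rational points in open cones.\<close>

lemma rational_span_dense:
 fixes X :: "'a::real_normed_vector set"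
 assumes X0: "0 : X" and Xadd: "!!x y. x : X ==> y : X ==> x + y : X"
  and Xscale: "!!q x. q : \<rat> ==> x : X ==> q *\<^sub>R x : X" shows "span X <= closure X"
proof (rule span_minimal)
 show "X <= closure X" by (rule closure_subset)
 show "subspace (closure X)" unfolding subspace_def
 proof (intro conjI ballI allI)
  show "0 : closure X" using X0 closure_subset by blast
  fix x assume "x : closure X"
  then obtain s where s: "ALL n. s n : X" "s \<longlonglongrightarrow> x" by (auto simp: closure_sequential)
  {
  fix c :: real
  have "c : closure \<rat>" by (simp add: Rats_closure_real)
  then obtain q where q: "ALL n. q n : \<rat>" "q \<longlonglongrightarrow> c" unfolding closure_sequential by blast
  have "(%n. q n *\<^sub>R s n) \<longlonglongrightarrow> c *\<^sub>R x" by (intro tendsto_scaleR q s)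
  moreover have "ALL n. q n *\<^sub>R s n : X" using q s Xscale by blast
  ultimately show "c *\<^sub>R x : closure X" unfolding closure_sequential by (intro exI conjI)
  }
  fix y assume "y : closure X"
  then obtain t where t: "ALL n. t n : X" "t \<longlonglongrightarrow> y" by (auto simp: closure_sequential)
  have "(%n. s n + t n) \<longlonglongrightarrow> x + y" by (intro tendsto_add t s)
  moreover have "ALL n. s n + t n : X" using t s Xadd by blast
  ultimately show "x + y : closure X" unfolding closure_sequential by (intro exI conjI)
 qed
qed

lemma power_series_leading_coefficient:
 fixes c :: "nat => complex"
 assumes \<sigma>: "\<sigma> > 0" and g: "!!t. norm t < \<sigma> ==> (%n. c n * t ^ n) sums g t"
  and lim: "((%t. g t / t ^ \<nu>) \<longlongrightarrow> G) (at 0)" shows "c \<nu> = G"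
proof -
 have lim_j: "((%t. g t / t ^ j) \<longlongrightarrow> c j) (at 0)" if "!!i. i < j ==> c i = 0" for j
 proof -
  have "((%t. g t / t ^ j) \<longlongrightarrow> c (0 + j)) (at 0)"
  proof (rule powser_limit_0_strong[OF \<sigma>, where a = "%n. c (n + j)"])
  fix t :: complex assume t: "t ~= 0" "norm t < \<sigma>"
  have "(%n. c (n + j) * t ^ (n + j)) sums (g t - (\<Sum>i<j. c i * t ^ i))"
  using sums_split_initial_segment[OF g[OF t(2)], of j] by simp
  then have "(%n. c (n + j) * t ^ (n + j)) sums g t" using that by simp
  from sums_divide[OF this, of "t ^ j"] show "(%n. c (n + j) * t ^ n) sums (g t / t ^ j)" using t(1) by (simp add: power_add)
  qed
  then show ?thesis by simp
 qed
 have "c j = 0" if "j < \<nu>" for j using that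
 proof (induction j rule: less_induct)
  case (less j)
  then have "((%t. g t / t ^ j) \<longlongrightarrow> c j) (at 0)" by (intro lim_j) auto
  moreover have "((%t. g t / t ^ \<nu> * t ^ (\<nu> - j)) \<longlongrightarrow> G * 0 ^ (\<nu> - j)) (at 0)"
  by (intro tendsto_mult lim tendsto_power tendsto_ident_at)
  then have "((%t. g t / t ^ j) \<longlongrightarrow> G * 0 ^ (\<nu> - j)) (at 0)"
  proof (rule Lim_transform_eventually)
  show "\<forall>\<^sub>F t in at 0. g t / t ^ \<nu> * t ^ (\<nu> - j) = g t / t ^ j" unfolding eventually_at_filter
  proof (rule always_eventually, intro allI impI)
  fix t :: complex assume "t ~= 0"
  moreover have "t ^ \<nu> = t ^ (\<nu> - j) * t ^ j" using less.prems by (simp add: power_add[symmetric])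
  ultimately show "g t / t ^ \<nu> * t ^ (\<nu> - j) = g t / t ^ j" by simp
  qed
  qed
  ultimately have "c j = G * 0 ^ (\<nu> - j)" by (rule tendsto_unique[rotated]) simp
  then show ?case using less.prems by simp
 qed
 then have "((%t. g t / t ^ \<nu>) \<longlongrightarrow> c \<nu>) (at 0)" by (rule lim_j)
 from tendsto_unique[OF _ this lim] show ?thesis by simp
qed

text \<open>If an exponential sum in \<open>t\<close> converges near \<open>0\<close>, then it converges absolutely there, and evaluating
  it at four points \<open>\<rho> \<i>\<^sup>k\<close> bounds the sum with all \<open>t w\<close> replaced by positive real numbers. So it may
  be expanded in powers of \<open>t\<close> term by term.\<close>

lemma exponential_sum_leading_coefficient:
 fixes A w :: "'i => complex"
 assumes \<rho>: "\<rho> > 0" and g: "!!t. norm t < \<rho> ==> ((%i. A i * exp (t * w i)) has_sum g t) I"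
  and lim: "((%t. g t / t ^ \<nu>) \<longlongrightarrow> G) (at 0)" shows "((%i. A i * w i ^ \<nu> / fact \<nu>) has_sum G) I"
proof -
 define \<sigma> where "\<sigma> = \<rho> / 4"
 have \<sigma>: "\<sigma> > 0" using \<rho> by (simp add: \<sigma>_def)
 have abs: "(%i. norm (A i) * exp (Re (t * w i))) summable_on I" if "norm t < \<rho>" for t
 proof -
  have "(%i. norm (A i * exp (t * w i))) summable_on I"
  using has_sum_imp_summable[OF g[OF that]] by (simp add: summable_on_iff_abs_summable_on_complex)
  then show ?thesis by (simp add: norm_mult)
 qed
 have big: "(%i. norm (A i) * exp (\<sigma> * norm (w i))) summable_on I"
 proof (rule summable_on_comparison_test)
  let ?r = "complex_of_real (\<rho> / 2)"
  show "(%i. norm (A i) * exp (Re (?r * w i)) + norm (A i) * exp (Re (- ?r * w i))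
  + (norm (A i) * exp (Re (\<i> * ?r * w i)) + norm (A i) * exp (Re (- (\<i> * ?r) * w i)))) summable_on I"
  by (intro summable_on_add abs) (use \<rho> in "auto simp: norm_mult")
  fix i
  have "norm (w i) <= \<bar>Re (w i)\<bar> + \<bar>Im (w i)\<bar>" by (rule cmod_le)
  then have "norm (w i) <= 2 * \<bar>Re (w i)\<bar> | norm (w i) <= 2 * \<bar>Im (w i)\<bar>" by linarith
  then have "\<rho> / 4 * norm (w i) <= \<rho> / 4 * (2 * \<bar>Re (w i)\<bar>) | \<rho> / 4 * norm (w i) <= \<rho> / 4 * (2 * \<bar>Im (w i)\<bar>)"
  using \<rho> mult_left_mono[of "norm (w i)" _ "\<rho> / 4"] by fastforce
  then have "\<sigma> * norm (w i) <= \<rho> / 2 * \<bar>Re (w i)\<bar> | \<sigma> * norm (w i) <= \<rho> / 2 * \<bar>Im (w i)\<bar>"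
  by (simp add: \<sigma>_def)
  then have "\<sigma> * norm (w i) <= Re (?r * w i) | \<sigma> * norm (w i) <= Re (- ?r * w i) |
  \<sigma> * norm (w i) <= Re (\<i> * ?r * w i) | \<sigma> * norm (w i) <= Re (- (\<i> * ?r) * w i)"
  by (auto simp: abs_if split: if_splits)
  then have "exp (\<sigma> * norm (w i)) <= exp (Re (?r * w i)) + exp (Re (- ?r * w i))
  + (exp (Re (\<i> * ?r * w i)) + exp (Re (- (\<i> * ?r) * w i)))" by (smt (verit) exp_le_cancel_iff exp_gt_zero)
  from mult_left_mono[OF this norm_ge_zero[of "A i"]]
  show "norm (A i) * exp (\<sigma> * norm (w i)) <= norm (A i) * exp (Re (?r * w i)) + norm (A i) * exp (Re (- ?r * w i))
  + (norm (A i) * exp (Re (\<i> * ?r * w i)) + norm (A i) * exp (Re (- (\<i> * ?r) * w i)))" by (simp only: distrib_left)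
 qed auto
 have inner: "((%n. norm (A i * w i ^ n / fact n * t ^ n)) has_sum norm (A i) * exp (norm (w i) * norm t)) UNIV" for i t
 proof (rule sums_nonneg_imp_has_sum)
  have "(%n. norm (A i) * ((norm (w i) * norm t) ^ n /\<^sub>R fact n)) sums (norm (A i) * exp (norm (w i) * norm t))"
  by (intro sums_mult exp_converges)
  then show "(%n. norm (A i * w i ^ n / fact n * t ^ n)) sums (norm (A i) * exp (norm (w i) * norm t))"
  by (simp add: norm_mult norm_divide norm_inverse norm_power power_mult_distrib divide_inverse mult_ac)
 qed auto
 have inner': "((%n. A i * w i ^ n / fact n * t ^ n) has_sum A i * exp (t * w i)) UNIV" for i t
 proof (rule norm_summable_imp_has_sum)
  show "summable (%n. norm (A i * w i ^ n / fact n * t ^ n))"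
  using inner by (intro summable_on_imp_summable) (rule has_sum_imp_summable)
  have "(%n. A i * ((t * w i) ^ n /\<^sub>R fact n)) sums (A i * exp (t * w i))" by (intro sums_mult exp_converges)
  then show "(%n. A i * w i ^ n / fact n * t ^ n) sums (A i * exp (t * w i))"
  by (simp add: power_mult_distrib scaleR_conv_of_real divide_inverse mult_ac)
 qed
 have joint: "(%(i, n). A i * w i ^ n / fact n * t ^ n) summable_on I \<times> UNIV" if t: "norm t < \<sigma>" for t
 proof -
  have eq: "infsum (%n. norm (case (i, n) of (i, n) => A i * w i ^ n / fact n * t ^ n)) UNIV
  = norm (A i) * exp (norm (w i) * norm t)" for i using infsumI[OF inner[of i t]] by simp
  have "(%i. norm (A i) * exp (norm (w i) * norm t)) summable_on I"
  proof (rule summable_on_comparison_test[OF big])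
  fix i show "norm (A i) * exp (norm (w i) * norm t) <= norm (A i) * exp (\<sigma> * norm (w i))"
  using t mult_right_mono[of "norm t" \<sigma> "norm (w i)"] by (intro mult_left_mono) (auto simp: mult.commute)
  qed auto
  then have "(%p. norm ((%(i, n). A i * w i ^ n / fact n * t ^ n) p)) summable_on Sigma I (%_. UNIV)"
  unfolding Infinite_Sum.abs_summable_on_Sigma_iff eq using has_sum_imp_summable[OF inner[of _ t]] by simp
  then show ?thesis by (rule Infinite_Sum.abs_summable_summable)
 qed
 have joint_sum: "((%(i, n). A i * w i ^ n / fact n * t ^ n) has_sum g t) (I \<times> UNIV)" if t: "norm t < \<sigma>" for t
 proof -
  have "norm t < \<rho>" using t \<rho> by (simp add: \<sigma>_def)
  then show ?thesis using inner' by (intro has_sum_SigmaI[OF _ g joint[OF t]]) auto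
 qed
 have coeff: "(%i. A i * w i ^ n / fact n) summable_on I" for n
 proof -
  let ?t = "complex_of_real (\<sigma> / 2)"
  have t: "norm ?t < \<sigma>" "?t ~= 0" using \<sigma> by auto
  have "((%(n, i). A i * w i ^ n / fact n * ?t ^ n) has_sum g ?t) (UNIV \<times> I)"
  using joint_sum[OF t(1)] by (subst (asm) has_sum_swap) (simp add: case_prod_unfold)
  from summable_on_SigmaD1[OF has_sum_imp_summable[OF this], of n]
  have "(%i. A i * w i ^ n / fact n * ?t ^ n) summable_on I" by simp
  from summable_on_cmult_left[OF this, of "inverse (?t ^ n)"]
  show ?thesis using t(2) by (simp add: mult.assoc)
 qed
 define c where "c n = infsum (%i. A i * w i ^ n / fact n) I" for n
 have c: "((%i. A i * w i ^ n / fact n) has_sum c n) I" for n unfolding c_def by (rule has_sum_infsum[OF coeff])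
 have "(%n. c n * t ^ n) sums g t" if t: "norm t < \<sigma>" for t
 proof (rule has_sum_imp_sums, rule has_sum_SigmaD)
  show "((%(n, i). A i * w i ^ n / fact n * t ^ n) has_sum g t) (UNIV \<times> I)"
  using joint_sum[OF t] by (subst (asm) has_sum_swap) (simp add: case_prod_unfold)
  show "((%i. case (n, i) of (n, i) => A i * w i ^ n / fact n * t ^ n) has_sum c n * t ^ n) I" for n
  using has_sum_cmult_left[OF c] by simp
 qed
 then have "c \<nu> = G" by (rule power_series_leading_coefficient[OF \<sigma> _ lim])
 then show ?thesis using c[of \<nu>] by (simp only:)
qed

section \<open>Expansion at a cusp and Koecher's principle\<close>

lemma mpow_mult: "mpow (mpow g j) n = mpow g (j * n)" by (induction n) (simp_all add: mpow_add)

text \<open>The conflict of growth rates behind Koecher's principle.\<close>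

lemma exp_power_growth:
 fixes a \<kappa> C M :: real
 assumes a: "a > 0" and \<kappa>: "\<kappa> > 0" and C: "C \<ge> 1" and le: "!!n. a * exp (\<kappa> * 2 ^ n) <= C ^ n * M"
 shows False
proof -
 have lim: "(%n. real n * (1/2) ^ n) \<longlonglongrightarrow> 0" by (rule powser_times_n_limit_0) simp
 have lnC: "ln C + 1 > 0" using C ln_ge_zero[OF C] by linarith
 have "\<forall>\<^sub>F n in sequentially. real n * (1/2) ^ n < \<kappa> / (ln C + 1)"
  by (rule order_tendstoD(2)[OF lim]) (use \<kappa> lnC in simp)
 then obtain n0 where n0: "!!n. n \<ge> n0 ==> real n * (1/2) ^ n < \<kappa> / (ln C + 1)"
  unfolding eventually_sequentially by blast
 define n where "n = max n0 (nat \<lceil>M / a\<rceil>)"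
 have "real n * (1/2) ^ n < \<kappa> / (ln C + 1)" by (rule n0) (simp add: n_def)
 then have "real n * (ln C + 1) < \<kappa> * 2 ^ n" using lnC by (simp add: field_simps)
 then have "exp (real n * (ln C + 1)) <= exp (\<kappa> * 2 ^ n)" by simp
 moreover have "exp (real n * (ln C + 1)) = C ^ n * exp (real n)" using C by (simp add: distrib_left exp_add exp_of_nat_mult)
 ultimately have "a * (C ^ n * exp (real n)) <= C ^ n * M"
  using le[of n] a mult_left_mono[of "C ^ n * exp (real n)" "exp (\<kappa> * 2 ^ n)" a] by linarith
 then have "C ^ n * (a * exp (real n)) <= C ^ n * M" by (simp add: mult_ac)
 then have "a * exp (real n) <= M" using C by (simp add: mult_le_cancel_left_pos)
 moreover have "a * (1 + real n) <= a * exp (real n)" using a exp_ge_add_one_self by (intro mult_left_mono) auto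
 moreover have "M / a <= real n" unfolding n_def by linarith
 then have "M <= a * real n" using a by (simp add: field_simps)
 ultimately show False using a by (simp add: distrib_left)
qed

locale cusp_data = qp_data Q L L' K D D' f la k \<nu> e e'
 for Q :: "real ^ 'm ^ 'm" and L L' K :: "(real ^ 'm) set" and D D' :: "(complex ^ 'm) set"
  and f :: "complex ^ 'm => 'm tensor" and la :: "nat list" and k :: int and \<nu> :: nat
  and e e' :: "real ^ 'm" +
 fixes \<Gamma> :: "(real ^ 'm ^ 'm) set" and y0 :: "real ^ 'm"
 assumes \<Gamma>: "subgroup \<Gamma> (O_plus Q L D)" "finite (rcosets\<^bsub>O_plus Q L D\<^esub> \<Gamma>)"
  and modular: "g : \<Gamma> ==> om : D ==>
  f (cmat g *v om) - tmap (cmat g) (f om) : hodge_null Q L (sum_list la) (cmat g *v om)"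
  and rat: "e : L'" "e' : rat_space L'" "y0 : rat_space L'" "y0 : fcone e e' y0"
  and base: "tube_point Q e e' (\<i> *s cvec y0) : D" and card: "5 <= CARD('m)"
begin

abbreviation "pcone \<equiv> fcone e e' y0"
abbreviation "tp \<equiv> tube_point Q e e'"
abbreviation "UQ \<equiv> U_rat Q L e e'"
abbreviation "UZ \<equiv> U_int Q L \<Gamma> e e'"
abbreviation "perp x \<equiv> rform Q x e = 0 & rform Q x e' = 0"

lemma hD: "rform Q e e = 0" "rform Q e' e' = 0" "rform Q e e' = 1" "rform Q e' e = 1" using hypD[OF h(1)] by auto

lemma coneD: "x : pcone ==> perp x" "x : pcone ==> rform Q x x > 0" "x : pcone ==> rform Q x y0 > 0" by (auto simp: fcone_def)

lemma Uc_iff: "v : Uc e e' \<longleftrightarrow> perp (Revec v) & perp (Imvec v)"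
proof -
 have "cform Q v (cvec x) = 0 \<longleftrightarrow> rform Q (Revec v) x = 0 & rform Q (Imvec v) x = 0" for x
  by (simp add: cform_Re_Im Revec_cvec Imvec_cvec rform_simps complex_eq_iff)
 then show ?thesis by (auto simp: Uc_def)
qed

lemma Uc_cvec: "perp x ==> cvec x : Uc e e'" by (simp add: Uc_iff Revec_cvec Imvec_cvec rform_simps)

lemma Uc_add: "v : Uc e e' ==> w : Uc e e' ==> v + w : Uc e e'"
 and Uc_scale: "v : Uc e e' ==> c *s v : Uc e e'" by (simp_all add: Uc_def cform_simps)

lemma UQ_perp: "x : UQ ==> perp x" and UQ_rat: "x : UQ ==> x : rat_space L" by (auto simp: U_rat_def)

lemma tp_D: "z : Uc e e' ==> Imvec z : pcone ==> tp z : D" using coneD(1)[OF rat(4)]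
 by (intro tube_point_in_component[OF h(1) D cspace_L rat(4) base refl])
  (auto simp: Uc_def cform_simps cform_cvec Imvec_scale Imvec_cvec Revec_cvec rat(4))

definition prU :: "complex ^ 'm => complex ^ 'm" where
 "prU z = z - cform Q z (cvec e') *s cvec e - cform Q z (cvec e) *s cvec e'"

lemma prU_Uc: "prU z : Uc e e'" by (simp add: prU_def Uc_def cform_simps cform_cvec hD)

lemma prU_id: "z : Uc e e' ==> prU z = z" by (simp add: prU_def Uc_def)

lemma prU_add: "v : Uc e e' ==> prU (z + v) = prU z + v" by (simp add: prU_def Uc_def cform_simps)

text \<open>The tube domain lies in a subspace. Composition with the projection \<open>prU\<close> turns functions on it into
  functions on an open subset of the coordinate space.\<close>

definition Om :: "(complex ^ 'm) set" where "Om = {z. Imvec (prU z) : pcone}"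

definition F :: "'m list => complex ^ 'm => complex" where
 "F idx z = tmap (P (tp (prU z))) (f (tp (prU z))) idx"

lemma F_Uc: "z : Uc e e' ==> F idx z = tmap (P (tp z)) (f (tp z)) idx" by (simp add: F_def prU_id)

lemma Om_Uc: "z : Uc e e' ==> z : Om \<longleftrightarrow> Imvec z : pcone" by (simp add: Om_def prU_id)

lemma Om_D: "z : Om ==> tp (prU z) : D" by (rule tp_D[OF prU_Uc]) (simp add: Om_def)

lemma open_Om: "open Om"
proof -
 have "Om = {z. 0 < rform Q (Imvec (prU z)) (Imvec (prU z))} Int {z. 0 < rform Q (Imvec (prU z)) y0}"
  using prU_Uc by (auto simp: Om_def fcone_def Uc_iff)
 moreover have "continuous_on UNIV (%z. Imvec (prU z))" unfolding prU_def by (intro continuous_intros)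
 then have "open ({z. 0 < rform Q (Imvec (prU z)) (Imvec (prU z))} Int {z. 0 < rform Q (Imvec (prU z)) y0})"
  by (intro open_Int open_Collect_less continuous_on_rform continuous_on_const)
 ultimately show ?thesis by simp
qed

sublocale tube: tube_region Om "cvec ` pcone"
proof
 show "open Om" by (rule open_Om)
 fix z b :: "complex ^ 'm" and t assume z: "z : Om" and b: "b : cvec ` pcone" and t: "0 <= Im t"
 obtain x where x: "b = cvec x" "x : pcone" using b by blast
 have "Imvec (prU (z + t *s b)) = Imvec (prU z) + Im t *\<^sub>R x" using Uc_scale[OF Uc_cvec[OF coneD(1)[OF x(2)]], of t]
  by (simp add: x prU_add Imvec_add Imvec_scale Imvec_cvec Revec_cvec)
 moreover have "Imvec (prU z) + Im t *\<^sub>R x : pcone"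
 proof (cases "Im t = 0")
  case False
  then show ?thesis using z t x(2) by (intro fcone_add[OF h(1) rat(4)] fcone_scale) (auto simp: Om_def)
 qed (use z in "simp add: Om_def")
 ultimately show "z + t *s b : Om" by (simp add: Om_def)
qed

lemma F_holomorphic: "holomorphic_cvec Om (F idx)" unfolding holomorphic_cvec_def
proof
 fix z0 assume z0: "z0 : Om"
 define Y where "Y z = tp (prU z)" for z
 have Yh: "holomorphic_cvec X (%z. Y z $ i)" for i X
 proof -
  have c: "holomorphic_cvec X (%z. cform Q (p z) (q z))"
  if "!!i. holomorphic_cvec X (%z. p z $ i)" "!!i. holomorphic_cvec X (%z. q z $ i)" for p q
  by (rule holomorphic_cform[OF that])
  have pr: "holomorphic_cvec X (%z. prU z $ i)" for i
  proof -
  have "holomorphic_cvec X (%z. z $ i - cform Q z (cvec e') * cvec e $ i - cform Q z (cvec e) * cvec e' $ i)"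
  by (rule hol_cvec_diff[OF hol_cvec_diff[OF hol_cvec_coord
  hol_cvec_mult[OF c[OF hol_cvec_coord hol_cvec_const] hol_cvec_const]]
  hol_cvec_mult[OF c[OF hol_cvec_coord hol_cvec_const] hol_cvec_const]])
  then show ?thesis by (simp add: prU_def)
  qed
  have "holomorphic_cvec X (%z. cvec e' $ i + prU z $ i - 1/2 * cform Q (prU z) (prU z) * cvec e $ i)"
  by (rule hol_cvec_diff[OF hol_cvec_add[OF hol_cvec_const pr]
  hol_cvec_mult[OF hol_cvec_cmult[OF c[OF pr pr]] hol_cvec_const]])
  then show ?thesis by (simp add: Y_def tube_point_def)
 qed
 have YD: "Y z0 : D" using z0 Om_D by (simp add: Y_def)
 have lifts: "ALL om:D. EX U F. open U & om : U & (ALL idx. holomorphic_cvec U (%y. F y idx)) &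
  (ALL y:U Int D. F y - f y : hodge_null Q L deg y)"
  using f unfolding hodge_sections_def by (elim CollectE conjE)
 obtain U H where UH: "open U & Y z0 : U & (ALL idx. holomorphic_cvec U (%y. H y idx)) &
  (ALL y:U Int D. H y - f y : hodge_null Q L deg y)" using bspec[OF lifts YD] by (elim exE)
 then have U: "open U" "Y z0 : U" "!!idx. holomorphic_cvec U (%y. H y idx)"
  "!!y. y : U Int D ==> H y - f y : hodge_null Q L deg y" by simp_all
 define V where "V = U Int {y. cform Q y (cvec e) ~= 0}"
 define W where "W = Om Int Y -` U"
 have cY: "continuous_on UNIV Y" unfolding Y_def prU_def tube_point_def by (intro continuous_intros)
 have W: "open W" "z0 : W" unfolding W_def using z0 U(1,2) by (simp_all add: open_Int open_Om open_vimage[OF _ cY])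
 have Y1: "cform Q (Y z) (cvec e) = 1" for z using tube_point_isotropic(2)[OF h(1)] prU_Uc[of z] by (simp add: Y_def Uc_def)
 have "holomorphic_cvec V (%y. tmap (P y) (H y) idx)"
  by (rule holomorphic_tmap[OF holomorphic_Ptriv hol_cvec_subset[OF U(3)]]) (auto simp: V_def)
 then have "holomorphic_cvec W (%z. tmap (P (Y z)) (H (Y z)) idx)"
  by (rule hol_cvec_compose[OF _ Yh]) (simp add: V_def W_def Y1)
 then have "holomorphic_cvec W (F idx)"
 proof (rule hol_cvec_cong[OF _ W(1)])
  fix z assume z: "z : W"
  then have "Y z : U Int D" using Om_D by (auto simp: W_def Y_def)
  then have "tmap (P (Y z)) (H (Y z)) = tmap (P (Y z)) (f (Y z))" by (intro null_vanish_diff[OF _ h(1) U(4)]) simp_all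
  then show "F idx z = tmap (P (Y z)) (H (Y z)) idx" by (simp add: F_def Y_def)
 qed
 then show "EX H'. (F idx has_derivative H') (at z0) & (ALL c v. H' (c *s v) = c * H' v)"
  using W(2) unfolding holomorphic_cvec_def by blast
qed

subsection \<open>Translations in the unipotent radical\<close>

context
 fixes m :: "real ^ 'm"
 assumes m: "perp m"
begin

lemma transvection_isometric: "isometric Q (transvection Q m e)" unfolding isometric_def
proof (intro allI)
 fix x y
 have s: "rform Q m e = 0" "rform Q e m = 0" "rform Q x m = rform Q m x" "rform Q x e = rform Q e x"
  using m rform_sym[of e m] rform_sym[of x m] rform_sym[of x e] by auto
 show "rform Q (transvection Q m e *v x) (transvection Q m e *v y) = rform Q x y"
  by (simp add: transvection_apply rform_simps s hD field_simps)
qed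

lemma transvection_inverse: "transvection Q m e ** transvection Q (- m) e = mat 1"
proof -
 have s: "rform Q m e = 0" "rform Q e m = 0" using m rform_sym[of e m] by auto
 have "transvection Q m e *v (transvection Q (- m) e *v v) = v" for v
  by (simp add: transvection_apply rform_simps s hD vec_eq_iff field_simps)
 then show ?thesis by (simp add: matrix_eq matrix_vector_mul_assoc[symmetric])
qed

lemma transvection_tp:
 assumes z: "z : Uc e e'" shows "cmat (transvection Q m e) *v tp z = tp (z + cvec m)"
proof -
 have s: "rform Q m e = 0" "rform Q e m = 0" "rform Q m e' = 0" using m rform_sym[of e m] by auto
 have zz: "cform Q (cvec e) z = 0" "cform Q z (cvec m) = cform Q (cvec m) z"
  using z cform_sym[of "cvec e" z] cform_sym[of z "cvec m"] by (auto simp: Uc_def)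
 show ?thesis unfolding transvection_apply_cplx tube_point_def
  by (simp add: cform_simps cform_cvec s hD zz vec_eq_iff field_simps)
qed

text \<open>On the complement of \<open>e\<close>, a transvection is the identity modulo \<open>e\<close>, which the trivialization projects
  away. So the trivialized form is truly periodic.\<close>

lemma transvection_Ptriv:
 assumes y: "cform Q y (cvec e) ~= 0" shows "P (cmat (transvection Q m e) *v y) ** cmat (transvection Q m e) = P y"
proof -
 let ?E = "cmat (transvection Q m e)"
 have s: "rform Q m e = 0" "rform Q e m = 0" "rform Q m e' = 0" using m rform_sym[of e m] by auto
 have Ee: "cform Q (?E *v v) (cvec e) = cform Q v (cvec e)" for v
  by (simp add: transvection_apply_cplx cform_simps cform_cvec s hD)
 have "P (?E *v y) *v (?E *v v) = P y *v v" for v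
 proof -
  define x where "x = v - (cform Q v (cvec e) / cform Q y (cvec e)) *s y"
  have xe: "cform Q (cvec e) x = 0" using y cform_sym[of "cvec e" x] by (simp add: x_def cform_simps)
  have Ex: "?E *v x = x - cform Q (cvec m) x *s cvec e" by (simp add: transvection_apply_cplx xe)
  have "?E *v v - (cform Q (?E *v v) (cvec e) / cform Q (?E *v y) (cvec e)) *s (?E *v y) = ?E *v x"
  by (simp add: Ee x_def matrix_vector_mult_diff_distrib vector_scalar_commute)
  then have "P (?E *v y) *v (?E *v v) = ?E *v x - cform Q (?E *v x) (cvec e') *s cvec e" by (simp add: Ptriv_apply Let_def)
  also have "... = x - cform Q x (cvec e') *s cvec e"
  unfolding Ex by (simp add: cform_simps cform_cvec hD vec_eq_iff algebra_simps)
  finally show ?thesis by (simp add: Ptriv_apply Let_def x_def)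
 qed
 then show ?thesis by (simp add: matrix_eq matrix_vector_mul_assoc[symmetric])
qed

end

lemma F_periodic:
 assumes m: "m : UZ" and z: "z : Om" shows "F idx (z + cvec m) = F idx z"
proof -
 have mp: "perp m" and mG: "transvection Q m e : \<Gamma>" using m by (auto simp: U_int_def U_rat_def)
 let ?E = "cmat (transvection Q m e)" and ?y = "tp (prU z)"
 have eq: "tp (prU (z + cvec m)) = ?E *v ?y" by (simp add: prU_add Uc_cvec mp transvection_tp prU_Uc)
 have "z + cvec m : Om" using z by (simp add: Om_def prU_add Uc_cvec mp Imvec_add Imvec_cvec)
 from Om_D[OF this] have D1: "?E *v ?y : D" by (simp add: eq)
 have "tmap (P (?E *v ?y)) (f (?E *v ?y)) = tmap (P (?E *v ?y)) (tmap ?E (f ?y))"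
  by (rule null_vanish_diff[OF D1 h(1) modular[OF mG Om_D[OF z]]])
 have "cform Q ?y (cvec e) ~= 0" using D_nz[OF Om_D[OF z] h(1)] .
 from transvection_Ptriv[OF mp this] \<open>tmap (P (?E *v ?y)) (f (?E *v ?y)) = _\<close>
 show ?thesis by (simp add: F_def eq tmap_compose)
qed

lemma transvection_power: "perp m ==> mpow (transvection Q m e) j = transvection Q (real j *\<^sub>R m) e"
proof (induction j)
 case 0
 then show ?case by (simp add: matrix_eq transvection_apply rform_simps)
next
 case (Suc j)
 have s: "rform Q m e = 0" "rform Q e m = 0" using Suc.prems rform_sym[of e m] by auto
 have "transvection Q m e *v (transvection Q (real j *\<^sub>R m) e *v v) = transvection Q (real (Suc j) *\<^sub>R m) e *v v" for v
  by (simp add: transvection_apply rform_simps s hD vec_eq_iff field_simps)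
 then show ?case using Suc by (simp add: matrix_eq matrix_vector_mul_assoc[symmetric])
qed

lemma lattice_int: "x : L ==> y : L ==> rform Q x y : \<int>" using lattice(1) unfolding is_lattice_def by blast

lemma eL: "e : L" using rat(1) lattice'(2) by blast

lemma transvection_lattice:
 assumes x: "x : L" and m: "perp m" "v : L" "m = 2 *\<^sub>R v | m = - (2 *\<^sub>R v)" shows "transvection Q m e *v x : L"
proof -
 have mL: "m : L" using m(2,3) lattice_scale[OF lattice(1) m(2), of 2] lattice_minus[OF lattice(1)] by auto
 have half: "rform Q m m = 4 * rform Q v v" using m(3) by (auto simp: rform_simps)
 obtain i j k where ijk: "rform Q m x = of_int i" "rform Q e x = of_int j" "rform Q v v = of_int k"
  using lattice_int[OF mL x] lattice_int[OF eL x] lattice_int[OF m(2,2)] by (auto elim!: Ints_cases)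
 have "transvection Q m e *v x = x - of_int i *\<^sub>R e + of_int j *\<^sub>R m - of_int (2 * k * j) *\<^sub>R e"
  by (simp add: transvection_apply half ijk)
 also have "... : L" by (intro lattice_diff[OF lattice(1)] lattice_add[OF lattice(1)] lattice_scale[OF lattice(1)] x mL eL)
 finally show ?thesis .
qed

text \<open>A multiple of the transvection vector makes it integral, and a power of it lies in the subgroup of finite
  index.\<close>

lemma U_int_multiple:
 assumes m: "m : UQ" shows "\<exists>c::nat. c > 0 & real c *\<^sub>R m : UZ"
proof -
 obtain N :: nat where N: "N > 0" "real N *\<^sub>R m : L" using UQ_rat[OF m] by (auto simp: rat_space_def)
 define m1 where "m1 = 2 *\<^sub>R (real N *\<^sub>R m)"
 have m1: "perp m1" "perp (- m1)" using UQ_perp[OF m] by (auto simp: m1_def rform_simps)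
 let ?E = "transvection Q m1 e" and ?E' = "transvection Q (- m1) e"
 have inv: "?E ** ?E' = mat 1" "?E' ** ?E = mat 1" using transvection_inverse[OF m1(1)] transvection_inverse[OF m1(2)] by auto
 have "?E : carrier (O_plus Q L D)"
 proof (rule O_plus_carrierI[OF transvection_isometric[OF m1(1)] inv _ _ base])
  show "?E *v x : L" "?E' *v x : L" if "x : L" for x
  using transvection_lattice[OF that m1(1) N(2)] transvection_lattice[OF that m1(2) N(2)] by (auto simp: m1_def)
  have y0U: "\<i> *s cvec y0 : Uc e e'" by (intro Uc_scale Uc_cvec coneD(1) rat(4))
  show "cmat ?E *v tp (\<i> *s cvec y0) : D" unfolding transvection_tp[OF m1(1) y0U]
  by (intro tp_D Uc_add y0U Uc_cvec m1(1)) (simp add: Imvec_add Imvec_scale Imvec_cvec Revec_cvec rat(4))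
 qed
 from finite_index_power[OF \<Gamma> this inv(2,1)] obtain j where j: "j > 0" "mpow ?E j : \<Gamma>" by blast
 have eq: "real j *\<^sub>R m1 = real (j * 2 * N) *\<^sub>R m" by (simp add: m1_def)
 have "real (j * 2 * N) *\<^sub>R m : UQ"
  using m rat_space_scale[OF lattice(1), of "real (j * 2 * N)" m] by (auto simp: U_rat_def rform_simps simp del: of_nat_mult)
 then have "real (j * 2 * N) *\<^sub>R m : UZ"
  using j(2) by (simp only: U_int_def transvection_power[OF m1(1)] eq mem_Collect_eq)
 then show ?thesis using j(1) N(1) by (intro exI[of _ "j * 2 * N"]) auto
qed

end

lemma weight_1: "weight 1 js = 1" by (induction js) auto

context cusp_data
begin

lemma y0L: "y0 : rat_space L" using rat(3) rat_space_mono by blast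

lemma e'L: "e' : rat_space L" using rat(2) rat_space_mono by blast

lemma y0_UQ: "y0 : UQ" using y0L coneD(1)[OF rat(4)] by (simp add: U_rat_def)

lemma UQ_scale: "q : \<rat> ==> x : UQ ==> q *\<^sub>R x : UQ"
 and UQ_add: "x : UQ ==> y : UQ ==> x + y : UQ"
 by (auto simp: U_rat_def rform_simps rat_space_scale[OF lattice(1)] rat_space_add[OF lattice(1)])

lemma UQ_0: "0 : UQ" by (simp add: U_rat_def rform_simps rat_space_0[OF lattice(1)])

lemma frame_orthogonal:
 assumes y: "y : pcone" shows "orth_set {e + e', e - e', y}"
proof -
 have p: "rform Q y e = 0" "rform Q y e' = 0" "rform Q e y = 0" "rform Q e' y = 0" "rform Q y y > 0"
  using coneD[OF y] rform_sym[of e y] rform_sym[of e' y] by auto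
 show ?thesis by (auto simp: orth_set_def rform_simps hD p less_imp_neq[OF p(5), symmetric])
qed

text \<open>A rational orthogonal basis adapted to the cusp and to a rational vector of the cone.\<close>

lemma frame_basis:
 assumes y: "y : pcone" "y : UQ" shows "EX M. finite M & y ~: M & orth_set (insert y M) & M <= UQ &
  (ALL x. perp x --> x : span (insert y M)) & CARD('m) = 3 + card M"
proof -
 let ?B0 = "{e + e', e - e', y}"
 have "?B0 <= rat_space L" using y(2) eL e'L lattice_rat_space[of L] UQ_rat
  by (auto intro!: rat_space_add[OF lattice(1)] rat_space_diff[OF lattice(1)])
 from rational_orth_basis[OF lattice(1) frame_orthogonal[OF y(1)] this]
 obtain B where B: "orth_set B" "?B0 <= B" "B <= rat_space L" "span B = span L" by blast
 define M where "M = B - ?B0"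
 have fin: "finite B" using B(1) by (simp add: orth_set_def)
 have p: "rform Q y e = 0" "rform Q y e' = 0" "rform Q e y = 0" "rform Q e' y = 0" "rform Q y y > 0"
  using coneD[OF y(1)] rform_sym[of e y] rform_sym[of e' y] by auto
 have d1: "e + e' ~= e - e'"
 proof
  assume "e + e' = e - e'"
  then have "rform Q (e + e') (e + e') = rform Q (e - e') (e - e')" by (simp only:)
  then show False by (simp add: rform_simps hD)
 qed
 have d2: "y ~= e + e'" "y ~= e - e'"
 proof -
  have "rform Q (e + e') e = 1" "rform Q (e - e') e' = 1" by (simp_all add: rform_simps hD)
  then show "y ~= e + e'" "y ~= e - e'" using p by auto
 qed
 have c3: "card ?B0 = 3" using d1 d2 by auto
 have perpM: "perp b" if "b : M | b = y" for b
 proof (cases "b = y")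
  case False
  then have b: "b : B" "b ~= e + e'" "b ~= e - e'" using that by (auto simp: M_def)
  have "e + e' : B" "e - e' : B" using B(2) by auto
  then have "rform Q b (e + e') = 0" "rform Q b (e - e') = 0" using B(1) b by (auto simp: orth_set_def)
  then show ?thesis by (simp add: rform_simps)
 qed (use p in simp)
 have spanB: "x : span B" for x using B(4) lattice(2) by simp
 have "x : span (insert y M)" if x: "perp x" for x
 proof -
  have "x = (SUM b:B. (rform Q x b / rform Q b b) *\<^sub>R b)" by (rule orth_expand[OF B(1) spanB])
  also have "... : span (insert y M)"
  proof (rule span_sum)
  fix b assume "b : B"
  then consider "b = e + e' | b = e - e'" | "b : insert y M" by (auto simp: M_def)
  then show "(rform Q x b / rform Q b b) *\<^sub>R b : span (insert y M)"
  proof cases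
  case 1
  then have "rform Q x b = 0" using x by (auto simp: rform_simps)
  then show ?thesis by (simp add: span_zero)
  qed (intro span_scale span_base)
  qed
  finally show ?thesis .
 qed
 moreover have "orth_set (insert y M)" using B(1,2) unfolding orth_set_def M_def by auto
 moreover have "M <= UQ" using perpM B(3) by (auto simp: U_rat_def M_def)
 moreover have "CARD('m) = 3 + card M"
 proof -
  have "card B = dim (span B)" using dim_eq_card_independent[OF orth_independent[OF B(1)]] by simp
  also have "... = CARD('m)" using B(4) lattice(2) by (simp add: dim_UNIV)
  finally have "card B = CARD('m)" .
  moreover have "card B = card ?B0 + card M"
  unfolding M_def using B(2) fin card_mono[OF fin B(2)] by (simp add: card_Diff_subset finite_subset)
  ultimately show ?thesis using c3 by simp
 qed
 moreover have "finite M" "y ~: M" using fin by (auto simp: M_def)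
 ultimately show ?thesis by blast
qed

text \<open>The periods are taken inside the cone, where the expansion converges; they form a basis, but not
  an orthogonal one.\<close>

lemma periods:
 "EX bs. set bs <= pcone Int UZ & (ALL x. perp x --> x : span (set bs)) &
  (ALL js. length js = length bs --> (EX l:UQ. \<forall>i<length bs. rform Q l (bs ! i) = real_of_int (js ! i)))"
proof -
 obtain M where M: "finite M" "y0 ~: M" "orth_set (insert y0 M)" "M <= UQ"
  "!!x. perp x ==> x : span (insert y0 M)" using frame_basis[OF rat(4) y0_UQ] by blast
 obtain ms' where ms': "set ms' = M" "distinct ms'" using finite_distinct_list[OF M(1)] by blast
 define ms where "ms = y0 # ms'"
 have ms: "set ms = insert y0 M" "distinct ms" using ms' M(2) by (auto simp: ms_def)
 have y00: "rform Q y0 y0 > 0" using coneD(2)[OF rat(4)] .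
 have my0: "rform Q m y0 = 0" "rform Q y0 m = 0" if "m : M" for m using M(2,3) that by (auto simp: orth_set_def)
 have ex: "\<exists>N::nat. m + real N *\<^sub>R y0 : pcone & (m = y0 --> N = 0)" if m: "m : insert y0 M" for m
 proof (cases "m = y0")
  case False
  then have mM: "m : M" using m by simp
  obtain N0 :: nat where N0: "\<bar>rform Q m m\<bar> < real N0 * rform Q y0 y0" using reals_Archimedean3[OF y00] by blast
  define N where "N = Suc N0"
  have "real N0 <= real N * real N" unfolding N_def of_nat_mult[symmetric] of_nat_le_iff by simp
  then have "real N0 * rform Q y0 y0 <= real N * real N * rform Q y0 y0" using y00 by (intro mult_right_mono) auto
  then have "rform Q (m + real N *\<^sub>R y0) (m + real N *\<^sub>R y0) > 0" using N0 by (simp add: rform_simps my0[OF mM])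
  moreover have "rform Q (m + real N *\<^sub>R y0) y0 > 0" using y00 by (simp add: rform_simps my0[OF mM] N_def)
  moreover have "perp (m + real N *\<^sub>R y0)" using UQ_perp[of m] M(4) mM coneD(1)[OF rat(4)] by (auto simp: rform_simps)
  ultimately have "m + real N *\<^sub>R y0 : pcone" by (simp add: fcone_def)
  then show ?thesis using False by blast
 qed (auto intro: exI[of _ 0] rat(4))
 define N where "N m = (SOME N::nat. m + real N *\<^sub>R y0 : pcone & (m = y0 --> N = 0))" for m
 have Nm: "m + real (N m) *\<^sub>R y0 : pcone & (m = y0 --> N m = 0)" if "m : set ms" for m
  unfolding N_def by (rule someI_ex[OF ex]) (use that in "simp only: ms(1)")
 have N: "m + real (N m) *\<^sub>R y0 : pcone" "m = y0 --> N m = 0" if "m : set ms" for m using Nm[OF that] by simp_all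
 have UQN: "m + real (N m) *\<^sub>R y0 : UQ" if "m : set ms" for m
  using that M(4) y0_UQ unfolding ms(1) by (auto intro!: UQ_add UQ_scale)
 define c where "c m = (SOME c::nat. c > 0 & real c *\<^sub>R (m + real (N m) *\<^sub>R y0) : UZ)" for m
 have c: "c m > 0" "real (c m) *\<^sub>R (m + real (N m) *\<^sub>R y0) : UZ" if "m : set ms" for m
  using someI_ex[OF U_int_multiple[OF UQN[OF that]]] unfolding c_def by blast+
 define b where "b m = real (c m) *\<^sub>R (m + real (N m) *\<^sub>R y0)" for m
 define bs where "bs = map b ms"
 have y0ms: "y0 : set ms" "ms ! 0 = y0" "0 < length ms" by (auto simp: ms_def)
 have "set bs <= pcone Int UZ" using N(1) c by (auto simp: bs_def b_def intro!: fcone_scale)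
 moreover have "x : span (set bs)" if "perp x" for x
 proof -
  have bm: "b m : span (set bs)" if "m : set ms" for m using that by (intro span_base) (auto simp: bs_def)
  have y0s: "y0 : span (set bs)"
  proof -
  have "y0 = (1 / real (c y0)) *\<^sub>R b y0" using c(1)[OF y0ms(1)] N(2)[OF y0ms(1)] by (simp add: b_def)
  then show ?thesis using span_scale[OF bm[OF y0ms(1)], of "1 / real (c y0)"] by simp
  qed
  have "m : span (set bs)" if m: "m : set ms" for m
  proof -
  have "m = (1 / real (c m)) *\<^sub>R b m - real (N m) *\<^sub>R y0" using c(1)[OF m] by (simp add: b_def)
  then show ?thesis using span_diff[OF span_scale[OF bm[OF m], of "1 / real (c m)"] span_scale[OF y0s, of "real (N m)"]] by simp
  qed
  then have "insert y0 M <= span (set bs)" unfolding ms(1)[symmetric] by blast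
  then have "span (insert y0 M) <= span (set bs)" by (rule span_minimal) simp
  then show ?thesis using M(5)[OF that] by blast
 qed
 moreover have "EX l:UQ. \<forall>i<length bs. rform Q l (bs ! i) = real_of_int (js ! i)" if "length js = length bs" for js :: "int list"
 proof -
  define l0 where "l0 = real_of_int (js ! 0) / real (c y0)"
  define lam where "lam i = real_of_int (js ! i) / real (c (ms ! i)) - real (N (ms ! i)) * l0" for i
  define l where "l = (\<Sum>i<length ms. (lam i / rform Q (ms ! i) (ms ! i)) *\<^sub>R (ms ! i))"
  have orth: "rform Q (ms ! i) (ms ! j) = 0" if "i < length ms" "j < length ms" "i ~= j" for i j
  using M(3) that ms(2) nth_mem[of i ms] nth_mem[of j ms] unfolding ms(1)[symmetric] orth_set_def
  by (auto simp: nth_eq_iff_index_eq)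
  have nz: "rform Q (ms ! i) (ms ! i) ~= 0" if "i < length ms" for i
  using M(3) nth_mem[OF that] unfolding ms(1)[symmetric] orth_set_def by blast
  have lm: "rform Q l (ms ! j) = lam j" if j: "j < length ms" for j
  proof -
  have "rform Q l (ms ! j) = (\<Sum>i<length ms. lam i / rform Q (ms ! i) (ms ! i) * rform Q (ms ! i) (ms ! j))"
  by (simp add: l_def rform_sum_left rform_simps)
  also have "... = (\<Sum>i<length ms. if i = j then lam i else 0)" by (rule sum.cong) (use j nz orth in auto)
  finally show ?thesis using j by simp
  qed
  have lam0: "lam 0 = l0" using y0ms N(2)[OF y0ms(1)] by (simp add: lam_def l0_def)
  have "rform Q l (bs ! i) = real_of_int (js ! i)" if i: "i < length ms" for i
  proof -
  have "rform Q l (bs ! i) = real (c (ms ! i)) * (lam i + real (N (ms ! i)) * lam 0)"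
  using i lm[OF i] lm[OF y0ms(3)] y0ms(2) by (simp add: bs_def b_def rform_simps)
  then show ?thesis unfolding lam0 using c(1)[OF nth_mem[OF i]] by (simp add: lam_def)
  qed
  moreover have "l : UQ"
  proof -
  have msUQ: "ms ! i : UQ" if "i < length ms" for i using nth_mem[OF that] M(4) y0_UQ unfolding ms(1) by auto
  have "lam i / rform Q (ms ! i) (ms ! i) : \<rat>" if "i < length ms" for i
  unfolding lam_def l0_def using rform_rat[OF lattice(1) UQ_rat[OF msUQ[OF that]] UQ_rat[OF msUQ[OF that]]]
  by (intro Rats_divide Rats_diff Rats_mult) auto
  then have t: "(lam i / rform Q (ms ! i) (ms ! i)) *\<^sub>R (ms ! i) : UQ" if "i < length ms" for i
  using that msUQ by (intro UQ_scale) auto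
  have "(SUM i:I. (lam i / rform Q (ms ! i) (ms ! i)) *\<^sub>R (ms ! i)) : UQ" if "I <= {..<length ms}" "finite I" for I
  using that(2,1) by (induction I) (auto intro!: UQ_0 UQ_add t)
  then show ?thesis unfolding l_def by simp
  qed
  ultimately show ?thesis by (auto simp: bs_def)
 qed
 ultimately show ?thesis by blast
qed

lemma real_period_box:
 assumes "set bs <= pcone" "w : period_box 0 (map cvec bs)" shows "EX x. perp x & w = cvec x" using assms
proof (induction bs arbitrary: w)
 case Nil
 then show ?case by (intro exI[of _ 0]) (simp add: rform_simps cvec_0)
next
 case (Cons b bs)
 obtain s v where w: "w = of_real s *s cvec b + v" "v : period_box 0 (map cvec bs)" using Cons.prems(2) by auto
 obtain x where x: "perp x" "v = cvec x" using Cons.IH[OF _ w(2)] Cons.prems(1) by auto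
 have "perp (s *\<^sub>R b + x)" using x(1) coneD(1)[of b] Cons.prems(1) by (simp add: rform_simps)
 then show ?case by (intro exI[of _ "s *\<^sub>R b + x"]) (simp add: w x cvec_add cvec_scale)
qed

lemma Uc_decompose: "z : Uc e e' ==> EX x y. perp x & perp y & z = cvec x + \<i> *s cvec y"
 using Re_Im_decomp[of z] Uc_iff by blast

text \<open>The frequencies are the rational vectors with integral pairing with the periods.\<close>

lemma fourier_expansion_at_cusp:
 "\<exists>a :: 'm list => real ^ 'm => complex.
  (ALL idx. ALL l. a idx l ~= 0 --> (ALL m:UZ. rform Q l m : \<int>)) &
  (ALL idx. ALL z:Uc e e'. Imvec z : pcone --> ((%l. a idx l * ec (cform Q (cvec l) z)) has_sum F idx z) UQ) &
  (ALL idx l y B. y : pcone --> (ALL x. perp x --> norm (F idx (cvec x + \<i> *s cvec y)) <= B) -->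
  norm (a idx l) * exp (- 2 * pi * rform Q l y) <= B)"
proof -
 obtain bs where bs: "set bs <= pcone" "set bs <= UZ" "!!x. perp x ==> x : span (set bs)"
  "ALL js. length js = length bs --> (EX l:UQ. \<forall>i<length bs. rform Q l (bs ! i) = real_of_int (js ! i))"
  using periods by blast
 let ?cs = "map cvec bs"
 define J where "J = {js :: int list. length js = length ?cs}"
 define lf where "lf js = (SOME l. l : UQ & (\<forall>i<length bs. rform Q l (bs ! i) = real_of_int (js ! i)))" for js :: "int list"
 have lf: "lf js : UQ" "!!i. i < length bs ==> rform Q (lf js) (bs ! i) = real_of_int (js ! i)" if "js : J" for js
 proof -
  have "EX l. l : UQ & (\<forall>i<length bs. rform Q l (bs ! i) = real_of_int (js ! i))" using bs(4) that by (auto simp: J_def)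
  from someI_ex[OF this] show "lf js : UQ" "!!i. i < length bs ==> rform Q (lf js) (bs ! i) = real_of_int (js ! i)"
  unfolding lf_def by blast+
 qed
 have inj: "inj_on lf J"
 proof (rule inj_onI)
  fix js ks assume jk: "js : J" "ks : J" "lf js = lf ks"
  then have "real_of_int (js ! i) = real_of_int (ks ! i)" if "i < length bs" for i
  using lf(2)[OF jk(1) that] lf(2)[OF jk(2) that] by simp
  then show "js = ks" using jk(1,2) by (intro nth_equalityI) (auto simp: J_def)
 qed
 define z0 where "z0 = \<i> *s cvec y0"
 have z0U: "z0 : Uc e e'" unfolding z0_def by (intro Uc_scale Uc_cvec coneD(1) rat(4))
 have z0: "z0 : Om" using Om_Uc[OF z0U] rat(4) by (simp add: z0_def Imvec_scale Imvec_cvec Revec_cvec)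
 have per: "ALL b:set ?cs. ALL z:Om. F idx (z + b) = F idx z" for idx using F_periodic bs(2) by auto
 have sub: "set ?cs <= cvec ` pcone" using bs(1) by auto
 define a where "a idx l = (if l : lf ` J then averages ?cs (inv_into J lf l) (F idx) z0 * ec (- cform Q (cvec l) z0) else 0)" for idx l
 have coeff: "averages ?cs js (F idx) z = a idx (lf js) * ec (cform Q (cvec (lf js)) z)"
  if js: "js : J" and z: "z : Uc e e'" "z : Om" for js z idx
 proof -
  have "z - z0 : Uc e e'" using z(1) z0U by (simp add: Uc_def cform_simps)
  then obtain x y where xy: "perp x" "perp y" "z - z0 = cvec x + \<i> *s cvec y" using Uc_decompose by blast
  obtain s where s: "x = (\<Sum>i<length bs. s i *\<^sub>R (bs ! i))" using span_list[OF bs(3)[OF xy(1)]] by blast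
  obtain t where t: "y = (\<Sum>i<length bs. t i *\<^sub>R (bs ! i))" using span_list[OF bs(3)[OF xy(2)]] by blast
  define ts where "ts i = complex_of_real (s i) + \<i> * of_real (t i)" for i
  have zz: "z - z0 = (\<Sum>i<length ?cs. ts i *s (?cs ! i))" unfolding xy(3) s t
  by (simp add: cvec_sum cvec_scale ts_def vector_sadd_rdistrib sum.distrib vec.scale_sum_right vector_smult_assoc)
  have "averages ?cs js (F idx) z = averages ?cs js (F idx) z0 * ec (\<Sum>i<length ?cs. of_int (js ! i) * ts i)"
  by (rule tube.fourier_coefficients[OF F_holomorphic per sub z0 z(2) _ zz]) (use js in "simp add: J_def")
  also have "(\<Sum>i<length ?cs. of_int (js ! i) * ts i) = cform Q (cvec (lf js)) (z - z0)" unfolding zz cform_sum_right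
  by (rule sum.cong) (simp_all add: cform_scale_right cform_cvec lf(2)[OF js])
  also have "ec (cform Q (cvec (lf js)) (z - z0)) = ec (- cform Q (cvec (lf js)) z0) * ec (cform Q (cvec (lf js)) z)"
  by (simp add: ec_add[symmetric] cform_diff_right)
  finally show ?thesis using js inj by (simp add: a_def)
 qed
 have aJ: "a idx l ~= 0 ==> l : lf ` J" for idx l by (auto simp: a_def split: if_splits)
 have "ALL idx l. a idx l ~= 0 --> (ALL m:UZ. rform Q l m : \<int>)"
 proof (intro allI impI ballI)
  fix idx l m assume al: "a idx l ~= 0" and m: "m : UZ"
  obtain js where js: "js : J" "l = lf js" using aJ[OF al] by blast
  have mp: "perp m" using m by (auto simp: U_int_def U_rat_def)
  have U1: "z0 + cvec m : Uc e e'" by (intro Uc_add z0U Uc_cvec mp)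
  have "z0 + cvec m : Om" unfolding Om_Uc[OF U1] using rat(4) by (simp add: z0_def Imvec_add Imvec_scale Imvec_cvec Revec_cvec)
  note c1 = coeff[OF js(1) U1 this, of idx]
  have "averages ?cs js (F idx) (z0 + cvec m) = 1 * averages ?cs js (F idx) z0"
  by (rule tube.averages_equivariant[OF _ sub z0]) (use F_periodic[OF m] in simp)
  then have "a idx l * ec (cform Q (cvec l) z0) * ec (of_real (rform Q l m)) = a idx l * ec (cform Q (cvec l) z0)"
  using c1 coeff[OF js(1) z0U z0, of idx] by (simp add: js(2) cform_add_right ec_add cform_cvec mult.assoc)
  then have "ec (of_real (rform Q l m)) = 1" using al by simp
  then obtain n where "complex_of_real (rform Q l m) = of_int n" unfolding ec_eq_1_iff by (auto elim: Ints_cases)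
  then have "rform Q l m = of_int n" by (metis of_real_eq_iff of_real_of_int_eq)
  then show "rform Q l m : \<int>" by simp
 qed
 moreover have "ALL idx. ALL z:Uc e e'. Imvec z : pcone --> ((%l. a idx l * ec (cform Q (cvec l) z)) has_sum F idx z) UQ"
 proof (intro allI ballI impI)
  fix idx z assume z: "z : Uc e e'" "Imvec z : pcone"
  then have zOm: "z : Om" by (simp add: Om_Uc)
  have "((%js. averages ?cs js (F idx) z) has_sum F idx z) J"
  unfolding J_def by (rule tube.averages_has_sum[OF F_holomorphic per sub zOm])
  then have "(((%l. a idx l * ec (cform Q (cvec l) z)) \<circ> lf) has_sum F idx z) J"
  by (rule has_sum_cong[THEN iffD1, rotated]) (simp add: coeff[OF _ z(1) zOm])
  then have "((%l. a idx l * ec (cform Q (cvec l) z)) has_sum F idx z) (lf ` J)" by (simp add: has_sum_reindex[OF inj])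
  then show "((%l. a idx l * ec (cform Q (cvec l) z)) has_sum F idx z) UQ"
  by (rule has_sum_cong_neutral[THEN iffD1, rotated 3]) (use aJ lf(1) in auto)
 qed
 moreover have "norm (a idx l) * exp (- 2 * pi * rform Q l y) <= B"
  if y: "y : pcone" and B: "!!x. perp x ==> norm (F idx (cvec x + \<i> *s cvec y)) <= B" for idx l y B
 proof (cases "a idx l = 0")
  case True
  have "0 <= norm (F idx (cvec 0 + \<i> *s cvec y))" by simp
  also have "... <= B" by (rule B) (simp add: rform_simps)
  finally show ?thesis using True by simp
 next
  case False
  obtain js where js: "js : J" "l = lf js" using aJ[OF False] by blast
  let ?z = "\<i> *s cvec y"
  have zU: "?z : Uc e e'" by (intro Uc_scale Uc_cvec coneD(1) y)
  have zOm: "?z : Om" using y by (simp add: Om_Uc[OF zU] Imvec_scale Imvec_cvec Revec_cvec)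
  have "norm (averages ?cs js (F idx) ?z) <= B * weight (exp (- 2 * pi * 0)) js"
  proof (rule tube.averages_bound[OF F_holomorphic per sub])
  show "ALL w:period_box 0 ?cs. ?z + w : Om & norm (F idx (?z + w)) <= B"
  proof
  fix w assume "w : period_box 0 ?cs"
  then obtain x where x: "perp x" "w = cvec x" using real_period_box[OF bs(1)] by blast
  have "?z + w : Uc e e'" unfolding x(2) by (intro Uc_add zU Uc_cvec x(1))
  then have "?z + w : Om" using y by (simp add: Om_Uc x(2) Imvec_add Imvec_scale Imvec_cvec Revec_cvec)
  then show "?z + w : Om & norm (F idx (?z + w)) <= B" using B[OF x(1)] by (simp add: x(2) add.commute)
  qed
  qed (use js in "auto simp: J_def")
  then have "norm (a idx l * ec (cform Q (cvec l) ?z)) <= B" using coeff[OF js(1) zU zOm, of idx] by (simp add: js(2) weight_1)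
  then show ?thesis by (simp add: norm_mult norm_ec cform_scale_right cform_cvec)
 qed
 ultimately show ?thesis by blast
qed

lemma \<Gamma>_isometric:
 assumes "g : \<Gamma>" shows "isometric Q g" and "!!om. om : D ==> cmat g *v om : D"
proof -
 have g: "g : carrier (O_plus Q L D)" using subgroup.subset[OF \<Gamma>(1)] assms by blast
 show "isometric Q g" by (rule isometric_of_lattice[OF lattice(2)]) (use g in "simp add: O_plus_def")
 show "cmat g *v om : D" if "om : D" for om using g that by (auto simp: O_plus_def)
qed

context
 fixes \<gamma> :: "real ^ 'm ^ 'm"
 assumes \<gamma>: "\<gamma> : \<Gamma>" "\<gamma> *v e = e" "\<gamma> *v e' = e'"
begin

lemma stab_perp: "perp (\<gamma> *v x) \<longleftrightarrow> perp x"
proof -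
 have "rform Q (\<gamma> *v x) (\<gamma> *v y) = rform Q x y" for y using \<Gamma>_isometric(1)[OF \<gamma>(1)] by (simp add: isometric_def)
 from this[of e] this[of e'] show ?thesis by (simp add: \<gamma>)
qed

lemma F_equivariant:
 assumes z: "z : Uc e e'" "Imvec z : pcone" shows "F idx (cmat \<gamma> *v z) = tmap (cmat \<gamma>) (%jdx. F jdx z) idx"
proof -
 note iso = isometric_cform[OF \<Gamma>_isometric(1)[OF \<gamma>(1)]]
 have ce: "cmat \<gamma> *v cvec e = cvec e" "cmat \<gamma> *v cvec e' = cvec e'" by (simp_all add: matrix_cvec \<gamma>)
 have gU: "cmat \<gamma> *v z : Uc e e'" using z(1) iso[of z "cvec e"] iso[of z "cvec e'"] by (simp add: Uc_def ce)
 have tpg: "tp (cmat \<gamma> *v z) = cmat \<gamma> *v tp z"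
  by (simp add: tube_point_def iso ce matrix_vector_right_distrib matrix_vector_mult_diff_distrib vector_scalar_commute)
 have D0: "tp z : D" by (rule tp_D[OF z])
 have "tmap (P (cmat \<gamma> *v tp z)) (f (cmat \<gamma> *v tp z)) = tmap (P (cmat \<gamma> *v tp z)) (tmap (cmat \<gamma>) (f (tp z)))"
  by (rule null_vanish_diff[OF \<Gamma>_isometric(2)[OF \<gamma>(1) D0] h(1) modular[OF \<gamma>(1) D0]])
 also have "... = tmap (cmat \<gamma>) (tmap (P (tp z)) (f (tp z)))"
  using Ptriv_equivariant[OF period_space_axioms \<Gamma>_isometric(1)[OF \<gamma>(1)], of e e' "tp z"]
  by (simp add: tmap_compose \<gamma>)
 also have "tmap (P (tp z)) (f (tp z)) = (%jdx. F jdx z)" by (simp add: fun_eq_iff F_Uc[OF z(1)])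
 finally show ?thesis by (simp add: F_Uc[OF gU] tpg)
qed

lemma stab_surj: "EX x'. x = \<gamma> *v x'"
proof -
 have "inj ((*v) \<gamma>)"
 proof (rule injI)
  fix x y assume "\<gamma> *v x = \<gamma> *v y"
  then have "rform Q (x - y) z = 0" for z using \<Gamma>_isometric(1)[OF \<gamma>(1)] unfolding isometric_def
  by (metis diff_self matrix_vector_mult_diff_distrib rform_0_left)
  then have "x - y = 0" by (rule nondegenerate)
  then show "x = y" by simp
 qed
 then have "surj ((*v) \<gamma>)" using linear_inj_imp_surj[OF matrix_vector_mul_linear] by blast
 then show ?thesis by (metis surjD)
qed

text \<open>By equivariance, every application of \<open>\<gamma>\<close> costs at most the factor \<open>C\<close> given by its matrix on tensors.\<close>

lemma F_growth:
 assumes y: "!!n. mpow \<gamma> n *v y : pcone"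
  and M: "!!x idx. perp x ==> length idx = d ==> norm (F idx (cvec x + \<i> *s cvec y)) <= M"
 shows "\<exists>C\<ge>1. ALL n x idx. perp x --> length idx = d --> norm (F idx (cvec x + \<i> *s cvec (mpow \<gamma> n *v y))) <= C ^ n * M"
proof -
 define w where "w idx jdx = (\<Prod>i<length idx. cmat \<gamma> $ (idx ! i) $ (jdx ! i))" for idx jdx :: "'m list"
 define C where "C = 1 + (\<Sum>idx | length idx = d. \<Sum>jdx | length jdx = d. norm (w idx jdx))"
 have C: "C \<ge> 1" unfolding C_def by (simp add: sum_nonneg)
 have Cw: "(\<Sum>jdx | length jdx = d. norm (w idx jdx)) <= C" if "length idx = d" for idx
  unfolding C_def using member_le_sum[of idx "{idx. length idx = d}" "%idx. \<Sum>jdx | length jdx = d. norm (w idx jdx)"] that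
  by (simp add: sum_nonneg)
 have "norm (F idx (cvec x + \<i> *s cvec (mpow \<gamma> n *v y))) <= C ^ n * M" if "perp x" "length idx = d" for n x idx
  using that
 proof (induction n arbitrary: x idx)
  case 0
  then show ?case using M by simp
 next
  case (Suc n)
  obtain x' where x': "x = \<gamma> *v x'" using stab_surj by blast
  have px: "perp x'" using Suc.prems(1) stab_perp[of x'] by (simp add: x')
  let ?z = "cvec x' + \<i> *s cvec (mpow \<gamma> n *v y)"
  have z: "?z : Uc e e'" by (intro Uc_add Uc_scale Uc_cvec px coneD(1) y)
  have "cvec x + \<i> *s cvec (mpow \<gamma> (Suc n) *v y) = cmat \<gamma> *v ?z"
  by (simp add: x' matrix_vector_right_distrib vector_scalar_commute matrix_cvec matrix_vector_mul_assoc[symmetric])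
  then have "norm (F idx (cvec x + \<i> *s cvec (mpow \<gamma> (Suc n) *v y))) = norm (tmap (cmat \<gamma>) (%jdx. F jdx ?z) idx)"
  using y[of n] by (simp add: F_equivariant[OF z] Revec_simps)
  also have "... <= (\<Sum>jdx | length jdx = d. norm (w idx jdx * F jdx ?z))"
  unfolding tmap_def w_def Suc.prems(2) by (rule norm_sum)
  also have "... <= (\<Sum>jdx | length jdx = d. norm (w idx jdx) * (C ^ n * M))"
  unfolding norm_mult using Suc.IH[OF px] by (intro sum_mono mult_left_mono) auto
  also have "... = (\<Sum>jdx | length jdx = d. norm (w idx jdx)) * (C ^ n * M)" by (simp add: sum_distrib_right)
  also have "... <= C * (C ^ n * M)"
  proof (rule mult_right_mono[OF Cw[OF Suc.prems(2)]])
  have "0 <= norm (F idx (cvec x' + \<i> *s cvec (mpow \<gamma> n *v y)))" by simp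
  also have "... <= C ^ n * M" by (rule Suc.IH[OF px Suc.prems(2)])
  finally show "0 <= C ^ n * M" .
  qed
  finally show ?case by (simp add: mult.assoc)
 qed
 then show ?thesis using C by blast
qed

end

end

lemma isometric_mpow: "isometric Q g ==> isometric Q (mpow g n)"
 by (induction n) (simp_all add: isometric_def matrix_vector_mul_assoc[symmetric])

lemma mpow_fix: "g *v x = x ==> mpow g n *v x = x" by (induction n) (simp_all add: matrix_vector_mul_assoc[symmetric])

context cusp_data
begin

lemma pconeI:
 assumes y: "y : pcone" and x: "perp x" "rform Q x x > 0" "rform Q x y > 0" shows "x : pcone"
proof -
 have "y : fcone e e' y" using coneD[OF y] by (simp add: fcone_def)
 moreover have "x : fcone e e' y" using x by (simp add: fcone_def)
 moreover have "y0 : fcone e e' y" using coneD[OF rat(4)] coneD(3)[OF y] rform_sym[of y0 y] by (simp add: fcone_def)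
 ultimately have "rform Q x y0 > 0" by (intro fcone_pairing[OF h(1)])
 then show ?thesis using x by (simp add: fcone_def)
qed

lemma boost_lattice:
 assumes yw: "y : L" "w : L" and v: "v : L" shows "boost Q y w (of_int a) (of_int b) (of_int c) *v v : L"
proof -
 obtain i j where ij: "rform Q v y = of_int i" "rform Q v w = of_int j"
  using lattice_int[OF v yw(1)] lattice_int[OF v yw(2)] by (auto elim!: Ints_cases)
 show ?thesis unfolding boost_apply ij
  by (intro lattice_diff[OF lattice(1)] lattice_add[OF lattice(1)] lattice_scale[OF lattice(1)] v yw)
qed

text \<open>A power of the boost lies in \<open>\<Gamma>\<close>. Its powers stretch \<open>y\<close> at least like \<open>2\<^sup>n\<close>, since the fundamental unit is at
  least \<open>2\<close>.\<close>

lemma hyperbolic_element: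
 assumes y: "y : L" "y : pcone" and w: "w : L" "perp w" "rform Q y w = 0" "rform Q w w < 0"
  and ns: "!!u::int. real_of_int (u * u) ~= rform Q y y * (- rform Q w w)"
 shows "EX \<gamma>:\<Gamma>. \<gamma> *v e = e & \<gamma> *v e' = e' &
  (ALL n. EX P R. mpow \<gamma> n *v y = P *\<^sub>R y + (R * rform Q y y) *\<^sub>R w & P \<ge> 2 ^ n & R \<ge> 0)"
proof -
 obtain A B' where AB': "rform Q y y = of_int A" "rform Q w w = of_int B'"
  using lattice_int[OF y(1) y(1)] lattice_int[OF w(1) w(1)] by (auto elim!: Ints_cases)
 define B where "B = - B'"
 have AB: "rform Q y y = of_int A" "rform Q w w = - of_int B" by (simp_all add: AB' B_def)
 have A0: "A > 0" using coneD(2)[OF y(2)] AB(1) by simp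
 have B0: "B > 0" using w(4) AB(2) by simp
 have nsq: "u * u ~= A * B" for u
 proof
  assume "u * u = A * B"
  then have "real_of_int (u * u) = real_of_int (A * B)" by (simp only:)
  then show False using ns[of u] AB by simp
 qed
 have "A * B > 0" using A0 B0 by simp
 moreover have "A * B ~= 1" using nsq[of 1] by simp
 ultimately have "A * B > 1" by linarith
 from pell_equation[OF nsq this] obtain p q where pq: "1 < p" "0 < q" "p^2 - A * B * q^2 = 1" by blast
 have "real_of_int (p^2 - A * B * q^2) = 1" unfolding pq(3) by simp
 then have pell: "(real_of_int p)^2 - of_int A * of_int B * (of_int q)^2 = 1" by simp
 note st = AB w(3) pell
 define g where "g = boost Q y w (2 * of_int B * (of_int q)^2) (2 * of_int p * of_int q) (2 * of_int A * (of_int q)^2)"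
 define g' where "g' = boost Q y w (2 * of_int B * (- of_int q)^2) (2 * of_int p * (- of_int q)) (2 * of_int A * (- of_int q)^2)"
 have inv: "g ** g' = mat 1" "g' ** g = mat 1" unfolding g_def g'_def by (rule boost_inverse[OF st])+
 have iso: "isometric Q g" unfolding g_def by (rule boost_isometric[OF st])
 have gi: "g = boost Q y w (of_int (2 * B * q^2)) (of_int (2 * p * q)) (of_int (2 * A * q^2))"
  "g' = boost Q y w (of_int (2 * B * q^2)) (of_int (2 * p * (- q))) (of_int (2 * A * q^2))" unfolding g_def g'_def by simp_all
 have eperp: "rform Q e y = 0" "rform Q e w = 0" "rform Q e' y = 0" "rform Q e' w = 0"
  using coneD(1)[OF y(2)] w(2) rform_sym[of e y] rform_sym[of e w] rform_sym[of e' y] rform_sym[of e' w] by auto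
 have ge: "g *v e = e" "g *v e' = e'" unfolding g_def by (simp_all add: boost_apply eperp)
 have orbit: "EX P R. mpow g n *v y = P *\<^sub>R y + (R * of_int A) *\<^sub>R w & P \<ge> 2 ^ n & R \<ge> 0" for n
  unfolding g_def by (rule boost_orbit[OF st]) (use pq A0 B0 in auto)
 have wy: "rform Q w y = 0" using w(3) rform_sym[of w y] by simp
 have gy: "g *v y : pcone"
 proof -
  obtain P R where PR: "mpow g 1 *v y = P *\<^sub>R y + (R * of_int A) *\<^sub>R w" "P \<ge> 2 ^ 1" using orbit[of 1] by blast
  have gPR: "g *v y = P *\<^sub>R y + (R * of_int A) *\<^sub>R w" using PR(1) by simp
  show ?thesis
  proof (rule pconeI[OF y(2)])
  show "perp (g *v y)" using coneD(1)[OF y(2)] w(2) by (simp add: gPR rform_simps)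
  show "rform Q (g *v y) (g *v y) > 0" using iso coneD(2)[OF y(2)] by (simp add: isometric_def)
  show "rform Q (g *v y) y > 0" using PR(2) coneD(2)[OF y(2)] by (simp add: gPR rform_simps wy)
  qed
 qed
 have "g : carrier (O_plus Q L D)"
 proof (rule O_plus_carrierI[OF iso inv])
  show "g *v x : L" "g' *v x : L" if "x : L" for x unfolding gi by (rule boost_lattice[OF y(1) w(1) that])+
  have c: "\<i> *s cvec x : Uc e e'" "Imvec (\<i> *s cvec x) : pcone" if "x : pcone" for x
  using that coneD(1)[OF that] by (auto intro: Uc_scale Uc_cvec simp: Imvec_scale Imvec_cvec Revec_cvec)
  show "tp (\<i> *s cvec y) : D" by (rule tp_D[OF c[OF y(2)]])
  have "cmat g *v tp (\<i> *s cvec y) = tp (\<i> *s cvec (g *v y))"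
  using iso by (simp add: tube_point_def matrix_vector_right_distrib matrix_vector_mult_diff_distrib
  vector_scalar_commute matrix_cvec ge cform_simps cform_cvec isometric_def)
  also have "... : D" by (rule tp_D[OF c[OF gy]])
  finally show "cmat g *v tp (\<i> *s cvec y) : D" .
 qed
 from finite_index_power[OF \<Gamma> this inv(2,1)] obtain j where j: "j > 0" "mpow g j : \<Gamma>" by blast
 have "EX P R. mpow (mpow g j) n *v y = P *\<^sub>R y + (R * rform Q y y) *\<^sub>R w & P \<ge> 2 ^ n & R \<ge> 0" for n
 proof -
  obtain P R where PR: "mpow g (j * n) *v y = P *\<^sub>R y + (R * of_int A) *\<^sub>R w" "P \<ge> 2 ^ (j * n)" "R \<ge> 0"
  using orbit by blast
  have "(2::real) ^ n <= 2 ^ (j * n)" using j(1) by (intro power_increasing) auto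
  then have "P \<ge> 2 ^ n" using PR(2) by linarith
  then show ?thesis using PR AB(1) by (intro exI[of _ P] exI[of _ R]) (simp add: mpow_mult)
 qed
 then show ?thesis using j(2) ge by (intro bexI[of _ "mpow g j"]) (auto simp: mpow_fix)
qed

lemma lattice_multiple: "x : rat_space L ==> \<exists>N::nat. N > 0 & real N *\<^sub>R x : L" by (auto simp: rat_space_def)

text \<open>A convergent expansion converges absolutely, and the absolute values of its terms depend on the imaginary
  part only.\<close>

lemma real_bound:
 assumes E: "!!idx z. z : Uc e e' ==> Imvec z : pcone ==> ((%l. a idx l * ec (cform Q (cvec l) z)) has_sum F idx z) UQ"
  and y: "y : pcone" shows "EX M. ALL x idx. perp x --> length idx = d --> norm (F idx (cvec x + \<i> *s cvec y)) <= M"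
proof -
 define m where "m idx = infsum (%l. norm (a idx l) * exp (- 2 * pi * rform Q l y)) UQ" for idx
 have m0: "m idx \<ge> 0" for idx unfolding m_def by (intro infsum_nonneg) simp
 have "norm (F idx (cvec x + \<i> *s cvec y)) <= m idx" if x: "perp x" for x idx
 proof -
  let ?z = "cvec x + \<i> *s cvec y"
  have z: "?z : Uc e e'" by (intro Uc_add Uc_scale Uc_cvec x coneD(1) y)
  have n: "norm (a idx l * ec (cform Q (cvec l) ?z)) = norm (a idx l) * exp (- 2 * pi * rform Q l y)" for l
  by (simp add: norm_mult norm_ec cform_simps cform_cvec)
  have hs: "((%l. a idx l * ec (cform Q (cvec l) ?z)) has_sum F idx ?z) UQ" by (rule E[OF z]) (simp add: y)
  have "(%l. norm (a idx l * ec (cform Q (cvec l) ?z))) summable_on UQ"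
  using has_sum_imp_summable[OF hs] by (simp add: summable_on_iff_abs_summable_on_complex)
  from norm_infsum_bound[OF this] show ?thesis unfolding n m_def[symmetric] infsumI[OF hs] .
 qed
 moreover have "m idx <= (\<Sum>idx | length idx = d. m idx)" if "length idx = d" for idx
  by (rule member_le_sum) (use that m0 in auto)
 ultimately have "ALL x idx. perp x --> length idx = d --> norm (F idx (cvec x + \<i> *s cvec y)) <= (\<Sum>idx | length idx = d. m idx)"
  by (intro allI impI) (rule order_trans)
 then show ?thesis by (rule exI)
qed

text \<open>Suppose that \<open>(l, y) < 0\<close>, where \<open>y\<close> may be taken integral. A boost \<open>\<gamma>\<close> of \<open>\<Gamma>\<close> in a plane
  containing \<open>y\<close> moves \<open>y\<close> towards the boundary of the cone such that the term of \<open>l\<close> at \<open>\<i> \<gamma>\<^sup>n y\<close> grows like an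
  exponential of \<open>2\<^sup>n\<close>. But by equivariance the function grows only like the \<open>n\<close>-th power of a constant.
  Such a boost needs a vector \<open>w\<close> orthogonal to \<open>y\<close> such that \<open>- (y, y) (w, w)\<close> is not a square; it exists as the
  complement of the frame and \<open>y\<close> has dimension at least 2.\<close>

lemma Koecher_principle:
 assumes E2: "!!idx z. z : Uc e e' ==> Imvec z : pcone ==> ((%l. a idx l * ec (cform Q (cvec l) z)) has_sum F idx z) UQ"
  and E3: "!!idx l y B. y : pcone ==> (!!x. perp x ==> norm (F idx (cvec x + \<i> *s cvec y)) <= B) ==>
  norm (a idx l) * exp (- 2 * pi * rform Q l y) <= B"
  and al: "a idx l ~= 0" and yc: "yc : pcone" shows "rform Q l yc \<ge> 0"
proof (rule ccontr)
 assume "~ rform Q l yc \<ge> 0"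
 then have neg: "rform Q l yc < 0" by simp
 have "EX y:L. y : pcone & rform Q l y < 0"
 proof -
  obtain M where M: "M <= UQ" "!!x. perp x ==> x : span (insert y0 M)" using frame_basis[OF rat(4) y0_UQ] by blast
  have "insert y0 M <= UQ" using M(1) y0_UQ by blast
  from span_mono[OF this] have "yc : span UQ" using M(2)[OF coneD(1)[OF yc]] by blast
  also have "span UQ <= closure UQ" by (rule rational_span_dense[OF UQ_0 UQ_add UQ_scale])
  finally have ycl: "yc : closure UQ" .
  let ?V = "{x. 0 < rform Q x x} Int {x. 0 < rform Q x y0} Int {x. rform Q l x < 0}"
  have "open ?V" by (intro open_Int open_Collect_less continuous_intros)
  moreover have "yc : ?V" using neg coneD[OF yc] by simp
  ultimately obtain y1 where y1: "y1 : UQ" "y1 : ?V" using ycl unfolding closure_iff_nhds_not_empty by blast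
  obtain N :: nat where N: "N > 0" "real N *\<^sub>R y1 : L" using lattice_multiple[OF UQ_rat[OF y1(1)]] by blast
  have "y1 : pcone" using y1 UQ_perp by (auto simp: fcone_def)
  then have "real N *\<^sub>R y1 : pcone" by (rule fcone_scale) (use N(1) in simp)
  moreover have "rform Q l (real N *\<^sub>R y1) < 0" using y1(2) N(1) by (simp add: rform_simps mult_pos_neg)
  ultimately show ?thesis using N(2) by blast
 qed
 then obtain y where y: "y : L" "y : pcone" "rform Q l y < 0" by blast
 have yU: "y : UQ" using y(1) coneD(1)[OF y(2)] lattice_rat_space by (auto simp: U_rat_def)
 obtain M where M: "finite M" "y ~: M" "orth_set (insert y M)" "M <= UQ" "CARD('m) = 3 + card M"
  using frame_basis[OF y(2) yU] by blast
 have "~ card M <= Suc 0" using M(5) card by simp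
 then obtain m1 m2 where m: "m1 : M" "m2 : M" "m1 ~= m2" using card_le_Suc0_iff_eq[OF M(1)] by blast
 obtain N1 :: nat where N1: "N1 > 0" "real N1 *\<^sub>R m1 : L" using lattice_multiple[OF UQ_rat] m(1) M(4) by blast
 obtain N2 :: nat where N2: "N2 > 0" "real N2 *\<^sub>R m2 : L" using lattice_multiple[OF UQ_rat] m(2) M(4) by blast
 define w1 where "w1 = real N1 *\<^sub>R m1"
 define w2 where "w2 = real N2 *\<^sub>R m2"
 have mm: "rform Q m1 m2 = 0" "rform Q m2 m1 = 0" "rform Q y m1 = 0" "rform Q y m2 = 0" "rform Q m1 y = 0" "rform Q m2 y = 0"
  "rform Q m1 m1 ~= 0" "rform Q m2 m2 ~= 0" using M(2,3) m by (auto simp: orth_set_def)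
 have mp: "perp m1" "perp m2" using M(4) m UQ_perp by blast+
 have mneg: "rform Q x x < 0" if "x = m1 | x = m2" for x
  using that mp mm by (intro orthogonal_to_positive[OF h(1) _ _ coneD(2)[OF y(2)]])
  (use coneD(1)[OF y(2)] in "auto simp: rform_simps")
 have w: "w1 : L" "w2 : L" "perp w1" "perp w2" "rform Q y w1 = 0" "rform Q y w2 = 0" "rform Q w1 w2 = 0" "rform Q w2 w1 = 0"
  using N1 N2 mp mm by (simp_all add: w1_def w2_def rform_simps)
 have wneg: "rform Q w1 w1 < 0" "rform Q w2 w2 < 0"
  using mneg[of m1] mneg[of m2] N1(1) N2(1) by (simp_all add: w1_def w2_def rform_simps mult_pos_neg)
 obtain A b1 b2 where int: "rform Q y y = of_int A" "rform Q w1 w1 = of_int b1" "rform Q w2 w2 = of_int b2"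
  using lattice_int[OF y(1) y(1)] lattice_int[OF w(1) w(1)] lattice_int[OF w(2) w(2)] by (auto elim!: Ints_cases)
 have pos: "A > 0" "b1 < 0" "b2 < 0" using coneD(2)[OF y(2)] wneg by (simp_all add: int)
 have "0 < A * (- b1)" "0 < A * (- b2)" using pos by (simp_all add: mult_pos_neg)
 from nonsquare_value[OF this] obtain s t where st: "(s, t) ~= (0, 0)"
  "ALL u. u * u ~= s^2 * (A * (- b1)) + t^2 * (A * (- b2))" by blast
 have "EX w. w : L & perp w & rform Q y w = 0 & rform Q w w = of_int (s^2 * b1 + t^2 * b2) & rform Q l w <= 0"
 proof -
  define w0 where "w0 = real_of_int s *\<^sub>R w1 + real_of_int t *\<^sub>R w2"
  have w0: "w0 : L" unfolding w0_def by (intro lattice_add[OF lattice(1)] lattice_scale[OF lattice(1)] w)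
  have props: "perp w0" "rform Q y w0 = 0" "rform Q w0 w0 = of_int (s^2 * b1 + t^2 * b2)"
  using w by (simp_all add: w0_def rform_simps int power2_eq_square)
  show ?thesis
  proof (cases "rform Q l w0 <= 0")
  case True then show ?thesis using w0 props by blast
  next
  case False
  then show ?thesis using lattice_minus[OF lattice(1) w0] props by (intro exI[of _ "- w0"]) (simp add: rform_simps)
  qed
 qed
 then obtain v where v: "v : L" "perp v" "rform Q y v = 0" "rform Q v v = of_int (s^2 * b1 + t^2 * b2)" "rform Q l v <= 0" by blast
 have vneg: "rform Q v v < 0"
 proof -
  have "s^2 * b1 + t^2 * b2 < 0"
  proof (cases "s = 0")
  case True
  then show ?thesis using st(1) pos by (simp add: mult_pos_neg)
  next
  case False
  then have "s^2 * b1 < 0" using pos by (simp add: mult_pos_neg)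
  moreover have "t^2 * b2 <= 0" using pos by (intro mult_nonneg_nonpos) auto
  ultimately show ?thesis by linarith
  qed
  then show ?thesis unfolding v(4) by (simp only: of_int_less_0_iff)
 qed
 have "real_of_int (u * u) ~= rform Q y y * (- rform Q v v)" for u
 proof
  assume "real_of_int (u * u) = rform Q y y * (- rform Q v v)"
  also have "... = real_of_int (A * (- (s^2 * b1 + t^2 * b2)))" by (simp only: int v(4) of_int_mult of_int_minus)
  finally have "u * u = A * (- (s^2 * b1 + t^2 * b2))" by (simp only: of_int_eq_iff)
  then have "u * u = s^2 * (A * (- b1)) + t^2 * (A * (- b2))" by (simp add: algebra_simps)
  then show False using st(2) by blast
 qed
 from hyperbolic_element[OF y(1,2) v(1,2,3) vneg this] obtain \<gamma> where \<gamma>: "\<gamma> : \<Gamma>" "\<gamma> *v e = e" "\<gamma> *v e' = e'"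
  and orbit: "!!n. EX P R. mpow \<gamma> n *v y = P *\<^sub>R y + (R * rform Q y y) *\<^sub>R v & P \<ge> 2 ^ n & R \<ge> 0" by blast
 have vy: "rform Q v y = 0" using v(3) rform_sym[of v y] by simp
 have yn: "mpow \<gamma> n *v y : pcone" and ln: "rform Q l (mpow \<gamma> n *v y) <= 2 ^ n * rform Q l y" for n
 proof -
  obtain P R where PR: "mpow \<gamma> n *v y = P *\<^sub>R y + (R * rform Q y y) *\<^sub>R v" "P \<ge> 2 ^ n" "R \<ge> 0" using orbit by blast
  have P0: "P > 0" using PR(2) by (rule less_le_trans[rotated]) simp
  show "mpow \<gamma> n *v y : pcone"
  proof (rule pconeI[OF y(2)])
  show "perp (mpow \<gamma> n *v y)" using coneD(1)[OF y(2)] v(2) by (simp add: PR(1) rform_simps)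
  show "rform Q (mpow \<gamma> n *v y) (mpow \<gamma> n *v y) > 0"
  using isometric_mpow[OF \<Gamma>_isometric(1)[OF \<gamma>(1)]] coneD(2)[OF y(2)] by (simp add: isometric_def)
  show "rform Q (mpow \<gamma> n *v y) y > 0" using P0 coneD(2)[OF y(2)] by (simp add: PR(1) rform_simps vy)
  qed
  have "P * rform Q l y <= 2 ^ n * rform Q l y" using PR(2) y(3) by (intro mult_right_mono_neg) auto
  moreover have "R * rform Q y y * rform Q l v <= 0" using PR(3) coneD(2)[OF y(2)] v(5) by (intro mult_nonneg_nonpos) auto
  ultimately show "rform Q l (mpow \<gamma> n *v y) <= 2 ^ n * rform Q l y" by (simp add: PR(1) rform_simps)
 qed
 obtain M0 where M0: "!!x jdx. perp x ==> length jdx = length idx ==> norm (F jdx (cvec x + \<i> *s cvec y)) <= M0"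
  using real_bound[where a = a and d = "length idx", OF E2 y(2)] by blast
 from F_growth[OF \<gamma> yn M0] obtain C where C: "C \<ge> 1"
  "!!n x jdx. perp x ==> length jdx = length idx ==> norm (F jdx (cvec x + \<i> *s cvec (mpow \<gamma> n *v y))) <= C ^ n * M0"
  by blast
 show False
 proof (rule exp_power_growth)
  show "0 < norm (a idx l)" using al by simp
  show "0 < 2 * pi * (- rform Q l y)" using y(3) by (simp add: mult_pos_neg)
  show "1 <= C" by (rule C(1))
  fix n
  have "exp (2 * pi * (- rform Q l y) * 2 ^ n) <= exp (- 2 * pi * rform Q l (mpow \<gamma> n *v y))"
  using mult_left_mono[OF ln[of n], of "2 * pi"] by (simp add: algebra_simps)
  then have "norm (a idx l) * exp (2 * pi * (- rform Q l y) * 2 ^ n)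
  <= norm (a idx l) * exp (- 2 * pi * rform Q l (mpow \<gamma> n *v y))" by (intro mult_left_mono) auto
  also have "... <= C ^ n * M0" by (rule E3[OF yn C(2)]) simp_all
  finally show "norm (a idx l) * exp (2 * pi * (- rform Q l y) * 2 ^ n) <= C ^ n * M0" .
 qed
qed

section \<open>Fourier expansion of the quasi-pullback\<close>

lemma y0_span: "y0 : span L'" using rat(3) rat_space_subset_span by blast

text \<open>Testing with \<open>y + s n\<close> for small \<open>s\<close> gives \<open>(l', y) \<ge> s \<kappa>\<close> whenever \<open>s\<^sup>2 \<kappa> < (y, y)\<close>, where \<open>\<kappa> = - (n, n)\<close>. If \<open>l'\<close> had
  norm at most \<open>0\<close>, this would fail for a suitable \<open>y\<close> in the plane of \<open>l'\<close> and \<open>y0\<close>.\<close>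

lemma tangential_frequency_positive:
 assumes l': "l' : span L'" "perp l'" and n: "n : span K" "n ~= 0"
  and nonneg: "!!y. y : pcone ==> rform Q (l' + n) y \<ge> 0" shows "l' : pcone"
proof -
 define \<kappa> where "\<kappa> = - rform Q n n"
 have \<kappa>: "\<kappa> > 0" using K_negative[OF n] by (simp add: \<kappa>_def)
 have orth: "rform Q x n = 0" "rform Q n x = 0" if "x : span L'" for x
  using L'_K_orth[OF that n(1)] rform_sym[of n x] by auto
 have claim: "rform Q l' y \<ge> s * \<kappa>" if y: "y : pcone" "y : span L'" and s: "s * s * \<kappa> < rform Q y y" for y s
 proof -
  have "perp (y + s *\<^sub>R n)" using coneD(1)[OF y(1)] orth(2)[OF h(2)] orth(2)[OF h(3)] by (simp add: rform_simps)
  moreover have "rform Q (y + s *\<^sub>R n) (y + s *\<^sub>R n) > 0" using s by (simp add: rform_simps orth[OF y(2)] \<kappa>_def)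
  moreover have "rform Q (y + s *\<^sub>R n) y0 > 0" using coneD(3)[OF y(1)] by (simp add: rform_simps orth(2)[OF y0_span])
  ultimately have "y + s *\<^sub>R n : pcone" by (simp add: fcone_def)
  from nonneg[OF this] show ?thesis by (simp add: rform_simps orth[OF y(2)] orth[OF l'(1)] \<kappa>_def)
 qed
 have pos: "rform Q l' y > 0" if y: "y : pcone" "y : span L'" for y
 proof -
  define s where "s = min 1 (rform Q y y / (2 * \<kappa>))"
  have q: "rform Q y y / (2 * \<kappa>) > 0" using coneD(2)[OF y(1)] \<kappa> by simp
  have s0: "s > 0" "s <= 1" "s <= rform Q y y / (2 * \<kappa>)" using q by (simp_all add: s_def)
  have "s * s <= 1 * s" using s0 by (intro mult_right_mono) auto
  from mult_right_mono[OF this less_imp_le[OF \<kappa>]] have "s * s * \<kappa> <= s * \<kappa>" by simp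
  also have "s * \<kappa> <= rform Q y y / (2 * \<kappa>) * \<kappa>" using s0 \<kappa> by (intro mult_right_mono) auto
  also have "... = rform Q y y / 2" using \<kappa> by simp
  also have "... < rform Q y y" using coneD(2)[OF y(1)] by simp
  finally have "s * s * \<kappa> < rform Q y y" .
  from claim[OF y this] have "s * \<kappa> <= rform Q l' y" .
  moreover have "s * \<kappa> > 0" using s0 \<kappa> by simp
  ultimately show ?thesis by linarith
 qed
 define A where "A = rform Q y0 y0"
 define B where "B = rform Q l' y0"
 define N where "N = rform Q l' l'"
 have A0: "A > 0" using coneD(2)[OF rat(4)] by (simp add: A_def)
 have B0: "B > 0" using pos[OF rat(4) y0_span] by (simp add: B_def)
 have By: "rform Q y0 l' = B" using rform_sym[of y0 l'] by (simp add: B_def)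
 have comb: "y0 + r *\<^sub>R l' : span L'" "perp (y0 + r *\<^sub>R l')" for r
  using y0_span l' coneD(1)[OF rat(4)] by (auto intro: span_add span_scale simp: rform_simps)
 have vals: "rform Q (y0 + r *\<^sub>R l') (y0 + r *\<^sub>R l') = A + 2 * r * B + r * r * N"
  "rform Q (y0 + r *\<^sub>R l') y0 = A + r * B" "rform Q l' (y0 + r *\<^sub>R l') = B + r * N" for r
  by (simp_all add: rform_simps By A_def[symmetric] B_def[symmetric] N_def[symmetric] algebra_simps)
 have "N > 0"
 proof (rule ccontr)
  assume "~ N > 0"
  then consider "N < 0" | "N = 0" by linarith
  then show False
  proof cases
  case 1
  define r where "r = B / (- N)"
  have r: "r > 0" "r * N = - B" using 1 B0 by (simp_all add: r_def divide_pos_neg)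
  have "2 * r * B + r * r * N = r * B" using r(2) by (simp add: mult.assoc)
  moreover have "r * B > 0" using r(1) B0 by simp
  ultimately have v1: "A + 2 * r * B + r * r * N > 0" using A0 by linarith
  have v2: "A + r * B > 0" using A0 r(1) B0 by (simp add: add_pos_pos)
  have "y0 + r *\<^sub>R l' : pcone" using v1 v2 comb(2)[of r] by (simp add: fcone_def vals del: rform_simps)
  from pos[OF this comb(1)] show False by (simp only: vals r(2))
  next
  case 2
  define s where "s = (B + 1) / \<kappa>"
  define r where "r = s * s * \<kappa> / (2 * B)"
  have s: "s * \<kappa> = B + 1" using \<kappa> by (simp add: s_def)
  have r: "2 * r * B = s * s * \<kappa>" "r \<ge> 0" using B0 \<kappa> by (simp_all add: r_def)
  have v2: "A + r * B > 0" using A0 r(2) B0 by (simp add: add_pos_nonneg)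
  have v1: "s * s * \<kappa> < A + 2 * r * B + r * r * N" using r(1) A0 2 by simp
  have "0 <= s * s * \<kappa>" using \<kappa> by simp
  then have v1': "A + 2 * r * B + r * r * N > 0" using v1 by linarith
  have "y0 + r *\<^sub>R l' : pcone" using v1' v2 comb(2)[of r] by (simp add: fcone_def vals del: rform_simps)
  from claim[OF this comb(1), of s] v1 have "s * \<kappa> <= B + r * N" by (simp only: vals)
  then show False using s 2 by simp
  qed
 qed
 then show ?thesis using l'(2) B0 by (simp add: fcone_def N_def B_def)
qed

text \<open>Projection to the first summand of \<open>L'\<^sub>\<rat> \<oplus> K\<^sub>\<rat>\<close>.\<close>

lemma frequency_projection:
 "EX pr. ALL l:UQ. pr l : U_rat Q L' e e' & l - pr l : span K"
proof -
 have "orth_set {}" "{} <= rat_space L'" by (simp_all add: orth_set_def)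
 from adapted_basis[OF this] obtain B' BK where B: "orth_set (B' Un BK)" "B' <= rat_space L'"
  "BK <= span K" "span (B' Un BK) = UNIV" "B' Int BK = {}" by blast
 have fin: "finite B'" "finite BK" using B(1) by (auto simp: orth_set_def)
 define pr where "pr l = (SUM b:B'. (rform Q l b / rform Q b b) *\<^sub>R b)" for l
 have "pr l : U_rat Q L' e e' & l - pr l : span K" if l: "l : UQ" for l
 proof -
  have "l = (SUM b:B' Un BK. (rform Q l b / rform Q b b) *\<^sub>R b)" by (rule orth_expand[OF B(1)]) (simp add: B(4))
  also have "... = pr l + (SUM b:BK. (rform Q l b / rform Q b b) *\<^sub>R b)"
  unfolding pr_def by (rule sum.union_disjoint[OF fin B(5)])
  finally have "l - pr l = (SUM b:BK. (rform Q l b / rform Q b b) *\<^sub>R b)" by (simp add: algebra_simps)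
  also have "... : span K" using B(3) by (intro span_sum span_scale) blast
  finally have k: "l - pr l : span K" .
  have "rform Q l b / rform Q b b : \<rat>" if "b : B'" for b
  using that B(2) rat_space_mono rform_rat[OF lattice(1)] UQ_rat[OF l] by (intro Rats_divide) blast+
  then have r: "pr l : rat_space L'"
  unfolding pr_def using B(2) by (intro rat_space_sum[OF lattice'(1)] rat_space_scale[OF lattice'(1)]) auto
  have "rform Q (l - pr l) e = 0" "rform Q (l - pr l) e' = 0"
  using L'_K_orth[OF h(2) k] L'_K_orth[OF h(3) k] rform_sym[of "l - pr l" e] rform_sym[of "l - pr l" e'] by auto
  then show ?thesis using k r UQ_perp[OF l] by (simp add: U_rat_def rform_simps)
 qed
 then show ?thesis by blast
qed

text \<open>Along the normal curve through \<open>tp z\<close> the expansion at the cusp is an exponential sum in the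
  curve parameter. So the quasi-pullback is given by the terms of order \<open>\<nu>\<close>, which vanish for
  the frequencies \<open>l\<close> orthogonal to \<open>K\<close> as \<open>\<nu> > 0\<close>.\<close>

lemma quasi_pullback_fourier:
 assumes u: "u : cspace K" and \<nu>: "\<nu> > 0" and \<Gamma>': "\<Gamma>' = fixing \<Gamma> K"
 shows "EX c. (ALL l. c l ~= 0 --> l : U_dual Q L' \<Gamma>' e e' & l : pcone) &
  (ALL l idx. length idx ~= deg --> c l idx = 0) &
  (ALL z. z : Uc e e' --> z : cspace L' --> Imvec z : pcone --> (ALL idx.
  ((%l. c l idx * ec (cform Q (cvec l) z)) has_sum tmap (P (tp z)) (qp (tp z) u) idx) (U_dual Q L' \<Gamma>' e e')))"
proof -
 obtain a :: "'m list => real ^ 'm => complex" where a: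
  "(ALL idx. ALL l. a idx l ~= 0 --> (ALL m:UZ. rform Q l m : \<int>)) &
  (ALL idx. ALL z:Uc e e'. Imvec z : pcone --> ((%l. a idx l * ec (cform Q (cvec l) z)) has_sum F idx z) UQ) &
  (ALL idx l y B. y : pcone --> (ALL x. perp x --> norm (F idx (cvec x + \<i> *s cvec y)) <= B) -->
  norm (a idx l) * exp (- 2 * pi * rform Q l y) <= B)" using fourier_expansion_at_cusp by (elim exE)
 have a1: "rform Q l m : \<int>" if "a idx l ~= 0" "m : UZ" for idx l m using conjunct1[OF a] that by blast
 have a2: "((%l. a idx l * ec (cform Q (cvec l) z)) has_sum F idx z) UQ"
  if "z : Uc e e'" "Imvec z : pcone" for idx z using conjunct1[OF conjunct2[OF a]] that by simp
 have a3: "norm (a idx l) * exp (- 2 * pi * rform Q l y) <= B"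
  if "y : pcone" "!!x. perp x ==> norm (F idx (cvec x + \<i> *s cvec y)) <= B" for idx l y B
  by (rule conjunct2[OF conjunct2[OF a], rule_format, OF that(1)]) (rule that(2))
 obtain pr where pr: "!!l. l : UQ ==> pr l : U_rat Q L' e e'" "!!l. l : UQ ==> l - pr l : span K"
  using frequency_projection by blast
 let ?U' = "U_rat Q L' e e'" and ?Ud = "U_dual Q L' \<Gamma>' e e'"
 define w where "w l = 2 * of_real pi * \<i> * cform Q (cvec l) u" for l
 define q where "q idx l = a idx l * w l ^ \<nu> / fact \<nu>" for idx l
 define fib where "fib l' = {l : UQ. pr l = l'}" for l'
 define c where "c l' idx = (if length idx = deg then infsum (q idx) (fib l') else 0)" for l' idx
 have U'_span: "x : span L'" if "x : ?U'" for x using that rat_space_subset_span by (auto simp: U_rat_def)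
 have supp: "l' : ?Ud & l' : pcone" if nz: "c l' idx ~= 0" for l' idx
 proof -
  have "infsum (q idx) (fib l') ~= 0" using nz by (auto simp: c_def split: if_splits)
  then have "EX l:fib l'. q idx l ~= 0" using infsum_0[of "fib l'" "q idx"] by blast
  then obtain l where l: "l : UQ" "pr l = l'" "q idx l ~= 0" by (auto simp: fib_def)
  have al: "a idx l ~= 0" and wl: "w l ~= 0" using l(3) \<nu> by (auto simp: q_def)
  have l'U: "l' : ?U'" using pr(1)[OF l(1)] l(2) by simp
  have kK: "l - l' : span K" using pr(2)[OF l(1)] l(2) by simp
  have "cform Q (cvec l') u = 0" by (rule L'_K_orth_cplx[OF _ u]) (simp add: cvec_cspace U'_span[OF l'U])
  then have "l - l' ~= 0" using wl by (auto simp: w_def)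
  have nn: "rform Q (l' + (l - l')) y \<ge> 0" if "y : pcone" for y
  proof -
  have "rform Q l y \<ge> 0" by (rule Koecher_principle[where a = a and idx = idx]) (fact a2 a3 al that)+
  then show ?thesis by simp
  qed
  have "l' : pcone" by (rule tangential_frequency_positive[OF U'_span[OF l'U] _ kK \<open>l - l' ~= 0\<close> nn])
  (use l'U in "auto simp: U_rat_def")
  moreover have "rform Q l' m : \<int>" if m: "m : U_int Q L' \<Gamma>' e e'" for m
  proof -
  have mU: "m : ?U'" and mG: "transvection Q m e : \<Gamma>" using m by (auto simp: U_int_def \<Gamma>' fixing_def)
  have "m : UZ" using mU mG rat_space_mono by (auto simp: U_int_def U_rat_def)
  from a1[OF al this] have "rform Q l m : \<int>" .
  moreover have "rform Q (l - l') m = 0" using L'_K_orth[OF U'_span[OF mU] kK] rform_sym[of "l - l'" m] by simp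
  ultimately show ?thesis by (simp add: rform_simps)
  qed
  ultimately show ?thesis using l'U by (simp add: U_dual_def)
 qed
 have "((%l. c l idx * ec (cform Q (cvec l) z)) has_sum tmap (P (tp z)) (qp (tp z) u) idx) ?Ud"
  if z: "z : Uc e e'" "z : cspace L'" "Imvec z : pcone" for z idx
 proof -
  have ce: "cvec e : cspace L'" "cvec e' : cspace L'" by (simp_all add: cvec_cspace h)
  have uz: "cform Q z u = 0" "cform Q u z = 0" "cform Q u (cvec e) = 0" "cform Q u (cvec e') = 0"
  using L'_K_orth_cplx[OF z(2) u] L'_K_orth_cplx[OF ce(1) u] L'_K_orth_cplx[OF ce(2) u]
  cform_sym[of u z] cform_sym[of u "cvec e"] cform_sym[of u "cvec e'"] by simp_all
  have uU: "u : Uc e e'" by (simp add: Uc_def uz)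
  have "tp z : cspace L'" unfolding tube_point_def using cspace_subspace[of L'] ce z(2)
  by (intro vec.subspace_diff vec.subspace_add vec.subspace_scale)
  then have tpD': "tp z : D'" using tp_D[OF z(1,3)] D' by simp
  show ?thesis
  proof (cases "length idx = deg")
  case False
  have "tmap (P (tp z)) (qp (tp z) u) : tpow deg UNIV" by (rule tmap_tpow[OF qp_tpow[OF tpD']]) simp
  then have "tmap (P (tp z)) (qp (tp z) u) idx = 0" using False tpow_deg by blast
  then show ?thesis using False by (simp add: c_def)
  next
  case True
  have one: "cform Q (tp z) (cvec e) = 1" by (rule tube_point_isotropic(2)[OF h(1)]) (use z(1) in "simp_all add: Uc_def")
  have tpc: "tp (z + t *s u) = ncurve e (tp z) u t" for t
  proof -
  have "cform Q (z + t *s u) (z + t *s u) = cform Q z z + t^2 * cform Q u u"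
  by (simp add: cform_simps uz power2_eq_square mult.assoc)
  then show ?thesis
  unfolding ncurve_def one unfolding tube_point_def by (simp add: vec_eq_iff distrib_right distrib_left add_divide_distrib)
  qed
  have "continuous_on UNIV (%t. z + t *s u)" by (intro continuous_intros)
  then have "open ((%t. z + t *s u) -` Om)" by (rule open_vimage[OF open_Om])
  moreover have "0 : (%t. z + t *s u) -` Om" using z by (simp add: Om_Uc)
  ultimately obtain \<rho> where \<rho>: "\<rho> > 0" "ball 0 \<rho> <= (%t. z + t *s u) -` Om"
  unfolding open_contains_ball by blast
  have zt: "z + t *s u : Uc e e'" for t by (intro Uc_add Uc_scale z(1) uU)
  have "((%l. a idx l * ec (cform Q (cvec l) z) * w l ^ \<nu> / fact \<nu>) has_sum tmap (P (tp z)) (qp (tp z) u) idx) UQ"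
  proof (rule exponential_sum_leading_coefficient[OF \<rho>(1)])
  fix t :: complex assume "norm t < \<rho>"
  then have "t : ball 0 \<rho>" by simp
  then have "z + t *s u : Om" using \<rho>(2) by auto
  then have "Imvec (z + t *s u) : pcone" using Om_Uc[OF zt] by blast
  have e: "ec (t * cform Q (cvec l) u) = exp (t * w l)" for l by (simp add: w_def ec_def mult_ac)
  from a2[OF zt \<open>Imvec (z + t *s u) : pcone\<close>, of idx]
  show "((%l. a idx l * ec (cform Q (cvec l) z) * exp (t * w l)) has_sum F idx (z + t *s u)) UQ"
  by (simp only: cform_add_right cform_scale_right ec_add e mult.assoc)
  next
  show "((%t. F idx (z + t *s u) / t ^ \<nu>) \<longlongrightarrow> tmap (P (tp z)) (qp (tp z) u) idx) (at 0)"
  using qp_limit[OF h(1,2) tpD' u] by (simp add: F_Uc[OF zt] tpc)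
  qed
  moreover have "ec (cform Q (cvec l) z) = ec (cform Q (cvec (pr l)) z)" if "l : UQ" for l
  proof -
  have "cform Q z (cvec (l - pr l)) = 0"
  proof (rule cform_span_0[OF _ z(2)])
  show "cvec (l - pr l) : cspace K" by (simp add: cvec_cspace pr(2)[OF that])
  show "rform Q x y = 0" if "x : L'" "y : K" for x y using L'_K_orth that span_base by blast
  qed
  then have "cform Q (cvec l - cvec (pr l)) z = 0" using cform_sym[of z "cvec (l - pr l)"] by (simp add: cvec_diff)
  then show ?thesis by (simp add: cform_diff_left)
  qed
  ultimately have main: "((%l. ec (cform Q (cvec (pr l)) z) * q idx l) has_sum tmap (P (tp z)) (qp (tp z) u) idx) UQ"
  by (elim has_sum_cong[THEN iffD1, rotated]) (simp add: q_def mult_ac)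
  have bij: "bij_betw (%l. (pr l, l)) UQ (Sigma ?U' fib)" by (rule bij_betwI[where g = snd]) (auto simp: fib_def pr(1))
  have "((%(l', l). ec (cform Q (cvec l') z) * q idx l) has_sum tmap (P (tp z)) (qp (tp z) u) idx) (Sigma ?U' fib)"
  using has_sum_reindex_bij_betw[OF bij, of "%(l', l). ec (cform Q (cvec l') z) * q idx l"] main by simp
  moreover have "((%l. case (l', l) of (l', l) => ec (cform Q (cvec l') z) * q idx l) has_sum c l' idx * ec (cform Q (cvec l') z)) (fib l')" for l'
  proof -
  have "(%l. ec (cform Q (cvec (pr l)) z) * q idx l) summable_on fib l'"
  by (rule summable_on_subset[OF has_sum_imp_summable[OF main]]) (auto simp: fib_def)
  then have "(%l. ec (cform Q (cvec l') z) * q idx l) summable_on fib l'"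
  by (rule summable_on_cong[THEN iffD1, rotated]) (simp add: fib_def)
  from summable_on_cmult_right[OF this, of "inverse (ec (cform Q (cvec l') z))"]
  have "q idx summable_on fib l'" by (simp add: mult.assoc[symmetric])
  from has_sum_cmult_right[OF has_sum_infsum[OF this], of "ec (cform Q (cvec l') z)"]
  show ?thesis by (simp add: c_def True mult.commute)
  qed
  ultimately have "((%l. c l idx * ec (cform Q (cvec l) z)) has_sum tmap (P (tp z)) (qp (tp z) u) idx) ?U'"
  by (rule has_sum_SigmaD)
  then show ?thesis by (rule has_sum_cong_neutral[THEN iffD1, rotated 3]) (use supp in "auto simp: U_dual_def")
  qed
 qed
 moreover have "l : ?Ud & l : pcone" if "c l ~= 0" for l
 proof -
  obtain idx where "c l idx ~= 0" using \<open>c l ~= 0\<close> by (auto simp: fun_eq_iff)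
  then show ?thesis by (rule supp)
 qed
 moreover have "length idx ~= deg ==> c l idx = 0" for l idx by (simp add: c_def)
 ultimately show ?thesis by blast
qed

end

section \<open>Isometries of the model space with the trivialized fibres\<close>

context period_space
begin

text \<open>An orthogonal rational basis becomes orthonormal after scaling by complex square roots.\<close>

lemma dim_cspace:
 assumes L': "is_lattice Q L'" shows "vec.dim (cspace L') = dim (span L')"
proof -
 have empty: "orth_set {}" "{} <= rat_space L'" by (simp_all add: orth_set_def)
 obtain B where B: "orth_set B" "{} <= B" "B <= rat_space L'" "span B = span L'"
  by (rule rational_orth_basis[OF L' empty])
 have fin: "finite B" using B(1) by (simp add: orth_set_def)
 obtain bs where bs: "set bs = B" "distinct bs" using finite_distinct_list[OF fin] by blast
 have n: "length bs = dim (span L')"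
  using dim_eq_card_independent[OF orth_independent[OF B(1)]] B(4) bs distinct_card[OF bs(2)] by (metis dim_span)
 define r where "r i = inverse (csqrt (of_real (rform Q (bs ! i) (bs ! i))))" for i
 define c where "c i = r i *s cvec (bs ! i)" for i
 have nz: "rform Q (bs ! i) (bs ! i) ~= 0" if "i < length bs" for i
  using B(1) nth_mem[OF that] bs(1) by (auto simp: orth_set_def)
 have rr: "r i * r i = inverse (of_real (rform Q (bs ! i) (bs ! i)))" for i
  unfolding r_def by (simp add: power2_eq_square[symmetric] power_inverse)
 have "onb (cspace L') (length bs) c" unfolding onb_def
 proof (intro conjI allI impI ballI)
  fix i assume i: "i < length bs"
  have "bs ! i : span L'" using nth_mem[OF i] bs(1) B(3) rat_space_subset_span by blast
  then show "c i : cspace L'" unfolding c_def by (intro vec.subspace_scale[OF cspace_subspace]) (simp add: cvec_cspace)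
  fix j assume j: "j < length bs"
  have "rform Q (bs ! i) (bs ! j) = 0" if "i ~= j"
  using B(1) that i j bs nth_mem[OF i] nth_mem[OF j] by (auto simp: orth_set_def nth_eq_iff_index_eq)
  then show "cform Q (c i) (c j) = (if i = j then 1 else 0)"
  using rr[of j] nz[OF j] by (cases "i = j") (simp_all add: c_def cform_simps cform_cvec mult.assoc[symmetric])
 next
  fix v assume v: "v : cspace L'"
  then have "Revec v : span B" "Imvec v : span B" using B(4) by (auto simp: cspace_iff)
  note ex = this[THEN orth_expand[OF B(1)]]
  have "v = cvec (SUM b:B. (rform Q (Revec v) b / rform Q b b) *\<^sub>R b) + \<i> *s cvec (SUM b:B. (rform Q (Imvec v) b / rform Q b b) *\<^sub>R b)"
  unfolding ex[symmetric] by (rule Re_Im_decomp)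
  also have "... = (SUM b:B. of_real (rform Q (Revec v) b / rform Q b b) *s cvec b + \<i> *s (of_real (rform Q (Imvec v) b / rform Q b b) *s cvec b))"
  by (simp only: cvec_sum cvec_scale vec.scale_sum_right sum.distrib)
  also have "... = (SUM b:B. (cform Q v (cvec b) / of_real (rform Q b b)) *s cvec b)"
  proof (rule sum.cong[OF refl])
  fix b
  have "cform Q v (cvec b) = of_real (rform Q (Revec v) b) + \<i> * of_real (rform Q (Imvec v) b)"
  by (simp add: cform_Re_Im Revec_cvec Imvec_cvec rform_simps)
  then show "of_real (rform Q (Revec v) b / rform Q b b) *s cvec b + \<i> *s (of_real (rform Q (Imvec v) b / rform Q b b) *s cvec b)
  = (cform Q v (cvec b) / of_real (rform Q b b)) *s cvec b" by (simp add: vec_eq_iff add_divide_distrib distrib_right)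
  qed
  also have "... = (\<Sum>i<length bs. (cform Q v (cvec (bs ! i)) / of_real (rform Q (bs ! i) (bs ! i))) *s cvec (bs ! i))"
  by (rule sum.reindex_bij_betw[symmetric]) (use bij_betw_nth[OF bs(2), of "{..<length bs}" B] bs(1) in simp)
  also have "... = (\<Sum>i<length bs. cform Q v (c i) *s c i)"
  proof (rule sum.cong[OF refl])
  fix i
  have "cform Q v (c i) *s c i = (r i * r i * cform Q v (cvec (bs ! i))) *s cvec (bs ! i)"
  by (simp add: c_def cform_scale_right vector_smult_assoc mult_ac)
  then show "(cform Q v (cvec (bs ! i)) / of_real (rform Q (bs ! i) (bs ! i))) *s cvec (bs ! i) = cform Q v (c i) *s c i"
  unfolding rr by (simp add: divide_inverse mult.commute)
  qed
  finally show "v = (\<Sum>i<length bs. cform Q v (c i) *s c i)" .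
 qed
 from onb_dim[OF this] n show ?thesis by simp
qed

lemma hyp_split:
 assumes h: "hyp a a'" and v: "cvec a : W" "cvec a' : W" "v : W" and W: "vec.subspace W"
 defines "v0 \<equiv> v - cform Q v (cvec a') *s cvec a - cform Q v (cvec a) *s cvec a'" shows "v0 : W" "v0 : Uc a a'"
 unfolding v0_def by (intro vec.subspace_diff[OF W] vec.subspace_scale[OF W] v)
  (simp add: Uc_def cform_simps cform_cvec hypD[OF h])

lemma Uc_subspace: "vec.subspace (Uc a a')" by (simp add: vec.subspace_def Uc_def cform_simps)

lemma Uc_nondegenerate:
 assumes h: "hyp a a'" and L': "is_lattice Q L'" "a : span L'" "a' : span L'"
  and v: "v : cspace L' Int Uc a a'" "!!w. w : cspace L' Int Uc a a' ==> cform Q v w = 0" shows "v = 0"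
proof (rule cspace_nondegenerate[OF L'(1)])
 show "v : cspace L'" using v(1) by simp
 fix w assume w: "w : cspace L'"
 let ?w = "w - cform Q w (cvec a') *s cvec a - cform Q w (cvec a) *s cvec a'"
 have "?w : cspace L' Int Uc a a'" using hyp_split[OF h _ _ w cspace_subspace] L'(2,3) by (simp add: cvec_cspace)
 from v(2)[OF this] v(1) show "cform Q v w = 0" by (simp add: cform_simps Uc_def)
qed

lemma Uc_onb:
 assumes h: "hyp a a'" and L': "is_lattice Q L'" "a : span L'" "a' : span L'"
 shows "EX c. onb (cspace L' Int Uc a a') (vec.dim (cspace L' Int Uc a a')) c"
proof (rule onb_exists)
 show "vec.subspace (cspace L' Int Uc a a')" by (rule vec.subspace_inter[OF cspace_subspace Uc_subspace])
 show "v = 0" if "v : cspace L' Int Uc a a'" "!!w. w : cspace L' Int Uc a a' ==> cform Q v w = 0" for v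
  by (rule Uc_nondegenerate[OF h L' that])
qed (rule exI)

lemma dim_Uc:
 assumes h: "hyp a a'" and L': "is_lattice Q L'" "a : span L'" "a' : span L'"
 shows "vec.dim (cspace L' Int Uc a a') + 2 = dim (span L')"
proof -
 let ?U = "cspace L' Int Uc a a'"
 have sub: "vec.subspace ?U" by (rule vec.subspace_inter[OF cspace_subspace Uc_subspace])
 obtain c where c: "onb ?U (vec.dim ?U) c" using Uc_onb[OF h L'] by (elim exE)
 let ?p = "vec.dim ?U"
 define s where "s = complex_of_real (1 / sqrt 2)"
 have ss: "s * s = 1 / 2" by (simp add: s_def of_real_mult[symmetric] del: of_real_mult of_real_divide) simp
 define d where "d i = (if i < ?p then c i else if i = ?p then s *s (cvec a + cvec a') else (\<i> * s) *s (cvec a - cvec a'))" for i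
 have ac: "cvec a : cspace L'" "cvec a' : cspace L'" using L' by (simp_all add: cvec_cspace)
 have hh: "rform Q a a = 0" "rform Q a' a' = 0" "rform Q a a' = 1" "rform Q a' a = 1" using hypD[OF h] by auto
 have cU: "c i : cspace L'" "cform Q (c i) (cvec a) = 0" "cform Q (c i) (cvec a') = 0"
  "cform Q (cvec a) (c i) = 0" "cform Q (cvec a') (c i) = 0" if "i < ?p" for i
  using c that cform_sym[of "c i" "cvec a"] cform_sym[of "c i" "cvec a'"] by (auto simp: onb_def Uc_def)
 have "onb (cspace L') (?p + 2) d" unfolding onb_def
 proof (intro conjI allI impI ballI)
  show "d i : cspace L'" if "i < ?p + 2" for i unfolding d_def using cU(1) ac
  by (auto intro!: vec.subspace_scale[OF cspace_subspace] vec.subspace_add[OF cspace_subspace] vec.subspace_diff[OF cspace_subspace])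
  have last: "i = ?p | i = Suc ?p" if "i < ?p + 2" "~ i < ?p" for i using that by linarith
  show "cform Q (d i) (d j) = (if i = j then 1 else 0)" if ij: "i < ?p + 2" "j < ?p + 2" for i j
  proof (cases "i < ?p & j < ?p")
  case True then show ?thesis using c by (simp add: d_def onb_def)
  next
  case False
  have s2: "s * (s * 2) = 1" by (simp only: mult.assoc[symmetric] ss) simp
  show ?thesis using False last[OF ij(1)] last[OF ij(2)] cU ss by (auto simp: d_def cform_simps cform_cvec hh algebra_simps s2)
  qed
  fix v assume v: "v : cspace L'"
  define w where "w = v - cform Q v (cvec a') *s cvec a - cform Q v (cvec a) *s cvec a'"
  have w: "w : ?U" using hyp_split[OF h ac v cspace_subspace] by (simp add: w_def)
  have "(\<Sum>i<?p + 2. cform Q v (d i) *s d i) = (\<Sum>i<?p. cform Q v (d i) *s d i)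
  + (cform Q v (d ?p) *s d ?p + cform Q v (d (Suc ?p)) *s d (Suc ?p))" by (simp add: add.assoc)
  also have "(\<Sum>i<?p. cform Q v (d i) *s d i) = (\<Sum>i<?p. cform Q w (c i) *s c i)"
  by (rule sum.cong) (simp_all add: d_def w_def cform_simps cU)
  also have "... = w" using c w by (simp add: onb_def)
  also have "cform Q v (d ?p) *s d ?p + cform Q v (d (Suc ?p)) *s d (Suc ?p)
  = (s * s) *s ((cform Q v (cvec a) + cform Q v (cvec a')) *s (cvec a + cvec a')
  - (cform Q v (cvec a) - cform Q v (cvec a')) *s (cvec a - cvec a'))"
  by (simp add: d_def cform_simps vec_eq_iff algebra_simps)
  also have "... = cform Q v (cvec a') *s cvec a + cform Q v (cvec a) *s cvec a'" by (simp add: ss vec_eq_iff algebra_simps)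
  also have "w + ... = v" by (simp add: w_def)
  finally show "v = (\<Sum>i<?p + 2. cform Q v (d i) *s d i)" by simp
 qed
 from onb_dim[OF this] dim_cspace[OF L'(1)] show ?thesis by simp
qed

end

context sublattice_pair
begin

text \<open>Mutually inverse isometries of the model space \<open>V'\<close> with the model of the fibres given by \<open>a\<close> and \<open>a'\<close>, both
  extended by the identity of \<open>K\<close>.\<close>

definition frame_pair :: "(complex ^ 'm) set => real ^ 'm => real ^ 'm => complex ^ 'm ^ 'm => complex ^ 'm ^ 'm => bool" where
 "frame_pair V' a a' g g' \<longleftrightarrow>
  (ALL v:V'. g *v v : cspace L' Int Uc a a' & g' *v (g *v v) = v) &
  (ALL v:cspace L' Int Uc a a'. g' *v v : V' & g *v (g' *v v) = v) &
  (ALL v:V'. ALL w:V'. cform Q (g *v v) (g *v w) = cform Q v w) &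
  (ALL u:cspace K. g *v u = u & g' *v u = u)"

lemma frame_pair_exists:
 assumes V': "vec.subspace V'" "V' <= cspace L'" "vec.dim V' + 2 = dim (span L')"
  and nd: "!!v. v : V' ==> (!!w. w : V' ==> cform Q v w = 0) ==> v = 0"
  and a: "hyp a a'" "a : span L'" "a' : span L'" shows "EX g g'. frame_pair V' a a' g g'"
proof -
 let ?U = "cspace L' Int Uc a a'"
 have sub: "vec.subspace ?U" by (rule vec.subspace_inter[OF cspace_subspace Uc_subspace])
 define p where "p = vec.dim V'"
 have dimU: "vec.dim ?U = p" using dim_Uc[OF a(1) lattice'(1) a(2,3)] V'(3) by (simp add: p_def)
 have "EX b. onb V' (vec.dim V') b"
 proof (rule onb_exists[OF V'(1)])
  show "v = 0" if "v : V'" "!!w. w : V' ==> cform Q v w = 0" for v by (rule nd[OF that])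
 qed (rule exI)
 then obtain b where b: "onb V' p b" unfolding p_def by (elim exE)
 obtain c where c: "onb ?U p c" using Uc_onb[OF a(1) lattice'(1) a(2,3)] unfolding dimU by (elim exE)
 have mk: "EX g. (ALL v:A. g *v v = (\<Sum>i<p. cform Q v (x i) *s y i)) & (ALL u:cspace K. g *v u = u)"
  if A: "onb A p x" "A <= cspace L'" for A x y
 proof -
  define z where "z i = y i - x i" for i
  define F where "F v = v + (\<Sum>i<p. cform Q v (x i) *s z i)" for v
  have "matrix F *v v = F v" for v
  by (rule matrix_of_linear(2)) (simp_all add: F_def cform_simps sum.distrib vector_sadd_rdistrib vector_add_ldistrib vec.scale_sum_right vector_smult_assoc)
  moreover have "F v = (\<Sum>i<p. cform Q v (x i) *s y i)" if "v : A" for v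
  proof -
  have "v = (\<Sum>i<p. cform Q v (x i) *s x i)" using A(1) that by (simp add: onb_def)
  moreover have "F v = v + ((\<Sum>i<p. cform Q v (x i) *s y i) - (\<Sum>i<p. cform Q v (x i) *s x i))"
  by (simp add: F_def z_def sum_subtractf vector_ssub_ldistrib)
  ultimately show ?thesis by simp
  qed
  moreover have "F u = u" if "u : cspace K" for u
  proof -
  have "cform Q u (x i) = 0" if "i < p" for i
  using L'_K_orth_cplx[of "x i" u] A that \<open>u : cspace K\<close> cform_sym[of u "x i"] by (auto simp: onb_def)
  then show ?thesis by (simp add: F_def)
  qed
  ultimately show ?thesis by (intro exI[of _ "matrix F"]) simp
 qed
 obtain g where g: "!!v. v : V' ==> g *v v = (\<Sum>i<p. cform Q v (b i) *s c i)" "!!u. u : cspace K ==> g *v u = u"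
  using mk[OF b V'(2), of c] by blast
 obtain g' where g': "!!v. v : ?U ==> g' *v v = (\<Sum>i<p. cform Q v (c i) *s b i)" "!!u. u : cspace K ==> g' *v u = u"
  using mk[OF c, of b] by blast
 have bV: "b i : V'" and cU: "c i : ?U" if "i < p" for i using b c that by (auto simp: onb_def)
 have ob: "cform Q (b i) (b j) = (if i = j then 1 else 0)" "cform Q (c i) (c j) = (if i = j then 1 else 0)"
  if "i < p" "j < p" for i j using b c that by (auto simp: onb_def)
 have gU: "g *v v : ?U" if "v : V'" for v
  unfolding g(1)[OF that] by (intro vec.subspace_sum[OF sub] vec.subspace_scale[OF sub] cU) simp
 have gV: "g' *v v : V'" if "v : ?U" for v
  unfolding g'(1)[OF that] by (intro vec.subspace_sum[OF V'(1)] vec.subspace_scale[OF V'(1)] bV) simp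
 have co: "cform Q (\<Sum>i<p. t i *s c i) (c j) = t j" "cform Q (\<Sum>i<p. t i *s b i) (b j) = t j" if "j < p" for t j
 proof -
  have "(\<Sum>i<p. t i * cform Q (c i) (c j)) = (\<Sum>i<p. if i = j then t i else 0)" by (rule sum.cong) (use ob that in auto)
  then show "cform Q (\<Sum>i<p. t i *s c i) (c j) = t j" using that by (simp add: cform_sum_left cform_scale_left)
  have "(\<Sum>i<p. t i * cform Q (b i) (b j)) = (\<Sum>i<p. if i = j then t i else 0)" by (rule sum.cong) (use ob that in auto)
  then show "cform Q (\<Sum>i<p. t i *s b i) (b j) = t j" using that by (simp add: cform_sum_left cform_scale_left)
 qed
 have g'g: "g' *v (g *v v) = v" if v: "v : V'" for v
 proof -
  have "g' *v (g *v v) = (\<Sum>i<p. cform Q v (b i) *s b i)"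
  unfolding g'(1)[OF gU[OF v]] unfolding g(1)[OF v] by (rule sum.cong) (simp_all add: co)
  then show ?thesis using b v by (simp add: onb_def)
 qed
 have gg': "g *v (g' *v v) = v" if v: "v : ?U" for v
 proof -
  have "g *v (g' *v v) = (\<Sum>i<p. cform Q v (c i) *s c i)"
  unfolding g(1)[OF gV[OF v]] unfolding g'(1)[OF v] by (rule sum.cong) (simp_all add: co)
  then show ?thesis using c v by (simp add: onb_def)
 qed
 have iso: "cform Q (g *v v) (g *v w) = cform Q v w" if vw: "v : V'" "w : V'" for v w
 proof -
  have "cform Q (g *v v) (g *v w) = (\<Sum>j<p. cform Q w (b j) * cform Q v (b j))"
  unfolding g(1)[OF vw(1)] g(1)[OF vw(2)] unfolding cform_sum_right cform_scale_right by (rule sum.cong) (simp_all add: co)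
  also have "... = cform Q v (\<Sum>j<p. cform Q w (b j) *s b j)" by (simp add: cform_sum_right cform_scale_right)
  also have "... = cform Q v w" using b vw(2) by (simp add: onb_def)
  finally show ?thesis .
 qed
 have "frame_pair V' a a' g g'" unfolding frame_pair_def
  by (intro conjI ballI) (erule (1) iso | erule gU g'g gV gg' g(2) g'(2))+
 then show ?thesis by (intro exI)
qed

end

section \<open>Interpolation in finite-dimensional function spaces\<close>

text \<open>Choose a point where some function is nonzero; the functions vanishing there form a smaller space, to
  which the induction hypothesis applies. The set of points depends only on the space.\<close>

lemma interpolation:
 fixes W :: "('x => complex) set"
 assumes "finite I"
  and "!!v w c. v : W ==> w : W ==> (%x. v x - c * w x) : W"
  and "!!v. v : W ==> EX c. ALL x:X. v x = (SUM b:I. c b * h b x)"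
 shows "EX N p w. (\<forall>i<(N::nat). p i : X & w i : W) & (ALL v:W. ALL x:X. v x = (\<Sum>i<N. v (p i) * w i x))"
 using assms
proof (induction "card I" arbitrary: I W h)
 case 0
 then have "I = {}" by simp
 have "v x = 0" if "v : W" "x : X" for v x using "0.prems"(3)[OF that(1)] that(2) by (auto simp: \<open>I = {}\<close>)
 then show ?case by (intro exI[of _ "0::nat"] exI[of _ undefined]) simp
next
 case (Suc n)
 note Wcl = Suc.prems(2)
 show ?case
 proof (cases "ALL v:W. ALL x:X. v x = 0")
  case True
  then show ?thesis by (intro exI[of _ "0::nat"] exI[of _ undefined]) simp
 next
  case False
  then obtain v1 p where v1: "v1 : W" "p : X" "v1 p ~= 0" by blast
  define v0 where "v0 x = v1 x - (1 - 1 / v1 p) * v1 x" for x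
  have v0: "v0 : W" unfolding v0_def by (rule Suc.prems(2)[OF v1(1,1)])
  have v0p: "v0 p = 1" using v1(3) by (simp add: v0_def field_simps)
  obtain c1 where c1: "!!x. x : X ==> v0 x = (SUM b:I. c1 b * h b x)" using Suc.prems(3)[OF v0] by blast
  have "(SUM b:I. c1 b * h b p) ~= 0" using c1[OF v1(2)] v0p by simp
  then obtain b0 where b0: "b0 : I" "h b0 p ~= 0" by (metis (no_types, lifting) mult_zero_right sum.neutral)
  define h' where "h' b x = h b x - h b p / h b0 p * h b0 x" for b x
  define W1 where "W1 = {v : W. v p = 0}"
  have "EX N q w. (\<forall>i<(N::nat). q i : X & w i : W1) & (ALL v:W1. ALL x:X. v x = (\<Sum>i<N. v (q i) * w i x))"
  proof (rule Suc.hyps(1)[of "I - {b0}"])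
  show "n = card (I - {b0})" using Suc.hyps(2) b0(1) Suc.prems(1) by simp
  show "finite (I - {b0})" using Suc.prems(1) by simp
  show "(%x. v x - c * w x) : W1" if "v : W1" "w : W1" for v w c using that Suc.prems(2) by (auto simp: W1_def)
  show "EX c. ALL x:X. v x = (SUM b:I - {b0}. c b * h' b x)" if "v : W1" for v
  proof -
  have v: "v : W" "v p = 0" using that by (auto simp: W1_def)
  obtain c where c: "!!x. x : X ==> v x = (SUM b:I. c b * h b x)" using Suc.prems(3)[OF v(1)] by blast
  have split: "(SUM b:I. c b * h b x) = c b0 * h b0 x + (SUM b:I - {b0}. c b * h b x)" for x
  by (rule sum.remove[OF Suc.prems(1) b0(1)])
  have "c b0 * h b0 p = - (SUM b:I - {b0}. c b * h b p)"
  using c[OF v1(2)] v(2) split[of p] by (simp add: eq_neg_iff_add_eq_0)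
  then have cb0: "c b0 = - (SUM b:I - {b0}. c b * h b p) / h b0 p" using b0(2) by (simp add: field_simps)
  have "v x = (SUM b:I - {b0}. c b * h' b x)" if x: "x : X" for x
  proof -
  have "(SUM b:I - {b0}. c b * h' b x) = (SUM b:I - {b0}. c b * h b x) - (SUM b:I - {b0}. c b * h b p / h b0 p * h b0 x)"
  by (simp add: h'_def right_diff_distrib sum_subtractf mult.assoc)
  also have "(SUM b:I - {b0}. c b * h b p / h b0 p * h b0 x) = - c b0 * h b0 x"
  unfolding cb0 by (simp add: sum_distrib_right sum_divide_distrib)
  finally show ?thesis using c[OF x] split[of x] by simp
  qed
  then show ?thesis by blast
  qed
  qed
  then obtain N q w where IH: "!!i. i < (N::nat) ==> q i : X" "!!i. i < N ==> w i : W1"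
  "!!v x. v : W1 ==> x : X ==> v x = (\<Sum>i<N. v (q i) * w i x)" by blast
  have comb: "(%x. v x - (\<Sum>i<M. c i * w i x)) : W" if "v : W" "M <= N" for v c M using that(2)
  proof (induction M)
  case (Suc M)
  have "(%x. (v x - (\<Sum>i<M. c i * w i x)) - c M * w M x) : W" using Suc IH(2)[of M] by (intro Wcl) (auto simp: W1_def)
  then show ?case by (simp add: algebra_simps)
  qed (use that in simp)
  define q' where "q' i = (if i < N then q i else p)" for i
  define w' where "w' i = (if i < N then w i else (%x. v0 x - (\<Sum>i<N. v0 (q i) * w i x)))" for i
  have "\<forall>i<Suc N. q' i : X & w' i : W" using IH(1,2) v1(2) comb[OF v0, of N] by (auto simp: q'_def w'_def W1_def)
  moreover have "v x = (\<Sum>i<Suc N. v (q' i) * w' i x)" if v: "v : W" and x: "x : X" for v x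
  proof -
  have "(%x. v x - v p * v0 x) : W1" using Suc.prems(2)[OF v v0] v0p by (simp add: W1_def)
  from IH(3)[OF this x] have "v x - v p * v0 x = (\<Sum>i<N. v (q i) * w i x) - v p * (\<Sum>i<N. v0 (q i) * w i x)"
  by (simp add: left_diff_distrib sum_subtractf sum_distrib_left mult.assoc)
  then show ?thesis by (simp add: q'_def w'_def algebra_simps)
  qed
  ultimately show ?thesis by (intro exI[of _ "Suc N"] exI[of _ q'] exI[of _ w']) blast
 qed
qed

section \<open>The components of the quasi-pullback\<close>

lemma has_sum_finite_sum:
 fixes f :: "'j => 'x => complex"
 assumes "finite J" "!!j. j : J ==> (f j has_sum s j) A" shows "((%x. SUM j:J. f j x) has_sum (SUM j:J. s j)) A"
 using assms by (induction J) (auto intro: has_sum_add)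

lemma tlinear_has_sum:
 fixes c :: "'x => 'm::finite tensor"
 assumes \<Lambda>: "tlinear \<Lambda>" and c: "!!l idx. length idx ~= d ==> c l idx = 0" and G: "!!idx. length idx ~= d ==> G idx = 0"
  and hs: "!!idx. ((%l. c l idx * E l) has_sum G idx) A" shows "((%l. \<Lambda> (c l) idx * E l) has_sum \<Lambda> G idx) A"
proof -
 let ?b = "%jdx. \<Lambda> (pure_tensor (map (%a. axis a 1) jdx)) idx"
 have eq: "(\<Sum>jdx | length jdx = d. (c l jdx * E l) * ?b jdx) = \<Lambda> (c l) idx * E l" for l
  by (simp add: tlinear_matrix[OF \<Lambda> c] sum_distrib_right sum_distrib_left mult_ac)
 have "((%l. \<Sum>jdx | length jdx = d. (c l jdx * E l) * ?b jdx) has_sum (\<Sum>jdx | length jdx = d. G jdx * ?b jdx)) A"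
  by (intro has_sum_finite_sum has_sum_cmult_left hs) simp
 then show ?thesis by (simp only: eq tlinear_matrix[OF \<Lambda> G])
qed

lemma (in symmetric_form) preservesI:
 assumes V: "vec.subspace V" and nd: "!!v. v : V ==> (!!w. w : V ==> cform Q v w = 0) ==> v = 0"
  and M: "!!v. v : V ==> M *v v : V" and iso: "!!v w. v : V ==> w : V ==> cform Q (M *v v) (M *v w) = cform Q v w"
 shows "preserves Q V M"
proof -
 have "EX b. onb V (vec.dim V) b"
 proof (rule onb_exists[OF V])
  show "v = 0" if "v : V" "!!w. w : V ==> cform Q v w = 0" for v by (rule nd[OF that])
 qed (rule exI)
 then obtain b where b: "onb V (vec.dim V) b" by (elim exE)
 let ?p = "vec.dim V"
 define c where "c i = M *v b i" for i
 have bV: "b i : V" if "i < ?p" for i using b that by (simp add: onb_def)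
 have "cform Q (c i) (c j) = (if i = j then 1 else 0)" if "i < ?p" "j < ?p" for i j
  using b that iso[OF bV[OF that(1)] bV[OF that(2)]] by (simp add: c_def onb_def)
 then have ind: "inj_on c {..<?p} & vec.independent (c ` {..<?p})" by (rule orthonormal_independent)
 have "V <= vec.span (c ` {..<?p})"
 proof (rule vec.card_ge_dim_independent)
  show "c ` {..<?p} <= V" using bV M by (auto simp: c_def)
  show "vec.independent (c ` {..<?p})" using ind by simp
  show "?p <= card (c ` {..<?p})" using card_image[OF conjunct1[OF ind]] by simp
 qed
 also have "... <= (%v. M *v v) ` V"
 proof (rule vec.span_minimal)
  show "c ` {..<?p} <= (%v. M *v v) ` V" using bV by (auto simp: c_def)
  show "vec.subspace ((%v. M *v v) ` V)" unfolding vec.subspace_def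
  proof (intro conjI ballI allI)
  show "0 : (%v. M *v v) ` V" using vec.subspace_0[OF V] by (intro image_eqI[of _ _ 0]) simp_all
  fix x assume "x : (%v. M *v v) ` V"
  then obtain v where v: "v : V" "x = M *v v" by (elim imageE)
  show "r *s x : (%v. M *v v) ` V" for r
  by (rule image_eqI[of _ _ "r *s v"]) (use v vec.subspace_scale[OF V] in "simp_all add: vector_scalar_commute")
  fix y assume "y : (%v. M *v v) ` V"
  then obtain w where w: "w : V" "y = M *v w" by (elim imageE)
  show "x + y : (%v. M *v v) ` V"
  by (rule image_eqI[of _ _ "v + w"]) (use v w vec.subspace_add[OF V] in "simp_all add: matrix_vector_right_distrib")
  qed
 qed
 finally show ?thesis unfolding preserves_def using M iso by blast
qed

lemma sum_lessThan_split: "(\<Sum>j<N + N'. f j) = (\<Sum>j<(N::nat). f j) + (\<Sum>j<N'. f (N + j) :: 'a::comm_monoid_add)"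
 by (induction N') (simp_all add: add.assoc)

lemma sym_invariants_diff:
 fixes v w :: "complex ^ 'm => 'm::finite tensor"
 assumes v: "v : sym_invariants Q K G la \<nu>" and w: "w : sym_invariants Q K G la \<nu>"
 shows "(%u. v u + tscale (- c) (w u)) : sym_invariants Q K G la \<nu>"
proof -
 obtain N \<kappa> t where v1: "!!j. j < N ==> t j : schur Q la (cspace K) {0} & (\<forall>i<\<nu>. \<kappa> j i : cspace K)"
  "v = (%u. \<Sum>j<(N::nat). tscale (\<Prod>i<\<nu>. cform Q (\<kappa> j i) u) (t j))"
  "!!g u. g : G ==> u : cspace K ==> v (cmat g *v u) = tmap (cmat g) (v u)" using v unfolding sym_invariants_def by blast
 obtain N' \<kappa>' t' where w1: "!!j. j < N' ==> t' j : schur Q la (cspace K) {0} & (\<forall>i<\<nu>. \<kappa>' j i : cspace K)"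
  "w = (%u. \<Sum>j<(N'::nat). tscale (\<Prod>i<\<nu>. cform Q (\<kappa>' j i) u) (t' j))"
  "!!g u. g : G ==> u : cspace K ==> w (cmat g *v u) = tmap (cmat g) (w u)" using w unfolding sym_invariants_def by blast
 define \<kappa>'' where "\<kappa>'' j = (if j < N then \<kappa> j else \<kappa>' (j - N))" for j
 define t'' where "t'' j = (if j < N then t j else tscale (- c) (t' (j - N)))" for j
 have "\<forall>j<N + N'. t'' j : schur Q la (cspace K) {0} & (\<forall>i<\<nu>. \<kappa>'' j i : cspace K)"
 proof (intro allI impI)
  fix j assume j: "j < N + N'"
  show "t'' j : schur Q la (cspace K) {0} & (\<forall>i<\<nu>. \<kappa>'' j i : cspace K)"
  proof (cases "j < N")
  case True then show ?thesis using v1(1) by (simp add: t''_def \<kappa>''_def)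
  next
  case False
  then have "j - N < N'" using j by simp
  from w1(1)[OF this] tensor.subspace_scale[OF schur_subspace conjunct1[OF w1(1)[OF this]], of "- c"] False
  show ?thesis by (simp add: t''_def \<kappa>''_def)
  qed
 qed
 moreover have "(%u. v u + tscale (- c) (w u)) = (%u. \<Sum>j<N + N'. tscale (\<Prod>i<\<nu>. cform Q (\<kappa>'' j i) u) (t'' j))"
  by (simp add: v1(2) w1(2) sum_lessThan_split \<kappa>''_def t''_def tensor.scale_sum_right mult.commute)
 moreover have "v (cmat g *v u) + tscale (- c) (w (cmat g *v u)) = tmap (cmat g) (v u + tscale (- c) (w u))"
  if "g : G" "u : cspace K" for g u
  by (simp only: v1(3)[OF that] w1(3)[OF that] tlinear_add[OF tlinear_tmap] tlinear_scale[OF tlinear_tmap])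
 ultimately show ?thesis unfolding sym_invariants_def by blast
qed

text \<open>Expansion in monomials of degree \<open>\<nu>\<close> in \<open>u\<close>, times coordinates of the target.\<close>

lemma sym_invariants_finite_dim:
 fixes w :: "complex ^ 'm => 'm::finite tensor"
 assumes w: "w : sym_invariants Q K G la \<nu>"
 shows "EX c. ALL u jdx'. w u jdx' = (SUM b:{as. length as = \<nu>} \<times> {jdx. length jdx = sum_list la}.
  c b * ((\<Prod>i<\<nu>. u $ (fst b ! i)) * (if jdx' = snd b then 1 else 0)))"
proof -
 obtain N \<kappa> t where w1: "!!j. j < N ==> t j : schur Q la (cspace K) {0}"
  "w = (%u. \<Sum>j<(N::nat). tscale (\<Prod>i<\<nu>. cform Q (\<kappa> j i) u) (t j))"
  using w unfolding sym_invariants_def by blast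
 define cf where "cf j i a = (SUM p:UNIV. \<kappa> j i $ p * of_real (Q $ p $ a))" for j i a
 have cf: "cform Q (\<kappa> j i) u = (SUM a:UNIV. cf j i a * u $ a)" for j i u
  unfolding cform_def cf_def sum_distrib_right by (rule sum.swap)
 define c where "c b = (\<Sum>j<N. (\<Prod>i<\<nu>. cf j i (fst b ! i)) * t j (snd b))" for b :: "'m list \<times> 'm list"
 have "w u jdx' = (SUM b:{as. length as = \<nu>} \<times> {jdx. length jdx = sum_list la}.
  c b * ((\<Prod>i<\<nu>. u $ (fst b ! i)) * (if jdx' = snd b then 1 else 0)))" for u jdx'
 proof -
  have "(SUM b:{as. length as = \<nu>} \<times> {jdx. length jdx = sum_list la}.
  c b * ((\<Prod>i<\<nu>. u $ (fst b ! i)) * (if jdx' = snd b then 1 else 0)))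
  = (\<Sum>as | length as = \<nu>. \<Sum>jdx | length jdx = sum_list la. c (as, jdx) * ((\<Prod>i<\<nu>. u $ (as ! i)) * (if jdx' = jdx then 1 else 0)))"
  by (simp add: sum.cartesian_product case_prod_unfold)
  also have "... = (\<Sum>as | length as = \<nu>. if length jdx' = sum_list la then c (as, jdx') * (\<Prod>i<\<nu>. u $ (as ! i)) else 0)"
  by (rule sum.cong[OF refl]) (simp add: if_distrib[where f = "%x. _ * x"] sum.delta cong: if_cong)
  also have "... = w u jdx'"
  proof (cases "length jdx' = sum_list la")
  case True
  have "w u jdx' = (\<Sum>j<N. (\<Prod>i<\<nu>. SUM a:UNIV. cf j i a * u $ a) * t j jdx')"
  by (simp add: w1(2) sum_tensor_apply cf)
  also have "... = (\<Sum>j<N. \<Sum>as | length as = \<nu>. (\<Prod>i<\<nu>. cf j i (as ! i) * u $ (as ! i)) * t j jdx')"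
  by (simp only: prod_sum_len[symmetric] sum_distrib_right)
  also have "... = (\<Sum>as | length as = \<nu>. \<Sum>j<N. (\<Prod>i<\<nu>. cf j i (as ! i) * u $ (as ! i)) * t j jdx')"
  by (rule sum.swap)
  also have "... = (\<Sum>as | length as = \<nu>. c (as, jdx') * (\<Prod>i<\<nu>. u $ (as ! i)))"
  by (simp add: c_def sum_distrib_right sum_distrib_left prod.distrib mult_ac)
  finally show ?thesis using True by simp
  next
  case False
  have "t j jdx' = 0" if "j < N" for j using w1(1)[OF that] schur_tpow tpow_deg False by blast
  then show ?thesis using False by (simp add: w1(2) sum_tensor_apply)
  qed
  finally show ?thesis by simp
 qed
 then show ?thesis by blast
qed

lemma (in sublattice_pair) frame_pairD:
 assumes "frame_pair V' a a' g g'"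
 shows "!!v. v : V' ==> g *v v : cspace L'" "!!v. v : V' ==> g *v v : Uc a a'" "!!v. v : V' ==> g' *v (g *v v) = v"
  "!!v. v : cspace L' ==> v : Uc a a' ==> g' *v v : V'" "!!v. v : cspace L' ==> v : Uc a a' ==> g *v (g' *v v) = v"
  "!!v w. v : V' ==> w : V' ==> cform Q (g *v v) (g *v w) = cform Q v w"
  "!!u. u : cspace K ==> g *v u = u" "!!u. u : cspace K ==> g' *v u = u" using assms unfolding frame_pair_def by simp_all

locale decomp_data = qp_data Q L L' K D D' f la k \<nu> e e'
 for Q :: "real ^ 'm ^ 'm" and L L' K :: "(real ^ 'm) set" and D D' :: "(complex ^ 'm) set"
  and f :: "complex ^ 'm => 'm tensor" and la :: "nat list" and k :: int and \<nu> :: nat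
  and e e' :: "real ^ 'm" +
 fixes \<Gamma> :: "(real ^ 'm ^ 'm) set" and V' :: "(complex ^ 'm) set" and lap lapp :: "nat list"
  and \<phi> :: "'m tensor => 'm tensor" and g0 g0' :: "complex ^ 'm ^ 'm"
 assumes \<Gamma>: "subgroup \<Gamma> (O_plus Q L D)" "finite (rcosets\<^bsub>O_plus Q L D\<^esub> \<Gamma>)"
  and modular: "g : \<Gamma> ==> om : D ==>
  f (cmat g *v om) - tmap (cmat g) (f om) : hodge_null Q L (sum_list la) (cmat g *v om)"
  and card: "5 <= CARD('m)"
  and V': "vec.subspace V'" "V' <= cspace L'" "vec.dim V' + 2 = dim (span L')"
  and V'_nd: "v : V' ==> (!!w. w : V' ==> cform Q v w = 0) ==> v = 0"
  and frame: "frame_pair V' e e' g0 g0'"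
  and lin: "S : schur Q la (sum_space V' (cspace K)) {0} ==> T : schur Q la (sum_space V' (cspace K)) {0} ==>
  \<phi> (S + tscale c T) = \<phi> S + tscale c (\<phi> T)"
  and equi: "T : schur Q la (sum_space V' (cspace K)) {0} ==> preserves Q V' M ==> preserves Q (cspace K) M ==>
  \<phi> (tmap M T) = tmap M (\<phi> T)"
  and im: "T : schur Q la (sum_space V' (cspace K)) {0} ==> \<phi> T : schur_box Q lap lapp V' (cspace K)"
begin

abbreviation "X \<equiv> schur Q la (sum_space V' (cspace K)) {0}"
abbreviation "Box \<equiv> schur_box Q lap lapp V' (cspace K)"
abbreviation "R \<equiv> Rtriv e"
abbreviation "dL \<equiv> sum_list lap"
abbreviation "dK \<equiv> sum_list lapp"

lemma sum_isometry:
 assumes M: "!!v. v : V' ==> M *v v : cspace L'" "!!v w. v : V' ==> w : V' ==> cform Q (M *v v) (M *v w) = cform Q v w"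
  "!!u. u : cspace K ==> M *v u = u"
  and vw: "v : sum_space V' (cspace K)" "w : sum_space V' (cspace K)" shows "cform Q (M *v v) (M *v w) = cform Q v w"
proof -
 obtain v1 v2 where v: "v = v1 + v2" "v1 : V'" "v2 : cspace K" using vw(1) by (auto simp: sum_space_def)
 obtain w1 w2 where w: "w = w1 + w2" "w1 : V'" "w2 : cspace K" using vw(2) by (auto simp: sum_space_def)
 have o: "cform Q x y = 0" "cform Q y x = 0" if "x : cspace L'" "y : cspace K" for x y
  using L'_K_orth_cplx[OF that] cform_sym[of y x] by simp_all
 have "v1 : cspace L'" "w1 : cspace L'" using V'(2) v(2) w(2) by auto
 then show ?thesis using M(1)[OF v(2)] M(1)[OF w(2)] v(3) w(3) M(2)[OF v(2) w(2)]
  by (simp add: v(1) w(1) matrix_vector_right_distrib M(3) cform_simps o)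
qed

lemma K_perp: "u : cspace K ==> a : span L' ==> cform Q u (cvec a) = 0"
 using L'_K_orth_cplx[of "cvec a" u] cform_sym[of u "cvec a"] by (simp add: cvec_cspace)

lemma frame_inverse:
 assumes fp: "frame_pair V' a a' g g'" and a: "hyp a a'" "a : span L'" "a' : span L'" and v: "v : Uc a a'"
 shows "g' *v v : sum_space V' (cspace K)" "g *v (g' *v v) = v"
proof -
 obtain v1 v2 where v12: "v1 : cspace L'" "v2 : cspace K" "v = v1 + v2" using decomposition_cplx[of v] by blast
 have "v2 : Uc a a'" using K_perp[OF v12(2)] a by (simp add: Uc_def)
 then have v1U: "v1 : Uc a a'" using v v12(3) by (simp add: Uc_def cform_simps)
 note fd = frame_pairD[OF fp]
 have "g' *v v = g' *v v1 + v2" by (simp add: v12(3) matrix_vector_right_distrib fd(8)[OF v12(2)])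
 then show "g' *v v : sum_space V' (cspace K)" using fd(4)[OF v12(1) v1U] v12(2) by (auto simp: sum_space_def)
 show "g *v (g' *v v) = v"
  by (simp add: v12(3) matrix_vector_right_distrib fd(8)[OF v12(2)] fd(7)[OF v12(2)] fd(5)[OF v12(1) v1U])
qed

lemma frame_inv_isometry:
 assumes fp: "frame_pair V' a a' g g'" and a: "hyp a a'" "a : span L'" "a' : span L'" and v: "v : Uc a a'" "w : Uc a a'"
 shows "cform Q (g' *v v) (g' *v w) = cform Q v w"
 using sum_isometry[of g "g' *v v" "g' *v w"] frame_pairD(1,6,7)[OF fp] frame_inverse[OF fp a v(1)] frame_inverse[OF fp a v(2)]
 by simp

lemma D'D: "om : D' ==> om : D" and D'L': "om : D' ==> om : cspace L'" by (simp_all add: D')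

lemma cline_cperp: "om : D' ==> cline om <= cperp Q L' om"
 using D'L' D_isotropic[OF D'D] vec.subspace_scale[OF cspace_subspace, of om L'] by (auto simp: cline_def cperp_def cform_simps)

lemma U_cplx_L: "U_cplx Q L a a' = Uc a a'" by (simp add: U_cplx_eq)

text \<open>Composition with the trivialization of a hyperbolic pair turns its isometry with the model space into a
  frame at every point.\<close>

lemma frame_point:
 assumes fp: "frame_pair V' a a' g g'" and a: "hyp a a'" "a : span L'" "a' : span L'"
  and om: "om : D'" and x: "x : hodge_fibre Q L la om"
 shows "fibre_frame Q L' K V' om (Rtriv a om ** g)" "tmap (g' ** Ptriv a a' om) x : X"
  "x - tmap (Rtriv a om ** g) (tmap (g' ** Ptriv a a' om) x) : hodge_null Q L deg om"
proof -
 note w = D_isotropic[OF D'D[OF om]] D_nz[OF D'D[OF om] a(1)]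
 note fd = frame_pairD[OF fp]
 have Ku: "cform Q u om = 0" if "u : cspace K" for u
  using L'_K_orth_cplx[OF D'L'[OF om] that] cform_sym[of u om] by simp
 show "fibre_frame Q L' K V' om (Rtriv a om ** g)" unfolding fibre_frame_def
 proof (intro conjI ballI)
  fix v assume v: "v : V'"
  show "(Rtriv a om ** g) *v v : cperp Q L' om" using Rtriv_cspace[OF a(2) fd(1)[OF v], of om] Rtriv_perp[OF a(1) w]
  by (simp add: cperp_def matrix_vector_mul_assoc[symmetric])
  fix z assume z: "z : V'"
  show "cform Q ((Rtriv a om ** g) *v v) ((Rtriv a om ** g) *v z) = cform Q v z"
  using Rtriv_isometry[OF a(1) w fd(2)[OF v] fd(2)[OF z]] fd(6)[OF v z] by (simp add: matrix_vector_mul_assoc[symmetric])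
 next
  fix u assume "u : cspace K"
  then show "(Rtriv a om ** g) *v u = u" using fd(7) Rtriv_fix[OF Ku] by (simp add: matrix_vector_mul_assoc[symmetric])
 qed
 have Px: "tmap (Ptriv a a' om) x : schur Q la (Uc a a') {0}"
  using tmap_Ptriv_fibre[OF a(1) span_L _ w x] by (simp add: U_cplx_L)
 show "tmap (g' ** Ptriv a a' om) x : X" unfolding tmap_compose[symmetric]
  by (rule tmap_schur[OF Px]) (use frame_inverse(1)[OF fp a] frame_inv_isometry[OF fp a] in auto)
 have Pt: "tmap (Ptriv a a' om) x : tpow deg (Uc a a')" using Px schur_tpow by blast
 have "tmap (g ** g') (tmap (Ptriv a a' om) x) = tmap (Ptriv a a' om) x"
  by (rule tmap_id[OF Pt]) (use frame_inverse(2)[OF fp a] in "simp add: matrix_vector_mul_assoc[symmetric]")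
 moreover have "tmap (Rtriv a om ** g) (tmap (g' ** Ptriv a a' om) x) = tmap (Rtriv a om) (tmap (g ** g') (tmap (Ptriv a a' om) x))"
  by (simp add: tmap_compose matrix_mul_assoc)
 ultimately have "tmap (Rtriv a om ** g) (tmap (g' ** Ptriv a a' om) x) = tmap (Rtriv a om) (tmap (Ptriv a a' om) x)"
  by (simp only:)
 moreover have "tmap (Rtriv a om) (tmap (Ptriv a a' om) x) - x : hodge_null Q L deg om"
  by (rule hodge_null_iff(2)[OF a(1) span_L _ w]) (use x hodge_fibre_tpow in auto)
 ultimately show "x - tmap (Rtriv a om ** g) (tmap (g' ** Ptriv a a' om) x) : hodge_null Q L deg om"
  using tensor.subspace_neg[OF tnull_subspace] unfolding hodge_null_def by (metis minus_diff_eq)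
qed

definition T0 :: "complex ^ 'm => 'm tensor => 'm tensor" where
 "T0 om x = tmap (g0' ** P om) x"

text \<open>Any two frames differ by an isometry of the model space, with which the projection to the
  constituent commutes. So the component does not depend on the frame, modulo the null tensors.\<close>

lemma transition:
 assumes om: "om : D'" and M: "fibre_frame Q L' K V' om M" and T: "T : X"
  and x: "x - tmap M T : hodge_null Q L deg om"
 shows "tmap (R om ** g0) (\<phi> (T0 om x)) - tmap M (\<phi> T) : box_null Q L' K dL dK om"
  "tmap (R om ** g0) (lslice dL jdx (\<phi> (T0 om x))) - tmap M (lslice dL jdx (\<phi> T)) : hodge_null Q L' dL om"
proof -
 note w = D_isotropic[OF D'D[OF om]] D_nz[OF D'D[OF om] h(1)]
 note fd = frame_pairD[OF frame]
 have Mv: "M *v v : cspace L'" "cform Q (M *v v) om = 0" if "v : V'" for v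
  using M that by (auto simp: fibre_frame_def cperp_def)
 have Miso: "cform Q (M *v v) (M *v z) = cform Q v z" if "v : V'" "z : V'" for v z using M that by (auto simp: fibre_frame_def)
 have MK: "M *v u = u" if "u : cspace K" for u using M that by (auto simp: fibre_frame_def)
 have PM: "P om *v (M *v v) : cspace L'" "P om *v (M *v v) : Uc e e'" if "v : V'" for v
  using Ptriv_cspace[OF D'L'[OF om] h(2) Mv(1)[OF that]] Ptriv_Uc[OF h(1) w] by auto
 define H where "H = g0' ** P om ** M"
 have Hv: "H *v v = g0' *v (P om *v (M *v v))" for v by (simp add: H_def matrix_vector_mul_assoc[symmetric])
 have HV: "H *v v : V'" if "v : V'" for v unfolding Hv by (rule fd(4)[OF PM[OF that]])
 have HK: "H *v u = u" if "u : cspace K" for u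
  using Ptriv_fix[OF K_perp[OF that h(2)] K_perp[OF that h(3)]] by (simp add: Hv MK[OF that] fd(8)[OF that])
 have Hiso: "cform Q (H *v v) (H *v z) = cform Q v z" if "v : V'" "z : V'" for v z unfolding Hv
  using frame_inv_isometry[OF frame h PM(2)[OF that(1)] PM(2)[OF that(2)]]
  Ptriv_isometry[OF h(1) w Mv(2)[OF that(1)] Mv(2)[OF that(2)]] Miso[OF that] by simp
 have pV: "preserves Q V' H"
 proof (rule preservesI[OF V'(1)])
  show "v = 0" if "v : V'" "!!w. w : V' ==> cform Q v w = 0" for v by (rule V'_nd[OF that])
 qed (rule HV Hiso; assumption)+
 have pK: "preserves Q (cspace K) H" unfolding preserves_def using HK by auto
 have "tmap (P om) x = tmap (P om) (tmap M T)" by (rule null_vanish_diff[OF D'D[OF om] h(1) x])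
 then have T0: "T0 om x = tmap H T" unfolding T0_def H_def by (simp add: tmap_compose[symmetric])
 have \<phi>T0: "\<phi> (T0 om x) = tmap H (\<phi> T)" unfolding T0 by (rule equi[OF T pV pK])
 define N where "N = R om ** g0 ** H"
 have Nv: "N *v v = R om *v (P om *v (M *v v))" if "v : V'" for v
  unfolding N_def by (simp only: matrix_vector_mul_assoc[symmetric] Hv fd(5)[OF PM[OF that]])
 have NV: "N *v v : cperp Q L' om" if "v : V'" for v
  unfolding Nv[OF that] using Rtriv_cspace[OF h(2) PM(1)[OF that], of om] Rtriv_perp[OF h(1) w] by (simp add: cperp_def)
 have MV: "M *v v : cperp Q L' om" if "v : V'" for v using Mv[OF that] by (simp add: cperp_def)
 have NM: "N *v v - M *v v : cline om" if "v : V'" for v unfolding Nv[OF that] by (rule Rtriv_Ptriv[OF h(1) w Mv(2)[OF that]])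
 have NK: "N *v u = u" if "u : cspace K" for u
 proof -
  have "cform Q u om = 0" using L'_K_orth_cplx[OF D'L'[OF om] that] cform_sym[of u om] by simp
  then show ?thesis unfolding N_def by (simp only: matrix_vector_mul_assoc[symmetric] HK[OF that] fd(7)[OF that] Rtriv_fix)
 qed
 have "tmap N (\<phi> T) - tmap M (\<phi> T) : box_null Q L' K dL dK om"
  by (rule tmap_diff_box_null[OF im[OF T]]) (erule NV MV NM NK MK | rule cline_cperp[OF om])+
 then show "tmap (R om ** g0) (\<phi> (T0 om x)) - tmap M (\<phi> T) : box_null Q L' K dL dK om"
  unfolding \<phi>T0 N_def by (simp only: tmap_compose)
 have "lslice dL jdx (\<phi> T) : tpow dL V'" using lslice_box[OF im[OF T]] schur_tpow by blast
 then have "tmap N (lslice dL jdx (\<phi> T)) - tmap M (lslice dL jdx (\<phi> T)) : hodge_null Q L' dL om"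
  unfolding hodge_null_def by (rule tmap_diff_tnull) (erule NV MV NM | rule cline_cperp[OF om])+
 moreover have "lslice dL jdx (tmap H (\<phi> T)) = tmap H (lslice dL jdx (\<phi> T))"
  by (rule lslice_tmap[OF im[OF T]]) (rule HK)
 ultimately show "tmap (R om ** g0) (lslice dL jdx (\<phi> (T0 om x))) - tmap M (lslice dL jdx (\<phi> T)) : hodge_null Q L' dL om"
  unfolding \<phi>T0 N_def by (simp only: tmap_compose)
qed

lemma T0_X: "om : D' ==> x : hodge_fibre Q L la om ==> T0 om x : X" unfolding T0_def by (rule frame_point(2)[OF frame h])

lemma fibre_component_eq:
 assumes om: "om : D'"
 shows "fibre_component Q L L' K V' la \<phi> om (qp om u) - tmap (R om ** g0) (\<phi> (T0 om (qp om u))) : box_null Q L' K dL dK om"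
proof -
 let ?x = "qp om u"
 let ?A = "%y. EX g T. fibre_frame Q L' K V' om g & T : X & ?x - tmap g T : hodge_null Q L deg om & y = tmap g (\<phi> T)"
 have "EX y. ?A y" using frame_point[OF frame h om qp_fibre[OF om, of u]] by blast
 then have "?A (fibre_component Q L L' K V' la \<phi> om ?x)" unfolding fibre_component_def by (rule someI_ex)
 then obtain g T where g: "fibre_frame Q L' K V' om g" "T : X" "?x - tmap g T : hodge_null Q L deg om"
  "fibre_component Q L L' K V' la \<phi> om ?x = tmap g (\<phi> T)" by (elim exE conjE)
 have "- (tmap (R om ** g0) (\<phi> (T0 om ?x)) - tmap g (\<phi> T)) : box_null Q L' K dL dK om"
  using transition(1)[OF om g(1,2,3)] unfolding box_null_def by (rule tensor.span_neg)
 then show ?thesis unfolding g(4) by (simp only: minus_diff_eq)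
qed

definition \<psi> :: "'m tensor => 'm tensor" where
 "\<psi> = (SOME \<psi>. tlinear \<psi> & (ALL T:X. \<psi> T = \<phi> T) & (ALL T. \<psi> T : Box))"

lemma \<psi>: "tlinear \<psi>" "T : X ==> \<psi> T = \<phi> T" "\<psi> T : Box"
proof -
 have "EX \<psi>. tlinear \<psi> & (ALL T:X. \<psi> T = \<phi> T) & (ALL T. \<psi> T : Box)"
 proof (rule tlinear_extension[OF schur_subspace schur_box_subspace])
  show "\<phi> (x + tscale c y) = \<phi> x + tscale c (\<phi> y)" if "x : X" "y : X" for x y c by (rule lin[OF that])
  show "\<phi> x : Box" if "x : X" for x by (rule im[OF that])
 qed blast
 from someI_ex[OF this] show "tlinear \<psi>" "T : X ==> \<psi> T = \<phi> T" "\<psi> T : Box" unfolding \<psi>_def by blast+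
qed

text \<open>The scalar value of the component at the normal vector \<open>u\<close> and at the coordinate \<open>jdx\<close> of the second tensor
  factor.\<close>

definition coord :: "complex ^ 'm => 'm list => complex ^ 'm => 'm tensor" where
 "coord u jdx om = tmap (R om ** g0) (lslice dL jdx (\<psi> (T0 om (qp om u))))"

lemma \<psi>_T0: "om : D' ==> \<psi> (T0 om (qp om u)) = \<phi> (T0 om (qp om u))" by (rule \<psi>(2)[OF T0_X[OF _ qp_fibre]])

lemma \<Gamma>_isom:
 assumes "g : \<Gamma>" shows "isometric Q g" and "!!om. om : D ==> cmat g *v om : D"
proof -
 have g: "g : carrier (O_plus Q L D)" using subgroup.subset[OF \<Gamma>(1)] assms by blast
 show "isometric Q g" by (rule isometric_of_lattice[OF lattice(2)]) (use g in "simp add: O_plus_def")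
 show "cmat g *v om : D" if "om : D" for om using g that by (auto simp: O_plus_def)
qed

lemma fix_span: "(!!x. x : A ==> g *v x = x) ==> x : span A ==> g *v x = (x :: real ^ 'm)"
 by (rule linear_eq_on_span[of "(*v) g" "%x. x" A]) (auto simp: linear_iff matrix_vector_right_distrib matrix_vector_mult_scaleR)

lemma fix_cspace:
 fixes A :: "(real ^ 'm) set" shows "(!!x. x : A ==> g *v x = x) ==> v : cspace A ==> cmat g *v v = v"
 unfolding cmat_decomp using fix_span[of A g] by (simp add: cspace_iff Re_Im_decomp[symmetric])

lemma fixing_K:
 assumes g: "isometric Q g" "!!x. x : K ==> g *v x = x" and x: "x : span L'" shows "g *v x : span L'" unfolding span_L'_iff
proof
 fix y assume y: "y : span K"
 have "rform Q (g *v x) y = rform Q (g *v x) (g *v y)" by (simp add: fix_span[OF g(2) y])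
 also have "... = 0" using g(1) L'_K_orth[OF x y] by (simp add: isometric_def)
 finally show "rform Q (g *v x) y = 0" .
qed

lemma fixing_L':
 assumes g: "isometric Q g" "!!x. x : L' ==> g *v x = x" and x: "x : span K" shows "g *v x : span K" unfolding span_K_iff
proof
 fix y assume y: "y : span L'"
 have "rform Q y (g *v x) = rform Q (g *v y) (g *v x)" by (simp add: fix_span[OF g(2) y])
 also have "... = 0" using g(1) L'_K_orth[OF y x] by (simp add: isometric_def)
 finally show "rform Q y (g *v x) = 0" .
qed

lemma cmat_cspace:
 fixes A :: "(real ^ 'm) set" shows "(!!x. x : span A ==> g *v x : span A) ==> v : cspace A ==> cmat g *v v : cspace A"
 by (simp add: cspace_iff Revec_cmat Imvec_cmat)

lemma T0_split: "T0 om x = tmap g0' (tmap (P om) x)" by (simp add: T0_def tmap_compose)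

lemma coord_fibre:
 assumes om: "om : D'" shows "coord u jdx om : hodge_fibre Q L' lap om"
proof -
 note fd = frame_pairD[OF frame]
 let ?\<sigma> = "lslice dL jdx (\<psi> (T0 om (qp om u)))"
 have "?\<sigma> : schur Q lap V' {0}" by (rule lslice_box[OF \<psi>(3)])
 then have "tmap g0 ?\<sigma> : schur Q lap (U_cplx Q L' e e') {0}" by (rule tmap_schur) (simp_all add: U_cplx_eq fd(1,2,6))
 then have "tmap (R om) (tmap g0 ?\<sigma>) : hodge_fibre Q L' lap om"
  by (rule tmap_Rtriv_fibre[OF h(1,2) D'L'[OF om] D_isotropic[OF D'D[OF om]] D_nz[OF D'D[OF om] h(1)]])
 then show ?thesis by (simp add: coord_def tmap_compose)
qed

lemma coord_homogeneous:
 assumes om: "om : D'" and u: "u : cspace K" and c: "c ~= 0"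
 shows "coord u jdx (c *s om) = tscale (c powi (- (k + int \<nu>))) (coord u jdx om)"
 unfolding coord_def T0_split qp_homogeneous(1)[OF om u c] Rtriv_smult[OF c]
 by (simp only: tlinear_scale[OF tlinear_tmap] tlinear_scale[OF \<psi>(1)] tlinear_scale[OF tlinear_lslice])

lemma coord_transition:
 assumes om: "om : D'" and M: "fibre_frame Q L' K V' om M" and T: "T : X"
  and x: "qp om u - tmap M T : hodge_null Q L deg om"
 shows "coord u jdx om - tmap M (lslice dL jdx (\<psi> T)) : hodge_null Q L' dL om"
 unfolding coord_def \<psi>_T0[OF om] \<psi>(2)[OF T] by (rule transition(2)[OF om M T x])

text \<open>An element of \<open>\<Gamma>\<close> fixing \<open>K\<close> moves a frame at \<open>\<omega>\<close> to a frame at the image of \<open>\<omega>\<close>, so that \<open>transition\<close>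
  applies.\<close>

lemma coord_invariant:
 assumes g: "g : fixing \<Gamma> K" and om: "om : D'" and u: "u : cspace K"
 shows "coord u jdx (cmat g *v om) - tmap (cmat g) (coord u jdx om) : hodge_null Q L' dL (cmat g *v om)"
proof -
 have g\<Gamma>: "g : \<Gamma>" and gK: "g *v x = x" if "x : K" for x using g that by (auto simp: fixing_def)
 have g\<Gamma>: "g : \<Gamma>" using g by (simp add: fixing_def)
 note iso = \<Gamma>_isom[OF g\<Gamma>]
 have gL': "g *v x : span L'" if "x : span L'" for x by (rule fixing_K[OF iso(1) gK that])
 have gsK: "g *v x : span K" if "x : span K" for x using fix_span[OF gK that] that by simp
 have gu: "cmat g *v v = v" if "v : cspace K" for v by (rule fix_cspace[OF gK that])
 have fg: "f (cmat g *v y) - tmap (cmat g) (f y) : hodge_null Q L deg (cmat g *v y)" if "y : D" for y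
  by (rule modular[OF g\<Gamma> that])
 note eq = qp_equivariant[OF iso(1) iso(2) gL' gsK fg om u, unfolded gu[OF u]]
 let ?om = "cmat g *v om"
 have omg: "?om : D'" by (rule eq(2))
 define T where "T = T0 om (qp om u)"
 note fp = frame_point[OF frame h om qp_fibre[OF om, of u], folded T0_def, folded T_def]
 define M where "M = cmat g ** (R om ** g0)"
 have Mv: "M *v v = cmat g *v ((R om ** g0) *v v)" for v by (simp add: M_def matrix_vector_mul_assoc)
 note ci = isometric_cform[OF iso(1)]
 have fr: "fibre_frame Q L' K V' ?om M" using fp(1) unfolding fibre_frame_def cperp_def Mv ci
  by (auto simp: ci gu cmat_cspace[OF gL'])
 have "tmap (cmat g) (qp om u - tmap (R om ** g0) T) : hodge_null Q L deg ?om" unfolding hodge_null_def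
 proof (rule tmap_tnull[OF fp(3)[unfolded hodge_null_def]])
  show "cmat g *v v : cperp Q L ?om" if "v : cperp Q L om" for v using that by (simp add: cperp_def ci)
  show "cmat g *v v : cline ?om" if "v : cline om" for v using that by (auto simp: cline_def vector_scalar_commute)
 qed
 then have "(qp ?om u - tmap (cmat g) (qp om u)) + tmap (cmat g) (qp om u - tmap (R om ** g0) T) : hodge_null Q L deg ?om"
  using eq(1) unfolding hodge_null_def by (intro tensor.subspace_add[OF tnull_subspace])
 then have "qp ?om u - tmap M T : hodge_null Q L deg ?om" by (simp add: tlinear_diff[OF tlinear_tmap] M_def tmap_compose)
 from coord_transition[OF omg fr fp(2) this, of jdx] show ?thesis by (simp only: M_def tmap_compose[symmetric] coord_def T_def)
qed

lemma coord_holomorphic: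
 assumes om0: "om0 : D'" and u: "u : cspace K" shows "EX U F. open U & om0 : U & (ALL idx. holomorphic_cvec U (%y. F y idx)) &
  (ALL y:U Int D'. F y - coord u jdx y : hodge_null Q L' dL y)"
proof -
 have "EX U F. open U & om0 : U & (ALL idx. holomorphic_cvec U (%y. F y idx)) &
  (ALL om:U Int D'. tmap (P om) (qp om u) = F om) & (ALL y:U. cform Q y (cvec e) ~= 0)"
 proof (rule qp_holomorphic[OF om0 u])
  fix U F
  assume a: "open U" "om0 : U" "!!idx. holomorphic_cvec U (%y. F y idx)"
  "!!om. om : U Int D' ==> tmap (P om) (qp om u) = F om" "!!y. y : U ==> cform Q y (cvec e) ~= 0"
  show ?thesis by (intro exI[of _ U] exI[of _ F] conjI allI ballI a; assumption)
 qed
 then obtain U F where UF: "open U & om0 : U & (ALL idx. holomorphic_cvec U (%y. F y idx)) &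
  (ALL om:U Int D'. tmap (P om) (qp om u) = F om) & (ALL y:U. cform Q y (cvec e) ~= 0)" by (elim exE)
 have U: "open U" "om0 : U" and F: "holomorphic_cvec U (%y. F y idx)"
  "om : U Int D' ==> tmap (P om) (qp om u) = F om" and nz: "y : U ==> cform Q y (cvec e) ~= 0" for idx om y
  using UF by simp_all
 define \<Lambda> where "\<Lambda> T = lslice dL jdx (\<psi> (tmap g0' T))" for T
 have \<Lambda>: "tlinear \<Lambda>"
  unfolding \<Lambda>_def by (rule tlinear_compose[OF tlinear_compose[OF tlinear_tmap \<psi>(1)] tlinear_lslice])
 define Fc where "Fc y = (%idx. if length idx = deg then F y idx else 0)" for y
 have Fch: "holomorphic_cvec U (%y. Fc y idx)" for idx
  using F(1)[of idx] hol_cvec_const[of U 0] by (cases "length idx = deg") (simp_all add: Fc_def)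
 have \<Lambda>F: "\<Lambda> (Fc y) idx = (\<Sum>jdx | length jdx = deg. Fc y jdx * \<Lambda> (pure_tensor (map (%a. axis a 1) jdx)) idx)" for y idx
  by (rule tlinear_matrix[OF \<Lambda>]) (simp add: Fc_def)
 have "holomorphic_cvec U (%y. \<Lambda> (Fc y) idx)" for idx
  unfolding \<Lambda>F by (intro hol_cvec_sum hol_cvec_mult Fch hol_cvec_const)
 moreover have "holomorphic_cvec U (%y. (R y ** g0) $ i $ j)" for i j
 proof -
  have "holomorphic_cvec U (%y. SUM p:UNIV. R y $ i $ p * g0 $ p $ j)"
  by (intro hol_cvec_sum hol_cvec_mult holomorphic_Rtriv nz hol_cvec_const)
  then show ?thesis by (simp add: matrix_matrix_mult_def)
 qed
 ultimately have hol: "holomorphic_cvec U (%y. tmap (R y ** g0) (\<Lambda> (Fc y)) idx)" for idx by (intro holomorphic_tmap)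
 have "tmap (R y ** g0) (\<Lambda> (Fc y)) - coord u jdx y : hodge_null Q L' dL y" if y: "y : U Int D'" for y
 proof -
  have "tmap (P y) (qp y u) : tpow deg UNIV" by (rule tmap_tpow[OF qp_tpow]) (use y in auto)
  then have "Fc y = tmap (P y) (qp y u)" using F(2)[OF y] tpow_deg by (auto simp: Fc_def fun_eq_iff)
  then have "tmap (R y ** g0) (\<Lambda> (Fc y)) = coord u jdx y" by (simp add: \<Lambda>_def coord_def T0_split)
  then show ?thesis by (simp add: hodge_null_def tensor.subspace_0[OF tnull_subspace])
 qed
 then show ?thesis using U hol by (intro exI[of _ U] exI[of _ "%y. tmap (R y ** g0) (\<Lambda> (Fc y))"] conjI allI ballI)
qed

lemma coord_modular:
 assumes u: "u : cspace K" shows "coord u jdx : modular_forms Q L' D' lap (k + int \<nu>) (fixing \<Gamma> K)"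
 unfolding modular_forms_def hodge_sections_def
proof (intro CollectI conjI ballI allI impI)
 show "coord u jdx om : hodge_fibre Q L' lap om" if "om : D'" for om by (rule coord_fibre[OF that])
 show "coord u jdx (c *s om) - tscale (c powi (- (k + int \<nu>))) (coord u jdx om) : hodge_null Q L' dL om"
  if "om : D'" "c ~= 0" for om c unfolding coord_homogeneous[OF that(1) u that(2)] hodge_null_def
  by (simp add: tensor.subspace_0[OF tnull_subspace])
 show "EX U F. open U & om : U & (ALL idx. holomorphic_cvec U (%y. F y idx)) &
  (ALL y:U Int D'. F y - coord u jdx y : hodge_null Q L' dL y)" if "om : D'" for om
  by (rule coord_holomorphic[OF that u])
 show "coord u jdx (cmat g *v om) - tmap (cmat g) (coord u jdx om) : hodge_null Q L' dL (cmat g *v om)"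
  if "g : fixing \<Gamma> K" "om : D'" for g om by (rule coord_invariant[OF that u])
qed

lemma rational_point_of_cone:
 assumes a: "hyp a a'" "a : L'" "a' : rat_space L'"
  and C: "C : components {x : U_real Q L' a a'. rform Q x x > 0}" shows "EX y:C. y : rat_space L'"
proof -
 obtain y where y: "y : C" using in_components_nonempty[OF C] by blast
 note Cy = cusp_component[OF a(1) C y]
 define pr where "pr x = x - rform Q x a' *\<^sub>R a - rform Q x a *\<^sub>R a'" for x
 have "linear pr" by (rule linearI) (simp_all add: pr_def rform_simps algebra_simps)
 have aL: "a : rat_space L'" using a(2) lattice_rat_space by blast
 have "pr x : U_rat Q L' a a'" if "x : rat_space L'" for x unfolding pr_def U_rat_def using that hypD[OF a(1)]
  by (auto intro!: rat_space_diff[OF lattice'(1)] rat_space_scale[OF lattice'(1)] rform_rat[OF lattice'(1)] aL a(3) simp: rform_simps)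
 then have "pr ` span (rat_space L') <= span (U_rat Q L' a a')"
  unfolding linear_span_image[OF \<open>linear pr\<close>, symmetric] by (intro span_mono) blast
 moreover have "y : span (rat_space L')" using y Cy(1) span_rat_space[OF lattice'(1)] by blast
 moreover have "pr y = y" using Cy(2) by (simp add: pr_def fcone_def)
 ultimately have "y : span (U_rat Q L' a a')" by (metis image_subset_iff)
 also have "... <= closure (U_rat Q L' a a')"
  by (rule rational_span_dense) (auto simp: U_rat_def rform_simps rat_space_0[OF lattice'(1)]
  rat_space_add[OF lattice'(1)] rat_space_scale[OF lattice'(1)])
 finally have ycl: "y : closure (U_rat Q L' a a')" .
 let ?V = "{x. 0 < rform Q x x} Int {x. 0 < rform Q x y}"
 have "open ?V" by (intro open_Int open_Collect_less continuous_intros)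
 moreover have "y : ?V" using Cy(2) by (simp add: fcone_def)
 ultimately obtain y1 where y1: "y1 : U_rat Q L' a a'" "y1 : ?V" using ycl unfolding closure_iff_nhds_not_empty by blast
 have "y1 : span L'" using y1(1) rat_space_subset_span by (auto simp: U_rat_def)
 then have "y1 : C" unfolding Cy(1) using y1 by (simp add: fcone_def U_rat_def)
 then show ?thesis using y1(1) by (auto simp: U_rat_def)
qed

text \<open>In the frame of the cusp, the form is a fixed linear image of the trivialized quasi-pullback, so its
  Fourier coefficients are the images of those of the quasi-pullback.\<close>

lemma coord_cusp_form:
 assumes u: "u : cspace K" and \<nu>: "\<nu> > 0"
 shows "coord u jdx : cusp_forms Q L' D' lap (k + int \<nu>) (fixing \<Gamma> K)" unfolding cusp_forms_def
proof (intro CollectI conjI allI impI)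
 show "coord u jdx : modular_forms Q L' D' lap (k + int \<nu>) (fixing \<Gamma> K)" by (rule coord_modular[OF u])
 fix a a' C assume "cusp_frame Q L' a a' & is_cusp_cone Q L' D' a a' C"
 then have cf: "cusp_frame Q L' a a'" and cc: "is_cusp_cone Q L' D' a a' C" by simp_all
 have aL: "a : L'" "a' : rat_space L'" and ha: "hyp a a'" using cf by (simp_all add: cusp_frame_def hyp_def)
 have as: "a : span L'" "a' : span L'" using aL rat_space_subset_span span_base by blast+
 have C: "C : components {x : U_real Q L' a a'. rform Q x x > 0}"
  and DC: "D' = {c *s tube_point Q a a' z | c z. c ~= 0 & z : tube Q L' a a' C}" using cc by (simp_all add: is_cusp_cone_def)
 obtain y where y: "y : C" "y : rat_space L'" using rational_point_of_cone[OF ha aL C] by blast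
 note Cy = cusp_component[OF ha C y(1)]
 have tube_D': "tube_point Q a a' z : D'" if "z : tube Q L' a a' C" for z
  unfolding DC using that by (intro CollectI exI[of _ "1::complex"] exI[of _ z]) simp
 have "\<i> *s cvec y : tube Q L' a a' C"
 proof -
  have "cvec y : U_cplx Q L' a a'" using Cy y(1) by (auto simp: U_cplx_def cvec_cspace cform_cvec fcone_def)
  then show ?thesis using y(1) vec.subspace_scale[OF cspace_subspace, of "cvec y" L' \<i>]
  by (simp add: tube_def U_cplx_def cform_simps Imvec_scale Imvec_cvec Revec_cvec)
 qed
 from D'D[OF tube_D'[OF this]] have base: "tube_point Q a a' (\<i> *s cvec y) : D" .
 have cd: "cusp_data Q L L' K D D' f la k \<nu> a a' \<Gamma> y"
  by (intro cusp_data.intro qp_data.intro qp_data_axioms.intro cusp_data_axioms.intro sublattice_pair_axioms f ideal ha as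
  \<Gamma> modular aL y(2) Cy(2) base card)
 let ?Ud = "U_dual Q L' (fixing \<Gamma> K) a a'"
 obtain c where c: "(ALL l. c l ~= 0 --> l : ?Ud & l : fcone a a' y) &
  (ALL l idx. length idx ~= deg --> c l idx = 0) &
  (ALL z. z : Uc a a' --> z : cspace L' --> Imvec z : fcone a a' y --> (ALL idx.
  ((%l. c l idx * ec (cform Q (cvec l) z)) has_sum tmap (Ptriv a a' (tube_point Q a a' z)) (qp (tube_point Q a a' z) u) idx) ?Ud))"
  using cusp_data.quasi_pullback_fourier[OF cd u \<nu> refl] by (elim exE)
 have "EX g g'. frame_pair V' a a' g g'"
 proof (rule frame_pair_exists[OF V'])
  show "v = 0" if "v : V'" "!!w. w : V' ==> cform Q v w = 0" for v by (rule V'_nd[OF that])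
 qed (fact ha as)+
 then obtain g g' where fp: "frame_pair V' a a' g g'" by (elim exE)
 define \<Lambda> where "\<Lambda> T = tmap g (lslice dL jdx (\<psi> (tmap g' T)))" for T
 have \<Lambda>: "tlinear \<Lambda>"
  unfolding \<Lambda>_def by (rule tlinear_compose[OF tlinear_compose[OF tlinear_compose[OF tlinear_tmap \<psi>(1)] tlinear_lslice] tlinear_tmap])
 have \<Lambda>_schur: "\<Lambda> T : schur Q lap (U_cplx Q L' a a') {0}" for T unfolding \<Lambda>_def
  by (rule tmap_schur[OF lslice_box[OF \<psi>(3)]]) (simp_all add: U_cplx_eq frame_pairD(1,2,6)[OF fp])
 define F where "F z = \<Lambda> (tmap (Ptriv a a' (tube_point Q a a' z)) (qp (tube_point Q a a' z) u))" for z
 have main: "F z : schur Q lap (U_cplx Q L' a a') {0} &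
  coord u jdx (tube_point Q a a' z) - tmap (cusp_triv Q a (tube_point Q a a' z)) (F z)
  : hodge_null Q L' dL (tube_point Q a a' z) &
  (ALL idx. ((%l. \<Lambda> (c l) idx * exp (2 * of_real pi * \<i> * cform Q (cvec l) z)) has_sum F z idx) ?Ud)"
  if z: "z : tube Q L' a a' C" for z
 proof (intro conjI allI)
  let ?om = "tube_point Q a a' z"
  have om: "?om : D'" by (rule tube_D'[OF z])
  have zU: "z : Uc a a'" "z : cspace L'" "Imvec z : fcone a a' y" using z Cy(1) by (auto simp: tube_def U_cplx_eq)
  show "F z : schur Q lap (U_cplx Q L' a a') {0}" unfolding F_def by (rule \<Lambda>_schur)
  have one: "cform Q ?om (cvec a) = 1" by (rule tube_point_isotropic(2)[OF ha]) (use zU(1) in "simp_all add: Uc_def")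
  have ct: "cusp_triv Q a ?om = Rtriv a ?om" unfolding matrix_eq by (simp add: cusp_triv_apply Rtriv_apply one)
  note fpt = frame_point[OF fp ha as om qp_fibre[OF om, of u]]
  show "coord u jdx ?om - tmap (cusp_triv Q a ?om) (F z) : hodge_null Q L' dL ?om"
  using coord_transition[OF om fpt, of jdx] unfolding ct F_def \<Lambda>_def by (simp only: tmap_compose)
  fix idx
  have "tmap (Ptriv a a' ?om) (qp ?om u) : tpow deg UNIV" by (rule tmap_tpow[OF qp_tpow[OF om]]) simp
  then have G0: "tmap (Ptriv a a' ?om) (qp ?om u) idx = 0" if "length idx ~= deg" for idx using that tpow_deg by blast
  have "((%l. \<Lambda> (c l) idx * ec (cform Q (cvec l) z)) has_sum F z idx) ?Ud" unfolding F_def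
  proof (rule tlinear_has_sum[OF \<Lambda>])
  show "c l idx = 0" if "length idx ~= deg" for l idx using c that by blast
  show "tmap (Ptriv a a' ?om) (qp ?om u) idx = 0" if "length idx ~= deg" for idx by (rule G0[OF that])
  show "((%l. c l idx * ec (cform Q (cvec l) z)) has_sum tmap (Ptriv a a' ?om) (qp ?om u) idx) ?Ud" for idx
  using conjunct2[OF conjunct2[OF c]] zU by simp
  qed
  then show "((%l. \<Lambda> (c l) idx * exp (2 * of_real pi * \<i> * cform Q (cvec l) z)) has_sum F z idx) ?Ud"
  by (simp only: ec_def)
 qed
 show "EX b. fourier_expansion Q L' lap (fixing \<Gamma> K) a a' C (coord u jdx) b & (ALL l:?Ud. b l ~= 0 --> l : C)"
 proof (intro exI[of _ "%l. \<Lambda> (c l)"] conjI ballI impI)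
  show "fourier_expansion Q L' lap (fixing \<Gamma> K) a a' C (coord u jdx) (%l. \<Lambda> (c l))"
  unfolding fourier_expansion_def using main \<Lambda>_schur by (intro conjI ballI exI[of _ F]) simp_all
  fix l assume l: "l : ?Ud" "\<Lambda> (c l) ~= 0"
  then have "c l ~= 0" using tlinear_0[OF \<Lambda>] by auto
  moreover have "l : span L'" using l(1) rat_space_subset_span by (auto simp: U_dual_def U_rat_def)
  ultimately show "l : C" using c Cy(1) by simp
 qed
qed

end

context decomp_data
begin

lemma K_functional:
 assumes add: "!!v w. l (v + w) = l v + l w" and scale: "!!c v. l (c *s v) = c * l v"
 shows "EX \<kappa>. \<kappa> : cspace K & (ALL u:cspace K. l u = cform Q \<kappa> u)"
proof -
 have "EX b. onb (cspace K) (vec.dim (cspace K)) b"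
 proof (rule onb_exists[OF cspace_subspace])
  show "v = 0" if "v : cspace K" "!!w. w : cspace K ==> cform Q v w = 0" for v by (rule K_nondegenerate[OF that])
 qed (rule exI)
 then obtain b where b: "onb (cspace K) (vec.dim (cspace K)) b" by (elim exE)
 let ?p = "vec.dim (cspace K)"
 have l0: "l 0 = 0" using scale[of 0 0] by simp
 have sum: "l (\<Sum>i<q. t i *s b i) = (\<Sum>i<q. t i * l (b i))" for t and q :: nat
  by (induction q) (simp_all add: l0 add scale)
 define \<kappa> where "\<kappa> = (\<Sum>i<?p. l (b i) *s b i)"
 have "\<kappa> : cspace K" unfolding \<kappa>_def using b
  by (intro vec.subspace_sum[OF cspace_subspace] vec.subspace_scale[OF cspace_subspace]) (simp add: onb_def)
 moreover have "l u = cform Q \<kappa> u" if u: "u : cspace K" for u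
 proof -
  have e: "u = (\<Sum>i<?p. cform Q u (b i) *s b i)" using b u by (simp add: onb_def)
  have "l u = (\<Sum>i<?p. cform Q u (b i) * l (b i))" using sum[of "%i. cform Q u (b i)" ?p] e by simp
  also have "... = cform Q \<kappa> u" unfolding \<kappa>_def cform_sum_left cform_scale_left
  by (rule sum.cong[OF refl]) (metis cform_sym mult.commute)
  finally show ?thesis .
 qed
 ultimately show ?thesis by blast
qed

lemma T0_equivariant:
 assumes g: "g : fixing \<Gamma> L'" and om: "om : D'" and u: "u : cspace K"
 shows "\<phi> (T0 om (qp om (cmat g *v u))) = tmap (cmat g) (\<phi> (T0 om (qp om u)))" "cmat g *v u : cspace K"
proof -
 have gL': "g *v x = x" if "x : L'" for x using g that by (auto simp: fixing_def)
 have g\<Gamma>: "g : \<Gamma>" using g by (simp add: fixing_def)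
 note iso = \<Gamma>_isom[OF g\<Gamma>]
 have gsL: "g *v x : span L'" if "x : span L'" for x using fix_span[OF gL' that] that by simp
 have gsK: "g *v x : span K" if "x : span K" for x by (rule fixing_L'[OF iso(1) gL' that])
 have gK: "cmat g *v v : cspace K" if "v : cspace K" for v by (rule cmat_cspace[OF gsK that])
 have gv: "cmat g *v v = v" if "v : cspace L'" for v by (rule fix_cspace[OF gL' that])
 show gu: "cmat g *v u : cspace K" by (rule gK[OF u])
 have fg: "f (cmat g *v y) - tmap (cmat g) (f y) : hodge_null Q L deg (cmat g *v y)" if "y : D" for y
  by (rule modular[OF g\<Gamma> that])
 have "qp om (cmat g *v u) - tmap (cmat g) (qp om u) : hodge_null Q L deg om"
  using qp_equivariant(1)[OF iso(1) iso(2) gsL gsK fg om u] gv[OF D'L'[OF om]] by simp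
 from null_vanish_diff[OF D'D[OF om] h(1) this]
 have "T0 om (qp om (cmat g *v u)) = tmap (g0' ** P om ** cmat g) (qp om u)"
  by (simp add: T0_split tmap_compose matrix_mul_assoc)
 also have "... = tmap (cmat g ** g0' ** P om) (qp om u)"
 proof (rule tmap_cong[OF qp_tpow[OF om]])
  fix v
  have "P om ** cmat g = cmat g ** P om" using Ptriv_equivariant[OF period_space_axioms iso(1), of e e' om] gv[OF D'L'[OF om]]
  fix_span[OF gL' h(2)] fix_span[OF gL' h(3)] by simp
  then have e: "P om *v (cmat g *v v) = cmat g *v (P om *v v)" by (simp add: matrix_vector_mul_assoc)
  have "P om *v v : Uc e e'" by (rule Ptriv_Uc[OF h(1) D_isotropic[OF D'D[OF om]] D_nz[OF D'D[OF om] h(1)]])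
  moreover have "g0' *v (cmat g *v z) = cmat g *v (g0' *v z)" if z: "z : Uc e e'" for z
  proof -
  obtain z1 z2 where z12: "z1 : cspace L'" "z2 : cspace K" "z = z1 + z2" using decomposition_cplx[of z] by blast
  have "z2 : Uc e e'" using K_perp[OF z12(2)] h by (simp add: Uc_def)
  then have z1: "z1 : Uc e e'" using z z12(3) by (simp add: Uc_def cform_simps)
  note fd = frame_pairD[OF frame]
  have "g0' *v z1 : cspace L'" using fd(4)[OF z12(1) z1] V'(2) by blast
  then show ?thesis by (simp add: z12(3) matrix_vector_right_distrib gv z12(1) fd(8)[OF z12(2)] fd(8)[OF gK[OF z12(2)]])
  qed
  ultimately show "(g0' ** P om ** cmat g) *v v = (cmat g ** g0' ** P om) *v v"
  by (simp add: matrix_vector_mul_assoc[symmetric] e)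
 qed
 finally have "T0 om (qp om (cmat g *v u)) = tmap (cmat g) (T0 om (qp om u))"
  by (simp add: T0_def tmap_compose matrix_mul_assoc)
 moreover have "preserves Q V' (cmat g)" unfolding preserves_def
 proof (intro conjI ballI)
  have gV: "cmat g *v v = v" if "v : V'" for v using gv V'(2) that by blast
  show "(*v) (cmat g) ` V' = V'" using image_cong[OF refl gV, of V'] by simp
  show "cform Q (cmat g *v v) (cmat g *v w) = cform Q v w" for v w by (rule isometric_cform[OF iso(1)])
 qed
 moreover have "preserves Q (cspace K) (cmat g)"
 proof (rule preservesI[OF cspace_subspace])
  show "v = 0" if "v : cspace K" "!!w. w : cspace K ==> cform Q v w = 0" for v by (rule K_nondegenerate[OF that])
  show "cmat g *v v : cspace K" if "v : cspace K" for v by (rule gK[OF that])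
  show "cform Q (cmat g *v v) (cmat g *v w) = cform Q v w" for v w by (rule isometric_cform[OF iso(1)])
 qed
 ultimately show "\<phi> (T0 om (qp om (cmat g *v u))) = tmap (cmat g) (\<phi> (T0 om (qp om u)))"
  using equi[OF T0_X[OF om qp_fibre[OF om]]] by simp
qed

abbreviation "Sym \<equiv> sym_invariants Q K (fixing \<Gamma> L') lapp \<nu>"

text \<open>For fixed coordinates in the first factor, the dependence on \<open>u\<close>. The equivariance holds exactly and not
  only modulo null tensors, because the trivialization is exact.\<close>

lemma slice_invariant:
 assumes om: "om : D'" and idx: "length idx = dL"
 shows "EX w:Sym. ALL u:cspace K. w u = rslice idx (\<phi> (T0 om (qp om u)))"
proof -
 have "EX N l T. (\<forall>j<N. T j : hodge_fibre Q L la om) &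
  (\<forall>j<N. \<forall>i<\<nu>. (ALL v w. l j i (v + w) = l j i v + l j i w) & (ALL c v. l j i (c *s v) = c * l j i v)) &
  qp om = (%u. \<Sum>j<(N::nat). tscale (\<Prod>i<\<nu>. l j i u) (T j))"
 proof (rule qp_polynomial[OF om])
  fix N l T
  assume a: "!!j. j < N ==> T j : hodge_fibre Q L la om"
  "!!j i v w. j < N ==> i < \<nu> ==> l j i (v + w) = l j i v + l j i w"
  "!!j i c v. j < N ==> i < \<nu> ==> l j i (c *s v) = c * l j i v"
  "qp om = (%u. \<Sum>j<(N::nat). tscale (\<Prod>i<\<nu>. l j i u) (T j))"
  show ?thesis by (intro exI[of _ N] exI[of _ l] exI[of _ T] conjI allI impI a; assumption)
 qed
 then obtain N l T where NlT: "(\<forall>j<N. T j : hodge_fibre Q L la om) &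
  (\<forall>j<N. \<forall>i<\<nu>. (ALL v w. l j i (v + w) = l j i v + l j i w) & (ALL c v. l j i (c *s v) = c * l j i v)) &
  qp om = (%u. \<Sum>j<(N::nat). tscale (\<Prod>i<\<nu>. l j i u) (T j))" by (elim exE)
 have l: "l j i (v + w) = l j i v + l j i w" "l j i (c *s v) = c * l j i v" if "j < N" "i < \<nu>" for j i v w c
  using NlT that by simp_all
 have qpT: "qp om = (%u. \<Sum>j<N. tscale (\<Prod>i<\<nu>. l j i u) (T j))" using NlT by simp
 define \<kappa> where "\<kappa> j i = (SOME \<kappa>. \<kappa> : cspace K & (ALL u:cspace K. l j i u = cform Q \<kappa> u))" for j i
 have \<kappa>: "\<kappa> j i : cspace K & (ALL u:cspace K. l j i u = cform Q (\<kappa> j i) u)" if "j < N" "i < \<nu>" for j i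
  unfolding \<kappa>_def by (rule someI_ex[OF K_functional]) (rule l[OF that])+
 define \<Xi> where "\<Xi> x = rslice idx (\<psi> (tmap (g0' ** P om) x))" for x
 have \<Xi>: "tlinear \<Xi>"
  unfolding \<Xi>_def by (rule tlinear_compose[OF tlinear_compose[OF tlinear_tmap \<psi>(1)] tlinear_rslice])
 define w where "w = (%u. \<Sum>j<N. tscale (\<Prod>i<\<nu>. cform Q (\<kappa> j i) u) (\<Xi> (T j)))"
 have wu: "w u = rslice idx (\<phi> (T0 om (qp om u)))" if u: "u : cspace K" for u
 proof -
  have "rslice idx (\<phi> (T0 om (qp om u))) = \<Xi> (qp om u)" unfolding \<Xi>_def T0_def[symmetric] \<psi>_T0[OF om] ..
  also have "... = (\<Sum>j<N. tscale (\<Prod>i<\<nu>. l j i u) (\<Xi> (T j)))"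
  by (simp only: qpT tlinear_sum[OF \<Xi>] tlinear_scale[OF \<Xi>])
  also have "... = w u" unfolding w_def by (intro sum.cong arg_cong2[where f = tscale] prod.cong) (use \<kappa> u in auto)
  finally show ?thesis by simp
 qed
 have "w : Sym" unfolding sym_invariants_def
 proof (intro CollectI conjI exI[of _ N] exI[of _ \<kappa>] exI[of _ "%j. \<Xi> (T j)"] allI impI ballI)
  show "\<Xi> (T j) : schur Q lapp (cspace K) {0}" for j unfolding \<Xi>_def by (rule rslice_box[OF \<psi>(3) idx])
  show "\<kappa> j i : cspace K" if "j < N" "i < \<nu>" for j i using \<kappa>[OF that] by simp
  show "w = (%u. \<Sum>j<N. tscale (\<Prod>i<\<nu>. cform Q (\<kappa> j i) u) (\<Xi> (T j)))" by (rule w_def)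
  fix g u assume g: "g : fixing \<Gamma> L'" and u: "u : cspace K"
  have "cmat g *v v = v" if "v : V'" for v by (rule fix_cspace[of L']) (use g that V'(2) in "auto simp: fixing_def")
  then have "rslice idx (tmap (cmat g) (\<phi> (T0 om (qp om u)))) = tmap (cmat g) (rslice idx (\<phi> (T0 om (qp om u))))"
  by (intro rslice_tmap[OF im[OF T0_X[OF om qp_fibre[OF om]]] _ idx])
  then show "w (cmat g *v u) = tmap (cmat g) (w u)"
  by (simp add: wu[OF u] wu[OF T0_equivariant(2)[OF g om u]] T0_equivariant(1)[OF g om u])
 qed
 then show ?thesis using wu by blast
qed

lemma Sym_tpow: "w : Sym ==> w u : tpow dK (cspace K)" unfolding sym_invariants_def using schur_tpow[of Q lapp "cspace K" "{0}"]
 by (auto intro!: tensor.subspace_sum[OF tpow_subspace] tensor.subspace_scale[OF tpow_subspace])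

text \<open>By interpolation, the invariant-valued function is a combination of fixed invariants whose
  coefficients are slices of its values at fixed vectors \<open>u\<close>.\<close>

lemma component_in_cusp_tensor_space:
 assumes \<nu>: "\<nu> > 0" shows "(%om u. fibre_component Q L L' K V' la \<phi> om (qp om u))
  : cusp_tensor_space Q L' K D' (fixing \<Gamma> K) (fixing \<Gamma> L') lap lapp (k + int \<nu>) \<nu>"
proof -
 define W where "W = {(%x. v (fst x) (snd x)) | v. v : Sym}"
 define I where "I = {as :: 'm list. length as = \<nu>} \<times> {jdx :: 'm list. length jdx = dK}"
 define hh where "hh b x = (\<Prod>i<\<nu>. fst x $ (fst b ! i)) * (if snd x = snd b then 1 else 0)"
  for b :: "'m list \<times> 'm list" and x :: "(complex ^ 'm) \<times> 'm list"
 have "EX N p w. (\<forall>i<(N::nat). p i : cspace K \<times> (UNIV :: 'm list set) & w i : W) &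
  (ALL v:W. ALL x:cspace K \<times> UNIV. v x = (\<Sum>i<N. v (p i) * w i x))"
 proof (rule interpolation[where I = I and h = hh])
  show "finite I" by (simp add: I_def)
  show "(%x. v x - c * w x) : W" if "v : W" "w : W" for v w c
  proof -
  obtain v' w' where vw: "v = (%x. v' (fst x) (snd x))" "v' : Sym" "w = (%x. w' (fst x) (snd x))" "w' : Sym"
  using \<open>v : W\<close> \<open>w : W\<close> unfolding W_def by blast
  show ?thesis unfolding W_def by (intro CollectI exI[of _ "%u. v' u + tscale (- c) (w' u)"] conjI sym_invariants_diff vw(2,4))
  (simp add: vw(1,3))
  qed
  show "EX c. ALL x:cspace K \<times> UNIV. v x = (SUM b:I. c b * hh b x)" if v: "v : W" for v
  proof -
  obtain v' where v': "v = (%x. v' (fst x) (snd x))" "v' : Sym" using v unfolding W_def by blast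
  obtain c where "ALL u jdx'. v' u jdx' = (SUM b:I. c b * ((\<Prod>i<\<nu>. u $ (fst b ! i)) * (if jdx' = snd b then 1 else 0)))"
  using sym_invariants_finite_dim[OF v'(2)] unfolding I_def by (elim exE)
  then show ?thesis unfolding v'(1) hh_def by (intro exI[of _ c]) simp
  qed
 qed
 then obtain N p w where N: "(\<forall>i<(N::nat). p i : cspace K \<times> (UNIV :: 'm list set) & w i : W) &
  (ALL v:W. ALL x:cspace K \<times> UNIV. v x = (\<Sum>i<N. v (p i) * w i x))" by (elim exE)
 define w' where "w' i u jdx = w i (u, jdx)" for i u jdx
 have w'S: "w' i : Sym" if "i < N" for i
 proof -
  have "w i : W" using N that by blast
  then obtain v where v: "w i = (%x. v (fst x) (snd x))" "v : Sym" unfolding W_def by blast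
  have "w' i = v" by (simp add: w'_def v(1) fun_eq_iff)
  then show ?thesis using v(2) by simp
 qed
 have pK: "fst (p i) : cspace K" if "i < N" for i using N that by (auto simp: mem_Times_iff)
 define Y where "Y om u = \<phi> (T0 om (qp om u))" for om u
 have YBox: "Y om u : Box" if "om : D'" for om u unfolding Y_def by (rule im[OF T0_X[OF that qp_fibre[OF that]]])
 have expand: "Y om u = (\<Sum>i<N. tprod dL (lslice dL (snd (p i)) (Y om (fst (p i)))) (w' i u))"
  if om: "om : D'" and u: "u : cspace K" for om u
 proof
  fix l :: "'m list"
  let ?i = "take dL l" and ?j = "drop dL l"
  show "Y om u l = (\<Sum>i<N. tprod dL (lslice dL (snd (p i)) (Y om (fst (p i)))) (w' i u)) l"
  proof (cases "length ?i = dL")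
  case True
  then have True': "min (length l) dL = dL" by simp
  obtain v where v: "v : Sym" "!!u. u : cspace K ==> v u = rslice ?i (Y om u)"
  using slice_invariant[OF om True] unfolding Y_def by blast
  have vW: "(%x. v (fst x) (snd x)) : W" using v(1) unfolding W_def by blast
  have "(u, ?j) : cspace K \<times> UNIV" using u by simp
  from bspec[OF bspec[OF conjunct2[OF N] vW] this]
  have "v u ?j = (\<Sum>i<N. v (fst (p i)) (snd (p i)) * w i (u, ?j))" by simp
  also have "... = (\<Sum>i<N. tprod dL (lslice dL (snd (p i)) (Y om (fst (p i)))) (w' i u) l)"
  by (rule sum.cong) (simp_all add: v(2)[OF pK] tprod_def lslice_def rslice_def w'_def True')
  finally show ?thesis by (simp add: v(2)[OF u] rslice_def sum_tensor_apply)
  next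
  case False
  have "length l ~= dL + dK" using False by auto
  then have "Y om u l = 0" using YBox[OF om] schur_box_tpow tpow_deg by blast
  moreover have "tprod dL (lslice dL j T) T' l = 0" for j and T T' :: "'m tensor"
  using False by (simp only: tprod_def lslice_def if_False mult_zero_left)
  ultimately show ?thesis by (simp add: sum_tensor_apply)
  qed
 qed
 show ?thesis unfolding cusp_tensor_space_def
 proof (rule CollectI, rule exI[of _ N], rule exI[of _ "%i. coord (fst (p i)) (snd (p i))"], rule exI[of _ w'],
  intro conjI allI impI ballI)
  fix i assume i: "i < N"
  show "coord (fst (p i)) (snd (p i)) : cusp_forms Q L' D' lap (k + int \<nu>) (fixing \<Gamma> K)"
  by (rule coord_cusp_form[OF pK[OF i] \<nu>])
  show "w' i : Sym" by (rule w'S[OF i])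
 next
  fix om u assume om: "om : D'" and u: "u : cspace K"
  have id: "(R om ** g0) *v v = v" if "v : cspace K" for v
  using frame_point(1)[OF frame h om qp_fibre[OF om, of u]] that unfolding fibre_frame_def by blast
  have "tmap (R om ** g0) (Y om u) = (\<Sum>i<N. tmap (R om ** g0) (tprod dL (lslice dL (snd (p i)) (Y om (fst (p i)))) (w' i u)))"
  by (subst expand[OF om u]) (rule tlinear_sum[OF tlinear_tmap])
  also have "... = (\<Sum>i<N. tprod dL (coord (fst (p i)) (snd (p i)) om) (w' i u))"
  proof (rule sum.cong[OF refl])
  fix i assume "i : {..<N}"
  then have w: "w' i u : tpow dK (cspace K)" by (intro Sym_tpow w'S) simp
  have s: "lslice dL (snd (p i)) (Y om (fst (p i))) : tpow dL V'" using lslice_box[OF YBox[OF om]] schur_tpow by blast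
  have idw: "tmap (R om ** g0) (w' i u) = w' i u" by (rule tmap_id[OF w]) (rule id)
  show "tmap (R om ** g0) (tprod dL (lslice dL (snd (p i)) (Y om (fst (p i)))) (w' i u))
  = tprod dL (coord (fst (p i)) (snd (p i)) om) (w' i u)"
  unfolding tmap_tprod[OF s w] idw unfolding coord_def \<psi>_T0[OF om] Y_def ..
  qed
  finally have "tmap (R om ** g0) (Y om u) = (\<Sum>i<N. tprod dL (coord (fst (p i)) (snd (p i)) om) (w' i u))" .
  with fibre_component_eq[OF om, of u]
  show "fibre_component Q L L' K V' la \<phi> om (qp om u) - (\<Sum>i<N. tprod dL (coord (fst (p i)) (snd (p i)) om) (w' i u))
  : box_null Q L' K dL dK om" unfolding Y_def by simp
 qed
qed

end

section \<open>The signature conditions\<close>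

lemma nonzero_of_dim:
 fixes S :: "(real ^ 'm) set"
 assumes "dim S ~= 0" shows "EX v. v : S & v ~= 0"
proof (rule ccontr)
 assume "\<nexists>v. v : S & v ~= 0"
 then have "S <= {0}" by blast
 then have "dim S = 0" unfolding dim_eq_0 .
 with assms show False by (rule notE)
qed

lemma symmetric_form_of_lattice:
 assumes L: "is_lattice Q L" "span L = UNIV" shows "symmetric_form Q"
proof
 fix i j
 define A where "A = (\<chi> i j. Q $ i $ j - Q $ j $ i)"
 have A: "rform A x y = rform Q x y - rform Q y x" for x y
 proof -
  have "rform Q y x = (SUM i:UNIV. SUM j:UNIV. x $ i * Q $ j $ i * y $ j)"
  unfolding rform_def by (subst sum.swap) (simp add: mult_ac)
  then show ?thesis unfolding rform_def[of Q x y] rform_def[of A] by (simp add: A_def algebra_simps sum_subtractf)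
 qed
 have "rform A (axis i 1) (axis j 1) = 0"
 proof (rule rform_span_0)
  show "rform A x y = 0" if "x : L" "y : L" for x y using L(1) that by (auto simp: A is_lattice_def)
 qed (simp_all add: L)
 moreover have "rform A (axis i 1) (axis j 1) = A $ i $ j"
 proof -
  have "rform A (axis i 1) (axis j 1) = (SUM i':UNIV. SUM j':UNIV. if i' = i & j' = j then A $ i $ j else 0)"
  unfolding rform_def by (intro sum.cong) (auto simp: axis_def)
  also have "... = (SUM i':UNIV. if i' = i then A $ i $ j else 0)" by (rule sum.cong) (auto simp: sum.delta)
  finally show ?thesis by simp
 qed
 ultimately show "Q $ i $ j = Q $ j $ i" by (simp add: A_def)
qed

text \<open>A positive definite space of dimension 3 would meet the negative definite space of codimension 2.\<close>

lemma period_space_of_lattice: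
 assumes L: "is_lattice Q L" "span L = UNIV" "has_signature Q L 2 n" shows "period_space Q"
proof -
 interpret symmetric_form Q by (rule symmetric_form_of_lattice[OF L(1,2)])
 from L(3) obtain P N where PN: "subspace P & subspace N & P <= span L & N <= span L &
  dim P = 2 & dim N = n & dim (span L) = 2 + n &
  (ALL x:P. x ~= 0 --> rform Q x x > 0) &
  (ALL x:N. x ~= 0 --> rform Q x x < 0) &
  (ALL x:P. ALL y:N. rform Q x y = 0)" unfolding has_signature_def by (elim exE)
 then have N: "subspace N" "dim N = n" "dim (span L) = 2 + n" "!!x. x : N ==> x ~= 0 ==> rform Q x x < 0" by simp_all
 show ?thesis
 proof
  show "x = 0" if "!!y. rform Q x y = 0" for x by (rule lattice_nondegenerate[OF L(1)]) (simp_all add: L(2) that)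
  fix x y z
  assume p: "rform Q x x > 0" "rform Q y y > 0" "rform Q z z > 0" "rform Q x y = 0" "rform Q x z = 0" "rform Q y z = 0"
  have s: "rform Q y x = 0" "rform Q z x = 0" "rform Q z y = 0"
  using p rform_sym[of y x] rform_sym[of z x] rform_sym[of z y] by auto
  have B: "orth_set {x, y, z}" using p s by (auto simp: orth_set_def)
  have "x ~= y" "x ~= z" "y ~= z" using p by auto
  then have "card {x, y, z} = 3" by simp
  then have d3: "dim (span {x, y, z}) = 3" using dim_eq_card_independent[OF orth_independent[OF B]] by simp
  have d: "dim {a + b |a b. a : span {x, y, z} & b : N} + dim (span {x, y, z} Int N) = dim (span {x, y, z}) + dim N"
  by (rule dim_sums_Int[OF subspace_span N(1)])
  have d': "dim {a + b |a b. a : span {x, y, z} & b : N} <= dim (span L)" unfolding L(2) by (rule dim_subset) simp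
  have "dim (span {x, y, z} Int N) ~= 0" using d d' d3 N(2,3) by linarith
  from nonzero_of_dim[OF this] obtain v where v: "v : span {x, y, z}" "v : N" "v ~= 0" by (elim exE conjE IntE)
  have "rform Q v v = rform Q (SUM b:{x, y, z}. (rform Q v b / rform Q b b) *\<^sub>R b) v"
  using orth_expand[OF B v(1)] by simp
  also have "... = (SUM b:{x, y, z}. rform Q v b * rform Q v b / rform Q b b)" unfolding rform_sum_left rform_scale_left
  proof (rule sum.cong[OF refl])
  fix b show "rform Q v b / rform Q b b * rform Q b v = rform Q v b * rform Q v b / rform Q b b"
  using rform_sym[of b v] by simp
  qed
  also have "... \<ge> 0" using p by (intro sum_nonneg divide_nonneg_pos) auto
  finally show False using N(4)[OF v(2,3)] by simp
 qed
qed

lemma positive_pair: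
 assumes "has_signature Q L' 2 n'"
 shows "EX p:span L'. EX q:span L'. rform Q p p > 0 & rform Q q q > 0 & rform Q p q = 0"
proof -
 from assms obtain P N where sig: "subspace P & subspace N & P <= span L' & N <= span L' &
  dim P = 2 & dim N = n' & dim (span L') = 2 + n' &
  (ALL x:P. x ~= 0 --> rform Q x x > 0) &
  (ALL x:N. x ~= 0 --> rform Q x x < 0) &
  (ALL x:P. ALL y:N. rform Q x y = 0)" unfolding has_signature_def by (elim exE)
 then have P: "subspace P" "P <= span L'" "dim P = 2" "!!x. x : P ==> x ~= 0 ==> rform Q x x > 0" by simp_all
 obtain p where p: "p : P" "p ~= 0" using nonzero_of_dim[of P] P(3) by auto
 have "~ P <= span {p}"
 proof
  assume "P <= span {p}"
  then have "dim P <= card {p}" by (rule dim_le_card) simp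
  then show False using P(3) by simp
 qed
 then obtain q0 where q0: "q0 : P" "q0 ~: span {p}" by blast
 define q where "q = q0 - (rform Q p q0 / rform Q p p) *\<^sub>R p"
 have pp: "rform Q p p > 0" by (rule P(4)[OF p])
 have "q : P" unfolding q_def by (intro subspace_diff[OF P(1)] subspace_scale[OF P(1)] p(1) q0(1))
 moreover have "q ~= 0"
 proof
  assume "q = 0"
  then have "q0 = (rform Q p q0 / rform Q p p) *\<^sub>R p" by (simp add: q_def)
  then show False using q0(2) by (metis span_base span_scale singletonI)
 qed
 moreover have "rform Q p q = 0" using pp by (simp add: q_def rform_simps)
 ultimately have "p : span L'" "q : span L'" "rform Q q q > 0" "rform Q p q = 0" using p(1) P(2,4) by auto
 then show ?thesis using pp by (intro bexI[of _ p] bexI[of _ q] conjI)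
qed

text \<open>Sums and differences of a positive and a negative vector of opposite norms. The vectors need not be
  rational, and they serve as a global frame that is independent of the cusps.\<close>

lemma (in period_space) hyperbolic_pair:
 assumes "has_signature Q L' 2 n'" "n' > 0" shows "EX a a'. hyp a a' & a : span L' & a' : span L'"
proof -
 from assms(1) obtain P N where sig: "subspace P & subspace N & P <= span L' & N <= span L' &
  dim P = 2 & dim N = n' & dim (span L') = 2 + n' &
  (ALL x:P. x ~= 0 --> rform Q x x > 0) &
  (ALL x:N. x ~= 0 --> rform Q x x < 0) &
  (ALL x:P. ALL y:N. rform Q x y = 0)" unfolding has_signature_def by (elim exE)
 then have PN: "P <= span L'" "N <= span L'" "dim P = 2" "dim N = n'"
  "!!x. x : P ==> x ~= 0 ==> rform Q x x > 0" "!!x. x : N ==> x ~= 0 ==> rform Q x x < 0"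
  "!!x y. x : P ==> y : N ==> rform Q x y = 0" by simp_all
 obtain p where p: "p : P" "p ~= 0" using nonzero_of_dim[of P] PN(3) by auto
 obtain m where m: "m : N" "m ~= 0" using nonzero_of_dim[of N] PN(4) assms(2) by auto
 define A where "A = rform Q p p"
 define B where "B = - rform Q m m"
 have AB: "A > 0" "B > 0" using PN(5)[OF p] PN(6)[OF m] by (simp_all add: A_def B_def)
 have o: "rform Q p m = 0" "rform Q m p = 0" using PN(7)[OF p(1) m(1)] rform_sym[of m p] by simp_all
 define p1 where "p1 = (1 / sqrt (2 * A)) *\<^sub>R p"
 define m1 where "m1 = (1 / sqrt (2 * B)) *\<^sub>R m"
 have v: "rform Q p1 p1 = 1/2" "rform Q m1 m1 = - 1/2" "rform Q p1 m1 = 0" "rform Q m1 p1 = 0"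
  using AB by (simp_all add: p1_def m1_def rform_simps o A_def[symmetric] B_def minus_equation_iff[of _ B] field_simps)
 have "hyp (p1 + m1) (p1 - m1)" by (simp add: hyp_def rform_simps v)
 moreover have "p1 : span L'" "m1 : span L'" using PN(1,2) p(1) m(1) by (auto simp: p1_def m1_def intro!: span_scale)
 ultimately show ?thesis by (intro exI[of _ "p1 + m1"] exI[of _ "p1 - m1"] conjI span_add span_diff)
qed

theorem proposition4p10:
  fixes Q :: "real ^ 'm ^ 'm" and L L' K :: "(real ^ 'm) set"
    and D D' :: "(complex ^ 'm) set" and \<Gamma> \<Gamma>' G :: "(real ^ 'm ^ 'm) set"
    and n n' \<nu> N :: nat and k :: int and la :: "nat list"
    and f :: "complex ^ 'm \<Rightarrow> 'm::finite tensor"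
    and V' :: "(complex ^ 'm) set"
    and la' la'' :: "nat \<Rightarrow> nat list" and \<phi> :: "nat \<Rightarrow> 'm tensor \<Rightarrow> 'm tensor"
  assumes L: "is_lattice Q L" "span L = UNIV" "has_signature Q L 2 n"
    and L': "is_lattice Q L'" "primitive_in L' L" "has_signature Q L' 2 n'" "n' \<ge> 3"
    and K: "K = orth_lattice Q L L'"
    and D: "D \<in> components (period_cone Q L)" and D': "D' = D \<inter> cspace L'"
    and \<Gamma>: "subgroup \<Gamma> (O_plus Q L D)" "finite (rcosets\<^bsub>O_plus Q L D\<^esub> \<Gamma>)"
    and \<Gamma>': "\<Gamma>' = fixing \<Gamma> K" and G: "G = fixing \<Gamma> L'"
    and la: "O_partition n la"
    and f: "f \<in> modular_forms Q L D la k \<Gamma>" "nonzero_section Q L D la f"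
    and \<nu>: "is_vanishing_order Q L L' D la k f \<nu>" "\<nu> > 0"
    and V': "vec.subspace V'" "V' \<subseteq> cspace L'" "vec.dim V' = n'"
      "\<And>v. v \<in> V' \<Longrightarrow> (\<And>w. w \<in> V' \<Longrightarrow> cform Q v w = 0) \<Longrightarrow> v = 0"
    and decomp: "irreducible_decomposition Q V' (cspace K) n' (n - n') la N la' la'' \<phi>"
  shows "\<forall>\<alpha><N. (\<lambda>\<omega> u. fibre_component Q L L' K V' la (\<phi> \<alpha>) \<omega>
                          (quasi_pullback Q L L' D la k \<nu> f \<omega> u))
           \<in> cusp_tensor_space Q L' K D' \<Gamma>' G (la' \<alpha>) (la'' \<alpha>) (k + int \<nu>) \<nu>"
proof (intro allI impI)
 fix \<alpha> assume \<alpha>: "\<alpha> < N"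
 have ps: "period_space Q" by (rule period_space_of_lattice[OF L])
 have sp: "sublattice_pair Q L L' K D D'"
  by (intro sublattice_pair.intro sublattice_pair_axioms.intro ps L L' K D D' positive_pair[OF L'(3)])
  (use L'(2) in "simp add: primitive_in_def")
 interpret sublattice_pair Q L L' K D D' by (rule sp)
 have dimL': "dim (span L') = 2 + n'" using L'(3) unfolding has_signature_def by blast
 have "dim (span L') <= CARD('m)" using dim_subset_UNIV_cart[of "span L'"] .
 then have card: "5 <= CARD('m)" using dimL' L'(4) by simp
 obtain a a' where a: "hyp a a'" "a : span L'" "a' : span L'" using hyperbolic_pair[OF L'(3)] L'(4) by auto
 have dimV: "vec.dim V' + 2 = dim (span L')" using V'(3) dimL' by simp
 have "EX g g'. frame_pair V' a a' g g'"
 proof (rule frame_pair_exists[OF V'(1,2) dimV])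
  show "v = 0" if "v : V'" "!!w. w : V' ==> cform Q v w = 0" for v by (rule V'(4)[OF that])
 qed (fact a)+
 then obtain g0 g0' where frame: "frame_pair V' a a' g0 g0'" by (elim exE)
 let ?X = "schur Q la (sum_space V' (cspace K)) {0}"
 have lin: "\<phi> \<alpha> (S + tscale c T) = \<phi> \<alpha> S + tscale c (\<phi> \<alpha> T)" if "S : ?X" "T : ?X" for S T c
  using decomp \<alpha> that unfolding irreducible_decomposition_def by simp
 have equi: "\<phi> \<alpha> (tmap M T) = tmap M (\<phi> \<alpha> T)" if "T : ?X" "preserves Q V' M" "preserves Q (cspace K) M" for T M
  using decomp \<alpha> that unfolding irreducible_decomposition_def by simp
 have im: "\<phi> \<alpha> T : schur_box Q (la' \<alpha>) (la'' \<alpha>) V' (cspace K)" if "T : ?X" for T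
 proof -
  have "bij_betw (%T. \<lambda>\<alpha>\<in>{..<N}. \<phi> \<alpha> T) ?X (\<Pi>\<^sub>E \<alpha>\<in>{..<N}. schur_box Q (la' \<alpha>) (la'' \<alpha>) V' (cspace K))"
  using decomp unfolding irreducible_decomposition_def by simp
  from bij_betwE[OF this] that have "(\<lambda>\<alpha>\<in>{..<N}. \<phi> \<alpha> T) : (\<Pi>\<^sub>E \<alpha>\<in>{..<N}. schur_box Q (la' \<alpha>) (la'' \<alpha>) V' (cspace K))" by blast
  from PiE_mem[OF this, of \<alpha>] \<alpha> show ?thesis by simp
 qed
 have fh: "f : hodge_sections Q L D la k" using f(1) by (simp add: modular_forms_def)
 have fm: "f (cmat g *v om) - tmap (cmat g) (f om) : hodge_null Q L (sum_list la) (cmat g *v om)"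
  if "g : \<Gamma>" "om : D" for g om using f(1) that by (simp add: modular_forms_def)
 have ideal: "in_ideal_power Q L L' D la k \<nu> f" using \<nu>(1) by (simp add: is_vanishing_order_def)
 have "decomp_data Q L L' K D D' f la k \<nu> a a' \<Gamma> V' (la' \<alpha>) (la'' \<alpha>) (\<phi> \<alpha>) g0 g0'"
 proof (intro decomp_data.intro qp_data.intro qp_data_axioms.intro decomp_data_axioms.intro)
  show "v = 0" if "v : V'" "!!w. w : V' ==> cform Q v w = 0" for v by (rule V'(4)[OF that])
 qed (fact sp fh ideal a \<Gamma> fm card V' dimV frame lin equi im)+
 from decomp_data.component_in_cusp_tensor_space[OF this \<nu>(2)]
 show "(%om u. fibre_component Q L L' K V' la (\<phi> \<alpha>) om (quasi_pullback Q L L' D la k \<nu> f om u))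
  : cusp_tensor_space Q L' K D' \<Gamma>' G (la' \<alpha>) (la'' \<alpha>) (k + int \<nu>) \<nu>" unfolding \<Gamma>' G .
qed

end
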